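(* Let $\mathbf{k}$ be a field of characteristic $0$, and let $V$ be a finite-dimensional $\mathbf{k}$-vector space equipped with a non-degenerate bilinear form $\omega$ that is symmetric ($e=+1$) or skew-symmetric ($e=-1$). Let $G(V)\subset\mathrm{GL}(V)$ be the subgroup preserving $\omega$, and let $B=B^{\mathbf{k},\delta}$ be the Brauer category with $\delta=e\dim V$. For every $q\ge0$, the canonical $G(V)$-module map $$\Phi^V_q:V^{\otimes q}\to\bigoplus_{p\preceq q}B^+(p,q)\otimes_{\mathbb{S}_p}V^{\langle p\rangle},\qquad \Phi^V_q(v)=\sum_{p\preceq q}\ \sum_{f\in\mathbb{B}^{+,m}(p,q)}f\otimes\pi^{\langle p\rangle}(\overline f\cdot v),$$ is injective. Moreover: (1) The maps $\Phi^V_q$, $q\ge0$, form a natural transformation $F^V\to\widetilde F^V$ between functors from $B$ to the category of $G(V)$-modules. (2) If $\delta=e\dim V$ is non-singular at ranks $\preceq q$, then $\Phi^V_q$ is an isomorphism.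
   Context: **Brauer diagrams.** For integers $p,q\ge0$, a $(p,q)$-Brauer diagram is a partition of $[p]^+\sqcup[q]^-=\{1^+,\dots,p^+\}\sqcup\{1^-,\dots,q^-\}$ into unordered pairs ($i^+$ top points, $i^-$ bottom points); $\mathbb{B}(p,q)$ is the set of these. A diagram is upward if it contains no pair of two top points, downward if it contains no pair of two bottom points, level if both; monotone if $(i-k)(j-l)>0$ for any two distinct pairs $\{i^+,j^-\},\{k^+,l^-\}$ in it. $\mathbb{B}^+,\mathbb{B}^-,\mathbb{B}^0$: upward, downward, level diagrams; $\mathbb{B}^{\pm,m}$: the monotone ones in $\mathbb{B}^\pm$. $\overline f\in\mathbb{B}(q,p)$ is $f\in\mathbb{B}(p,q)$ with $i^\pm\leftrightarrow i^\mp$ exchanged. $p\preceq q$ iff $p\le q$ and $q-p$ even. **Brauer category $B=B^{\mathbf{k},\delta}$.** Objects: non-negative integers; $B(p,q)$ free $\mathbf{k}$-module on $\mathbb{B}(p,q)$; for $f\in\mathbb{B}(q,r)$, $g\in\mathbb{B}(p,q)$, place $g$ above $f$ and identify the $q$ middle points; $f\circ g=\delta^{l(f,g)}f\hat\circ g$, where $l(f,g)$ is the number of closed loops and $f\hat\circ g$ the diagram with loops deleted. $B^\pm(p,q)$ is the span of $\mathbb{B}^\pm(p,q)$; $\mathbb{S}_p=\mathbf{k}[\mathfrak{S}_p]$ is identified with the span of $\mathbb{B}^0(p,p)$ via $\sigma\mapsto\{\{i^+,\sigma(i)^-\}\}_i$. **Action on tensor spaces.** Let $\omega^*\in V\otimes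 V$ be the unique tensor with $(\mathrm{id}_V\otimes\omega)(\omega^*\otimes u)=u$ for all $u\in V$. The linear functor $F^V:B\to G(V)\text{-mod}$ has $F^V(p)=V^{\otimes p}$; for $f\in\mathbb{B}(p,q)$ with pairs $\{i_a^+,j_a^+\}$ ($i_a<j_a$), $\{k_b^+,l_b^-\}$, $\{m_c^-,n_c^-\}$ ($m_c<n_c$), $$f\cdot v=F^V(f)(v_1\otimes\cdots\otimes v_p)=e^{C(f)}\prod_a\omega(v_{i_a},v_{j_a})\sum w_1\otimes\cdots\otimes w_q,$$ where $w_{l_b}=v_{k_b}$, the pair of slots $(m_c,n_c)$ is filled by $\omega^*$ (i.e. $\sum w_{m_c}\otimes w_{n_c}=\omega^*$), and $C(f)$ is the number of crossings in the standard drawing of $f$ (only its parity matters). **Traceless part.** For $i\neq j$ in $[p]$, $c_{i,j}\in\mathbb{B}^{-,m}(p,p-2)$ is the diagram pairing $i^+$ with $j^+$ and the other top points with the bottom points in order-preserving fashion. $V^{\langle p\rangle}=\bigcap_{1\le i<j\le p}\ker(F^V(c_{i,j}))\subset V^{\otimes p}$, a $G(V)$-submodule stable under $\mathbb{S}_p$ (acting through $F^V$). There is a unique $G(V)$-equivariant projection $\pi^{\langle p\rangle}:V^{\otimes p}\to V^{\langle p\rangle}$. **The functor $\widetilde F^V:B\to G(V)\text{-mod}$.** $\widetilde F^V(q)=\bigoplus_{p\preceq q}B^+(p,q)\otimes_{\mathbb{S}_p}V^{\langle p\rangle}$, and for $g\in B(q,q')$, $\widetilde F^V(g)(f\otimes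 v)=(g\,\sharp\,f)\otimes v$, where for $f\in B^+(p,q)$ $$g\,\sharp\,f=\sum_{h\in\mathbb{B}^{+,m}(p,q')}h\cdot b'(\pi^-(\overline h g)\otimes f)\in B^+(p,q').$$ Here $\pi^-:B(q,p)\to B^-(q,p)$ is the projection killing non-downward diagrams, and $b':B^-(q,p)\otimes B^+(p,q)\to\mathbb{S}_p$ is the bilinear pairing with, for diagrams, $b'(u\otimes w)=\sigma$ if $u=\sigma\overline w$ for some $\sigma\in\mathfrak{S}_p$, and $0$ otherwise. **Non-singularity.** For $p\preceq q$, $b_{p,q}:B^-(q,p)\otimes B^+(p,q)\to\mathbb{S}_p$ sends $g\otimes f$ (diagrams) to $g\circ f$ if $g\hat\circ f$ is level and to $0$ otherwise. Over $\mathbb{Z}[x]$ with parameter $x$, put $A_{p,q}=(b_{p,q}(\overline f\otimes g))_{f,g\in\mathbb{B}^{+,m}(p,q)}\in M_n(\mathbb{Z}[x][\mathfrak{S}_p])$, let $\iota:M_n(\mathbb{Z}[x][\mathfrak{S}_p])\hookrightarrow M_{n\,p!}(\mathbb{Z}[x])$ be induced by the left regular representation, $f_{p,q}(x)=\det\iota(A_{p,q})$. $\delta$ is non-singular at ranks $\preceq r$ if $f_{p,q}(\delta)$ is invertible in $\mathbf{k}$ for all $p\preceq q\preceq r$. *)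

theory Defs
  imports
    "HOL-Library.Function_Algebras"
    "HOL-Library.FuncSet"
    "HOL-Library.Disjoint_Sets"
    "HOL-Combinatorics.Permutations"
    "HOL-Computational_Algebra.Polynomial"
    "HOL-Algebra.Module"
    "HOL-Algebra.Algebraic_Closure_Type"
    "Jordan_Normal_Form.Determinant"
begin

section \<open>Brauer diagrams\<close>

text \<open>
  Points are numbered from 0: the top points of a \<open>(p, q)\<close>-diagram are \<open>Top 0, \<dots>, Top (p - 1)\<close>,
  the bottom points are \<open>Bot 0, \<dots>, Bot (q - 1)\<close>.
\<close>

datatype point = Top nat | Bot nat

type_synonym diagram = "point set set"

definition brauer :: "nat \<Rightarrow> nat \<Rightarrow> diagram set" where
  "brauer p q = {d. partition_on (Top ` {..<p} \<union> Bot ` {..<q}) d \<and> (\<forall>e\<in>d. card e = 2)}"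

definition upward :: "nat \<Rightarrow> nat \<Rightarrow> diagram set" where
  "upward p q = {d \<in> brauer p q. \<not> (\<exists>i j. {Top i, Top j} \<in> d)}"

definition downward :: "nat \<Rightarrow> nat \<Rightarrow> diagram set" where
  "downward p q = {d \<in> brauer p q. \<not> (\<exists>i j. {Bot i, Bot j} \<in> d)}"

definition level :: "nat \<Rightarrow> nat \<Rightarrow> diagram set" where
  "level p q = upward p q \<inter> downward p q"

definition monotone_diagram :: "diagram \<Rightarrow> bool" where
  "monotone_diagram d \<longleftrightarrow>
     (\<forall>i j k l. {Top i, Bot j} \<in> d \<and> {Top k, Bot l} \<in> d \<and> {Top i, Bot j} \<noteq> {Top k, Bot l}
        \<longrightarrow> (int i - int k) * (int j - int l) > 0)"

definition upward_mono :: "nat \<Rightarrow> nat \<Rightarrow> diagram set" where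
  "upward_mono p q = {d \<in> upward p q. monotone_diagram d}"

fun flip :: "point \<Rightarrow> point" where
  "flip (Top i) = Bot i"
| "flip (Bot i) = Top i"

definition bar :: "diagram \<Rightarrow> diagram" where
  "bar d = (\<lambda>e. flip ` e) ` d"

definition preceq :: "nat \<Rightarrow> nat \<Rightarrow> bool" (infix \<open>\<preceq>\<close> 50) where
  "p \<preceq> q \<longleftrightarrow> p \<le> q \<and> even (q - p)"

definition perm_diagram :: "nat \<Rightarrow> (nat \<Rightarrow> nat) \<Rightarrow> diagram" where
  "perm_diagram p \<sigma> = {{Top i, Bot (\<sigma> i)} | i. i < p}"

text \<open>
  Vertical composition: \<open>g\<close> is placed above \<open>f\<close>, and the bottom points of \<open>g\<close> are identified
  with the top points of \<open>f\<close>.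
\<close>

datatype node = NTop nat | NMid nat | NBot nat

fun upper_node :: "point \<Rightarrow> node" where
  "upper_node (Top i) = NTop i"
| "upper_node (Bot j) = NMid j"

fun lower_node :: "point \<Rightarrow> node" where
  "lower_node (Top j) = NMid j"
| "lower_node (Bot k) = NBot k"

fun outer_node :: "point \<Rightarrow> node" where
  "outer_node (Top i) = NTop i"
| "outer_node (Bot k) = NBot k"

definition adjacent :: "diagram \<Rightarrow> diagram \<Rightarrow> (node \<times> node) set" where
  "adjacent f g =
     {(x, y). {x, y} \<in> (\<lambda>e. upper_node ` e) ` g \<union> (\<lambda>e. lower_node ` e) ` f}"

definition dcomp :: "diagram \<Rightarrow> diagram \<Rightarrow> diagram" where
  "dcomp f g = {{x, y} | x y. x \<noteq> y \<and> (outer_node x, outer_node y) \<in> (adjacent f g)\<^sup>*}"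

definition loops :: "diagram \<Rightarrow> diagram \<Rightarrow> nat" where
  "loops f g =
     card {C. C \<subseteq> range NMid \<and> (\<exists>x \<in> Field (adjacent f g). C = (adjacent f g)\<^sup>* `` {x})}"

text \<open>
  The values of \<open>cpos\<close> list the boundary points of the strip in their cyclic order
  (\<open>Top (p - 1), \<dots>, Top 0, Bot 0, \<dots>, Bot (q - 1)\<close>).  Two strands of the standard drawing cross
  (exactly once) iff their end points interlace in this order; the crossing is counted at the
  quadruple \<open>(a, c, b, d)\<close> which lists the end points in increasing order.
\<close>

fun cpos :: "point \<Rightarrow> int" where
  "cpos (Top i) = - int i - 1"
| "cpos (Bot j) = int j"

definition crossings :: "diagram \<Rightarrow> nat" where
  "crossings f = card {(a, c, b, d). {a, b} \<in> f \<and> {c, d} \<in> f \<and>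
     cpos a < cpos c \<and> cpos c < cpos b \<and> cpos b < cpos d}"


section \<open>Free modules\<close>

definition supp :: "('a \<Rightarrow> 'r::zero) \<Rightarrow> 'a set" where
  "supp x = {a. x a \<noteq> 0}"

definition fscale :: "'r::comm_ring_1 \<Rightarrow> ('a \<Rightarrow> 'r) \<Rightarrow> 'a \<Rightarrow> 'r" where
  "fscale c x = (\<lambda>a. c * x a)"

definition free_on :: "'a set \<Rightarrow> ('a \<Rightarrow> 'r::comm_ring_1) set" where
  "free_on S = {x. finite (supp x) \<and> supp x \<subseteq> S}"

definition delta :: "'a \<Rightarrow> 'a \<Rightarrow> 'r::comm_ring_1" where
  "delta a = (\<lambda>b. if b = a then 1 else 0)"

text \<open>Linear extension of \<open>a \<mapsto> \<phi> a\<close> and bilinear extension of \<open>(a, b) \<mapsto> \<beta> a b\<close> from basis elements;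
  only used on elements of finite support.\<close>

definition free_map :: "('a \<Rightarrow> 'b) \<Rightarrow> ('a \<Rightarrow> 'r::comm_ring_1) \<Rightarrow> 'b \<Rightarrow> 'r" where
  "free_map \<phi> x = (\<Sum>a\<in>supp x. fscale (x a) (delta (\<phi> a)))"

definition bilinear_ext ::
  "('a \<Rightarrow> 'b \<Rightarrow> 'c \<Rightarrow> 'r) \<Rightarrow> ('a \<Rightarrow> 'r) \<Rightarrow> ('b \<Rightarrow> 'r) \<Rightarrow> 'c \<Rightarrow> 'r::comm_ring_1" where
  "bilinear_ext \<beta> x y = (\<Sum>a\<in>supp x. \<Sum>b\<in>supp y. fscale (x a * y b) (\<beta> a b))"


section \<open>The Brauer category\<close>

definition hom_brauer :: "nat \<Rightarrow> nat \<Rightarrow> (diagram \<Rightarrow> 'r::comm_ring_1) set" where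
  "hom_brauer p q = free_on (brauer p q)"

definition bcomp ::
  "'r::comm_ring_1 \<Rightarrow> (diagram \<Rightarrow> 'r) \<Rightarrow> (diagram \<Rightarrow> 'r) \<Rightarrow> diagram \<Rightarrow> 'r" where
  "bcomp \<delta> = bilinear_ext (\<lambda>f g. fscale (\<delta> ^ loops f g) (delta (dcomp f g)))"

definition bid :: "nat \<Rightarrow> diagram \<Rightarrow> 'r::comm_ring_1" where
  "bid p = delta (perm_diagram p id)"


section \<open>Non-singular parameters\<close>

definition bpair_diagram ::
  "'r::comm_ring_1 \<Rightarrow> nat \<Rightarrow> diagram \<Rightarrow> diagram \<Rightarrow> diagram \<Rightarrow> 'r" where
  "bpair_diagram \<delta> p g f = (if dcomp g f \<in> level p p then bcomp \<delta> (delta g) (delta f) else 0)"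

definition bpair ::
  "'r::comm_ring_1 \<Rightarrow> nat \<Rightarrow> (diagram \<Rightarrow> 'r) \<Rightarrow> (diagram \<Rightarrow> 'r) \<Rightarrow> diagram \<Rightarrow> 'r" where
  "bpair \<delta> p = bilinear_ext (bpair_diagram \<delta> p)"

text \<open>Determinant of a square matrix indexed by a finite set; the value does not depend on the
  enumeration of the index set.\<close>

definition det_on :: "'i set \<Rightarrow> ('i \<Rightarrow> 'i \<Rightarrow> 'r::comm_ring_1) \<Rightarrow> 'r" where
  "det_on I A =
     (let xs = (SOME xs. distinct xs \<and> set xs = I); n = length xs
      in Determinant.det (Matrix.mat n n (\<lambda>(i, j). A (xs ! i) (xs ! j))))"

text \<open>
  The entry of \<open>\<iota> (A\<^sub>p\<^sub>,\<^sub>q)\<close> at \<open>((f, \<sigma>), (g, \<tau>))\<close> is the coefficient of \<open>\<sigma>\<close> in the product of the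
  group algebra element \<open>b\<^sub>p\<^sub>,\<^sub>q (bar f \<otimes> g)\<close> with \<open>\<tau>\<close>; the parameter is the polynomial variable.
\<close>

definition gram_entry ::
  "nat \<Rightarrow> diagram \<times> (nat \<Rightarrow> nat) \<Rightarrow> diagram \<times> (nat \<Rightarrow> nat) \<Rightarrow> int poly" where
  "gram_entry p = (\<lambda>(f, \<sigma>) (g, \<tau>).
     bcomp [:0, 1:] (bpair [:0, 1:] p (delta (bar f)) (delta g)) (delta (perm_diagram p \<tau>))
       (perm_diagram p \<sigma>))"

definition gram_det :: "nat \<Rightarrow> nat \<Rightarrow> int poly" where
  "gram_det p q = det_on (upward_mono p q \<times> {\<sigma>. \<sigma> permutes {..<p}}) (gram_entry p)"

definition nonsingular_upto :: "'k::comm_ring_1 \<Rightarrow> nat \<Rightarrow> bool" where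
  "nonsingular_upto \<delta> r \<longleftrightarrow>
     (\<forall>p q. p \<preceq> q \<and> q \<preceq> r \<longrightarrow> poly (map_poly of_int (gram_det p q)) \<delta> dvd 1)"


section \<open>Modules with a group action\<close>

text \<open>Groups are sets of bijections of a fixed type, with composition as multiplication.  The
  fields \<open>mult\<close> and \<open>one\<close> which module records inherit from rings carry no meaning.\<close>

record ('k, 'v, 'm) gmod = "('k, 'm) module" +
  act :: "('v \<Rightarrow> 'v) \<Rightarrow> 'm \<Rightarrow> 'm"

definition gmodule :: "('v \<Rightarrow> 'v) set \<Rightarrow> ('k::field, 'v, 'm) gmod \<Rightarrow> bool" where
  "gmodule G M \<longleftrightarrow>
     Module.module (ring_of_type_algebra :: 'k ring) M \<and>
     (\<forall>g\<in>G. \<forall>x\<in>carrier M. act M g x \<in> carrier M) \<and>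
     (\<forall>g\<in>G. \<forall>x\<in>carrier M. \<forall>y\<in>carrier M. act M g (x \<oplus>\<^bsub>M\<^esub> y) = act M g x \<oplus>\<^bsub>M\<^esub> act M g y) \<and>
     (\<forall>g\<in>G. \<forall>c. \<forall>x\<in>carrier M. act M g (c \<odot>\<^bsub>M\<^esub> x) = c \<odot>\<^bsub>M\<^esub> act M g x) \<and>
     (\<forall>x\<in>carrier M. act M id x = x) \<and>
     (\<forall>g\<in>G. \<forall>h\<in>G. \<forall>x\<in>carrier M. act M (g \<circ> h) x = act M g (act M h x))"

definition gmod_hom ::
  "('v \<Rightarrow> 'v) set \<Rightarrow> ('k::field, 'v, 'm) gmod \<Rightarrow> ('k, 'v, 'n) gmod \<Rightarrow> ('m \<Rightarrow> 'n) \<Rightarrow> bool" where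
  "gmod_hom G M N h \<longleftrightarrow>
     h \<in> carrier M \<rightarrow> carrier N \<and>
     (\<forall>x\<in>carrier M. \<forall>y\<in>carrier M. h (x \<oplus>\<^bsub>M\<^esub> y) = h x \<oplus>\<^bsub>N\<^esub> h y) \<and>
     (\<forall>c. \<forall>x\<in>carrier M. h (c \<odot>\<^bsub>M\<^esub> x) = c \<odot>\<^bsub>N\<^esub> h x) \<and>
     (\<forall>g\<in>G. \<forall>x\<in>carrier M. h (act M g x) = act N g (h x))"

definition gmod_iso ::
  "('v \<Rightarrow> 'v) set \<Rightarrow> ('k::field, 'v, 'm) gmod \<Rightarrow> ('k, 'v, 'n) gmod \<Rightarrow> ('m \<Rightarrow> 'n) \<Rightarrow> bool" where
  "gmod_iso G M N h \<longleftrightarrow> gmod_hom G M N h \<and> bij_betw h (carrier M) (carrier N)"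

text \<open>A functor is given by its values \<open>F q\<close> on objects and \<open>Fm p q a\<close> on morphisms
  \<open>a : p \<rightarrow> q\<close>; functors on the Brauer category are required to be linear.\<close>

definition brauer_functor ::
  "'k::field \<Rightarrow> ('v \<Rightarrow> 'v) set \<Rightarrow> (nat \<Rightarrow> ('k, 'v, 'm) gmod) \<Rightarrow>
     (nat \<Rightarrow> nat \<Rightarrow> (diagram \<Rightarrow> 'k) \<Rightarrow> 'm \<Rightarrow> 'm) \<Rightarrow> bool" where
  "brauer_functor \<delta> G F Fm \<longleftrightarrow>
     (\<forall>q. gmodule G (F q)) \<and>
     (\<forall>p q. \<forall>a\<in>hom_brauer p q. gmod_hom G (F p) (F q) (Fm p q a)) \<and>
     (\<forall>p q. \<forall>a\<in>hom_brauer p q. \<forall>b\<in>hom_brauer p q. \<forall>x\<in>carrier (F p).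
        Fm p q (a + b) x = Fm p q a x \<oplus>\<^bsub>F q\<^esub> Fm p q b x) \<and>
     (\<forall>p q c. \<forall>a\<in>hom_brauer p q. \<forall>x\<in>carrier (F p).
        Fm p q (fscale c a) x = c \<odot>\<^bsub>F q\<^esub> Fm p q a x) \<and>
     (\<forall>q. \<forall>x\<in>carrier (F q). Fm q q (bid q) x = x) \<and>
     (\<forall>p q r. \<forall>a\<in>hom_brauer q r. \<forall>b\<in>hom_brauer p q. \<forall>x\<in>carrier (F p).
        Fm p r (bcomp \<delta> a b) x = Fm q r a (Fm p q b x))"

definition natural_transformation ::
  "'k::field \<Rightarrow> ('v \<Rightarrow> 'v) set \<Rightarrow>
     (nat \<Rightarrow> ('k, 'v, 'm) gmod) \<Rightarrow> (nat \<Rightarrow> nat \<Rightarrow> (diagram \<Rightarrow> 'k) \<Rightarrow> 'm \<Rightarrow> 'm) \<Rightarrow>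
     (nat \<Rightarrow> ('k, 'v, 'n) gmod) \<Rightarrow> (nat \<Rightarrow> nat \<Rightarrow> (diagram \<Rightarrow> 'k) \<Rightarrow> 'n \<Rightarrow> 'n) \<Rightarrow>
     (nat \<Rightarrow> 'm \<Rightarrow> 'n) \<Rightarrow> bool" where
  "natural_transformation \<delta> G F Fm E Em \<eta> \<longleftrightarrow>
     brauer_functor \<delta> G F Fm \<and> brauer_functor \<delta> G E Em \<and>
     (\<forall>q. gmod_hom G (F q) (E q) (\<eta> q)) \<and>
     (\<forall>p q. \<forall>a\<in>hom_brauer p q. \<forall>x\<in>carrier (F p). \<eta> q (Fm p q a x) = Em p q a (\<eta> p x))"

definition function_gmod ::
  "('a \<Rightarrow> 'k::field) set \<Rightarrow> (('v \<Rightarrow> 'v) \<Rightarrow> ('a \<Rightarrow> 'k) \<Rightarrow> 'a \<Rightarrow> 'k) \<Rightarrow> ('k, 'v, 'a \<Rightarrow> 'k) gmod"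
  where
  "function_gmod S ac =
     \<lparr>carrier = S, monoid.mult = undefined, one = undefined, ring.zero = 0, add = (+),
      module.smult = fscale, act = ac\<rparr>"

definition coset :: "('a \<Rightarrow> 'k::field) set \<Rightarrow> ('a \<Rightarrow> 'k) \<Rightarrow> ('a \<Rightarrow> 'k) set" where
  "coset R x = {y. y - x \<in> R}"

text \<open>Quotient of the subspace \<open>S\<close> by the subspace \<open>R \<subseteq> S\<close>.  The map induced by \<open>h\<close> on cosets is
  written as the union of the (equal) cosets of all values of \<open>h\<close>.\<close>

definition quotient_map ::
  "('b \<Rightarrow> 'k::field) set \<Rightarrow> (('a \<Rightarrow> 'k) \<Rightarrow> 'b \<Rightarrow> 'k) \<Rightarrow> ('a \<Rightarrow> 'k) set \<Rightarrow> ('b \<Rightarrow> 'k) set" where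
  "quotient_map R h A = (\<Union>x\<in>A. coset R (h x))"

definition quotient_gmod ::
  "('a \<Rightarrow> 'k::field) set \<Rightarrow> ('a \<Rightarrow> 'k) set \<Rightarrow> (('v \<Rightarrow> 'v) \<Rightarrow> ('a \<Rightarrow> 'k) \<Rightarrow> 'a \<Rightarrow> 'k) \<Rightarrow>
     ('k, 'v, ('a \<Rightarrow> 'k) set) gmod" where
  "quotient_gmod S R ac =
     \<lparr>carrier = coset R ` S, monoid.mult = undefined, one = undefined, ring.zero = coset R 0,
      add = (\<lambda>A B. \<Union>x\<in>A. \<Union>y\<in>B. coset R (x + y)),
      module.smult = (\<lambda>c. quotient_map R (fscale c)), act = (\<lambda>g. quotient_map R (ac g))\<rparr>"

definition sum_gmod ::
  "'i set \<Rightarrow> ('i \<Rightarrow> ('k::field, 'v, 'm) gmod) \<Rightarrow> ('k, 'v, 'i \<Rightarrow> 'm) gmod" where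
  "sum_gmod I M =
     \<lparr>carrier = (\<Pi>\<^sub>E i\<in>I. carrier (M i)), monoid.mult = undefined, one = undefined,
      ring.zero = (\<lambda>i\<in>I. \<zero>\<^bsub>M i\<^esub>), add = (\<lambda>x y. \<lambda>i\<in>I. x i \<oplus>\<^bsub>M i\<^esub> y i),
      module.smult = (\<lambda>c x. \<lambda>i\<in>I. c \<odot>\<^bsub>M i\<^esub> x i), act = (\<lambda>g x. \<lambda>i\<in>I. act (M i) g (x i))\<rparr>"

text \<open>
  The tensor product \<open>M \<otimes>\<^sub>S N\<close> of a right module \<open>M\<close> and a left module \<open>N\<close> over an algebra \<open>S\<close>
  is the quotient of the vector space with basis \<open>M \<times> N\<close> by the following relations.
\<close>

definition tensor_relations ::
  "('a \<Rightarrow> 'k::field) set \<Rightarrow> ('b \<Rightarrow> 'k) set \<Rightarrow> 's set \<Rightarrow>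
     (('a \<Rightarrow> 'k) \<Rightarrow> 's \<Rightarrow> 'a \<Rightarrow> 'k) \<Rightarrow> ('s \<Rightarrow> ('b \<Rightarrow> 'k) \<Rightarrow> 'b \<Rightarrow> 'k) \<Rightarrow>
     (('a \<Rightarrow> 'k) \<times> ('b \<Rightarrow> 'k) \<Rightarrow> 'k) set" where
  "tensor_relations M N S rmul lmul = Modules.module.span fscale (
     {delta (m + m', n) - delta (m, n) - delta (m', n) | m m' n. m \<in> M \<and> m' \<in> M \<and> n \<in> N} \<union>
     {delta (m, n + n') - delta (m, n) - delta (m, n') | m n n'. m \<in> M \<and> n \<in> N \<and> n' \<in> N} \<union>
     {delta (fscale c m, n) - fscale c (delta (m, n)) | c m n. m \<in> M \<and> n \<in> N} \<union>
     {delta (m, fscale c n) - fscale c (delta (m, n)) | c m n. m \<in> M \<and> n \<in> N} \<union>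
     {delta (rmul m s, n) - delta (m, lmul s n) | m s n. m \<in> M \<and> s \<in> S \<and> n \<in> N})"


section \<open>Tensor spaces and the two functors\<close>

text \<open>
  \<open>V\<close> is the type \<open>'v\<close> with scalar multiplication \<open>scale\<close>.  For finite-dimensional \<open>V\<close>, the tensor
  power \<open>V\<^sup>\<otimes>\<^sup>p\<close> is realised canonically as the space of multilinear forms on \<open>p\<close>-tuples of
  elements of the dual space, with \<open>v\<^sub>1 \<otimes> \<dots> \<otimes> v\<^sub>p\<close> the form
  \<open>(\<psi>\<^sub>1, \<dots>, \<psi>\<^sub>p) \<mapsto> \<psi>\<^sub>1 v\<^sub>1 \<cdots> \<psi>\<^sub>p v\<^sub>p\<close>; forms are extended by 0 to all other lists.
\<close>

type_synonym ('k, 'v) tensor = "('v \<Rightarrow> 'k) list \<Rightarrow> 'k"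

context
  fixes scale :: "'k::field \<Rightarrow> 'v::ab_group_add \<Rightarrow> 'v"
    and \<omega> :: "'v \<Rightarrow> 'v \<Rightarrow> 'k"
    and e :: 'k
begin

definition isometry_group :: "('v \<Rightarrow> 'v) set" where
  "isometry_group =
     {g. Vector_Spaces.linear scale scale g \<and> bij g \<and> (\<forall>x y. \<omega> (g x) (g y) = \<omega> x y)}"

definition dual :: "('v \<Rightarrow> 'k) set" where
  "dual = {\<psi>. Vector_Spaces.linear scale (*) \<psi>}"

definition tensors :: "nat \<Rightarrow> ('k, 'v) tensor set" where
  "tensors p =
     {t. (\<forall>\<psi>s. \<not> (length \<psi>s = p \<and> set \<psi>s \<subseteq> dual) \<longrightarrow> t \<psi>s = 0) \<and>
         (\<forall>\<psi>s. \<forall>i<p. \<forall>\<phi>\<in>dual. \<forall>\<psi>\<in>dual. \<forall>c. length \<psi>s = p \<and> set \<psi>s \<subseteq> dual \<longrightarrow>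
            t (\<psi>s[i := \<phi> + fscale c \<psi>]) = t (\<psi>s[i := \<phi>]) + c * t (\<psi>s[i := \<psi>]))}"

definition pure :: "'v list \<Rightarrow> ('k, 'v) tensor" where
  "pure vs = (\<lambda>\<psi>s. if length \<psi>s = length vs \<and> set \<psi>s \<subseteq> dual
                     then (\<Prod>i<length vs. (\<psi>s ! i) (vs ! i)) else 0)"

definition tensor_act :: "('v \<Rightarrow> 'v) \<Rightarrow> ('k, 'v) tensor \<Rightarrow> ('k, 'v) tensor" where
  "tensor_act g t = (\<lambda>\<psi>s. t (map (\<lambda>\<psi>. \<psi> \<circ> g) \<psi>s))"

text \<open>The condition is \<open>(id \<otimes> \<omega>) (\<omega>\<^sup>* \<otimes> u) = u\<close>, evaluated at an arbitrary element \<open>\<psi>\<close> of the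
  dual space.\<close>

definition omega_star :: "('k, 'v) tensor" where
  "omega_star = (THE t. t \<in> tensors 2 \<and> (\<forall>u. \<forall>\<psi>\<in>dual. t [\<psi>, \<lambda>y. \<omega> y u] = \<psi> u))"

definition linear_on ::
  "('k, 'v) tensor set \<Rightarrow> (('k, 'v) tensor \<Rightarrow> ('k, 'v) tensor) \<Rightarrow> bool" where
  "linear_on S h \<longleftrightarrow>
     (\<forall>s\<in>S. \<forall>t\<in>S. h (s + t) = h s + h t) \<and> (\<forall>c. \<forall>t\<in>S. h (fscale c t) = fscale c (h t))"

text \<open>\<open>f \<cdot> (v\<^sub>1 \<otimes> \<dots> \<otimes> v\<^sub>p)\<close> for a \<open>(p, q)\<close>-diagram \<open>f\<close>: evaluating
  \<open>\<Sum> w\<^sub>1 \<otimes> \<dots> \<otimes> w\<^sub>q\<close> at \<open>\<psi>s\<close>, a pair of a top point \<open>k\<close> and a bottom point \<open>l\<close> contributes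
  \<open>\<psi>\<^sub>l v\<^sub>k\<close>, and a pair of bottom points \<open>m < n\<close> contributes \<open>\<omega>\<^sup>* (\<psi>\<^sub>m, \<psi>\<^sub>n)\<close>.\<close>

definition diagram_on_pure :: "nat \<Rightarrow> diagram \<Rightarrow> 'v list \<Rightarrow> ('k, 'v) tensor" where
  "diagram_on_pure q f vs = (\<lambda>\<psi>s.
     if length \<psi>s = q \<and> set \<psi>s \<subseteq> dual
     then e ^ crossings f *
          (\<Prod>(i, j)\<in>{(i, j). i < j \<and> {Top i, Top j} \<in> f}. \<omega> (vs ! i) (vs ! j)) *
          (\<Prod>(k, l)\<in>{(k, l). {Top k, Bot l} \<in> f}. (\<psi>s ! l) (vs ! k)) *
          (\<Prod>(m, n)\<in>{(m, n). m < n \<and> {Bot m, Bot n} \<in> f}. omega_star [\<psi>s ! m, \<psi>s ! n])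
     else 0)"

definition diagram_map :: "nat \<Rightarrow> nat \<Rightarrow> diagram \<Rightarrow> ('k, 'v) tensor \<Rightarrow> ('k, 'v) tensor" where
  "diagram_map p q f = (THE L. L \<in> extensional (tensors p) \<and> linear_on (tensors p) L \<and>
     (\<forall>vs. length vs = p \<longrightarrow> L (pure vs) = diagram_on_pure q f vs))"

definition F_obj :: "nat \<Rightarrow> ('k, 'v, ('k, 'v) tensor) gmod" where
  "F_obj p = function_gmod (tensors p) tensor_act"

definition F_mor ::
  "nat \<Rightarrow> nat \<Rightarrow> (diagram \<Rightarrow> 'k) \<Rightarrow> ('k, 'v) tensor \<Rightarrow> ('k, 'v) tensor" where
  "F_mor p q a t = (\<Sum>f\<in>supp a. fscale (a f) (diagram_map p q f t))"

definition contraction :: "nat \<Rightarrow> nat \<Rightarrow> nat \<Rightarrow> diagram" where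
  "contraction p i j = insert {Top i, Top j}
     {{Top k, Bot (card {m. m < k \<and> m \<noteq> i \<and> m \<noteq> j})} | k. k < p \<and> k \<noteq> i \<and> k \<noteq> j}"

definition traceless :: "nat \<Rightarrow> ('k, 'v) tensor set" where
  "traceless p = {t \<in> tensors p.
     \<forall>i j. i < j \<and> j < p \<longrightarrow> F_mor p (p - 2) (delta (contraction p i j)) t = 0}"

text \<open>The unique equivariant linear projection onto \<open>traceless p\<close>.\<close>

definition traceless_proj :: "nat \<Rightarrow> ('k, 'v) tensor \<Rightarrow> ('k, 'v) tensor" where
  "traceless_proj p = (THE \<pi>. \<pi> \<in> extensional (tensors p) \<and> linear_on (tensors p) \<pi> \<and>
     \<pi> ` tensors p \<subseteq> traceless p \<and> (\<forall>t\<in>traceless p. \<pi> t = t) \<and>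
     (\<forall>g\<in>isometry_group. \<forall>t\<in>tensors p. \<pi> (tensor_act g t) = tensor_act g (\<pi> t)))"

text \<open>In what follows \<open>\<delta>\<close> is the parameter of the Brauer category.  The symmetric group algebra is
  identified with \<open>free_on (level p p)\<close>; it acts on \<open>free_on (upward p q)\<close> from the right by
  composition and on \<open>traceless p\<close> from the left through \<open>F_mor\<close>.\<close>

definition Ft_generators :: "nat \<Rightarrow> nat \<Rightarrow> ((diagram \<Rightarrow> 'k) \<times> ('k, 'v) tensor \<Rightarrow> 'k) set" where
  "Ft_generators p q = free_on (free_on (upward p q) \<times> traceless p)"

definition Ft_relations ::
  "'k \<Rightarrow> nat \<Rightarrow> nat \<Rightarrow> ((diagram \<Rightarrow> 'k) \<times> ('k, 'v) tensor \<Rightarrow> 'k) set" where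
  "Ft_relations \<delta> p q = tensor_relations (free_on (upward p q)) (traceless p)
     (free_on (level p p)) (bcomp \<delta>) (F_mor p p)"

definition Ft_summand ::
  "'k \<Rightarrow> nat \<Rightarrow> nat \<Rightarrow> ('k, 'v, ((diagram \<Rightarrow> 'k) \<times> ('k, 'v) tensor \<Rightarrow> 'k) set) gmod" where
  "Ft_summand \<delta> p q = quotient_gmod (Ft_generators p q) (Ft_relations \<delta> p q)
     (\<lambda>g. free_map (\<lambda>(f, v). (f, tensor_act g v)))"

definition Ft_obj ::
  "'k \<Rightarrow> nat \<Rightarrow> ('k, 'v, nat \<Rightarrow> ((diagram \<Rightarrow> 'k) \<times> ('k, 'v) tensor \<Rightarrow> 'k) set) gmod" where
  "Ft_obj \<delta> q = sum_gmod {p. p \<preceq> q} (\<lambda>p. Ft_summand \<delta> p q)"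

end

definition down_proj ::
  "nat \<Rightarrow> nat \<Rightarrow> (diagram \<Rightarrow> 'k::field) \<Rightarrow> diagram \<Rightarrow> 'k" where
  "down_proj q p a = (\<lambda>d. if d \<in> downward q p then a d else 0)"

definition bprime_diagram :: "nat \<Rightarrow> diagram \<Rightarrow> diagram \<Rightarrow> diagram \<Rightarrow> 'k::field" where
  "bprime_diagram p u w =
     (if \<exists>\<sigma>. \<sigma> permutes {..<p} \<and> u = dcomp (perm_diagram p \<sigma>) (bar w)
      then delta (perm_diagram p (THE \<sigma>. \<sigma> permutes {..<p} \<and> u = dcomp (perm_diagram p \<sigma>) (bar w)))
      else 0)"

definition bprime ::
  "nat \<Rightarrow> (diagram \<Rightarrow> 'k::field) \<Rightarrow> (diagram \<Rightarrow> 'k) \<Rightarrow> diagram \<Rightarrow> 'k" where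
  "bprime p = bilinear_ext (bprime_diagram p)"

definition sharp ::
  "'k::field \<Rightarrow> nat \<Rightarrow> nat \<Rightarrow> nat \<Rightarrow> (diagram \<Rightarrow> 'k) \<Rightarrow> (diagram \<Rightarrow> 'k) \<Rightarrow> diagram \<Rightarrow> 'k" where
  "sharp \<delta> p q q' g f = (\<Sum>h\<in>upward_mono p q'.
     bcomp \<delta> (delta h) (bprime p (down_proj q p (bcomp \<delta> (delta (bar h)) g)) f))"

context
  fixes scale :: "'k::field \<Rightarrow> 'v::ab_group_add \<Rightarrow> 'v"
    and \<omega> :: "'v \<Rightarrow> 'v \<Rightarrow> 'k"
    and e :: 'k
begin

text \<open>A summand of the target which is not present in the source (\<open>q < p \<preceq> q'\<close>) receives 0.\<close>

definition Ft_mor ::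
  "'k \<Rightarrow> nat \<Rightarrow> nat \<Rightarrow> (diagram \<Rightarrow> 'k) \<Rightarrow>
     (nat \<Rightarrow> ((diagram \<Rightarrow> 'k) \<times> ('k, 'v) tensor \<Rightarrow> 'k) set) \<Rightarrow>
     nat \<Rightarrow> ((diagram \<Rightarrow> 'k) \<times> ('k, 'v) tensor \<Rightarrow> 'k) set" where
  "Ft_mor \<delta> q q' g x = (\<lambda>p\<in>{p. p \<preceq> q'}.
     if p \<preceq> q
     then quotient_map (Ft_relations scale \<omega> e \<delta> p q')
            (free_map (\<lambda>(f, v). (sharp \<delta> p q q' g f, v))) (x p)
     else \<zero>\<^bsub>Ft_summand scale \<omega> e \<delta> p q'\<^esub>)"

definition Phi ::
  "'k \<Rightarrow> nat \<Rightarrow> ('k, 'v) tensor \<Rightarrow> nat \<Rightarrow> ((diagram \<Rightarrow> 'k) \<times> ('k, 'v) tensor \<Rightarrow> 'k) set" where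
  "Phi \<delta> q v = (\<lambda>p\<in>{p. p \<preceq> q}. coset (Ft_relations scale \<omega> e \<delta> p q)
     (\<Sum>f\<in>upward_mono p q.
        delta (delta f, traceless_proj scale \<omega> e p (F_mor scale \<omega> e q p (delta (bar f)) v))))"

end

end

theory Submission
 imports Defs
begin

text \<open>
  The functor \<open>F\<close> sends a diagram to a contraction of forms, which is functorial because contracting a
  matching along an edge multiplies weights. Over the rationals a Casimir argument (the sum of squares of
  the operators that replace letters) shows that an invariant multilinear form all of whose contractions
  vanish is zero; hence every equivariant map from fewer tensor factors to traceless tensors vanishes.
  The sum of the operators cap-cup is diagonalisable enough (its kernel, the traceless tensors, equals the
  kernel of its square, again by positivity over the rationals) to yield the projection, which therefore
  kills the images of all non-downward diagrams. In coordinates indexed by monotone diagrams the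
  map \<open>\<Phi>\<close> becomes \<open>v \<mapsto> (\<pi> (bar h \<cdot> v))\<^sub>h\<close>: if all of these vanish, then by induction on the degree all
  contractions of \<open>v\<close> vanish, so \<open>v = 0\<close>; and inverting the Gram matrix solves for \<open>v\<close>.
\<close>

text \<open>Composites of diagrams are defined by a transitive closure, whereas tensors are
  contracted one pair of slots at a time. To connect the two, the contraction formula is proved for
  abstract dual bases and used twice: for \<omega>, where a loop is worth
  \<open>e * of_nat n\<close>, and for equality of Booleans, where it is worth 2. The Boolean case
  counts two-colourings of the middle points that are constant along edges; it identifies the
  composite and its loops, and yields associativity and the addition rule for loops by counting in
  two ways. The field carries no order, so sums of squares are of no use in it. Orthogonal or
  symplectic bases make the relevant matrices rational after rescaling, and rational functionals
  then move the relations to the rationals. Nor is there an exponential map: invariance under the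
  Lie algebra is read off from Cayley transforms, a family of isometries rational in its parameter.
  For \<open>e = 1\<close> these miss the reflections, and the determinant would survive as an
  invariant with vanishing contractions; reflections have to be used separately.\<close>

abbreviation "iv \<equiv> inv_into UNIV"
abbreviation "pd \<equiv> perm_diagram"
abbreviation "um \<equiv> upward_mono"

section \<open>Weighted matchings and their contraction\<close>

text \<open>A perfect matching stored as its partner function, a fixed-point-free involution of
  \<open>S\<close>. Nothing is demanded outside \<open>S\<close>, so that \<open>rewire\<close> may
  leave stale entries at removed points.\<close>

definition matching :: "'p set => ('p => 'p) => bool" where
 "matching S \<tau> \<longleftrightarrow> (\<forall>x\<in>S. \<tau> x : S & \<tau> x ~= x & \<tau> (\<tau> x) = x)"

lemma matchingD:
 assumes "matching S \<tau>" "x : S"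
 shows "\<tau> x : S" "\<tau> x ~= x" "\<tau> (\<tau> x) = x"
 using assms by (auto simp: matching_def)

text \<open>With \<open>a\<close> and \<open>c\<close> the left ends of their chords, two
  interlacing chords are counted at exactly one ordered pair of points.\<close>

definition crosses :: "('p => int) => ('p => 'p) => 'p => 'p => bool" where
 "crosses pos \<tau> a c \<longleftrightarrow> pos a < pos c & pos c < pos (\<tau> a) & pos (\<tau> a) < pos (\<tau> c)"

definition cross_sign :: "'k::comm_ring_1 => ('p => int) => ('p => 'p) => 'p => 'p => 'k" where
 "cross_sign e pos \<tau> a c = (if crosses pos \<tau> a c then e else 1)"

definition pair_weight ::
 "('v => 'v => 'k::comm_ring_1) => ('p => int) => ('p => 'p) => ('p => 'v) => 'p => 'k" where
 "pair_weight w pos \<tau> l a = (if pos a < pos (\<tau> a) then w (l a) (l (\<tau> a)) else 1)"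

text \<open>The value of a drawing: a factor \<open>e\<close> for each crossing, and
  \<open>w\<close> once for each chord, read from its left end to its right end. Right ends
  contribute 1, so the product can run over all points.\<close>

definition mweight ::
 "'k::comm_ring_1 => ('v => 'v => 'k) => ('p => int) => 'p set => ('p => 'p) => ('p => 'v) => 'k" where
 "mweight e w pos S \<tau> l =
   (\<Prod>a\<in>S. \<Prod>c\<in>S. cross_sign e pos \<tau> a c) * (\<Prod>a\<in>S. pair_weight w pos \<tau> l a)"

text \<open>The two chords at \<open>x\<close> and \<open>y\<close> are spliced into a single one
  between their partners. If \<open>x\<close> and \<open>y\<close> are partners of each other, this
  changes nothing.\<close>

definition rewire :: "('p => 'p) => 'p => 'p => 'p => 'p" where
 "rewire \<tau> x y = \<tau>(\<tau> x := \<tau> y, \<tau> y := \<tau> x)"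

lemma matching_rewire:
 assumes "matching S \<tau>" "x : S" "y : S" "x ~= y"
 shows "matching (S - {x, y}) (rewire \<tau> x y)"
 using assms unfolding matching_def rewire_def by (auto simp: fun_upd_def) metis+

lemma prod_square_Un:
 fixes f :: "'p => 'p => 'k::comm_ring_1"
 assumes "finite A" "finite Q" "A \<inter> Q = {}"
 shows "(\<Prod>a\<in>A \<union> Q. \<Prod>c\<in>A \<union> Q. f a c) =
   (\<Prod>a\<in>A. \<Prod>c\<in>A. f a c) * (\<Prod>c\<in>A. \<Prod>z\<in>Q. f c z * f z c) * (\<Prod>a\<in>Q. \<Prod>c\<in>Q. f a c)"
proof -
 have "(\<Prod>a\<in>A \<union> Q. \<Prod>c\<in>A \<union> Q. f a c) =
   ((\<Prod>a\<in>A. \<Prod>c\<in>A. f a c) * (\<Prod>a\<in>A. \<Prod>c\<in>Q. f a c)) *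
   ((\<Prod>a\<in>Q. \<Prod>c\<in>A. f a c) * (\<Prod>a\<in>Q. \<Prod>c\<in>Q. f a c))"
  using assms by (simp add: prod.union_disjoint prod.distrib)
 moreover have "(\<Prod>a\<in>Q. \<Prod>c\<in>A. f a c) = (\<Prod>c\<in>A. \<Prod>a\<in>Q. f a c)"
  by (rule prod.swap)
 ultimately show ?thesis by (simp add: prod.distrib mult_ac)
qed

text \<open>\<open>B\<close> and \<open>U\<close> play the role of dual bases for \<open>w\<close>,
  and \<open>dd\<close> is the value of a closed loop. Both \<omega> and equality on
  \<open>bool\<close> are instances.\<close>

locale contraction_data =
 fixes w :: "'v => 'v => 'k::comm_ring_1" and e dd :: 'k
  and J :: "'i set" and B U :: "'i => 'v"
 assumes ee: "e * e = 1"
  and w_sym: "w u v = e * w v u"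
  and w_contract: "(\<Sum>i\<in>J. w u (B i) * w (U i) v) = w u v"
  and w_loop: "(\<Sum>i\<in>J. w (B i) (U i)) = dd"
  and finJ: "finite J"
begin

lemma ee_left: "e * (e * t) = t"
 using ee by (metis mult.assoc mult_1)

text \<open>The four factors are the four ways in which the crossing of a chord \<open>C < D\<close>
  with a chord of unordered ends \<open>x\<close>, \<open>a\<close> may be listed. At most one
  applies, and one does exactly when \<open>C\<close> and \<open>D\<close> separate \<open>x\<close>
  from \<open>a\<close>.\<close>

lemma chord_factor:
 fixes x a C D :: int
 assumes "C < D" "x ~= a" "x ~= C" "x ~= D" "a ~= C" "a ~= D"
 shows "(if C < x & x < D & D < a then e else 1) * (if x < C & C < a & a < D then e else 1) *
  ((if C < a & a < D & D < x then e else 1) * (if a < C & C < x & x < D then e else 1)) =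
  (if (C < x & x < D) ~= (C < a & a < D) then e else 1)"
 using assms by auto

text \<open>Since \<open>x\<close> and \<open>y\<close> are adjacent, any third chord has them on
  the same side. Its crossings with the chords at \<open>x\<close> and \<open>y\<close> therefore
  agree modulo 2 with those of the spliced chord, and \<open>e * e = 1\<close> absorbs the rest.
  What remains is a sign among four points, where a chord read backwards costs \<open>e\<close>. If
  \<open>x\<close> and \<open>y\<close> are partners, their chord crosses nothing and closes up to a
  loop.\<close>

lemma mweight_contract:
 assumes fin: "finite S" and inj: "inj_on pos S" and m: "matching S \<tau>"
  and x: "x : S" and y: "y : S" and xy: "pos x < pos y"
  and cons: "!!z. z : S ==> \<not> (pos x < pos z & pos z < pos y)"
 shows "(\<Sum>i\<in>J. mweight e w pos S \<tau> (l(x := B i, y := U i))) =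
  (if \<tau> x = y then dd else 1) * mweight e w pos (S - {x, y}) (rewire \<tau> x y) l"
proof (cases "\<tau> x = y")
 case True
 note loop = this
 have ty: "\<tau> y = x" using matchingD[OF m x] True by simp
 have rw: "rewire \<tau> x y = \<tau>" using True ty by (auto simp: rewire_def)
 let ?S = "S - {x, y}"
 have tS: "\<tau> z : ?S" if "z : ?S" for z
  using that matchingD[OF m, of z] True ty by auto
 \<comment> \<open>No point lies between the ends of the chord from \<open>x\<close> to
   \<open>y\<close>, so it takes part in no crossing.\<close>
 have k1: "cross_sign e pos \<tau> a c = 1" if "a : S" "c : S" "a : {x,y} | c : {x,y}" for a c
 proof -
  have "\<not> crosses pos \<tau> a c"
   using that cons[of "c"] cons[of "\<tau> a"] matchingD[OF m, of a] True ty xy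
   by (auto simp: crosses_def)
  then show ?thesis by (simp add: cross_sign_def)
 qed
 have signs: "(\<Prod>a\<in>S. \<Prod>c\<in>S. cross_sign e pos \<tau> a c) = (\<Prod>a\<in>?S. \<Prod>c\<in>?S. cross_sign e pos \<tau> a c)"
 proof -
  have "(\<Prod>a\<in>S. \<Prod>c\<in>S. cross_sign e pos \<tau> a c) = (\<Prod>a\<in>?S. \<Prod>c\<in>S. cross_sign e pos \<tau> a c)"
   by (rule prod.mono_neutral_right) (use fin k1 in auto)
  also have "... = (\<Prod>a\<in>?S. \<Prod>c\<in>?S. cross_sign e pos \<tau> a c)"
   by (intro prod.cong refl prod.mono_neutral_right) (use fin k1 in auto)
  finally show ?thesis .
 qed
 have wts: "(\<Prod>a\<in>S. pair_weight w pos \<tau> (l(x := B i, y := U i)) a) =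
   w (B i) (U i) * (\<Prod>a\<in>?S. pair_weight w pos \<tau> l a)" for i
 proof -
  have S: "S = insert x (insert y ?S)" using x y by auto
  have "(\<Prod>a\<in>S. pair_weight w pos \<tau> (l(x := B i, y := U i)) a) =
   pair_weight w pos \<tau> (l(x := B i, y := U i)) x * (pair_weight w pos \<tau> (l(x := B i, y := U i)) y *
    (\<Prod>a\<in>?S. pair_weight w pos \<tau> (l(x := B i, y := U i)) a))"
   by (subst S, subst prod.insert) (use fin xy in \<open>auto simp: prod.insert\<close>)
  also have "(\<Prod>a\<in>?S. pair_weight w pos \<tau> (l(x := B i, y := U i)) a) = (\<Prod>a\<in>?S. pair_weight w pos \<tau> l a)"
   by (rule prod.cong) (use tS in \<open>auto simp: pair_weight_def\<close>)
  finally have f: "(\<Prod>a\<in>S. pair_weight w pos \<tau> (l(x := B i, y := U i)) a) =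
   pair_weight w pos \<tau> (l(x := B i, y := U i)) x * (pair_weight w pos \<tau> (l(x := B i, y := U i)) y *
    (\<Prod>a\<in>?S. pair_weight w pos \<tau> l a))" .
  have "pair_weight w pos \<tau> (l(x := B i, y := U i)) x = w (B i) (U i)"
   "pair_weight w pos \<tau> (l(x := B i, y := U i)) y = 1"
   using xy True ty by (auto simp: pair_weight_def)
  then show ?thesis by (simp add: f)
 qed
 show ?thesis
  by (simp add: mweight_def signs wts rw loop w_loop[symmetric] sum_distrib_left sum_distrib_right mult_ac)
next
 case False
 define a b where "a = \<tau> x" and "b = \<tau> y"
 have ab: "a : S" "b : S" "\<tau> a = x" "\<tau> b = y" "a ~= x" "b ~= y" "a ~= y" "b ~= x" "x ~= y" "a ~= b"
 proof -
  note mx = matchingD[OF m x] and my = matchingD[OF m y]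
  have xy': "x ~= y" using xy by auto
  moreover have "\<tau> y ~= x" using False my(3) by metis
  moreover have "\<tau> x ~= \<tau> y" using mx(3) my(3) xy' by metis
  ultimately show "a : S" "b : S" "\<tau> a = x" "\<tau> b = y" "a ~= x" "b ~= y" "a ~= y" "b ~= x" "x ~= y" "a ~= b"
   using mx my False by (simp_all add: a_def b_def)
 qed
 define A where "A = S - {x, y, a, b}"
 let ?Q = "{x, y, a, b}" and ?R = "{a, b}"
 let ?t = "rewire \<tau> x y"
 have SQ: "S = A \<union> ?Q" and SR: "S - {x, y} = A \<union> ?R" and dQ: "A \<inter> ?Q = {}" and dR: "A \<inter> ?R = {}"
  and finA: "finite A"
  using ab x y fin by (auto simp: A_def)
 have tA: "\<tau> c : A" if "c : A" for c
 proof -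
  have c: "c : S" "c ~= x" "c ~= y" "c ~= a" "c ~= b" using that by (simp_all add: A_def)
  have "\<tau> c ~= z" if "\<tau> z ~= c" for z using matchingD(3)[OF m c(1)] that by metis
  then have "\<tau> c ~= x" "\<tau> c ~= y" "\<tau> c ~= a" "\<tau> c ~= b"
   using c ab(3,4) by (simp_all add: a_def[symmetric] b_def[symmetric])
  then show ?thesis using matchingD(1)[OF m c(1)] by (simp add: A_def)
 qed
 have trA: "?t c = \<tau> c" if "c : A" for c
  using that by (auto simp: rewire_def A_def a_def b_def)
 have tr: "?t a = b" "?t b = a" using ab by (auto simp: rewire_def a_def[symmetric] b_def[symmetric])
 have tx: "\<tau> x = a" "\<tau> y = b" by (simp_all add: a_def b_def)
 have ne: "pos u ~= pos v" if "u : S" "v : S" "u ~= v" for u v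
  using inj that by (auto simp: inj_on_def)
 have K: "(\<Prod>z\<in>?Q. cross_sign e pos \<tau> c z * cross_sign e pos \<tau> z c) =
   (\<Prod>z\<in>?R. cross_sign e pos ?t c z * cross_sign e pos ?t z c)" if c: "c : A" for c
 proof -
  let ?C = "pos c" and ?D = "pos (\<tau> c)"
  have cS: "c : S" "\<tau> c : S" "c \<notin> ?Q" "\<tau> c \<notin> ?Q"
   using c tA[OF c] by (auto simp: A_def)
  have dis: "pos z ~= ?C" "pos z ~= ?D" if "z : ?Q" for z
   using ne[of z c] ne[of z "\<tau> c"] cS that x y ab(1,2) by auto
  show ?thesis
  proof (cases "?C < ?D")
   case less: True
   let ?in = "%z. ?C < pos z & pos z < ?D"
   have L: "(\<Prod>z\<in>?Q. cross_sign e pos \<tau> c z * cross_sign e pos \<tau> z c) =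
     (if ?in x ~= ?in a then e else 1) * (if ?in y ~= ?in b then e else 1)"
   proof -
    have "(\<Prod>z\<in>?Q. cross_sign e pos \<tau> c z * cross_sign e pos \<tau> z c) =
     (cross_sign e pos \<tau> c x * cross_sign e pos \<tau> x c * (cross_sign e pos \<tau> c a * cross_sign e pos \<tau> a c)) *
     (cross_sign e pos \<tau> c y * cross_sign e pos \<tau> y c * (cross_sign e pos \<tau> c b * cross_sign e pos \<tau> b c))"
     using ab by (simp add: mult_ac)
    also have "cross_sign e pos \<tau> c x * cross_sign e pos \<tau> x c * (cross_sign e pos \<tau> c a * cross_sign e pos \<tau> a c) =
      (if ?in x ~= ?in a then e else 1)"
     unfolding cross_sign_def crosses_def tx ab(3,4)
     by (rule chord_factor) (use less dis ne[OF x ab(1)] ab in auto)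
    also have "cross_sign e pos \<tau> c y * cross_sign e pos \<tau> y c * (cross_sign e pos \<tau> c b * cross_sign e pos \<tau> b c) =
      (if ?in y ~= ?in b then e else 1)"
     unfolding cross_sign_def crosses_def tx ab(3,4)
     by (rule chord_factor) (use less dis ne[OF y ab(2)] ab in auto)
    finally show ?thesis .
   qed
   have R: "(\<Prod>z\<in>?R. cross_sign e pos ?t c z * cross_sign e pos ?t z c) = (if ?in a ~= ?in b then e else 1)"
   proof -
    have "(\<Prod>z\<in>?R. cross_sign e pos ?t c z * cross_sign e pos ?t z c) =
     cross_sign e pos ?t c a * cross_sign e pos ?t a c * (cross_sign e pos ?t c b * cross_sign e pos ?t b c)"
     using ab by simp
    also have "... = (if ?in a ~= ?in b then e else 1)"
     unfolding cross_sign_def crosses_def tr trA[OF c]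
     by (rule chord_factor) (use less dis ne[OF ab(1,2)] ab in auto)
    finally show ?thesis .
   qed
   \<comment> \<open>By adjacency neither end of the third chord lies between \<open>x\<close> and
     \<open>y\<close>; the two parities on the left then multiply to that of \<open>a\<close>
     against \<open>b\<close>.\<close>
   have "?in x = ?in y"
    using cons[OF cS(1)] cons[OF cS(2)] xy dis[of x] dis[of y] by auto
   then show ?thesis unfolding L R using ee by auto
  next
   case ge: False
   have one: "cross_sign e pos \<sigma> c z * cross_sign e pos \<sigma> z c = 1" if "\<sigma> c = \<tau> c" for \<sigma> z
   proof -
    have "\<not> crosses pos \<sigma> c z" "\<not> crosses pos \<sigma> z c" using ge that by (auto simp: crosses_def)
    then show ?thesis by (simp add: cross_sign_def)
   qed
   show ?thesis by (simp only: one[of \<tau>, OF refl] one[of ?t, OF trA[OF c]] prod.neutral_const)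
  qed
 qed
 have AA: "(\<Prod>a\<in>A. \<Prod>c\<in>A. cross_sign e pos \<tau> a c) = (\<Prod>a\<in>A. \<Prod>c\<in>A. cross_sign e pos ?t a c)"
  by (intro prod.cong refl) (simp add: cross_sign_def crosses_def trA)
 have AK: "(\<Prod>c\<in>A. \<Prod>z\<in>?Q. cross_sign e pos \<tau> c z * cross_sign e pos \<tau> z c) =
   (\<Prod>c\<in>A. \<Prod>z\<in>?R. cross_sign e pos ?t c z * cross_sign e pos ?t z c)"
  by (intro prod.cong refl K)
 have AW: "(\<Prod>c\<in>A. pair_weight w pos \<tau> (l(x := B i, y := U i)) c) = (\<Prod>c\<in>A. pair_weight w pos ?t l c)" for i
  by (intro prod.cong refl) (use tA dQ in \<open>auto simp: pair_weight_def trA\<close>)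
 have finite_Q: "finite ?Q" and finite_R: "finite ?R" by simp_all
 \<comment> \<open>The cost of reading the spliced chord from \<open>a\<close> to \<open>b\<close>
   instead of from left to right.\<close>
 define c0 where "c0 = (if pos a < pos b then 1 else e)"
 have QQ: "(\<Prod>u\<in>?Q. \<Prod>c\<in>?Q. cross_sign e pos \<tau> u c) *
    (\<Prod>c\<in>?Q. pair_weight w pos \<tau> (l(x := B i, y := U i)) c) = c0 * (w (l a) (B i) * w (U i) (l b))" for i
 proof -
  have q: "\<not> (pos x < pos a & pos a < pos y)" "\<not> (pos x < pos b & pos b < pos y)"
   using cons ab by auto
  have n: "pos a ~= pos x" "pos a ~= pos y" "pos b ~= pos x" "pos b ~= pos y" "pos a ~= pos b"
   using ne x y ab by metis+
  have W: "(\<Prod>c\<in>?Q. pair_weight w pos \<tau> (l(x := B i, y := U i)) c) =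
    (if pos a < pos x then w (l a) (B i) else e * w (l a) (B i)) *
    (if pos b < pos y then e * w (U i) (l b) else w (U i) (l b))"
   using ab n w_sym[of "B i" "l a"] w_sym[of "l b" "U i"]
   by (auto simp: pair_weight_def tx)
  have C: "(\<Prod>u\<in>?Q. \<Prod>c\<in>?Q. cross_sign e pos \<tau> u c) =
    cross_sign e pos \<tau> x y * cross_sign e pos \<tau> x b * (cross_sign e pos \<tau> y x * cross_sign e pos \<tau> y a) *
    (cross_sign e pos \<tau> a y * cross_sign e pos \<tau> a b * (cross_sign e pos \<tau> b x * cross_sign e pos \<tau> b a))"
   using ab by (simp add: cross_sign_def crosses_def tx)
  \<comment> \<open>The six possible orders of the four ends: neither \<open>a\<close> nor
    \<open>b\<close> lies between the adjacent points \<open>x\<close> and \<open>y\<close>.\<close>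
  consider "pos a < pos b" "pos b < pos x" | "pos b < pos a" "pos a < pos x"
   | "pos a < pos x" "pos y < pos b" | "pos b < pos x" "pos y < pos a"
   | "pos y < pos a" "pos a < pos b" | "pos y < pos b" "pos b < pos a"
   using q n xy by linarith
  then show ?thesis
   unfolding W C
   by cases (use xy in \<open>simp_all add: c0_def cross_sign_def crosses_def tx ab(3,4) ee ee_left mult_ac\<close>)
 qed
 have RR: "(\<Prod>u\<in>?R. \<Prod>c\<in>?R. cross_sign e pos ?t u c) * (\<Prod>c\<in>?R. pair_weight w pos ?t l c) = c0 * w (l a) (l b)"
  using ab ne[OF ab(1,2)] w_sym[of "l b" "l a"]
  by (auto simp: cross_sign_def crosses_def tr pair_weight_def c0_def)
 let ?P = "(\<Prod>a\<in>A. \<Prod>c\<in>A. cross_sign e pos ?t a c) * (\<Prod>c\<in>A. \<Prod>z\<in>?R. cross_sign e pos ?t c z * cross_sign e pos ?t z c) *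
   (\<Prod>c\<in>A. pair_weight w pos ?t l c)"
 have L: "mweight e w pos S \<tau> (l(x := B i, y := U i)) = ?P * (c0 * (w (l a) (B i) * w (U i) (l b)))" for i
 proof -
  have "mweight e w pos S \<tau> (l(x := B i, y := U i)) =
   (\<Prod>a\<in>A. \<Prod>c\<in>A. cross_sign e pos ?t a c) *
   (\<Prod>c\<in>A. \<Prod>z\<in>?R. cross_sign e pos ?t c z * cross_sign e pos ?t z c) *
   (\<Prod>u\<in>?Q. \<Prod>c\<in>?Q. cross_sign e pos \<tau> u c) *
   ((\<Prod>c\<in>A. pair_weight w pos ?t l c) * (\<Prod>c\<in>?Q. pair_weight w pos \<tau> (l(x := B i, y := U i)) c))"
   unfolding mweight_def SQ
   by (simp only: prod_square_Un[OF finA finite_Q dQ] prod.union_disjoint[OF finA finite_Q dQ, of "pair_weight w pos \<tau> (l(x := B i, y := U i))"] AA AK AW)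
  also have "... = ?P * ((\<Prod>u\<in>?Q. \<Prod>c\<in>?Q. cross_sign e pos \<tau> u c) *
   (\<Prod>c\<in>?Q. pair_weight w pos \<tau> (l(x := B i, y := U i)) c))" by (simp only: mult_ac)
  finally show ?thesis by (simp only: QQ)
 qed
 have R: "mweight e w pos (S - {x, y}) ?t l = ?P * (c0 * w (l a) (l b))"
 proof -
  have "mweight e w pos (S - {x, y}) ?t l =
   (\<Prod>a\<in>A. \<Prod>c\<in>A. cross_sign e pos ?t a c) *
   (\<Prod>c\<in>A. \<Prod>z\<in>?R. cross_sign e pos ?t c z * cross_sign e pos ?t z c) *
   (\<Prod>u\<in>?R. \<Prod>c\<in>?R. cross_sign e pos ?t u c) *
   ((\<Prod>c\<in>A. pair_weight w pos ?t l c) * (\<Prod>c\<in>?R. pair_weight w pos ?t l c))"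
   unfolding mweight_def SR
   by (simp only: prod_square_Un[OF finA finite_R dR] prod.union_disjoint[OF finA finite_R dR, of "pair_weight w pos ?t l"])
  also have "... = ?P * ((\<Prod>u\<in>?R. \<Prod>c\<in>?R. cross_sign e pos ?t u c) *
   (\<Prod>c\<in>?R. pair_weight w pos ?t l c))" by (simp only: mult_ac)
  finally show ?thesis by (simp only: RR)
 qed
 have "(\<Sum>i\<in>J. mweight e w pos S \<tau> (l(x := B i, y := U i))) = ?P * (c0 * (\<Sum>i\<in>J. w (l a) (B i) * w (U i) (l b)))"
  unfolding L by (simp only: sum_distrib_left)
 then show ?thesis using False by (simp add: R w_contract)
qed

end

section \<open>Contracting a list of pairs one after the other\<close>

fun contract_all :: "('p => 'p) => ('p \<times> 'p) list => 'p => 'p" where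
 "contract_all \<tau> [] = \<tau>"
| "contract_all \<tau> ((x, y) # xs) = contract_all (rewire \<tau> x y) xs"

fun loop_count :: "('p => 'p) => ('p \<times> 'p) list => nat" where
 "loop_count \<tau> [] = 0"
| "loop_count \<tau> ((x, y) # xs) = (if \<tau> x = y then 1 else 0) + loop_count (rewire \<tau> x y) xs"

fun rest :: "'p set => ('p \<times> 'p) list => 'p set" where
 "rest S [] = S"
| "rest S ((x, y) # xs) = rest (S - {x, y}) xs"

text \<open>Adjacency is required only at the moment of contraction, after the earlier pairs of the
  list have been removed.\<close>

fun contractible :: "('p => int) => 'p set => ('p \<times> 'p) list => bool" where
 "contractible pos S [] \<longleftrightarrow> True"
| "contractible pos S ((x, y) # xs) \<longleftrightarrow> x : S & y : S & pos x < pos y &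
   (\<forall>z\<in>S. \<not> (pos x < pos z & pos z < pos y)) & contractible pos (S - {x, y}) xs"

lemma matching_contract_all:
 "matching S \<tau> ==> contractible pos S xs ==> matching (rest S xs) (contract_all \<tau> xs)"
proof (induction xs arbitrary: S \<tau>)
 case (Cons xy xs)
 obtain x y where [simp]: "xy = (x, y)" by (cases xy)
 have "matching (S - {x, y}) (rewire \<tau> x y)"
  by (rule matching_rewire) (use Cons.prems in auto)
 then show ?case using Cons by simp
qed simp

context contraction_data
begin

text \<open>The head of the list is contracted first: its sum is the one applied directly to
  \<open>h\<close>.\<close>

fun msum :: "('p \<times> 'p) list => (('p => 'v) => 'k) => ('p => 'v) => 'k" where
 "msum [] h l = h l"
| "msum ((x, y) # xs) h l = msum xs (%l. \<Sum>i\<in>J. h (l(x := B i, y := U i))) l"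

lemma msum_cmult: "msum xs (%l. c * h l) l = c * msum xs h l"
 by (induction xs h l rule: msum.induct) (simp_all add: sum_distrib_left[symmetric])

lemma msum_mweight:
 assumes "finite S" "inj_on pos S" "matching S \<tau>" "contractible pos S xs"
 shows "msum xs (mweight e w pos S \<tau>) l =
  dd ^ loop_count \<tau> xs * mweight e w pos (rest S xs) (contract_all \<tau> xs) l"
 using assms
proof (induction xs arbitrary: S \<tau>)
 case (Cons xy xs)
 obtain x y where [simp]: "xy = (x, y)" by (cases xy)
 have m: "matching (S - {x, y}) (rewire \<tau> x y)"
  by (rule matching_rewire) (use Cons.prems in auto)
 have "(%l. \<Sum>i\<in>J. mweight e w pos S \<tau> (l(x := B i, y := U i))) =
   (%l. (if \<tau> x = y then dd else 1) * mweight e w pos (S - {x, y}) (rewire \<tau> x y) l)"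
  by (rule ext, rule mweight_contract) (use Cons.prems in auto)
 then have "msum (xy # xs) (mweight e w pos S \<tau>) l =
   (if \<tau> x = y then dd else 1) * msum xs (mweight e w pos (S - {x, y}) (rewire \<tau> x y)) l"
  by (simp only: msum.simps \<open>xy = _\<close> msum_cmult)
 also have "msum xs (mweight e w pos (S - {x, y}) (rewire \<tau> x y)) l = dd ^ loop_count (rewire \<tau> x y) xs *
   mweight e w pos (rest (S - {x, y}) xs) (contract_all (rewire \<tau> x y) xs) l"
  by (rule Cons.IH) (use Cons.prems m in \<open>auto simp: inj_on_def\<close>)
 finally show ?case by simp
qed simp

end

lemma sum_PiE_insert:
 assumes "finite J" "finite S" "x \<notin> S"
 shows "(\<Sum>kp\<in>PiE (insert x S) (%_. J). h kp) = (\<Sum>kp\<in>PiE S (%_. J). \<Sum>i\<in>J. h (kp(x := i)))"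
proof -
 have "(\<Sum>kp\<in>PiE (insert x S) (%_. J). h kp) = (\<Sum>(i, kp)\<in>J \<times> PiE S (%_. J). h (kp(x := i)))"
  unfolding PiE_insert_eq
  by (subst sum.reindex) (use assms inj_combinator[of x S] in \<open>auto simp: case_prod_unfold o_def\<close>)
 also have "... = (\<Sum>i\<in>J. \<Sum>kp\<in>PiE S (%_. J). h (kp(x := i)))"
  by (rule sum.cartesian_product[symmetric])
 finally show ?thesis by (subst sum.swap)
qed

lemma mweight_reindex:
 assumes "bij_betw \<phi> S S'"
  and ord: "!!x y. x : S ==> y : S ==> pos' (\<phi> x) < pos' (\<phi> y) \<longleftrightarrow> pos x < pos y"
  and \<tau>: "!!x. x : S ==> \<tau>' (\<phi> x) = \<phi> (\<tau> x)" and m: "matching S \<tau>"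
 shows "mweight e w pos' S' \<tau>' l = mweight e w pos S \<tau> (l o \<phi>)"
proof -
 have tS: "\<tau> x : S" if "x : S" for x using matchingD[OF m that] by simp
 have inj: "inj_on \<phi> S" and S': "S' = \<phi> ` S" using assms(1) by (auto simp: bij_betw_def)
 show ?thesis unfolding mweight_def S'
  unfolding prod.reindex[OF inj] o_def
  by (intro arg_cong2[where f="(*)"] prod.cong refl)
    (simp_all add: cross_sign_def crosses_def pair_weight_def \<tau> ord tS)
qed

lemma mweight_cong:
 assumes "matching S \<tau>" "!!x. x : S ==> \<tau> x = \<tau>' x" "!!x. x : S ==> l x = l' x"
 shows "mweight e w pos S \<tau> l = mweight e w pos S \<tau>' l'"
proof -
 have tS: "\<tau>' x : S" if "x : S" for x using matchingD[OF assms(1) that] assms(2)[OF that] by simp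
 show ?thesis unfolding mweight_def
  by (intro arg_cong2[where f="(*)"] prod.cong refl)
    (simp_all add: cross_sign_def crosses_def pair_weight_def assms(2,3) tS)
qed

text \<open>Chords that live in two consecutive blocks of positions never cross each other.\<close>

lemma mweight_disjoint_Un:
 assumes fin: "finite S" "finite T" and m: "matching S \<tau>" "matching T \<tau>"
  and sep: "!!x y. x : S ==> y : T ==> pos x < pos y"
 shows "mweight e w pos (S \<union> T) \<tau> l = mweight e w pos S \<tau> l * mweight e w pos T \<tau> l"
proof -
 have d: "S \<inter> T = {}" using sep by fastforce
 have "cross_sign e pos \<tau> c z * cross_sign e pos \<tau> z c = 1" if "c : S" "z : T" for c z
 proof -
  have "pos c < pos z" "pos (\<tau> c) < pos z" "pos c < pos (\<tau> z)"
   using sep that matchingD(1)[OF m(1) that(1)] matchingD(1)[OF m(2) that(2)] by auto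
  then show ?thesis by (auto simp: cross_sign_def crosses_def)
 qed
 then have "(\<Prod>c\<in>S. \<Prod>z\<in>T. cross_sign e pos \<tau> c z * cross_sign e pos \<tau> z c) = 1"
  by (simp add: prod.neutral)
 then have "(\<Prod>a\<in>S \<union> T. \<Prod>c\<in>S \<union> T. cross_sign e pos \<tau> a c) =
   (\<Prod>a\<in>S. \<Prod>c\<in>S. cross_sign e pos \<tau> a c) * (\<Prod>a\<in>T. \<Prod>c\<in>T. cross_sign e pos \<tau> a c)"
  by (simp only: prod_square_Un[OF fin d] mult_1_right)
 then show ?thesis
  by (simp only: mweight_def prod.union_disjoint[OF fin d, of "pair_weight w pos \<tau> l"] mult_ac)
qed

text \<open>Makes the indicator of a single chord constant on all chords; these indicators are the
  test colourings that separate points later.\<close>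

lemma matching_pair_iff:
 assumes "matching S \<tau>" "x : S" "z : S"
 shows "\<tau> z : {x, \<tau> x} \<longleftrightarrow> z : {x, \<tau> x}"
proof -
 have "\<tau> z = x \<longleftrightarrow> z = \<tau> x" "\<tau> z = \<tau> x \<longleftrightarrow> z = x"
  using matchingD(3)[OF assms(1,2)] matchingD(3)[OF assms(1,3)] by metis+
 then show ?thesis unfolding insert_iff empty_iff by blast
qed

section \<open>Brauer diagrams as matchings\<close>

definition points :: "nat => nat => point set" where
 "points p q = Top ` {..<p} \<union> Bot ` {..<q}"

lemma points_simps [simp]: "Top i : points p q \<longleftrightarrow> i < p" "Bot j : points p q \<longleftrightarrow> j < q" "finite (points p q)"
 by (auto simp: points_def)

definition mate :: "diagram => point => point" where
 "mate d x = (THE y. {x, y} : d)"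

lemma brauer_pairD:
 assumes "d : brauer p q" "{x, y} : d"
 shows "x ~= y" "x : points p q" "y : points p q"
proof -
 have "card {x, y} = 2" "{x, y} \<subseteq> points p q"
  using assms by (auto simp: brauer_def partition_on_def points_def)
 then show "x ~= y" "x : points p q" "y : points p q" by auto
qed

lemma brauer_pair_unique:
 assumes "d : brauer p q" "{x, y} : d" "{x, z} : d"
 shows "y = z"
proof -
 have "disjoint d" using assms(1) by (auto simp: brauer_def partition_on_def)
 moreover have "{x, y} \<inter> {x, z} ~= {}" by simp
 ultimately have "{x, y} = {x, z}" using assms(2,3) by (metis disjoint_def)
 then show ?thesis by (auto simp: doubleton_eq_iff)
qed

lemma brauer_pair_exists:
 assumes "d : brauer p q" "x : points p q"
 shows "\<exists>y. {x, y} : d"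
proof -
 obtain A where A: "A : d" "x : A" "card A = 2"
  using assms by (auto simp: brauer_def partition_on_def points_def)
 then obtain a b where "A = {a, b}" by (auto simp: card_2_iff)
 then show ?thesis using A by (auto simp: insert_commute)
qed

lemma pair_iff_mate:
 assumes "d : brauer p q"
 shows "{x, y} : d \<longleftrightarrow> x : points p q & y = mate d x"
proof -
 have "{x, mate d x} : d" if "x : points p q"
  unfolding mate_def using brauer_pair_exists[OF assms that] brauer_pair_unique[OF assms]
  by (rule ex_ex1I[THEN theI'])
 then show ?thesis using brauer_pairD[OF assms] brauer_pair_unique[OF assms] by metis
qed

lemma matching_mate:
 assumes "d : brauer p q"
 shows "matching (points p q) (mate d)"
 unfolding matching_def
proof
 fix x assume "x : points p q"
 then have *: "{x, mate d x} : d" using pair_iff_mate[OF assms] by blast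
 then have "{mate d x, x} : d" by (simp add: insert_commute)
 then show "mate d x : points p q & mate d x ~= x & mate d (mate d x) = x"
  using brauer_pairD[OF assms *] pair_iff_mate[OF assms] by metis
qed

lemma brauer_eq_pairs:
 assumes "d : brauer p q"
 shows "d = {{x, mate d x} | x. x : points p q}"
proof (rule Set.set_eqI)
 fix A
 have ex: "\<exists>x y. A = {x, y}" if "A : d"
 proof -
  have "card A = 2" using that assms by (simp add: brauer_def)
  then show ?thesis by (auto simp: card_2_iff)
 qed
 show "A : d \<longleftrightarrow> A : {{x, mate d x} | x. x : points p q}"
 proof
  assume "A : d"
  then obtain x y where "A = {x, y}" using ex by blast
  with \<open>A : d\<close> show "A : {{x, mate d x} | x. x : points p q}"
   using pair_iff_mate[OF assms, of x y] by auto
 next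
  assume "A : {{x, mate d x} | x. x : points p q}"
  then obtain x where "A = {x, mate d x}" "x : points p q" by auto
  then show "A : d" using pair_iff_mate[OF assms, of x "mate d x"] by simp
 qed
qed

lemma matching_brauer:
 assumes "matching (points p q) \<tau>" and d: "d = {{x, \<tau> x} | x. x : points p q}"
 shows "d : brauer p q" "!!x. x : points p q ==> mate d x = \<tau> x"
proof -
 note m = matchingD[OF assms(1)]
 have "partition_on (points p q) d"
  unfolding partition_on_def disjoint_def
 proof (intro conjI ballI impI)
  show "{} \<notin> d" by (auto simp: d)
  show "\<Union> d = points p q" using m by (auto simp: d)
  fix A A' assume "A : d" "A' : d" "A ~= A'"
  then obtain x y where xy: "x : points p q" "A = {x, \<tau> x}" "y : points p q" "A' = {y, \<tau> y}"
   by (auto simp: d)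
  then have "x ~= y" "x ~= \<tau> y" "\<tau> x ~= y" "\<tau> x ~= \<tau> y"
   using m(3) \<open>A ~= A'\<close> by (metis insert_commute)+
  then show "A \<inter> A' = {}" by (auto simp: xy)
 qed
 moreover have "\<forall>A\<in>d. card A = 2"
  unfolding d using m by (auto simp: card_2_iff)
 ultimately show b: "d : brauer p q" by (auto simp: brauer_def points_def)
 fix x assume "x : points p q"
 then show "mate d x = \<tau> x" using pair_iff_mate[OF b, of x "\<tau> x"] by (auto simp: d)
qed

lemma brauer_eqI:
 assumes "d : brauer p q" "d' : brauer p q" "!!x. x : points p q ==> mate d x = mate d' x"
 shows "d = d'"
proof -
 have "A = {x, mate d x} & x : points p q \<longleftrightarrow> A = {x, mate d' x} & x : points p q" for A x
  using assms(3)[of x] by auto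
 then have "{{x, mate d x} | x. x : points p q} = {{x, mate d' x} | x. x : points p q}" by simp
 then show ?thesis using brauer_eq_pairs[OF assms(1)] brauer_eq_pairs[OF assms(2)] by simp
qed

text \<open>The reverse of \<open>cpos\<close>, namely \<open>- 1 - cpos x\<close>. Interlacing is
  not affected, and reading each chord from left to right now gives the orientation needed for
  \<open>diagram_on_pure\<close>, for instance from a bottom to a top point.\<close>

fun ppos :: "point => int" where
 "ppos (Top i) = int i"
| "ppos (Bot j) = - 1 - int j"

lemma inj_ppos: "inj_on ppos S"
proof (rule inj_onI)
 fix x y assume "ppos x = ppos y"
 then show "x = y" by (cases x; cases y) auto
qed

text \<open>For \<open>w = \<omega>\<close> this is the matrix coefficient of \<open>d\<close>: the
  pure tensor of the vectors \<open>a\<close> is acted on and then evaluated at the functionals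
  \<open>\<omega> (b j)\<close>.\<close>

definition bracket ::
 "'k::comm_ring_1 => ('v => 'v => 'k) => nat => nat => diagram => (nat => 'v) => (nat => 'v) => 'k" where
 "bracket e w p q d a b = mweight e w ppos (points p q) (mate d) (case_point a b)"

text \<open>\<open>Inl\<close> is the lower diagram and \<open>Inr\<close> the upper one. From left
  to right come the bottom points, the middle points in increasing order (lower copy), the middle
  points in decreasing order (upper copy), and the top points. The two copies of the middle points
  are thus nested, and after their removal the order is that of \<open>ppos\<close>.\<close>

fun jpos :: "nat => point + point => int" where
 "jpos q (Inl x) = ppos x"
| "jpos q (Inr (Bot j)) = 2 * int q - 1 - int j"
| "jpos q (Inr (Top i)) = 2 * int q + int i"

definition jpoints :: "nat => nat => nat => (point + point) set" where
 "jpoints p m r = Inl ` points m r \<union> Inr ` points p m"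

text \<open>Nested pairs become adjacent from the inside outwards, hence the decreasing
  order.\<close>

definition jlist :: "nat => ((point + point) \<times> (point + point)) list" where
 "jlist m = map (%j. (Inl (Top j), Inr (Bot j))) (rev [0..<m])"

lemma jlist_simps [simp]:
 "jlist 0 = []" "jlist (Suc m) = (Inl (Top m), Inr (Bot m)) # jlist m"
 by (simp_all add: jlist_def)

lemma jpoints_step: "jpoints p (Suc m) r - {Inl (Top m), Inr (Bot m)} = jpoints p m r"
 by (auto simp: jpoints_def points_def less_Suc_eq)

lemma rest_jlist: "rest (jpoints p m r) (jlist m) = jpoints p 0 r"
 by (induction m) (simp_all add: jpoints_step)

lemma contractible_jlist: "m <= q ==> contractible (jpos q) (jpoints p m r) (jlist m)"
proof (induction m)
 case (Suc m)
 have "\<not> (jpos q (Inl (Top m)) < jpos q z & jpos q z < jpos q (Inr (Bot m)))"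
  if "z : jpoints p (Suc m) r" for z
  using that Suc.prems by (auto simp: jpoints_def points_def)
 then show ?case using Suc by (simp add: jpoints_step) (auto simp: jpoints_def)
qed simp

lemma inj_jpos: "inj_on (jpos q) (jpoints p q r)"
 by (rule inj_onI) (auto simp: jpoints_def points_def)

definition jlab :: "nat => (nat => 'v) => (nat => 'v) => (point + point => 'v) => point + point => 'v" where
 "jlab m a b l z = (case z of
   Inl x => (case x of Top j => if j < m then a j else l z | Bot k => l z)
  | Inr x => (case x of Top i => l z | Bot j => if j < m then b j else l z))"

lemma jlab_Suc:
 "jlab (Suc m) a b l = (jlab m a b l)(Inl (Top m) := a m, Inr (Bot m) := b m)"
 by (auto simp: jlab_def less_Suc_eq split: sum.splits point.splits)

lemma (in contraction_data) msum_jlist: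
 "msum (jlist m) h l = (\<Sum>kp\<in>PiE {..<m} (%_. J). h (jlab m (B o kp) (U o kp) l))"
proof (induction m arbitrary: h)
 case 0
 have "jlab 0 a b l = l" for a b :: "nat => 'v"
  by (auto simp: jlab_def split: sum.splits point.splits)
 then show ?case by simp
next
 case (Suc m)
 have eq: "jlab m (B o kp(m := i)) (U o kp(m := i)) l = jlab m (B o kp) (U o kp) l" for kp i
  by (auto simp: jlab_def split: sum.splits point.splits)
 have "msum (jlist (Suc m)) h l = (\<Sum>kp\<in>PiE {..<m} (%_. J). \<Sum>i\<in>J.
   h ((jlab m (B o kp) (U o kp) l)(Inl (Top m) := B i, Inr (Bot m) := U i)))"
  by (simp only: msum.simps jlist_simps Suc)
 also have "... = (\<Sum>kp\<in>PiE {..<m} (%_. J). \<Sum>i\<in>J.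
   h (jlab (Suc m) (B o kp(m := i)) (U o kp(m := i)) l))"
  by (simp only: jlab_Suc eq o_apply fun_upd_same)
 also have "... = (\<Sum>kp\<in>PiE (insert m {..<m}) (%_. J). h (jlab (Suc m) (B o kp) (U o kp) l))"
  by (rule sum_PiE_insert[symmetric]) (simp_all add: finJ)
 finally show ?case by (simp only: lessThan_Suc)
qed

section \<open>The composite computed by splicing\<close>

definition jmate :: "nat => diagram => diagram => point + point => point + point" where
 "jmate q f g = contract_all (map_sum (mate f) (mate g)) (jlist q)"

definition jloops :: "nat => diagram => diagram => nat" where
 "jloops q f g = loop_count (map_sum (mate f) (mate g)) (jlist q)"

fun outer :: "point => point + point" where
 "outer (Top i) = Inr (Top i)"
| "outer (Bot k) = Inl (Bot k)"

text \<open>\<open>case_sum id id\<close> forgets the copy. No information is lost, as only bottom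
  points of the lower and top points of the upper diagram survive the contraction.\<close>

definition comp_mate :: "nat => diagram => diagram => point => point" where
 "comp_mate q f g x = case_sum id id (jmate q f g (outer x))"

context
 fixes p q r f g
 assumes f: "f : brauer q r" and g: "g : brauer p q"
begin

lemma matching_join_halves:
 "matching (Inl ` points q r) (map_sum (mate f) (mate g))"
 "matching (Inr ` points p q) (map_sum (mate f) (mate g))"
 using matching_mate[OF f] matching_mate[OF g] by (simp_all add: matching_def)

lemma matching_join: "matching (jpoints p q r) (map_sum (mate f) (mate g))"
 using matching_join_halves unfolding matching_def jpoints_def by blast

lemma matching_jmate: "matching (jpoints p 0 r) (jmate q f g)"
 using matching_contract_all[OF matching_join contractible_jlist[OF order_refl]]
 by (simp add: rest_jlist jmate_def)

lemma outer_bij: "bij_betw outer (points p r) (jpoints p 0 r)"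
 by (rule bij_betw_byWitness[where f' = "case_sum id id"]) (auto simp: points_def jpoints_def)

lemma outer_comp_mate: "x : points p r ==> outer (comp_mate q f g x) = jmate q f g (outer x)"
proof -
 assume "x : points p r"
 then have "outer x : jpoints p 0 r" using outer_bij by (auto simp: bij_betw_def)
 then have "jmate q f g (outer x) : jpoints p 0 r" by (rule matchingD[OF matching_jmate])
 then show ?thesis by (auto simp: comp_mate_def jpoints_def points_def)
qed

lemma matching_comp_mate: "matching (points p r) (comp_mate q f g)"
 unfolding matching_def
proof
 fix x assume x: "x : points p r"
 then have ox: "outer x : jpoints p 0 r" using outer_bij by (auto simp: bij_betw_def)
 note m = matchingD[OF matching_jmate ox]
 have c: "comp_mate q f g x : points p r"
  using m(1) by (auto simp: comp_mate_def jpoints_def points_def)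
 have "outer (comp_mate q f g x) ~= outer x" using m outer_comp_mate[OF x] by simp
 moreover have "outer (comp_mate q f g (comp_mate q f g x)) = outer x"
  using m outer_comp_mate[OF x] outer_comp_mate[OF c] by simp
 then have "comp_mate q f g (comp_mate q f g x) = x"
  by (cases x; cases "comp_mate q f g (comp_mate q f g x)") auto
 ultimately show "comp_mate q f g x : points p r & comp_mate q f g x ~= x &
   comp_mate q f g (comp_mate q f g x) = x" using c by auto
qed

text \<open>The lower diagram lies entirely to the left of the upper one, so the product of the
  brackets is the weight of the join, and summing over middle labels contracts all nested pairs. The
  composite obtained is the spliced one; \<open>connected_iff_comp_mate\<close> and
  \<open>jloops_eq_loops\<close> identify it with \<open>dcomp\<close> and
  \<open>loops\<close>.\<close>

lemma bracket_join:
 assumes "contraction_data w e dd J B U"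
 shows "(\<Sum>kp\<in>PiE {..<q} (%_. J). bracket e w q r f (B o kp) c * bracket e w p q g a (U o kp)) =
  dd ^ jloops q f g * mweight e w ppos (points p r) (comp_mate q f g) (case_point a c)"
proof -
 interpret contraction_data w e dd J B U by (rule assms)
 let ?t = "map_sum (mate f) (mate g)" and ?l = "case_sum (case_point a c) (case_point a c)"
 have "mweight e w (jpos q) (jpoints p q r) ?t (jlab q a' b' ?l) =
   bracket e w q r f a' c * bracket e w p q g a b'" for a' b'
 proof -
  have "mweight e w (jpos q) (jpoints p q r) ?t (jlab q a' b' ?l) =
   mweight e w (jpos q) (Inl ` points q r) ?t (jlab q a' b' ?l) *
   mweight e w (jpos q) (Inr ` points p q) ?t (jlab q a' b' ?l)"
   unfolding jpoints_def
   by (rule mweight_disjoint_Un[OF _ _ matching_join_halves]) (auto simp: points_def)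
  also have "mweight e w (jpos q) (Inl ` points q r) ?t (jlab q a' b' ?l) =
    mweight e w ppos (points q r) (mate f) (jlab q a' b' ?l o Inl)"
   by (rule mweight_reindex) (auto simp: matching_mate[OF f] bij_betw_def)
  also have "... = bracket e w q r f a' c"
   unfolding bracket_def
   by (rule mweight_cong[OF matching_mate[OF f]]) (auto simp: jlab_def points_def)
  also have "mweight e w (jpos q) (Inr ` points p q) ?t (jlab q a' b' ?l) =
    mweight e w (jpos q o Inr) (points p q) (mate g) (jlab q a' b' ?l o Inr)"
   by (rule mweight_reindex) (auto simp: matching_mate[OF g] bij_betw_def)
  also have "... = mweight e w ppos (points p q) (mate g) (jlab q a' b' ?l o Inr)"
   by (rule mweight_reindex[where \<phi> = id, simplified]) (auto simp: matching_mate[OF g], auto simp: points_def)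
  also have "... = bracket e w p q g a b'"
   unfolding bracket_def
   by (rule mweight_cong[OF matching_mate[OF g]]) (auto simp: jlab_def points_def)
  finally show ?thesis .
 qed
 then have "(\<Sum>kp\<in>PiE {..<q} (%_. J). bracket e w q r f (B o kp) c * bracket e w p q g a (U o kp)) =
   msum (jlist q) (mweight e w (jpos q) (jpoints p q r) ?t) ?l"
  by (simp add: msum_jlist)
 also have "... = dd ^ jloops q f g * mweight e w (jpos q) (jpoints p 0 r) (jmate q f g) ?l"
  unfolding jloops_def jmate_def rest_jlist[of p q r, symmetric]
  by (rule msum_mweight[OF _ inj_jpos matching_join contractible_jlist]) (simp_all add: jpoints_def)
 also have "mweight e w (jpos q) (jpoints p 0 r) (jmate q f g) ?l =
   mweight e w ppos (points p r) (comp_mate q f g) (?l o outer)"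
 proof (rule mweight_reindex[OF outer_bij _ _ matching_comp_mate])
  show "jpos q (outer x) < jpos q (outer y) \<longleftrightarrow> ppos x < ppos y" if "x : points p r" "y : points p r" for x y
   by (cases x; cases y) auto
 qed (simp add: outer_comp_mate)
 also have "?l o outer = case_point a c"
  by (auto split: point.splits)
 finally show ?thesis .
qed

end

section \<open>Boolean labelings and composition of diagrams\<close>

text \<open>Two-colourings of the boundary that are constant on pairs. A diagram is determined by
  its colourings, and composition of diagrams becomes relational composition of colourings, which
  replaces path chasing.\<close>

definition lab :: "nat => nat => diagram => (nat => bool) => (nat => bool) => bool" where
 "lab p q d a b \<longleftrightarrow> (\<forall>x\<in>points p q. case_point a b (mate d x) = case_point a b x)"

lemma lab_cong:
 assumes "d : brauer p q" "!!i. i < p ==> a i = a' i" "!!j. j < q ==> b j = b' j"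
 shows "lab p q d a b \<longleftrightarrow> lab p q d a' b'"
proof -
 have "case_point a b x = case_point a' b' x" if "x : points p q" for x
  using that assms(2,3) by (cases x) auto
 then show ?thesis using matchingD(1)[OF matching_mate[OF assms(1)]] by (simp add: lab_def)
qed

lemma lab_pair:
 assumes "d : brauer p q" "lab p q d a b" "{x, y} : d"
 shows "case_point a b x = case_point a b y"
 using assms pair_iff_mate[OF assms(1), of x y] by (auto simp: lab_def)

lemma labI:
 assumes "d : brauer p q" "!!x y. {x, y} : d ==> case_point a b x = case_point a b y"
 shows "lab p q d a b"
 unfolding lab_def using assms(2) pair_iff_mate[OF assms(1)] by metis

text \<open>The identity matrix on two letters with its self-dual basis; a loop may carry either
  letter, hence the value 2.\<close>

lemma contraction_data_bool:
 "contraction_data (%x y. of_bool (x = y) :: int) 1 2 (UNIV :: bool set) id id"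
 by unfold_locales (auto simp: UNIV_bool of_bool_def)

lemma mweight_bool:
 assumes "matching S \<tau>" "finite S" "inj_on pos S"
 shows "mweight 1 (%x y. of_bool (x = y)) pos S \<tau> l = (of_bool (\<forall>x\<in>S. l (\<tau> x) = l x) :: int)"
proof -
 have "mweight 1 (%x y. of_bool (x = y)) pos S \<tau> l = (\<Prod>x\<in>S. of_bool (l (\<tau> x) = l x | \<not> pos x < pos (\<tau> x)) :: int)"
  unfolding mweight_def by (simp add: cross_sign_def prod.neutral, intro prod.cong refl) (auto simp: pair_weight_def)
 also have "... = of_bool (\<forall>x\<in>S. l (\<tau> x) = l x | \<not> pos x < pos (\<tau> x))"
  using assms(2) by (induction S) auto
 also have "(\<forall>x\<in>S. l (\<tau> x) = l x | \<not> pos x < pos (\<tau> x)) \<longleftrightarrow> (\<forall>x\<in>S. l (\<tau> x) = l x)"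
 proof (intro iffI ballI)
  fix x assume *: "\<forall>x\<in>S. l (\<tau> x) = l x | \<not> pos x < pos (\<tau> x)" and x: "x : S"
  note m = matchingD[OF assms(1) x]
  have "pos x < pos (\<tau> x) | pos (\<tau> x) < pos (\<tau> (\<tau> x))"
   using m assms(3) x by (metis inj_onD linorder_neqE)
  then show "l (\<tau> x) = l x" using * m x by metis
 qed auto
 finally show ?thesis .
qed

lemma bracket_bool:
 assumes "d : brauer p q"
 shows "bracket 1 (%x y. of_bool (x = y)) p q d a b = (of_bool (lab p q d a b) :: int)"
 unfolding bracket_def lab_def
 by (rule mweight_bool[OF matching_mate[OF assms]]) (simp_all add: inj_ppos)

section \<open>Colourings and connectivity of the glued diagrams\<close>

lemma adjacent_cases:
 assumes "(u, v) : adjacent f g"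
 obtains x y where "{x, y} : g" "u = upper_node x" "v = upper_node y"
  | x y where "{x, y} : f" "u = lower_node x" "v = lower_node y"
proof -
 have inj: "upper_node x = upper_node x' ==> x = x'" "lower_node x = lower_node x' ==> x = x'" for x x'
  by (cases x; cases x'; simp)+
 have pick: "\<exists>x y. e = {x, y} & u = h x & v = h y" if "{u, v} = h ` e" "!!x x'. h x = h x' ==> x = x'" for h :: "point => node" and e
 proof -
  have "u : h ` e" "v : h ` e" using that(1) by (metis insertCI)+
  then obtain x y where xy: "x : e" "u = h x" "y : e" "v = h y" by blast
  have "z = x | z = y" if "z : e" for z
  proof -
   have "h z : {u, v}" using \<open>{u, v} = h ` e\<close> that by blast
   then show ?thesis using xy \<open>!!x x'. h x = h x' ==> x = x'\<close> by auto
  qed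
  then show ?thesis using xy by blast
 qed
 from assms consider e where "e : g" "{u, v} = upper_node ` e" | e where "e : f" "{u, v} = lower_node ` e"
  by (auto simp: adjacent_def)
 then show ?thesis
 proof cases
  case 1
  then show ?thesis using pick[of upper_node e] inj(1) that(1) by metis
 next
  case 2
  then show ?thesis using pick[of lower_node e] inj(2) that(2) by metis
 qed
qed

lemma adjacent_upper: "{x, y} : g ==> (upper_node x, upper_node y) : adjacent f g"
 using imageI[of "{x, y}" g "%e. upper_node ` e"] by (simp add: adjacent_def)

lemma adjacent_lower: "{x, y} : f ==> (lower_node x, lower_node y) : adjacent f g"
 using imageI[of "{x, y}" f "%e. lower_node ` e"] by (simp add: adjacent_def)

lemma sym_adjacent: "sym (adjacent f g)"
 by (auto simp: sym_def adjacent_def insert_commute)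

lemma case_node_upper: "case_node a b c (upper_node x) = case_point a b x"
 and case_node_lower: "case_node a b c (lower_node x) = case_point b c x"
 and case_node_outer: "case_node a b c (outer_node x) = case_point a c x"
 by (cases x; simp)+

context
 fixes p q r f g
 assumes f: "f : brauer q r" and g: "g : brauer p q"
begin

private abbreviation "E \<equiv> adjacent f g"

lemma lab_adjacent:
 "lab p q g a kp & lab q r f kp c \<longleftrightarrow> (\<forall>(u, v)\<in>E. case_node a kp c u = case_node a kp c v)"
proof (intro iffI conjI)
 assume *: "lab p q g a kp & lab q r f kp c"
 show "\<forall>(u, v)\<in>E. case_node a kp c u = case_node a kp c v"
 proof (clarify)
  fix u v assume "(u, v) : E"
  then show "case_node a kp c u = case_node a kp c v"
   by (cases rule: adjacent_cases) (use * lab_pair[OF f] lab_pair[OF g] in \<open>simp_all add: case_node_upper case_node_lower\<close>)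
 qed
next
 assume *: "\<forall>(u, v)\<in>E. case_node a kp c u = case_node a kp c v"
 show "lab p q g a kp"
  by (rule labI[OF g]) (use * adjacent_upper[of _ _ g f] in \<open>fastforce simp: case_node_upper[symmetric, of a kp _ c]\<close>)
 show "lab q r f kp c"
  by (rule labI[OF f]) (use * adjacent_lower[of _ _ f g] in \<open>fastforce simp: case_node_lower[symmetric, of kp c _ a]\<close>)
qed

lemma lab_connected:
 assumes "lab p q g a kp" "lab q r f kp c" "(u, v) : E\<^sup>*"
 shows "case_node a kp c u = case_node a kp c v"
proof -
 have *: "\<forall>(u, v)\<in>E. case_node a kp c u = case_node a kp c v" using lab_adjacent assms(1,2) by blast
 show ?thesis using assms(3) by (induction rule: rtrancl_induct) (use * in auto)
qed

lemma connected_sym: "(u, v) : E\<^sup>* ==> (v, u) : E\<^sup>*"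
 using sym_rtrancl[OF sym_adjacent] by (auto simp: sym_def)

lemma connected_class: "(u, v) : E\<^sup>* ==> E\<^sup>* `` {u} = E\<^sup>* `` {v}"
 using connected_sym by (auto intro: rtrancl_trans)

lemma lab_indicator:
 assumes "!!u v. (u, v) : E ==> u : K \<longleftrightarrow> v : K"
 shows "lab p q g (%i. NTop i : K) (%j. NMid j : K) & lab q r f (%j. NMid j : K) (%k. NBot k : K)"
proof -
 have "case_node (%i. NTop i : K) (%j. NMid j : K) (%k. NBot k : K) u \<longleftrightarrow> u : K" for u
  by (cases u) auto
 then show ?thesis unfolding lab_adjacent using assms by auto
qed

text \<open>The Boolean case of \<open>bracket_join\<close>: all brackets are 0 or 1, so the sum of
  products counts the middle colourings compatible with both diagrams.\<close>

private lemma count_comp: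
 "int (card {kp : PiE {..<q} (%_. UNIV). lab p q g a kp & lab q r f kp c}) =
  2 ^ jloops q f g * of_bool (\<forall>x\<in>points p r. case_point a c (comp_mate q f g x) = case_point a c x)"
proof -
 have fin: "finite (PiE {..<q} (%_. UNIV :: bool set))" by (simp add: finite_PiE)
 have "int (card {kp : PiE {..<q} (%_. UNIV). lab p q g a kp & lab q r f kp c}) =
   (\<Sum>kp\<in>PiE {..<q} (%_. UNIV). of_bool (lab q r f kp c) * of_bool (lab p q g a kp))"
 proof -
  have "(\<Sum>kp\<in>PiE {..<q} (%_. UNIV). of_bool (lab q r f kp c) * of_bool (lab p q g a kp)) =
   (\<Sum>kp\<in>PiE {..<q} (%_. UNIV). of_bool (lab p q g a kp & lab q r f kp c) :: int)"
   by (intro sum.cong) auto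
  also have "... = int (card (PiE {..<q} (%_. UNIV) \<inter> {kp. lab p q g a kp & lab q r f kp c}))"
   using fin by simp
  also have "PiE {..<q} (%_. UNIV) \<inter> {kp. lab p q g a kp & lab q r f kp c} =
   {kp : PiE {..<q} (%_. UNIV). lab p q g a kp & lab q r f kp c}" by auto
  finally show ?thesis by simp
 qed
 also have "... = 2 ^ jloops q f g * mweight 1 (%x y. of_bool (x = y)) ppos (points p r) (comp_mate q f g) (case_point a c)"
  using bracket_join[OF f g contraction_data_bool, of c a] by (simp add: bracket_bool[OF f] bracket_bool[OF g] o_def)
 finally show ?thesis
  by (simp add: mweight_bool[OF matching_comp_mate[OF f g]] inj_ppos)
qed

private lemma comp_lab_iff:
 "(\<exists>kp. lab p q g a kp & lab q r f kp c) \<longleftrightarrow>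
  (\<forall>x\<in>points p r. case_point a c (comp_mate q f g x) = case_point a c x)"
proof -
 let ?K = "{kp : PiE {..<q} (%_. UNIV). lab p q g a kp & lab q r f kp c}"
 have "(\<exists>kp. lab p q g a kp & lab q r f kp c) \<longleftrightarrow> ?K ~= {}"
 proof
  assume "\<exists>kp. lab p q g a kp & lab q r f kp c"
  then obtain kp where kp: "lab p q g a kp" "lab q r f kp c" by blast
  have "restrict kp {..<q} : ?K"
   using kp lab_cong[OF g, of a a "restrict kp {..<q}" kp] lab_cong[OF f, of "restrict kp {..<q}" kp c c] by auto
  then show "?K ~= {}" by blast
 qed auto
 also have "... \<longleftrightarrow> card ?K ~= 0"
  using finite_subset[of ?K "PiE {..<q} (%_. UNIV)"] by (auto simp: finite_PiE)
 also have "... \<longleftrightarrow> (\<forall>x\<in>points p r. case_point a c (comp_mate q f g x) = case_point a c x)"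
  using count_comp[of a c] by (auto simp: of_bool_def split: if_splits)
 finally show ?thesis .
qed

lemma Field_adjacent: "u : Field E \<longleftrightarrow> (case u of NTop i => i < p | NMid j => j < q | NBot k => k < r)"
proof
 assume "u : Field E"
 then obtain v where "(u, v) : E" using sym_adjacent[of f g] by (auto simp: Field_def sym_def)
 then show "case u of NTop i => i < p | NMid j => j < q | NBot k => k < r"
 proof (cases rule: adjacent_cases)
  case (1 x y)
  then show ?thesis using brauer_pairD(2)[OF g 1(1)] by (cases x) auto
 next
  case (2 x y)
  then show ?thesis using brauer_pairD(2)[OF f 2(1)] by (cases x) auto
 qed
next
 assume *: "case u of NTop i => i < p | NMid j => j < q | NBot k => k < r"
 show "u : Field E"
 proof (cases u)
  case (NTop i)
  then obtain y where "{Top i, y} : g" using brauer_pair_exists[OF g, of "Top i"] * by auto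
  from adjacent_upper[OF this, of f] show ?thesis by (auto simp: Field_def NTop)
 next
  case (NMid j)
  then obtain y where "{Bot j, y} : g" using brauer_pair_exists[OF g, of "Bot j"] * by auto
  from adjacent_upper[OF this, of f] show ?thesis by (auto simp: Field_def NMid)
 next
  case (NBot k)
  then obtain y where "{Bot k, y} : f" using brauer_pair_exists[OF f, of "Bot k"] * by auto
  from adjacent_lower[OF this, of g] show ?thesis by (auto simp: Field_def NBot)
 qed
qed

lemma outer_node_inj: "outer_node x = outer_node y \<longleftrightarrow> x = y"
 by (cases x; cases y) auto

text \<open>Colourings decide both directions. The indicator of a pair of the spliced matching
  extends to the middle points and is then constant on components. Conversely, the indicator of a
  component is a colouring of both diagrams, so it cannot separate a point from its spliced
  partner.\<close>

lemma connected_iff_comp_mate: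
 "x ~= y & (outer_node x, outer_node y) : E\<^sup>* \<longleftrightarrow> x : points p r & y = comp_mate q f g x"
proof
 note mc = matchingD[OF matching_comp_mate[OF f g]]
 assume xy: "x ~= y & (outer_node x, outer_node y) : E\<^sup>*"
 then have "outer_node x : Field E"
  by (metis FieldI1 converse_rtranclE outer_node_inj)
 then have x: "x : points p r" by (cases x) (auto simp: Field_adjacent)
 let ?P = "{x, comp_mate q f g x}"
 let ?a = "%i. Top i : ?P" and ?c = "%k. Bot k : ?P"
 have ac: "case_point ?a ?c z \<longleftrightarrow> z : ?P" for z by (cases z) auto
 have "comp_mate q f g z : ?P \<longleftrightarrow> z : ?P" if "z : points p r" for z
  by (rule matching_pair_iff[OF matching_comp_mate[OF f g] x that])
 then obtain kp where "lab p q g ?a kp" "lab q r f kp ?c"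
  using comp_lab_iff[of ?a ?c] by (auto simp: ac)
 from lab_connected[OF this, of "outer_node x" "outer_node y"] xy
 have "y : ?P" unfolding case_node_outer ac by blast
 then show "x : points p r & y = comp_mate q f g x" using xy x by auto
next
 assume xy: "x : points p r & y = comp_mate q f g x"
 let ?K = "E\<^sup>* `` {outer_node x}"
 let ?a = "%i. NTop i : ?K" and ?c = "%k. NBot k : ?K"
 have "u : ?K \<longleftrightarrow> v : ?K" if "(u, v) : E" for u v
  using that connected_sym[of u v] by (auto intro: rtrancl_trans)
 then have "\<exists>kp. lab p q g ?a kp & lab q r f kp ?c"
  using lab_indicator[of ?K] by blast
 then have "case_point ?a ?c y = case_point ?a ?c x"
  using xy unfolding comp_lab_iff by blast
 moreover have "case_point ?a ?c z \<longleftrightarrow> outer_node z : ?K" for z by (cases z) auto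
 ultimately have "(outer_node x, outer_node y) : E\<^sup>*" by auto
 then show "x ~= y & (outer_node x, outer_node y) : E\<^sup>*"
  using matchingD(2)[OF matching_comp_mate[OF f g], of x] xy by auto
qed

lemma dcomp_pairs: "dcomp f g = {{x, comp_mate q f g x} | x. x : points p r}"
 unfolding dcomp_def connected_iff_comp_mate by blast

lemma dcomp_brauer: "dcomp f g : brauer p r"
 by (rule matching_brauer(1)[OF matching_comp_mate[OF f g] dcomp_pairs])

lemma mate_dcomp: "x : points p r ==> mate (dcomp f g) x = comp_mate q f g x"
 by (rule matching_brauer(2)[OF matching_comp_mate[OF f g] dcomp_pairs])

lemma lab_dcomp: "lab p r (dcomp f g) a c \<longleftrightarrow> (\<exists>kp. lab p q g a kp & lab q r f kp c)"
 unfolding comp_lab_iff lab_def[of p r] by (simp add: mate_dcomp)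

text \<open>With the whole boundary coloured \<open>True\<close>, components that meet the boundary
  are forced and each loop can be coloured freely. There are thus 2 to the number of loops middle
  colourings, while \<open>count_comp\<close> has \<open>jloops q f g\<close> in the
  exponent.\<close>

lemma jloops_eq_loops: "jloops q f g = loops f g"
proof -
 let ?K = "{kp : PiE {..<q} (%_. UNIV). lab p q g (%_. True) kp & lab q r f kp (%_. True)}"
 define C where "C j = E\<^sup>* `` {NMid j}" for j
 define L where "L = {C. C \<subseteq> range NMid & (\<exists>x \<in> Field E. C = E\<^sup>* `` {x})}"
 have LC: "\<exists>j<q. A = C j" if A: "A : L" for A
 proof -
  from that obtain x where x: "x : Field E" "A = E\<^sup>* `` {x}" "A \<subseteq> range NMid" by (auto simp: L_def)
  then obtain j where "x = NMid j" by blast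
  then show ?thesis using x by (auto simp: C_def Field_adjacent)
 qed
 then have "L \<subseteq> C ` {..<q}" by blast
 then have finL: "finite L" using finite_subset by blast
 \<comment> \<open>Middle points on loops outside \<open>A\<close> are coloured
   \<open>False\<close>, all others \<open>True\<close>.\<close>
 define \<Psi> where "\<Psi> A = restrict (%j. C j \<notin> L | C j : A) {..<q}" for A
 have "bij_betw \<Psi> (Pow L) ?K"
 proof (rule bij_betwI')
  fix A A' assume A: "A : Pow L" "A' : Pow L"
  show "\<Psi> A = \<Psi> A' \<longleftrightarrow> A = A'"
  proof
   assume eq: "\<Psi> A = \<Psi> A'"
   have "c : A \<longleftrightarrow> c : A'" if c: "c : L" for c
   proof -
    obtain j where j: "j < q" "c = C j" using LC c by blast
    then show ?thesis using fun_cong[OF eq, of j] c by (simp add: \<Psi>_def)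
   qed
   then show "A = A'" using A by blast
  qed simp
 next
  fix A assume A: "A : Pow L"
  let ?n = "case_node (%_. True) (\<Psi> A) (%_. True)"
  have mid: "?n u \<longleftrightarrow> E\<^sup>* `` {u} \<notin> L | E\<^sup>* `` {u} : A" if "u : Field E" for u
   using that by (cases u) (auto simp: \<Psi>_def C_def Field_adjacent L_def)
  have "?n u = ?n v" if "(u, v) : E" for u v
  proof -
   have "E\<^sup>* `` {u} = E\<^sup>* `` {v}" by (rule connected_class) (use that in auto)
   then show ?thesis using mid[OF FieldI1[OF that]] mid[OF FieldI2[OF that]] by simp
  qed
  then have "lab p q g (%_. True) (\<Psi> A) & lab q r f (\<Psi> A) (%_. True)"
   unfolding lab_adjacent by blast
  moreover have "\<Psi> A : PiE {..<q} (%_. UNIV)" by (simp add: \<Psi>_def)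
  ultimately show "\<Psi> A : ?K" by blast
 next
  fix kp assume "kp : ?K"
  then have k: "kp : PiE {..<q} (%_. UNIV)" "lab p q g (%_. True) kp" "lab q r f kp (%_. True)" by auto
  let ?n = "case_node (%_. True) kp (%_. True)"
  define A where "A = {c : L. \<exists>j<q. kp j & c = C j}"
  have "kp j = \<Psi> A j" for j
  proof (cases "j < q")
   case True
   have "kp j \<longleftrightarrow> C j \<notin> L | C j : A"
   proof (cases "C j : L")
    case False
    have "NMid j : Field E" using True by (simp add: Field_adjacent)
    then have "\<not> C j \<subseteq> range NMid" using False by (auto simp: L_def C_def)
    then obtain z where z: "(NMid j, z) : E\<^sup>*" "z \<notin> range NMid" by (auto simp: C_def)
    have "?n (NMid j) = ?n z" by (rule lab_connected[OF k(2,3) z(1)])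
    then show ?thesis using z(2) False by (cases z) auto
   next
    case inL: True
    have "kp j" if "C j = C j'" "kp j'" for j'
    proof -
     have "(NMid j, NMid j') : E\<^sup>*" using that(1) by (auto simp: C_def)
     from lab_connected[OF k(2,3) this] show ?thesis using that(2) by simp
    qed
    then show ?thesis using inL True by (auto simp: A_def)
   qed
   then show ?thesis using True by (simp add: \<Psi>_def)
  next
   case False
   then show ?thesis using k(1) by (auto simp: \<Psi>_def PiE_def extensional_def)
  qed
  then have "kp = \<Psi> A" by (rule ext)
  moreover have "A : Pow L" unfolding A_def by blast
  ultimately show "\<exists>A\<in>Pow L. kp = \<Psi> A" by blast
 qed
 from bij_betw_same_card[OF this] have "card ?K = 2 ^ card L" by (simp add: card_Pow[OF finL])
 moreover have "case_point (%_. True) (%_. True) x" for x by (cases x) auto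
 ultimately have "(2::int) ^ card L = 2 ^ jloops q f g"
  using count_comp[of "%_. True" "%_. True"] by simp
 then show ?thesis by (simp add: loops_def L_def)
qed

lemma card_lab_dcomp:
 "int (card {kp : PiE {..<q} (%_. UNIV). lab p q g a kp & lab q r f kp c}) =
  2 ^ loops f g * of_bool (lab p r (dcomp f g) a c)"
 unfolding count_comp jloops_eq_loops lab_def[of p r] by (simp add: mate_dcomp)

lemma bracket_dcomp:
 assumes "contraction_data w e dd J B U"
 shows "(\<Sum>kp\<in>PiE {..<q} (%_. J). bracket e w q r f (B o kp) c * bracket e w p q g a (U o kp)) =
  dd ^ loops f g * bracket e w p r (dcomp f g) a c"
 unfolding bracket_join[OF f g assms] jloops_eq_loops bracket_def[of e w p r]
 by (simp add: mweight_cong[OF matching_mate[OF dcomp_brauer] mate_dcomp refl])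

end

text \<open>The indicator of one pair of \<open>d\<close> is a colouring of \<open>d\<close>; being
  a colouring of \<open>d'\<close> as well, it forces the same partner there.\<close>

lemma brauer_eq_lab:
 assumes d: "d : brauer p q" and d': "d' : brauer p q"
  and eq: "!!a b. lab p q d a b \<longleftrightarrow> lab p q d' a b"
 shows "d = d'"
proof (rule brauer_eqI[OF d d'])
 fix x assume x: "x : points p q"
 let ?P = "{x, mate d x}"
 let ?a = "%i. Top i : ?P" and ?c = "%k. Bot k : ?P"
 have ac: "case_point ?a ?c z \<longleftrightarrow> z : ?P" for z by (cases z) auto
 note m' = matchingD[OF matching_mate[OF d'] x]
 have "mate d z : ?P \<longleftrightarrow> z : ?P" if "z : points p q" for z
  by (rule matching_pair_iff[OF matching_mate[OF d] x that])
 then have "lab p q d ?a ?c" unfolding lab_def ac by (rule ballI)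
 then have "lab p q d' ?a ?c" by (simp only: eq)
 then have "case_point ?a ?c (mate d' x) = case_point ?a ?c x" using x unfolding lab_def by (rule bspec)
 then have "mate d' x : ?P" unfolding ac by blast
 then show "mate d x = mate d' x" using m'(2) by auto
qed

section \<open>Calculus of diagrams\<close>

lemma lab_indicator_pair:
 assumes "d : brauer p q" "x : points p q"
 shows "lab p q d (%i. Top i : {x, mate d x}) (%k. Bot k : {x, mate d x})"
proof -
 have "case_point (%i. Top i : {x, mate d x}) (%k. Bot k : {x, mate d x}) z \<longleftrightarrow> z : {x, mate d x}" for z
  by (cases z) auto
 then show ?thesis
  unfolding lab_def using matching_pair_iff[OF matching_mate[OF assms(1)] assms(2)] by blast
qed

lemma mate_eq_lab:
 assumes d: "d : brauer p q" and x: "x : points p q" and "x ~= y"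
  and l: "!!a b. lab p q d a b ==> case_point a b x = case_point a b y"
 shows "mate d x = y"
proof -
 have "y : {x, mate d x}"
  using l[OF lab_indicator_pair[OF d x]] by (cases x; cases y) auto
 then show ?thesis using \<open>x ~= y\<close> by auto
qed

lemma lab_True: "lab p q d (%_. True) (%_. True)"
 by (auto simp: lab_def split: point.splits)

lemma lab_mate: "lab p q d a b ==> x : points p q ==> case_point a b (mate d x) = case_point a b x"
 by (simp add: lab_def)

section \<open>Turning diagrams upside down\<close>

lemma flip_flip [simp]: "flip (flip x) = x" by (cases x) auto

lemma flip_points [simp]: "flip x : points q p \<longleftrightarrow> x : points p q" by (cases x) auto

lemma bar_bar [simp]: "bar (bar d) = d"
 by (simp add: bar_def image_image)

lemma pair_bar: "{x, y} : bar d \<longleftrightarrow> {flip x, flip y} : d"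
proof
 assume "{x, y} : bar d"
 then obtain e where e: "e : d" "{x, y} = flip ` e" by (auto simp: bar_def)
 then have "flip ` {x, y} = e" by (simp only: image_image flip_flip image_ident)
 then show "{flip x, flip y} : d" using e(1) by auto
next
 assume "{flip x, flip y} : d"
 then have "flip ` {flip x, flip y} : bar d" unfolding bar_def by (rule imageI)
 then show "{x, y} : bar d" by simp
qed

lemma bar_pairs:
 assumes "d : brauer p q"
 shows "bar d = {{x, flip (mate d (flip x))} | x. x : points q p}"
proof -
 have "bar d = (%e. flip ` e) ` {{x, mate d x} | x. x : points p q}"
  unfolding bar_def by (rule arg_cong[OF brauer_eq_pairs[OF assms]])
 also have "... = (%x. {flip x, flip (mate d x)}) ` points p q"
  by (simp add: Setcompr_eq_image image_image)
 also have "points p q = flip ` points q p"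
 proof (rule Set.set_eqI)
  show "x : points p q \<longleftrightarrow> x : flip ` points q p" for x
   using imageI[of "flip x" "points q p" flip] by auto
 qed
 also have "(%x. {flip x, flip (mate d x)}) ` flip ` points q p = {{x, flip (mate d (flip x))} | x. x : points q p}"
  by (simp add: Setcompr_eq_image image_image)
 finally show ?thesis .
qed

lemma
 assumes "d : brauer p q"
 shows bar_brauer [intro, simp]: "bar d : brauer q p"
  and mate_bar: "!!x. x : points q p ==> mate (bar d) x = flip (mate d (flip x))"
proof -
 have "matching (points q p) (%x. flip (mate d (flip x)))"
  unfolding matching_def
 proof
  fix x assume "x : points q p"
  then have "flip x : points p q" by simp
  note m = matchingD[OF matching_mate[OF assms] this]
  have "flip (mate d (flip x)) ~= x" using m(2) by (metis flip_flip)
  with m show "flip (mate d (flip x)) : points q p & flip (mate d (flip x)) ~= x &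
    flip (mate d (flip (flip (mate d (flip x))))) = x"
   by auto
 qed
 from matching_brauer[OF this bar_pairs[OF assms]]
 show "bar d : brauer q p" "!!x. x : points q p ==> mate (bar d) x = flip (mate d (flip x))" by auto
qed

lemma lab_bar:
 fixes a b :: "nat => bool"
 assumes "d : brauer p q"
 shows "lab q p (bar d) b a \<longleftrightarrow> lab p q d a b"
proof -
 have c: "case_point b a (flip x) = case_point a b x" for x by (cases x) auto
 have "lab q p (bar d) b a \<longleftrightarrow> (\<forall>x\<in>points q p. case_point b a (flip (mate d (flip x))) = case_point b a (flip (flip x)))"
  unfolding lab_def by (simp add: mate_bar[OF assms])
 also have "... \<longleftrightarrow> lab p q d a b"
  unfolding lab_def c by (metis flip_flip flip_points)
 finally show ?thesis .
qed

lemma bar_dcomp: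
 assumes "f : brauer q r" "g : brauer p q"
 shows "bar (dcomp f g) = dcomp (bar g) (bar f)"
 by (rule brauer_eq_lab[of _ r p])
   (auto simp: assms bar_brauer[OF dcomp_brauer[OF assms]] dcomp_brauer[of _ q] lab_bar[OF dcomp_brauer[OF assms]]
    lab_dcomp[OF assms] lab_dcomp[of _ q p _ r] lab_bar[OF assms(1)] lab_bar[OF assms(2)])

text \<open>Reflection exchanges the factors but leaves the set of middle colourings
  unchanged.\<close>

lemma loops_bar:
 assumes "f : brauer q r" "g : brauer p q"
 shows "loops (bar g) (bar f) = loops f g"
proof -
 have "2 ^ loops (bar g) (bar f) = (2 ^ loops f g :: int)"
  using card_lab_dcomp[OF assms, of "%_. True" "%_. True"]
   card_lab_dcomp[OF bar_brauer[OF assms(2)] bar_brauer[OF assms(1)], of "%_. True" "%_. True"]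
  by (simp add: lab_True lab_bar[OF assms(1)] lab_bar[OF assms(2)] conj_commute)
 then show ?thesis by simp
qed

text \<open>Relational composition of colourings is associative.\<close>

lemma dcomp_assoc:
 assumes "f : brauer r s" "g : brauer q r" "h : brauer p q"
 shows "dcomp f (dcomp g h) = dcomp (dcomp f g) h"
proof (rule brauer_eq_lab)
 note gh = dcomp_brauer[OF assms(2,3)] and fg = dcomp_brauer[OF assms(1,2)]
 show "dcomp f (dcomp g h) : brauer p s" "dcomp (dcomp f g) h : brauer p s"
  using dcomp_brauer[OF assms(1) gh] dcomp_brauer[OF fg assms(3)] by auto
 show "lab p s (dcomp f (dcomp g h)) a b \<longleftrightarrow> lab p s (dcomp (dcomp f g) h) a b" for a b
  unfolding lab_dcomp[OF assms(1) gh] lab_dcomp[OF fg assms(3)] lab_dcomp[OF assms(1,2)] lab_dcomp[OF assms(2,3)]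
  by blast
qed

text \<open>The colourings of both middle layers of a triple composite, with constant boundary, are
  counted layer by layer in the two possible orders; equal powers of 2 have equal exponents.\<close>

lemma loops_assoc:
 assumes "f : brauer r s" "g : brauer q r" "h : brauer p q"
 shows "loops f (dcomp g h) + loops g h = loops (dcomp f g) h + loops f g"
proof -
 note gh = dcomp_brauer[OF assms(2,3)] and fg = dcomp_brauer[OF assms(1,2)]
 let ?T = "%_::nat. True"
 define K where "K = PiE {..<q} (%_. UNIV :: bool set)"
 define M where "M = PiE {..<r} (%_. UNIV :: bool set)"
 have fin: "finite K" "finite M" by (simp_all add: K_def M_def finite_PiE)
 have sumcard: "finite A ==> int (card {x : A. P x}) = (\<Sum>x\<in>A. of_bool (P x))" for A :: "(nat => bool) set" and P
  by (simp add: Int_def)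
 have 1: "(\<Sum>kp\<in>K. of_bool (lab p q h ?T kp & lab q r g kp \<mu>)) = (2 ^ loops g h * of_bool (lab p r (dcomp g h) ?T \<mu>) :: int)" for \<mu>
  using card_lab_dcomp[OF assms(2,3), of ?T \<mu>] sumcard[OF fin(1)] by (simp only: K_def)
 have 2: "(\<Sum>\<mu>\<in>M. of_bool (lab q r g kp \<mu> & lab r s f \<mu> ?T)) = (2 ^ loops f g * of_bool (lab q s (dcomp f g) kp ?T) :: int)" for kp
  using card_lab_dcomp[OF assms(1,2), of kp ?T] sumcard[OF fin(2)] by (simp only: M_def)
 have 3: "(\<Sum>\<mu>\<in>M. of_bool (lab p r (dcomp g h) ?T \<mu> & lab r s f \<mu> ?T)) = (2 ^ loops f (dcomp g h) :: int)"
  using card_lab_dcomp[OF assms(1) gh, of ?T ?T] sumcard[OF fin(2)] by (simp only: M_def lab_True) simp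
 have 4: "(\<Sum>kp\<in>K. of_bool (lab p q h ?T kp & lab q s (dcomp f g) kp ?T)) = (2 ^ loops (dcomp f g) h :: int)"
  using card_lab_dcomp[OF fg assms(3), of ?T ?T] sumcard[OF fin(1)] by (simp only: K_def lab_True) simp
 have "(\<Sum>\<mu>\<in>M. \<Sum>kp\<in>K. of_bool (lab p q h ?T kp & lab q r g kp \<mu>) * of_bool (lab r s f \<mu> ?T)) =
   (2 ^ loops g h * 2 ^ loops f (dcomp g h) :: int)"
  unfolding sum_distrib_right[symmetric] 1 3[symmetric] sum_distrib_left
  by (intro sum.cong) auto
 moreover have "(\<Sum>kp\<in>K. \<Sum>\<mu>\<in>M. of_bool (lab p q h ?T kp) * of_bool (lab q r g kp \<mu> & lab r s f \<mu> ?T)) =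
   (2 ^ loops f g * 2 ^ loops (dcomp f g) h :: int)"
  unfolding sum_distrib_left[symmetric] 2 4[symmetric] unfolding sum_distrib_left
  by (intro sum.cong) auto
 moreover have "(\<Sum>\<mu>\<in>M. \<Sum>kp\<in>K. of_bool (lab p q h ?T kp & lab q r g kp \<mu>) * of_bool (lab r s f \<mu> ?T)) =
   (\<Sum>kp\<in>K. \<Sum>\<mu>\<in>M. of_bool (lab p q h ?T kp) * (of_bool (lab q r g kp \<mu> & lab r s f \<mu> ?T) :: int))"
  by (subst sum.swap) (intro sum.cong refl, auto)
 ultimately have "(2::int) ^ (loops g h + loops f (dcomp g h)) = 2 ^ (loops f g + loops (dcomp f g) h)"
  by (simp add: power_add)
 then show ?thesis by simp
qed

section \<open>Upward and downward diagrams and their strands\<close>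

lemma upward_iff: "d : upward p q \<longleftrightarrow> d : brauer p q & (\<forall>i<p. \<exists>j<q. mate d (Top i) = Bot j)"
proof (cases "d : brauer p q")
 case d: True
 have "(\<exists>i j. {Top i, Top j} : d) \<longleftrightarrow> (\<exists>i<p. \<exists>j. mate d (Top i) = Top j)"
  unfolding pair_iff_mate[OF d] by (metis points_simps(1))
 moreover have "(\<forall>i<p. \<exists>j<q. mate d (Top i) = Bot j) \<longleftrightarrow> \<not> (\<exists>i<p. \<exists>j. mate d (Top i) = Top j)"
 proof -
  have "(\<exists>j<q. mate d (Top i) = Bot j) \<longleftrightarrow> \<not> (\<exists>j. mate d (Top i) = Top j)" if "i < p" for i
   using matchingD(1)[OF matching_mate[OF d], of "Top i"] that by (cases "mate d (Top i)") auto
  then show ?thesis by blast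
 qed
 ultimately show ?thesis using d by (auto simp: upward_def)
qed (simp add: upward_def)

lemma upward_brauer: "d : upward p q ==> d : brauer p q" by (simp add: upward_def)
lemma downward_brauer: "d : downward p q ==> d : brauer p q" by (simp add: downward_def)

lemma bar_upward: "d : brauer p q ==> bar d : upward q p \<longleftrightarrow> d : downward p q"
 by (simp add: upward_def downward_def pair_bar)

lemma bar_downward: "d : brauer p q ==> bar d : downward q p \<longleftrightarrow> d : upward p q"
 by (simp add: upward_def downward_def pair_bar)

text \<open>A pair of top points obstructs exactly the top colourings that separate it. In this form
  closure under composition is immediate.\<close>

lemma upward_iff_lab:
 assumes d: "d : brauer p q"
 shows "d : upward p q \<longleftrightarrow> (\<forall>a. \<exists>b. lab p q d a b)"
proof
 assume u: "d : upward p q"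
 show "\<forall>a. \<exists>b. lab p q d a b"
 proof
  fix a :: "nat => bool"
  have "case_point a (%j. case mate d (Bot j) of Top i => a i | Bot k => True) (mate d x) =
    case_point a (%j. case mate d (Bot j) of Top i => a i | Bot k => True) x" if x: "x : points p q" for x
  proof (cases x)
   case (Top i)
   then obtain j where "mate d (Top i) = Bot j" using u x by (auto simp: upward_iff)
   then show ?thesis using matchingD(3)[OF matching_mate[OF d], of "Top i"] Top x by auto
  next
   case (Bot k)
   then show ?thesis using matchingD(3)[OF matching_mate[OF d] x] by (cases "mate d (Bot k)") auto
  qed
  then show "\<exists>b. lab p q d a b" unfolding lab_def by blast
 qed
next
 assume l: "\<forall>a. \<exists>b. lab p q d a b"
 have "i = j" if "{Top i, Top j} : d" for i j
 proof -
  obtain b where "lab p q d (%k. k = i) b" using l by blast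
  from lab_pair[OF d this that] show ?thesis by auto
 qed
 then have "\<not> (\<exists>i j. {Top i, Top j} : d)" using brauer_pairD(1)[OF d] by metis
 then show "d : upward p q" using d by (simp add: upward_def)
qed

lemma downward_iff_lab:
 assumes d: "d : brauer p q"
 shows "d : downward p q \<longleftrightarrow> (\<forall>b. \<exists>a. lab p q d a b)"
 using bar_upward[OF d] upward_iff_lab[OF bar_brauer[OF d]] lab_bar[OF d] by simp

lemma upward_dcomp:
 assumes "f : upward q r" "g : upward p q"
 shows "dcomp f g : upward p r"
proof -
 note fg = upward_brauer[OF assms(1)] upward_brauer[OF assms(2)]
 have "\<forall>a. \<exists>c. lab p r (dcomp f g) a c"
  using assms unfolding upward_iff_lab[OF fg(1)] upward_iff_lab[OF fg(2)] lab_dcomp[OF fg] by blast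
 then show ?thesis by (simp add: upward_iff_lab[OF dcomp_brauer[OF fg]])
qed

lemma downward_dcomp:
 assumes "f : downward q r" "g : downward p q"
 shows "dcomp f g : downward p r"
proof -
 note fg = downward_brauer[OF assms(1)] downward_brauer[OF assms(2)]
 have "\<forall>c. \<exists>a. lab p r (dcomp f g) a c"
  using assms unfolding downward_iff_lab[OF fg(1)] downward_iff_lab[OF fg(2)] lab_dcomp[OF fg] by blast
 then show ?thesis by (simp add: downward_iff_lab[OF dcomp_brauer[OF fg]])
qed

lemma downward_dcompD:
 assumes fg: "f : brauer q r" "g : brauer p q" and "dcomp f g : downward p r"
 shows "f : downward q r"
 using assms(3) unfolding downward_iff_lab[OF dcomp_brauer[OF fg]] downward_iff_lab[OF fg(1)] lab_dcomp[OF fg]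
 by blast

text \<open>The bottom end of the strand that starts at top point \<open>i\<close>. The branch
  \<open>Top j\<close> is a default value; upward diagrams take the other one.\<close>

definition strand :: "diagram => nat => nat" where
 "strand d i = (case mate d (Top i) of Top j => j | Bot j => j)"

lemma strand_upward:
 assumes "d : upward p q" "i < p"
 shows "mate d (Top i) = Bot (strand d i)" "strand d i < q" "mate d (Bot (strand d i)) = Top i"
proof -
 obtain j where j: "j < q" "mate d (Top i) = Bot j" using assms by (auto simp: upward_iff)
 then show *: "mate d (Top i) = Bot (strand d i)" "strand d i < q" by (simp_all add: strand_def)
 show "mate d (Bot (strand d i)) = Top i"
  using matchingD(3)[OF matching_mate[OF upward_brauer[OF assms(1)]], of "Top i"] assms(2) * by simp
qed

lemma inj_strand: "d : upward p q ==> inj_on (strand d) {..<p}"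
 by (rule inj_onI) (metis lessThan_iff point.inject(1) strand_upward(3))

lemma upward_le: "d : upward p q ==> p <= q"
 using card_inj_on_le[OF inj_strand, of d p q "{..<q}"] strand_upward(2)[of d p q] by auto

lemma brauer_even: "d : brauer p q ==> even (p + q)"
proof -
 assume d: "d : brauer p q"
 have "\<Union> d = points p q" "disjoint d" "!!e. e : d ==> card e = 2"
  using d by (auto simp: brauer_def partition_on_def points_def)
 moreover have "finite d" using \<open>\<Union> d = points p q\<close> by (metis finite_UnionD points_simps(3))
 moreover have "card (points p q) = p + q"
  unfolding points_def by (subst card_Un_disjoint) (auto simp: card_image inj_on_def)
 moreover have "card (\<Union> d) = (\<Sum>e\<in>d. card e)"
 proof (rule card_Union_disjoint)
  show "pairwise disjnt d" using \<open>disjoint d\<close> by (simp add: pairwise_def disjnt_def disjoint_def)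
  show "finite e" if "e : d" for e
   using \<open>e : d ==> card e = 2\<close>[OF that] by (simp add: card_ge_0_finite)
 qed
 ultimately have "p + q = (\<Sum>e\<in>d. 2)" by simp
 then show ?thesis by simp
qed

lemma upward_preceq: "d : upward p q ==> p \<preceq> q"
 using upward_le[of d p q] brauer_even[of d p q] by (auto simp: preceq_def upward_brauer)

text \<open>Every top point of \<open>f\<close> is on a strand to the bottom, so a constant colour
  there forces all middle colours. With at most one middle colouring there can be no loop.\<close>

lemma loops_upward:
 assumes "f : upward q r" "g : brauer p q"
 shows "loops f g = 0"
proof -
 note f = upward_brauer[OF assms(1)]
 let ?K = "{kp : PiE {..<q} (%_. UNIV). lab p q g (%_. True) kp & lab q r f kp (%_. True)}"
 have "kp = restrict (%_. True) {..<q}" if "kp : ?K" for kp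
 proof
  fix j
  have "kp j" if "j < q"
   using \<open>kp : ?K\<close> lab_mate[of q r f kp "%_. True" "Top j"] that strand_upward(1)[OF assms(1) that] by simp
  then show "kp j = restrict (%_. True) {..<q} j"
   using that by (auto simp: PiE_def extensional_def)
 qed
 then have "?K \<subseteq> {restrict (%_. True) {..<q}}" by blast
 then have "card ?K <= 1" using card_mono[of "{restrict (%_. True) {..<q}}" ?K] by simp
 then have le: "int (card ?K) <= 1" by simp
 then have le: "(2::int) ^ loops f g <= 1"
  unfolding card_lab_dcomp[OF f assms(2)] by (simp add: lab_True)
 show ?thesis
 proof (cases "loops f g")
  case (Suc n)
  then have "2 * (2::int) ^ n <= 1" using le by simp
  moreover have "(1::int) <= 2 ^ n" by simp
  ultimately show ?thesis by linarith
 qed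
qed

lemma loops_downward:
 assumes "f : brauer q r" "g : downward p q"
 shows "loops f g = 0"
 using loops_bar[OF assms(1) downward_brauer[OF assms(2)]] loops_upward[of "bar g" q p "bar f" r]
  bar_upward[OF downward_brauer[OF assms(2)]] assms by simp

section \<open>Permutation diagrams\<close>

lemma
 assumes "\<sigma> permutes {..<p}"
 shows perm_diagram_brauer: "pd p \<sigma> : brauer p p"
  and mate_perm: "!!i. i < p ==> mate (pd p \<sigma>) (Top i) = Bot (\<sigma> i)"
   "!!i. i < p ==> mate (pd p \<sigma>) (Bot i) = Top (iv \<sigma> i)"
proof -
 let ?t = "case_point (%i. Bot (\<sigma> i)) (%j. Top (iv \<sigma> j))"
 have in_p: "\<sigma> i < p \<longleftrightarrow> i < p" "iv \<sigma> i < p \<longleftrightarrow> i < p" for i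
  using permutes_in_image[OF assms, of i] permutes_in_image[OF permutes_inv[OF assms], of i] by auto
 have inv: "\<sigma> (iv \<sigma> i) = i" "iv \<sigma> (\<sigma> i) = i" for i
  using permutes_inverses[OF assms] by auto
 have "matching (points p p) ?t"
  by (auto simp: matching_def points_def in_p inv)
 moreover have "pd p \<sigma> = {{x, ?t x} | x. x : points p p}"
 proof -
  have sub: "{Bot j, Top (iv \<sigma> j)} : {{Top i, Bot (\<sigma> i)} | i. i < p}" if "j < p" for j
  proof -
   have "{Bot j, Top (iv \<sigma> j)} = {Top (iv \<sigma> j), Bot (\<sigma> (iv \<sigma> j))}"
    by (simp only: inv insert_commute)
   then show ?thesis using in_p(2)[of j] that by blast
  qed
  have "{{x, ?t x} | x. x : points p p} = {{Top i, Bot (\<sigma> i)} | i. i < p} \<union> {{Bot j, Top (iv \<sigma> j)} | j. j < p}"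
  proof -
   have "{{x, ?t x} | x. x : points p p} = (%x. {x, ?t x}) ` points p p" by (rule Setcompr_eq_image)
   also have "... = (%i. {Top i, Bot (\<sigma> i)}) ` {..<p} \<union> (%j. {Bot j, Top (iv \<sigma> j)}) ` {..<p}"
    by (simp only: points_def image_Un image_image point.case)
   also have "... = {{Top i, Bot (\<sigma> i)} | i. i < p} \<union> {{Bot j, Top (iv \<sigma> j)} | j. j < p}"
    by blast
   finally show ?thesis .
  qed
  also have "{{Top i, Bot (\<sigma> i)} | i. i < p} \<union> {{Bot j, Top (iv \<sigma> j)} | j. j < p} = {{Top i, Bot (\<sigma> i)} | i. i < p}" using sub by blast
  finally show ?thesis by (simp add: perm_diagram_def)
 qed
 ultimately show "pd p \<sigma> : brauer p p"
  "!!i. i < p ==> mate (pd p \<sigma>) (Top i) = Bot (\<sigma> i)"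
  "!!i. i < p ==> mate (pd p \<sigma>) (Bot i) = Top (iv \<sigma> i)"
  using matching_brauer[of p p ?t "pd p \<sigma>"] by simp_all
qed

lemma lab_perm:
 assumes "\<sigma> permutes {..<p}"
 shows "lab p p (pd p \<sigma>) a b \<longleftrightarrow> (\<forall>i<p. b (\<sigma> i) = a i)"
proof
 assume "lab p p (pd p \<sigma>) a b"
 from lab_mate[OF this, of "Top _"] show "\<forall>i<p. b (\<sigma> i) = a i" by (simp add: mate_perm[OF assms])
next
 assume *: "\<forall>i<p. b (\<sigma> i) = a i"
 show "lab p p (pd p \<sigma>) a b"
  unfolding lab_def
 proof
  fix x assume x: "x : points p p"
  show "case_point a b (mate (pd p \<sigma>) x) = case_point a b x"
  proof (cases x)
   case (Bot j)
   then have "iv \<sigma> j < p" "\<sigma> (iv \<sigma> j) = j"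
    using x permutes_in_image[OF permutes_inv[OF assms], of j] permutes_inverses[OF assms] by auto
   then show ?thesis using * Bot x by (simp add: mate_perm[OF assms]) metis
  qed (use * x in \<open>simp add: mate_perm[OF assms]\<close>)
 qed
qed

lemma perm_upward: "\<sigma> permutes {..<p} ==> pd p \<sigma> : upward p p"
 using permutes_in_image[of \<sigma> "{..<p}"] by (auto simp: upward_iff perm_diagram_brauer mate_perm)

lemma strand_perm: "\<sigma> permutes {..<p} ==> i < p ==> strand (pd p \<sigma>) i = \<sigma> i"
 by (simp add: strand_def mate_perm)

lemma bar_perm: "\<sigma> permutes {..<p} ==> bar (pd p \<sigma>) = pd p (iv \<sigma>)"
proof (rule brauer_eq_lab[of _ p p])
 assume \<sigma>: "\<sigma> permutes {..<p}"
 note \<sigma>' = permutes_inv[OF \<sigma>]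
 show "bar (pd p \<sigma>) : brauer p p" "pd p (iv \<sigma>) : brauer p p"
  by (simp_all add: perm_diagram_brauer \<sigma> \<sigma>')
 show "lab p p (bar (pd p \<sigma>)) a b \<longleftrightarrow> lab p p (pd p (iv \<sigma>)) a b" for a b
  unfolding lab_bar[OF perm_diagram_brauer[OF \<sigma>]] lab_perm[OF \<sigma>] lab_perm[OF \<sigma>']
  using permutes_inverses[OF \<sigma>] permutes_in_image[OF \<sigma>] permutes_in_image[OF \<sigma>'] by (metis lessThan_iff)
qed

lemma perm_downward: "\<sigma> permutes {..<p} ==> pd p \<sigma> : downward p p"
 using bar_upward[OF perm_diagram_brauer, of \<sigma> p] perm_upward[OF permutes_inv, of \<sigma> p] by (simp add: bar_perm)

lemma strand_dcomp:
 assumes f: "f : upward q r" and g: "g : upward p q" and i: "i < p"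
 shows "strand (dcomp f g) i = strand f (strand g i)"
proof -
 note fg = upward_brauer[OF f] upward_brauer[OF g]
 note si = strand_upward[OF g i] and sj = strand_upward[OF f strand_upward(2)[OF g i]]
 have "mate (dcomp f g) (Top i) = Bot (strand f (strand g i))"
 proof (rule mate_eq_lab[OF dcomp_brauer[OF fg]])
  fix a c assume "lab p r (dcomp f g) a c"
  then obtain kp where "lab p q g a kp" "lab q r f kp c" by (auto simp: lab_dcomp[OF fg])
  from lab_mate[OF this(1), of "Top i"] lab_mate[OF this(2), of "Top (strand g i)"]
  show "case_point a c (Top i) = case_point a c (Bot (strand f (strand g i)))"
   using i si sj by simp
 qed (use i in auto)
 then show ?thesis by (simp add: strand_def)
qed

lemma perm_dcomp:
 assumes "\<sigma> permutes {..<p}" "\<tau> permutes {..<p}"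
 shows "dcomp (pd p \<sigma>) (pd p \<tau>) = pd p (\<sigma> o \<tau>)"
proof (rule brauer_eq_lab[of _ p p])
 note \<sigma>\<tau> = permutes_compose[OF assms(2,1)] and b = perm_diagram_brauer[OF assms(1)] perm_diagram_brauer[OF assms(2)]
 show "dcomp (pd p \<sigma>) (pd p \<tau>) : brauer p p" "pd p (\<sigma> o \<tau>) : brauer p p"
  using dcomp_brauer[OF b] perm_diagram_brauer[OF \<sigma>\<tau>] by auto
 fix a c :: "nat => bool"
 have "(\<exists>kp. (\<forall>i<p. kp (\<tau> i) = a i) & (\<forall>i<p. c (\<sigma> i) = kp i)) \<longleftrightarrow> (\<forall>i<p. c (\<sigma> (\<tau> i)) = a i)"
 proof
  assume "\<exists>kp. (\<forall>i<p. kp (\<tau> i) = a i) & (\<forall>i<p. c (\<sigma> i) = kp i)"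
  then show "\<forall>i<p. c (\<sigma> (\<tau> i)) = a i" using permutes_in_image[OF assms(2)] by auto
 next
  assume "\<forall>i<p. c (\<sigma> (\<tau> i)) = a i"
  then show "\<exists>kp. (\<forall>i<p. kp (\<tau> i) = a i) & (\<forall>i<p. c (\<sigma> i) = kp i)" by (intro exI[of _ "%i. c (\<sigma> i)"]) auto
 qed
 then show "lab p p (dcomp (pd p \<sigma>) (pd p \<tau>)) a c \<longleftrightarrow> lab p p (pd p (\<sigma> o \<tau>)) a c"
  unfolding lab_dcomp[OF b] lab_perm[OF assms(1)] lab_perm[OF assms(2)] lab_perm[OF \<sigma>\<tau>] by simp
qed

lemma dcomp_id_right:
 assumes d: "d : brauer p q"
 shows "dcomp d (pd p id) = d"
proof (rule brauer_eq_lab[OF dcomp_brauer[OF d] d])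
 note i = permutes_id[of "{..<p}"]
 show b: "pd p id : brauer p p" by (rule perm_diagram_brauer[OF i])
 fix a c
 show "lab p q (dcomp d (pd p id)) a c \<longleftrightarrow> lab p q d a c"
 proof -
  have "(\<exists>kp. (\<forall>i<p. kp (id i) = a i) & lab p q d kp c) \<longleftrightarrow> lab p q d a c"
  proof
   assume "\<exists>kp. (\<forall>i<p. kp (id i) = a i) & lab p q d kp c"
   then obtain kp where "\<forall>i<p. kp (id i) = a i" "lab p q d kp c" by blast
   then show "lab p q d a c" using lab_cong[OF d, of kp a c c] by simp
  qed auto
  then show ?thesis unfolding lab_dcomp[OF d b] lab_perm[OF i] .
 qed
qed

lemma dcomp_id_left:
 assumes d: "d : brauer p q"
 shows "dcomp (pd q id) d = d"
proof -
 note i = permutes_id[of "{..<q}"]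
 have "bar (dcomp (pd q id) d) = dcomp (bar d) (bar (pd q id))"
  by (rule bar_dcomp[OF perm_diagram_brauer[OF i] d])
 also have "... = bar d"
  by (simp add: bar_perm[OF i] dcomp_id_right[OF bar_brauer[OF d]])
 finally have "bar (dcomp (pd q id) d) = bar d" .
 from arg_cong[OF this, of bar] show ?thesis by simp
qed

abbreviation perms :: "nat => (nat => nat) set" where
 "perms p \<equiv> {\<sigma>. \<sigma> permutes {..<p}}"

lemma finite_perms: "finite (perms p)"
 by (rule finite_permutations) simp

section \<open>Monotone diagrams as representatives for the symmetric group\<close>

lemma pair_strand:
 assumes "d : upward p q"
 shows "{Top i, Bot j} : d \<longleftrightarrow> i < p & j = strand d i"
 unfolding pair_iff_mate[OF upward_brauer[OF assms]] using strand_upward(1)[OF assms, of i] by auto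

lemma upward_mono_iff:
 "h : um p q \<longleftrightarrow> h : upward p q & strict_mono_on {..<p} (strand h)"
proof (cases "h : upward p q")
 case h: True
 have "monotone_diagram h \<longleftrightarrow> strict_mono_on {..<p} (strand h)"
 proof
  assume m: "monotone_diagram h"
  show "strict_mono_on {..<p} (strand h)"
  proof (rule strict_mono_onI)
   fix i k assume ik: "i : {..<p}" "k : {..<p}" "i < k"
   then have "(int i - int k) * (int (strand h i) - int (strand h k)) > 0"
    using m pair_strand[OF h] by (auto simp: monotone_diagram_def doubleton_eq_iff)
   then show "strand h i < strand h k" using ik by (simp add: zero_less_mult_iff)
  qed
 next
  assume m: "strict_mono_on {..<p} (strand h)"
  show "monotone_diagram h"
   unfolding monotone_diagram_def
  proof (intro allI impI)
   fix i j k l assume *: "{Top i, Bot j} : h & {Top k, Bot l} : h & {Top i, Bot j} ~= {Top k, Bot l}"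
   then have ij: "i < p" "k < p" "j = strand h i" "l = strand h k" "i ~= k"
    using pair_strand[OF h] by auto
   consider "i < k" | "k < i" using ij(5) by linarith
   then show "(int i - int k) * (int j - int l) > 0"
   proof cases
    case 1
    then have "j < l" using strict_mono_onD[OF m, of i k] ij by simp
    then show ?thesis using 1 by (simp add: zero_less_mult_iff)
   next
    case 2
    then have "l < j" using strict_mono_onD[OF m, of k i] ij by simp
    then show ?thesis using 2 by (simp add: zero_less_mult_iff)
   qed
  qed
 qed
 then show ?thesis using h by (simp add: upward_mono_def)
qed (simp add: upward_mono_def)

lemma upward_mono_upward: "h : um p q ==> h : upward p q"
 by (simp add: upward_mono_def)

text \<open>Both functions list their common image in sorted order.\<close>

lemma strict_mono_same_image:
 fixes f g :: "nat => nat"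
 assumes "strict_mono_on {..<p} f" "strict_mono_on {..<p} g" "f ` {..<p} = g ` {..<p}" "i < p"
 shows "f i = g i"
proof -
 have s: "sorted (map h [0..<p])" "distinct (map h [0..<p])" if h: "strict_mono_on {..<p} h" for h :: "nat => nat"
 proof -
  show "sorted (map h [0..<p])"
   using strict_mono_onD[OF h] by (auto simp: sorted_iff_nth_mono le_less)
  show "distinct (map h [0..<p])"
   using strict_mono_on_imp_inj_on[OF h] by (simp add: distinct_map atLeast0LessThan)
 qed
 have "map f [0..<p] = map g [0..<p]"
  by (rule sorted_distinct_set_unique) (use s[OF assms(1)] s[OF assms(2)] assms(3) in \<open>simp_all add: atLeast0LessThan\<close>)
 then show ?thesis using assms(4) by (metis atLeastLessThan_iff le0 map_eq_conv set_upt)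
qed

lemma dcomp_perm_cancel:
 assumes "d : brauer p q" "\<sigma> permutes {..<p}"
 shows "dcomp (dcomp d (pd p \<sigma>)) (pd p (iv \<sigma>)) = d"
  "dcomp (dcomp d (pd p (iv \<sigma>))) (pd p \<sigma>) = d"
 using dcomp_assoc[OF assms(1) perm_diagram_brauer[OF assms(2)] perm_diagram_brauer[OF permutes_inv[OF assms(2)]]]
  dcomp_assoc[OF assms(1) perm_diagram_brauer[OF permutes_inv[OF assms(2)]] perm_diagram_brauer[OF assms(2)]]
 by (simp_all add: perm_dcomp assms permutes_inv permutes_inv_o[OF assms(2)] dcomp_id_right[OF assms(1)])

lemma dcomp_perm_cancel_left:
 assumes "d : brauer q p" "\<sigma> permutes {..<p}"
 shows "dcomp (pd p \<sigma>) (dcomp (pd p (iv \<sigma>)) d) = d"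
  "dcomp (pd p (iv \<sigma>)) (dcomp (pd p \<sigma>) d) = d"
 using dcomp_assoc[OF perm_diagram_brauer[OF assms(2)] perm_diagram_brauer[OF permutes_inv[OF assms(2)]] assms(1)]
  dcomp_assoc[OF perm_diagram_brauer[OF permutes_inv[OF assms(2)]] perm_diagram_brauer[OF assms(2)] assms(1)]
 by (simp_all add: perm_dcomp assms permutes_inv permutes_inv_o[OF assms(2)] dcomp_id_left[OF assms(1)])

lemma strand_dcomp_perm:
 assumes "d : upward p q" "\<sigma> permutes {..<p}" "i < p"
 shows "strand (dcomp d (pd p \<sigma>)) i = strand d (\<sigma> i)"
 using strand_dcomp[OF assms(1) perm_upward[OF assms(2)] assms(3)] by (simp add: strand_perm assms)

text \<open>Renumbering the strands by increasing bottom end makes the diagram monotone; the inverse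
  renumbering is the permutation.\<close>

lemma upward_decomp_exists:
 assumes w: "w : upward p q"
 obtains h \<sigma> where "h : um p q" "\<sigma> permutes {..<p}" "w = dcomp h (pd p \<sigma>)"
proof -
 define R where "R = strand w ` {..<p}"
 define xs where "xs = sorted_list_of_set R"
 have inj: "inj_on (strand w) {..<p}" by (rule inj_strand[OF w])
 have xs: "distinct xs" "set xs = R" "sorted xs" "length xs = p"
  using card_image[OF inj] by (simp_all add: xs_def R_def)
 \<comment> \<open>The strand of \<open>w\<close> that ends at the \<open>i\<close>-th smallest of
   the bottom ends.\<close>
 define \<tau> where "\<tau> i = (if i < p then the_inv_into {..<p} (strand w) (xs ! i) else i)" for i
 have "bij_betw ((!) xs) {..<p} R"
  using bij_betw_nth[OF xs(1), of "{..<p}" R] xs by simp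
 moreover have "bij_betw (the_inv_into {..<p} (strand w)) R {..<p}"
  unfolding R_def by (rule bij_betw_the_inv_into) (use inj in \<open>simp add: bij_betw_def\<close>)
 ultimately have "bij_betw (the_inv_into {..<p} (strand w) o (!) xs) {..<p} {..<p}"
  by (rule bij_betw_trans)
 then have "bij_betw \<tau> {..<p} {..<p}"
  by (subst bij_betw_cong[of _ _ "the_inv_into {..<p} (strand w) o (!) xs"]) (simp_all add: \<tau>_def)
 then have \<tau>: "\<tau> permutes {..<p}" by (rule bij_imp_permutes) (simp add: \<tau>_def)
 let ?h = "dcomp w (pd p \<tau>)"
 have st: "strand ?h i = xs ! i" if "i < p" for i
 proof -
  have "xs ! i : strand w ` {..<p}" using xs that R_def nth_mem by metis
  then show ?thesis
   using strand_dcomp_perm[OF w \<tau> that] f_the_inv_into_f[OF inj] that by (simp add: \<tau>_def)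
 qed
 have "strict_mono_on {..<p} (strand ?h)"
 proof (rule strict_mono_onI)
  fix i k assume "i : {..<p}" "k : {..<p}" "i < k"
  then show "strand ?h i < strand ?h k"
   using sorted_nth_mono[OF xs(3), of i k] nth_eq_iff_index_eq[OF xs(1), of i k] xs(4) by (simp add: st)
 qed
 then have "?h : um p q"
  using upward_dcomp[OF w perm_upward[OF \<tau>]] by (simp add: upward_mono_iff)
 then show ?thesis
  using that[of ?h "iv \<tau>"] permutes_inv[OF \<tau>] dcomp_perm_cancel(1)[OF upward_brauer[OF w] \<tau>] by simp
qed

text \<open>Precomposition with a permutation keeps the set of bottom ends of strands, and a
  monotone strand function is determined by this set. Injectivity of strands then recovers the
  permutation.\<close>

lemma upward_decomp_unique:
 assumes "h : um p q" "h' : um p q" "\<sigma> permutes {..<p}" "\<sigma>' permutes {..<p}"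
  and eq: "dcomp h (pd p \<sigma>) = dcomp h' (pd p \<sigma>')"
 shows "h = h'" "\<sigma> = \<sigma>'"
proof -
 note u = upward_mono_upward[OF assms(1)] upward_mono_upward[OF assms(2)]
 have st: "strand h (\<sigma> i) = strand h' (\<sigma>' i)" if "i < p" for i
  using strand_dcomp_perm[OF u(1) assms(3) that] strand_dcomp_perm[OF u(2) assms(4) that] eq by simp
 have "strand h ` {..<p} = strand h ` \<sigma> ` {..<p}" by (simp add: permutes_image[OF assms(3)])
 also have "... = strand h' ` \<sigma>' ` {..<p}" unfolding image_image by (rule image_cong) (simp_all add: st)
 also have "... = strand h' ` {..<p}" by (simp add: permutes_image[OF assms(4)])
 finally have im: "strand h ` {..<p} = strand h' ` {..<p}" .
 have same: "strand h i = strand h' i" if "i < p" for i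
  by (rule strict_mono_same_image[OF _ _ im that]) (use assms(1,2) in \<open>simp_all add: upward_mono_iff\<close>)
 show s: "\<sigma> = \<sigma>'"
 proof
  fix i
  show "\<sigma> i = \<sigma>' i"
  proof (cases "i < p")
   case True
   then have lt: "\<sigma> i < p" "\<sigma>' i < p"
    using permutes_in_image[OF assms(3), of i] permutes_in_image[OF assms(4), of i] by auto
   then have "strand h' (\<sigma> i) = strand h' (\<sigma>' i)" using st[OF True] same by simp
   then show ?thesis using inj_strand[OF u(2)] lt by (simp add: inj_on_def)
  next
   case False
   then show ?thesis using assms(3,4) by (simp add: permutes_def)
  qed
 qed
 show "h = h'"
 proof -
  have "h = dcomp (dcomp h (pd p \<sigma>)) (pd p (iv \<sigma>))"
   by (simp only: dcomp_perm_cancel(1)[OF upward_brauer[OF u(1)] assms(3)])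
  also have "... = dcomp (dcomp h' (pd p \<sigma>')) (pd p (iv \<sigma>'))"
   by (simp only: eq) (simp only: s)
  also have "... = h'"
   by (rule dcomp_perm_cancel(1)[OF upward_brauer[OF u(2)] assms(4)])
  finally show ?thesis .
 qed
qed

text \<open>The symmetric group acts freely from the right on upward diagrams, with the monotone
  ones as orbit representatives. All coordinates on the tensor products rest on this.\<close>

lemma bij_upward_decomp:
 "bij_betw (%(h, \<sigma>). dcomp h (pd p \<sigma>)) (um p q \<times> perms p) (upward p q)"
proof (rule bij_betwI')
 fix x y assume "x : um p q \<times> perms p" "y : um p q \<times> perms p"
 then obtain h \<sigma> h' \<sigma>' where "x = (h, \<sigma>)" "y = (h', \<sigma>')" "h : um p q" "h' : um p q"
  "\<sigma> permutes {..<p}" "\<sigma>' permutes {..<p}" by blast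
 then show "(case x of (h, \<sigma>) => dcomp h (pd p \<sigma>)) = (case y of (h, \<sigma>) => dcomp h (pd p \<sigma>)) \<longleftrightarrow> x = y"
  using upward_decomp_unique[of h p q h' \<sigma> \<sigma>'] by (metis case_prod_conv)
next
 fix x assume "x : um p q \<times> perms p"
 then show "(case x of (h, \<sigma>) => dcomp h (pd p \<sigma>)) : upward p q"
  by (auto intro: upward_dcomp upward_mono_upward perm_upward)
next
 fix w assume "w : upward p q"
 from upward_decomp_exists[OF this] obtain h \<sigma>
  where "h : um p q" "\<sigma> permutes {..<p}" "w = dcomp h (pd p \<sigma>)" .
 then show "\<exists>x\<in>um p q \<times> perms p. w = (case x of (h, \<sigma>) => dcomp h (pd p \<sigma>))"
  by (intro bexI[of _ "(h, \<sigma>)"]) auto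
qed

lemma sum_upward:
 "(\<Sum>w\<in>upward p q. \<phi> w) = (\<Sum>h\<in>um p q. \<Sum>\<sigma>\<in>perms p. \<phi> (dcomp h (pd p \<sigma>)))"
 using sum.reindex_bij_betw[OF bij_upward_decomp, of \<phi> p q]
 by (simp add: sum.cartesian_product case_prod_unfold)

lemma perm_diagram_inj: "\<sigma> permutes {..<p} ==> \<tau> permutes {..<p} ==> pd p \<sigma> = pd p \<tau> \<longleftrightarrow> \<sigma> = \<tau>"
proof
 assume *: "\<sigma> permutes {..<p}" "\<tau> permutes {..<p}" "pd p \<sigma> = pd p \<tau>"
 show "\<sigma> = \<tau>"
 proof
  fix i show "\<sigma> i = \<tau> i"
   using strand_perm[OF *(1), of i] strand_perm[OF *(2), of i] * by (cases "i < p") (auto simp: permutes_def)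
 qed
qed simp

lemma level_eq: "level p p = pd p ` perms p"
proof
 show "pd p ` perms p \<subseteq> level p p"
  by (auto simp: level_def perm_upward perm_downward)
 show "level p p \<subseteq> pd p ` perms p"
 proof
  fix d assume "d : level p p"
  then have u: "d : upward p p" by (simp add: level_def)
  define \<sigma> where "\<sigma> i = (if i < p then strand d i else i)" for i
  have "strand d ` {..<p} = {..<p}"
   by (rule card_subset_eq) (use strand_upward(2)[OF u] card_image[OF inj_strand[OF u]] in auto)
  then have "bij_betw (strand d) {..<p} {..<p}" using inj_strand[OF u] by (simp add: bij_betw_def)
  then have "bij_betw \<sigma> {..<p} {..<p}" by (subst bij_betw_cong[of _ _ "strand d"]) (simp_all add: \<sigma>_def)
  then have \<sigma>: "\<sigma> permutes {..<p}" by (rule bij_imp_permutes) (simp add: \<sigma>_def)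
  have "d = pd p \<sigma>"
  proof (rule brauer_eqI[OF upward_brauer[OF u] perm_diagram_brauer[OF \<sigma>]])
   fix x assume x: "x : points p p"
   show "mate d x = mate (pd p \<sigma>) x"
   proof (cases x)
    case (Top i)
    then show ?thesis using x strand_upward(1)[OF u, of i] by (simp add: mate_perm[OF \<sigma>] \<sigma>_def)
   next
    case (Bot j)
    define i where "i = iv \<sigma> j"
    have i: "i < p" "\<sigma> i = j"
     using x Bot permutes_in_image[OF permutes_inv[OF \<sigma>], of j] permutes_inverses(1)[OF \<sigma>]
     by (auto simp: i_def)
    then have "mate d (Bot j) = Top i" using strand_upward(3)[OF u i(1)] by (simp add: \<sigma>_def)
    then show ?thesis using x Bot by (simp add: mate_perm[OF \<sigma>] i_def)
   qed
  qed
  then show "d : pd p ` perms p" using \<sigma> by blast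
 qed
qed

lemma sum_level: "(\<Sum>d\<in>level p p. \<phi> d) = (\<Sum>\<sigma>\<in>perms p. \<phi> (pd p \<sigma>))"
 unfolding level_eq by (subst sum.reindex) (auto simp: inj_on_def perm_diagram_inj)

lemma finite_brauer: "finite (brauer p q)"
proof (rule finite_subset)
 show "brauer p q \<subseteq> Pow (Pow (points p q))"
  by (auto simp: brauer_def partition_on_def points_def)
qed simp

lemma finite_upward: "finite (upward p q)" and finite_downward: "finite (downward p q)"
 and finite_upward_mono: "finite (um p q)" and finite_level: "finite (level p q)"
 by (rule finite_subset[OF _ finite_brauer[of p q]]; auto simp: upward_def downward_def upward_mono_def level_def)+

section \<open>The Brauer category and its action on upward diagrams\<close>

lemma fscale_apply [simp]: "fscale c x a = c * x a" by (simp add: fscale_def)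

lemma delta_apply: "delta a b = (if b = a then 1 else 0)" by (simp add: delta_def)

lemma supp_delta: "supp (delta a :: _ => 'r::comm_ring_1) = {a}" by (auto simp: supp_def delta_def)

lemma free_onD: "x : free_on S ==> a \<notin> S ==> x a = 0" by (auto simp: free_on_def supp_def)

lemma free_on_finite:
 assumes "finite S"
 shows "x : free_on S \<longleftrightarrow> (\<forall>a. a \<notin> S --> x a = 0)"
 using finite_subset[OF _ assms, of "supp x"] by (auto simp: free_on_def supp_def)

lemma sum_apply: "(\<Sum>i\<in>A. F i) x = (\<Sum>i\<in>A. F i x)"
 by (induction A rule: infinite_finite_induct) auto

lemma bilinear_ext_sum:
 assumes "finite A" "x : free_on A" "finite C" "y : free_on C"
 shows "bilinear_ext \<beta> x y c = (\<Sum>a\<in>A. \<Sum>b\<in>C. x a * y b * \<beta> a b c)"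
proof -
 have sx: "supp x \<subseteq> A" and sy: "supp y \<subseteq> C" using assms by (auto simp: free_on_def)
 have "bilinear_ext \<beta> x y c = (\<Sum>a\<in>supp x. \<Sum>b\<in>supp y. x a * y b * \<beta> a b c)"
  by (simp add: bilinear_ext_def sum_apply)
 also have "... = (\<Sum>a\<in>supp x. \<Sum>b\<in>C. x a * y b * \<beta> a b c)"
  by (intro sum.cong refl sum.mono_neutral_left) (use assms sy in \<open>auto simp: supp_def\<close>)
 also have "... = (\<Sum>a\<in>A. \<Sum>b\<in>C. x a * y b * \<beta> a b c)"
  by (intro sum.mono_neutral_left) (use assms sx in \<open>auto simp: supp_def\<close>)
 finally show ?thesis .
qed

lemma sum_of_bool_pick:
 fixes \<phi> :: "'a => 'k::comm_ring_1"
 assumes "finite A" "a : A"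
 shows "(\<Sum>x\<in>A. \<phi> x * of_bool (x = a)) = \<phi> a"
 by (subst sum.remove[OF assms]) (auto intro!: sum.neutral)

lemma sum_swap3:
 "(\<Sum>a\<in>A. \<Sum>b\<in>B. \<Sum>c\<in>C. F a b c) = (\<Sum>b\<in>B. \<Sum>c\<in>C. \<Sum>a\<in>A. F a b c)"
proof -
 have "(\<Sum>a\<in>A. \<Sum>b\<in>B. \<Sum>c\<in>C. F a b c) = (\<Sum>b\<in>B. \<Sum>a\<in>A. \<Sum>c\<in>C. F a b c)"
  by (rule sum.swap)
 also have "... = (\<Sum>b\<in>B. \<Sum>c\<in>C. \<Sum>a\<in>A. F a b c)"
  by (intro sum.cong refl) (rule sum.swap)
 finally show ?thesis .
qed

lemma delta_hom: "d : brauer p q ==> delta d : hom_brauer p q"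
 by (auto simp: hom_brauer_def free_on_def supp_delta)

lemma free_on_mono: "S \<subseteq> T ==> free_on S \<subseteq> free_on T" by (auto simp: free_on_def)

lemma upward_hom: "x : free_on (upward p q) ==> x : hom_brauer p q"
 and level_hom: "x : free_on (level p q) ==> x : hom_brauer p q"
 using free_on_mono[of "upward p q" "brauer p q"] free_on_mono[of "level p q" "brauer p q"]
 by (auto simp: hom_brauer_def upward_def level_def)

lemma bcomp_apply:
 assumes "x : hom_brauer q r" "y : hom_brauer p q"
 shows "bcomp \<delta> x y d = (\<Sum>f\<in>brauer q r. \<Sum>g\<in>brauer p q. x f * y g * (\<delta> ^ loops f g * of_bool (dcomp f g = d)))"
 unfolding bcomp_def using assms
 by (subst bilinear_ext_sum[OF finite_brauer _ finite_brauer]) (auto simp: hom_brauer_def delta_def intro!: sum.cong)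

lemma bcomp_hom:
 assumes "x : hom_brauer q r" "y : hom_brauer p q"
 shows "bcomp \<delta> x y : hom_brauer p r"
 unfolding hom_brauer_def free_on_finite[OF finite_brauer]
proof (intro allI impI)
 fix d assume "d \<notin> brauer p r"
 then show "bcomp \<delta> x y d = 0"
  unfolding bcomp_apply[OF assms] by (intro sum.neutral ballI) (use dcomp_brauer in fastforce)
qed

text \<open>The arbitrary weight \<phi> lets the extraction of coefficients be done once, for
  associativity as well as for the functoriality of \<open>F_mor\<close>.\<close>

lemma sum_bcomp:
 assumes "x : hom_brauer q r" "y : hom_brauer p q"
 shows "(\<Sum>d\<in>brauer p r. bcomp \<delta> x y d * \<phi> d) =
  (\<Sum>f\<in>brauer q r. \<Sum>g\<in>brauer p q. x f * y g * (\<delta> ^ loops f g * \<phi> (dcomp f g)))"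
proof -
 have "(\<Sum>d\<in>brauer p r. bcomp \<delta> x y d * \<phi> d) = (\<Sum>d\<in>brauer p r. \<Sum>f\<in>brauer q r. \<Sum>g\<in>brauer p q.
   x f * y g * (\<delta> ^ loops f g * (of_bool (dcomp f g = d) * \<phi> d)))"
  unfolding bcomp_apply[OF assms] by (simp only: sum_distrib_right mult.assoc)
 also have "... = (\<Sum>f\<in>brauer q r. \<Sum>g\<in>brauer p q. \<Sum>d\<in>brauer p r.
   x f * y g * (\<delta> ^ loops f g * (of_bool (dcomp f g = d) * \<phi> d)))"
  by (rule sum_swap3)
 also have "... = (\<Sum>f\<in>brauer q r. \<Sum>g\<in>brauer p q. x f * y g * (\<delta> ^ loops f g * \<phi> (dcomp f g)))"
 proof (intro sum.cong refl)
  fix f g assume "f : brauer q r" "g : brauer p q"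
  then have "dcomp f g : brauer p r" by (rule dcomp_brauer)
  then have "(\<Sum>d\<in>brauer p r. of_bool (dcomp f g = d) * \<phi> d) = \<phi> (dcomp f g)"
   using sum.delta[OF finite_brauer[of p r], of "dcomp f g" \<phi>] by (simp add: of_bool_def eq_commute if_distrib[of "%t. t * _"] cong: if_cong)
  then show "(\<Sum>d\<in>brauer p r. x f * y g * (\<delta> ^ loops f g * (of_bool (dcomp f g = d) * \<phi> d))) =
    x f * y g * (\<delta> ^ loops f g * \<phi> (dcomp f g))"
   by (simp add: sum_distrib_left[symmetric])
 qed
 finally show ?thesis .
qed

lemma bcomp_assoc:
 assumes x: "x : hom_brauer r s" and y: "y : hom_brauer q r" and z: "z : hom_brauer p q"
 shows "bcomp \<delta> x (bcomp \<delta> y z) = bcomp \<delta> (bcomp \<delta> x y) z"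
proof
 fix d
 note yz = bcomp_hom[OF y z] and xy = bcomp_hom[OF x y]
 let ?T = "%f g h. x f * y g * z h * (\<delta> ^ (loops f (dcomp g h) + loops g h) * of_bool (dcomp f (dcomp g h) = d))"
 have "bcomp \<delta> x (bcomp \<delta> y z) d =
   (\<Sum>f\<in>brauer r s. x f * (\<Sum>k\<in>brauer p r. bcomp \<delta> y z k * (\<delta> ^ loops f k * of_bool (dcomp f k = d))))"
  unfolding bcomp_apply[OF x yz] by (simp add: sum_distrib_left mult_ac)
 also have "... = (\<Sum>f\<in>brauer r s. \<Sum>g\<in>brauer q r. \<Sum>h\<in>brauer p q. ?T f g h)"
  unfolding sum_bcomp[OF y z] by (simp add: sum_distrib_left mult_ac power_add)
 also have "... = (\<Sum>f\<in>brauer r s. \<Sum>g\<in>brauer q r. \<Sum>h\<in>brauer p q. x f * y g * z h *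
   (\<delta> ^ (loops (dcomp f g) h + loops f g) * of_bool (dcomp (dcomp f g) h = d)))"
  by (intro sum.cong refl) (simp add: dcomp_assoc[of _ r s _ q _ p] loops_assoc[of _ r s _ q _ p])
 also have "... = (\<Sum>h\<in>brauer p q. z h * (\<Sum>f\<in>brauer r s. \<Sum>g\<in>brauer q r. x f * y g *
   (\<delta> ^ loops f g * (\<delta> ^ loops (dcomp f g) h * of_bool (dcomp (dcomp f g) h = d)))))"
  by (subst sum_swap3[symmetric]) (simp only: sum_distrib_left power_add mult_ac)
 also have "... = (\<Sum>h\<in>brauer p q. z h * (\<Sum>k\<in>brauer q s. bcomp \<delta> x y k * (\<delta> ^ loops k h * of_bool (dcomp k h = d))))"
  unfolding sum_bcomp[OF x y] by (rule refl)
 also have "... = bcomp \<delta> (bcomp \<delta> x y) z d"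
  unfolding bcomp_apply[OF xy z] by (subst sum.swap) (simp add: sum_distrib_left mult_ac)
 finally show "bcomp \<delta> x (bcomp \<delta> y z) d = bcomp \<delta> (bcomp \<delta> x y) z d" .
qed

lemma bcomp_delta: "bcomp \<delta> (delta f) (delta g) = fscale (\<delta> ^ loops f g) (delta (dcomp f g))"
 by (rule ext) (simp add: bcomp_def bilinear_ext_def supp_delta delta_apply)

lemma bcomp_delta_left_apply:
 assumes "b : brauer q r" "y : hom_brauer p q"
 shows "bcomp \<delta> (delta b) y d = (\<Sum>g\<in>brauer p q. y g * (\<delta> ^ loops b g * of_bool (dcomp b g = d)))"
 unfolding bcomp_apply[OF delta_hom[OF assms(1)] assms(2)]
 by (subst sum.remove[OF finite_brauer assms(1)]) (auto simp: delta_apply intro!: sum.neutral)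

lemma bcomp_expand_left:
 assumes "x : hom_brauer q r" "y : hom_brauer p q"
 shows "bcomp \<delta> x y d = (\<Sum>b\<in>brauer q r. x b * bcomp \<delta> (delta b) y d)"
 unfolding bcomp_apply[OF assms]
 by (intro sum.cong refl) (simp add: bcomp_delta_left_apply[OF _ assms(2)] sum_distrib_left mult_ac)

lemma bcomp_bid_right:
 assumes "x : hom_brauer p q"
 shows "bcomp \<delta> x (bid p) = x"
proof
 fix d
 note i = perm_diagram_brauer[OF permutes_id[of "{..<p}"]]
 have "bcomp \<delta> (delta f) (bid p) d = of_bool (f = d)" if "f : brauer p q" for f
  using loops_downward[OF that perm_downward[OF permutes_id]]
  by (simp add: bid_def bcomp_delta dcomp_id_right[OF that] delta_apply)
 then have "bcomp \<delta> x (bid p) d = (\<Sum>f\<in>brauer p q. x f * of_bool (f = d))"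
  unfolding bcomp_expand_left[OF assms delta_hom[OF i, folded bid_def]] by simp
 also have "... = x d"
 proof (cases "d : brauer p q")
  case True
  then show ?thesis by (subst sum.remove[OF finite_brauer True]) (auto intro!: sum.neutral)
 next
  case False
  then have "x d = 0" using assms by (auto simp: hom_brauer_def dest: free_onD)
  then show ?thesis using False by (auto intro!: sum.neutral)
 qed
 finally show "bcomp \<delta> x (bid p) d = x d" .
qed

lemma bid_hom: "bid p : hom_brauer p p"
 unfolding bid_def by (rule delta_hom[OF perm_diagram_brauer[OF permutes_id]])

section \<open>The operation \<open>sharp\<close> as a matrix\<close>

lemma bcomp_left_perm:
 assumes b: "b : brauer q' p" and c: "c : brauer q p" and g: "g : hom_brauer q q'" and \<sigma>: "\<sigma> permutes {..<p}"
 shows "bcomp \<delta> (delta (dcomp (pd p \<sigma>) b)) g (dcomp (pd p \<sigma>) c) = bcomp \<delta> (delta b) g c"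
proof -
 note P = perm_diagram_brauer[OF \<sigma>]
 have "loops (dcomp (pd p \<sigma>) b) k = loops b k" if "k : brauer q q'" for k
  using loops_assoc[OF P b that] loops_upward[OF perm_upward[OF \<sigma>]] b dcomp_brauer[OF b that] by simp
 moreover have "dcomp (dcomp (pd p \<sigma>) b) k = dcomp (pd p \<sigma>) c \<longleftrightarrow> dcomp b k = c"
  if "k : brauer q q'" for k
  using dcomp_assoc[OF P b that] dcomp_perm_cancel_left(2)[OF dcomp_brauer[OF b that] \<sigma>]
   dcomp_perm_cancel_left(2)[OF c \<sigma>] by metis
 ultimately show ?thesis
  unfolding bcomp_delta_left_apply[OF b g] bcomp_delta_left_apply[OF dcomp_brauer[OF P b] g]
  by (intro sum.cong refl) simp
qed

text \<open>The matrix of \<open>sharp g\<close> in the basis of upward diagrams is the transpose of the action of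
 \<open>g\<close> by right composition on downward diagrams.\<close>

definition sharp_coeff :: "'k::field => (diagram => 'k) => diagram => diagram => 'k" where
 "sharp_coeff \<delta> g w u = bcomp \<delta> (delta (bar w)) g (bar u)"

lemma bar_dcomp_perm:
 assumes "w : brauer p q" "\<sigma> permutes {..<p}"
 shows "bar (dcomp w (pd p \<sigma>)) = dcomp (pd p (iv \<sigma>)) (bar w)"
 using bar_dcomp[OF assms(1) perm_diagram_brauer[OF assms(2)]] by (simp add: bar_perm[OF assms(2)])

text \<open>After reflection the permutation acts from the left, where it creates no loop and is
  injective, so it cancels from the coefficient.\<close>

lemma sharp_coeff_perm:
 assumes "w : brauer p q'" "u : brauer p q" "g : hom_brauer q q'" "\<sigma> permutes {..<p}"
 shows "sharp_coeff \<delta> g (dcomp w (pd p \<sigma>)) (dcomp u (pd p \<sigma>)) = sharp_coeff \<delta> g w u"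
 unfolding sharp_coeff_def bar_dcomp_perm[OF assms(1,4)] bar_dcomp_perm[OF assms(2,4)]
 by (rule bcomp_left_perm) (use assms permutes_inv in auto)

text \<open>Guarantees that the permutation selected by \<open>THE\<close> in
  \<open>bprime_diagram\<close> is the only candidate.\<close>

lemma perm_dcomp_bar_free:
 assumes v: "v : upward p q" and that: "\<sigma> permutes {..<p}" "\<sigma>' permutes {..<p}"
  and eq: "dcomp (pd p \<sigma>) (bar v) = dcomp (pd p \<sigma>') (bar v)"
 shows "\<sigma> = \<sigma>'"
proof -
 have bv: "bar v : brauer q p" using upward_brauer[OF v] by simp
 have "bar (dcomp (pd p \<rho>) (bar v)) = dcomp v (pd p (iv \<rho>))" if "\<rho> permutes {..<p}" for \<rho>
  using bar_dcomp[OF perm_diagram_brauer[OF that] bv] by (simp add: bar_perm[OF that])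
 then have e: "dcomp v (pd p (iv \<sigma>)) = dcomp v (pd p (iv \<sigma>'))"
  using that eq by metis
 have "iv \<sigma> i = iv \<sigma>' i" for i
 proof (cases "i < p")
  case True
  have "strand v (iv \<sigma> i) = strand v (iv \<sigma>' i)"
   using strand_dcomp_perm[OF v permutes_inv[OF that(1)] True] strand_dcomp_perm[OF v permutes_inv[OF that(2)] True] e by simp
  moreover have "iv \<sigma> i < p" "iv \<sigma>' i < p"
   using permutes_in_image[OF permutes_inv[OF that(1)], of i] permutes_in_image[OF permutes_inv[OF that(2)], of i] True by auto
  ultimately show ?thesis using inj_strand[OF v] by (simp add: inj_on_def)
 next
  case False
  then show ?thesis using permutes_not_in[OF permutes_inv[OF that(1)], of i] permutes_not_in[OF permutes_inv[OF that(2)], of i] by simp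
 qed
 then have "iv \<sigma> = iv \<sigma>'" by (rule ext)
 then show ?thesis using that(1,2) by (metis permutes_inv_inv)
qed

lemma bprime_diagram_cases:
 assumes v: "v : upward p q"
 obtains \<sigma> where "\<sigma> permutes {..<p}" "u = dcomp (pd p \<sigma>) (bar v)"
   "bprime_diagram p u v = (delta (pd p \<sigma>) :: diagram => 'a::field)"
  | "!!\<tau>. \<tau> permutes {..<p} ==> u ~= dcomp (pd p \<tau>) (bar v)"
   "bprime_diagram p u v = (0 :: diagram => 'a)"
proof (cases "\<exists>\<sigma>. \<sigma> permutes {..<p} & u = dcomp (pd p \<sigma>) (bar v)")
 case True
 then obtain \<sigma> where \<sigma>: "\<sigma> permutes {..<p}" "u = dcomp (pd p \<sigma>) (bar v)" by blast
 have "(THE \<sigma>. \<sigma> permutes {..<p} & u = dcomp (pd p \<sigma>) (bar v)) = \<sigma>"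
  by (rule the_equality) (use \<sigma> perm_dcomp_bar_free[OF v] in auto)
 then show ?thesis using True \<sigma> that(1)[OF \<sigma>] by (simp add: bprime_diagram_def)
next
 case False
 then have "bprime_diagram p u v = (0 :: diagram => 'a)" unfolding bprime_diagram_def by (rule if_not_P)
 then show ?thesis using that(2) False by blast
qed

lemma bprime_level:
 assumes "a : free_on (downward q p)" "f : free_on (upward p q)"
 shows "bprime p a f : free_on (level p p)"
 unfolding free_on_finite[OF finite_level] bprime_def bilinear_ext_sum[OF finite_downward assms(1) finite_upward assms(2)]
proof (intro allI impI sum.neutral ballI)
 fix d u v assume d: "d \<notin> level p p" and v: "v : upward p q"
 have "bprime_diagram p u v d = (0 :: 'a)"
 proof (cases rule: bprime_diagram_cases[OF v, of u, where ?'a = 'a])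
  case (1 \<sigma>)
  then show ?thesis using d by (auto simp: level_eq delta_apply)
 qed simp
 then show "a u * f v * bprime_diagram p u v d = 0" by simp
qed

lemma bprime_apply_perm:
 assumes a: "a : free_on (downward q p)" and f: "f : free_on (upward p q)" and \<tau>: "\<tau> permutes {..<p}"
 shows "bprime p a f (pd p \<tau>) = (\<Sum>v\<in>upward p q. f v * a (dcomp (pd p \<tau>) (bar v)))"
proof -
 have b: "bprime_diagram p u v (pd p \<tau>) = (of_bool (u = dcomp (pd p \<tau>) (bar v)) :: 'a)"
  if v: "v : upward p q" for u v
 proof (cases rule: bprime_diagram_cases[OF v, of u, where ?'a = 'a])
  case (1 \<sigma>)
  have "\<tau> = \<sigma> \<longleftrightarrow> u = dcomp (pd p \<tau>) (bar v)"
   using 1(2) perm_dcomp_bar_free[OF v \<tau> 1(1)] by auto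
  then show ?thesis unfolding 1(3) by (simp add: delta_apply perm_diagram_inj[OF \<tau> 1(1)])
 qed (use \<tau> in simp)
 have "bprime p a f (pd p \<tau>) = (\<Sum>u\<in>downward q p. \<Sum>v\<in>upward p q. a u * f v * of_bool (u = dcomp (pd p \<tau>) (bar v)))"
  unfolding bprime_def bilinear_ext_sum[OF finite_downward a finite_upward f]
  by (intro sum.cong refl) (simp add: b)
 also have "... = (\<Sum>v\<in>upward p q. \<Sum>u\<in>downward q p. a u * f v * of_bool (u = dcomp (pd p \<tau>) (bar v)))"
  by (rule sum.swap)
 also have "... = (\<Sum>v\<in>upward p q. f v * a (dcomp (pd p \<tau>) (bar v)))"
 proof (intro sum.cong refl)
  fix v assume v: "v : upward p q"
  let ?u = "dcomp (pd p \<tau>) (bar v)"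
  have "?u : downward q p"
   by (rule downward_dcomp[OF _ perm_downward[OF \<tau>]] downward_dcomp[OF perm_downward[OF \<tau>]])
    (use v bar_downward[OF upward_brauer[OF v]] in simp)
  then show "(\<Sum>u\<in>downward q p. a u * f v * of_bool (u = ?u)) = f v * a ?u"
   by (subst sum.remove[OF finite_downward, of ?u]) (auto intro!: sum.neutral simp: mult.commute)
 qed
 finally show ?thesis .
qed

lemma bcomp_upward_level_apply:
 assumes h: "h : upward p q" and y: "y : free_on (level p p)"
 shows "bcomp \<delta> (delta h) y w = (\<Sum>\<tau>\<in>perms p. y (pd p \<tau>) * of_bool (dcomp h (pd p \<tau>) = w))"
proof -
 have "bcomp \<delta> (delta h) y w = (\<Sum>g\<in>brauer p p. y g * of_bool (dcomp h g = w))"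
  unfolding bcomp_delta_left_apply[OF upward_brauer[OF h] level_hom[OF y]]
  by (intro sum.cong refl) (simp add: loops_upward[OF h])
 also have "... = (\<Sum>g\<in>level p p. y g * of_bool (dcomp h g = w))"
  by (rule sum.mono_neutral_right[OF finite_brauer])
    (use free_onD[OF y] in \<open>auto simp: level_def upward_def\<close>)
 finally show ?thesis unfolding sum_level .
qed

lemma down_proj_free: "down_proj q p a : free_on (downward q p)"
 by (simp add: free_on_finite[OF finite_downward] down_proj_def)

text \<open>In the definition of \<open>sharp\<close>, the monotone \<open>h\<close> and the
  permutations supplied by \<open>bprime\<close> together run through all upward diagrams exactly
  once, so the sum collapses to a matrix product.\<close>

lemma sharp_apply:
 assumes g: "g : hom_brauer q q'" and f: "f : free_on (upward p q)"
 shows "sharp \<delta> p q q' g f w = (if w : upward p q' then \<Sum>u\<in>upward p q. f u * sharp_coeff \<delta> g w u else 0)"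
proof -
 have eq: "sharp \<delta> p q q' g f w = (\<Sum>h\<in>um p q'. \<Sum>\<tau>\<in>perms p.
   of_bool (dcomp h (pd p \<tau>) = w) * (\<Sum>u\<in>upward p q. f u * sharp_coeff \<delta> g (dcomp h (pd p \<tau>)) u))"
  unfolding sharp_def sum_apply
 proof (intro sum.cong refl)
  fix h assume hm: "h : um p q'"
  then have h: "h : upward p q'" by (rule upward_mono_upward)
  let ?a = "down_proj q p (bcomp \<delta> (delta (bar h)) g)"
  have "bcomp \<delta> (delta h) (bprime p ?a f) w =
   (\<Sum>\<tau>\<in>perms p. bprime p ?a f (pd p \<tau>) * of_bool (dcomp h (pd p \<tau>) = w))"
   by (rule bcomp_upward_level_apply[OF h bprime_level[OF down_proj_free f]])
  also have "... = (\<Sum>\<tau>\<in>perms p. of_bool (dcomp h (pd p \<tau>) = w) *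
    (\<Sum>u\<in>upward p q. f u * sharp_coeff \<delta> g (dcomp h (pd p \<tau>)) u))"
  proof (intro sum.cong refl)
   fix \<tau> assume "\<tau> : perms p"
   then have \<tau>: "\<tau> permutes {..<p}" by simp
   have "?a (dcomp (pd p \<tau>) (bar u)) = sharp_coeff \<delta> g (dcomp h (pd p \<tau>)) u"
    if u: "u : upward p q" for u
   proof -
    have bu: "bar u : downward q p" using u bar_downward[OF upward_brauer[OF u]] by simp
    have d: "dcomp (pd p \<tau>) (bar u) : downward q p"
     by (rule downward_dcomp[OF perm_downward[OF \<tau>] bu])
    \<comment> \<open>The permutation passes from \<open>bar u\<close> to \<open>h\<close>, where
      reflection inverts it.\<close>
    have "sharp_coeff \<delta> g (dcomp h (pd p \<tau>)) u =
     bcomp \<delta> (delta (dcomp (pd p (iv \<tau>)) (bar h))) g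
      (dcomp (pd p (iv \<tau>)) (dcomp (pd p \<tau>) (bar u)))"
     unfolding sharp_coeff_def bar_dcomp_perm[OF upward_brauer[OF h] \<tau>]
     by (simp add: dcomp_perm_cancel_left(2)[OF downward_brauer[OF bu] \<tau>])
    also have "... = bcomp \<delta> (delta (bar h)) g (dcomp (pd p \<tau>) (bar u))"
     by (rule bcomp_left_perm[OF _ downward_brauer[OF d] g permutes_inv[OF \<tau>]])
       (use upward_brauer[OF h] in simp)
    finally show ?thesis using d by (simp add: down_proj_def)
   qed
   then show "bprime p ?a f (pd p \<tau>) * of_bool (dcomp h (pd p \<tau>) = w) =
    of_bool (dcomp h (pd p \<tau>) = w) * (\<Sum>u\<in>upward p q. f u * sharp_coeff \<delta> g (dcomp h (pd p \<tau>)) u)"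
    unfolding bprime_apply_perm[OF down_proj_free f \<tau>] by (simp add: mult.commute)
  qed
  finally show "bcomp \<delta> (delta h) (bprime p ?a f) w = ..." .
 qed
 have "sharp \<delta> p q q' g f w = (\<Sum>v\<in>upward p q'. of_bool (v = w) * (\<Sum>u\<in>upward p q. f u * sharp_coeff \<delta> g v u))"
  unfolding eq sum_upward[of _ p q'] by (rule refl)
 also have "... = (if w : upward p q' then \<Sum>u\<in>upward p q. f u * sharp_coeff \<delta> g w u else 0)"
 proof (cases "w : upward p q'")
  case True
  then show ?thesis by (subst sum.remove[OF finite_upward True]) (auto intro!: sum.neutral)
 qed (auto intro!: sum.neutral)
 finally show ?thesis .
qed

lemma sharp_free:
 assumes "g : hom_brauer q q'" "f : free_on (upward p q)"
 shows "sharp \<delta> p q q' g f : free_on (upward p q')"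
 by (simp add: free_on_finite[OF finite_upward] sharp_apply[OF assms])

lemma free_on_add: "x : free_on S ==> y : free_on S ==> x + y : free_on S"
proof -
 assume "x : free_on S" "y : free_on S"
 moreover have "supp (x + y) \<subseteq> supp x \<union> supp y" by (auto simp: supp_def)
 ultimately show ?thesis using finite_subset[of "supp (x + y)" "supp x \<union> supp y"] by (auto simp: free_on_def)
qed

lemma free_on_fscale: "x : free_on S ==> fscale c x : free_on S"
proof -
 assume "x : free_on S"
 moreover have "supp (fscale c x) \<subseteq> supp x" by (auto simp: supp_def)
 ultimately show ?thesis using finite_subset[of "supp (fscale c x)" "supp x"] by (auto simp: free_on_def)
qed

lemma free_on_zero: "0 : free_on S" by (simp add: free_on_def supp_def)

lemma free_on_sum: "(!!i. i : A ==> F i : free_on S) ==> (\<Sum>i\<in>A. F i) : free_on S"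
 by (induction A rule: infinite_finite_induct) (auto intro: free_on_add free_on_zero)

lemma free_on_delta: "a : S ==> delta a : free_on S"
 by (simp add: free_on_def supp_delta)

lemma bcomp_add_right:
 assumes "x : hom_brauer q r" "y : hom_brauer p q" "y' : hom_brauer p q"
 shows "bcomp \<delta> x (y + y') = bcomp \<delta> x y + bcomp \<delta> x y'"
 using assms free_on_add[of y "brauer p q" y']
 by (intro ext) (simp add: bcomp_apply[of _ q r _ p] hom_brauer_def sum.distrib distrib_right distrib_left)

lemma bcomp_scale_right:
 assumes "x : hom_brauer q r" "y : hom_brauer p q"
 shows "bcomp \<delta> x (fscale c y) = fscale c (bcomp \<delta> x y)"
 using assms free_on_fscale[of y "brauer p q" c]
 by (intro ext) (simp add: bcomp_apply[of _ q r _ p] hom_brauer_def sum_distrib_left mult_ac)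

lemma sharp_add_right:
 assumes "g : hom_brauer q q'" "f : free_on (upward p q)" "f' : free_on (upward p q)"
 shows "sharp \<delta> p q q' g (f + f') = sharp \<delta> p q q' g f + sharp \<delta> p q q' g f'"
 by (rule ext) (simp add: sharp_apply[OF assms(1)] assms free_on_add sum.distrib distrib_right)

lemma sharp_scale_right:
 assumes "g : hom_brauer q q'" "f : free_on (upward p q)"
 shows "sharp \<delta> p q q' g (fscale c f) = fscale c (sharp \<delta> p q q' g f)"
 by (rule ext) (simp add: sharp_apply[OF assms(1)] assms free_on_fscale sum_distrib_left mult_ac)

lemma sharp_add_left:
 assumes "g : hom_brauer q q'" "g' : hom_brauer q q'" "f : free_on (upward p q)"
 shows "sharp \<delta> p q q' (g + g') f = sharp \<delta> p q q' g f + sharp \<delta> p q q' g' f"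
proof
 fix w
 have gg: "g + g' : hom_brauer q q'" using assms free_on_add by (auto simp: hom_brauer_def)
 have "sharp_coeff \<delta> (g + g') w u = sharp_coeff \<delta> g w u + sharp_coeff \<delta> g' w u" if "w : upward p q'" for u
  unfolding sharp_coeff_def
  using bcomp_add_right[OF delta_hom[of "bar w" q' p] assms(1,2)] upward_brauer[OF that] by simp
 then show "sharp \<delta> p q q' (g + g') f w = (sharp \<delta> p q q' g f + sharp \<delta> p q q' g' f) w"
  by (simp add: sharp_apply assms gg sum.distrib distrib_left)
qed

lemma sharp_scale_left:
 assumes "g : hom_brauer q q'" "f : free_on (upward p q)"
 shows "sharp \<delta> p q q' (fscale c g) f = fscale c (sharp \<delta> p q q' g f)"
proof
 fix w
 have gg: "fscale c g : hom_brauer q q'" using assms free_on_fscale by (auto simp: hom_brauer_def)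
 have "sharp_coeff \<delta> (fscale c g) w u = c * sharp_coeff \<delta> g w u" if "w : upward p q'" for u
  unfolding sharp_coeff_def
  using bcomp_scale_right[OF delta_hom[of "bar w" q' p] assms(1)] upward_brauer[OF that] by simp
 then show "sharp \<delta> p q q' (fscale c g) f w = fscale c (sharp \<delta> p q q' g f) w"
  by (simp add: sharp_apply assms gg sum_distrib_left mult_ac)
qed

lemma bar_inj: "bar x = bar y \<longleftrightarrow> x = y" by (metis bar_bar)

lemma sharp_id:
 assumes "f : free_on (upward p q)"
 shows "sharp \<delta> p q q (bid q) f = f"
proof
 fix w
 show "sharp \<delta> p q q (bid q) f w = f w"
 proof (cases "w : upward p q")
  case True
  have "sharp_coeff \<delta> (bid q) w u = of_bool (u = w)" for u
   unfolding sharp_coeff_def bcomp_bid_right[OF delta_hom[OF bar_brauer[OF upward_brauer[OF True]]]]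
   by (simp add: delta_apply bar_inj)
  then show ?thesis
   using True by (simp add: sharp_apply[OF bid_hom assms]) (subst sum.remove[OF finite_upward True], auto intro!: sum.neutral)
 qed (use free_onD[OF assms] in \<open>simp add: sharp_apply[OF bid_hom assms]\<close>)
qed

text \<open>A pair of bottom points of the left factor survives in every composite.\<close>

lemma bcomp_delta_not_downward:
 assumes "d : brauer q p" "g : hom_brauer r q" "d \<notin> downward q p" "v : downward r p"
 shows "bcomp \<delta> (delta d) g v = 0"
 unfolding bcomp_delta_left_apply[OF assms(1,2)]
 by (intro sum.neutral ballI) (use assms downward_dcompD[OF assms(1)] in auto)

lemma sum_downward_bar: "(\<Sum>d\<in>downward q p. \<phi> d) = (\<Sum>u\<in>upward p q. \<phi> (bar u))"
proof -
 have "downward q p = bar ` upward p q"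
 proof
  show "downward q p \<subseteq> bar ` upward p q"
  proof
   fix d assume d: "d : downward q p"
   then have "bar d : upward p q" using bar_upward[OF downward_brauer[OF d]] by simp
   then show "d : bar ` upward p q" using image_eqI[of d bar "bar d"] by simp
  qed
  show "bar ` upward p q \<subseteq> downward q p" using bar_downward upward_brauer by blast
 qed
 then show ?thesis by (simp add: sum.reindex inj_on_def bar_inj)
qed

text \<open>Inserting all intermediate diagrams, those discarded by the projection in
  \<open>sharp\<close> contribute nothing anyway: a non-downward one never leads to the downward
  diagram \<open>bar u\<close>.\<close>

lemma sharp_bcomp:
 assumes g2: "g2 : hom_brauer q1 q2" and g1: "g1 : hom_brauer q q1" and f: "f : free_on (upward p q)"
 shows "sharp \<delta> p q q2 (bcomp \<delta> g2 g1) f = sharp \<delta> p q1 q2 g2 (sharp \<delta> p q q1 g1 f)"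
proof
 fix w
 show "sharp \<delta> p q q2 (bcomp \<delta> g2 g1) f w = sharp \<delta> p q1 q2 g2 (sharp \<delta> p q q1 g1 f) w"
 proof (cases "w : upward p q2")
  case w: True
  have bw: "delta (bar w) : hom_brauer q2 p" by (rule delta_hom[OF bar_brauer[OF upward_brauer[OF w]]])
  have "sharp_coeff \<delta> (bcomp \<delta> g2 g1) w u = (\<Sum>v\<in>upward p q1. sharp_coeff \<delta> g2 w v * sharp_coeff \<delta> g1 v u)"
   if u: "u : upward p q" for u
  proof -
   have bu: "bar u : downward q p" using u bar_downward[OF upward_brauer[OF u]] by simp
   have "sharp_coeff \<delta> (bcomp \<delta> g2 g1) w u =
     (\<Sum>d\<in>brauer q1 p. bcomp \<delta> (delta (bar w)) g2 d * bcomp \<delta> (delta d) g1 (bar u))"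
    unfolding sharp_coeff_def bcomp_assoc[OF bw g2 g1]
    by (rule bcomp_expand_left[OF bcomp_hom[OF bw g2] g1])
   also have "... = (\<Sum>d\<in>downward q1 p. bcomp \<delta> (delta (bar w)) g2 d * bcomp \<delta> (delta d) g1 (bar u))"
    by (rule sum.mono_neutral_right[OF finite_brauer])
      (use bcomp_delta_not_downward[OF _ g1 _ bu] in \<open>auto simp: downward_def\<close>)
   finally show ?thesis unfolding sum_downward_bar sharp_coeff_def .
  qed
  then have "sharp \<delta> p q q2 (bcomp \<delta> g2 g1) f w =
    (\<Sum>u\<in>upward p q. \<Sum>v\<in>upward p q1. f u * (sharp_coeff \<delta> g2 w v * sharp_coeff \<delta> g1 v u))"
   using w by (simp add: sharp_apply[OF bcomp_hom[OF g2 g1] f] sum_distrib_left)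
  also have "... = (\<Sum>v\<in>upward p q1. \<Sum>u\<in>upward p q. f u * (sharp_coeff \<delta> g2 w v * sharp_coeff \<delta> g1 v u))"
   by (rule sum.swap)
  also have "... = sharp \<delta> p q1 q2 g2 (sharp \<delta> p q q1 g1 f) w"
   using w by (simp add: sharp_apply[OF g2 sharp_free[OF g1 f]] sharp_apply[OF g1 f] sum_distrib_right sum_distrib_left mult_ac)
  finally show ?thesis .
 qed (simp add: sharp_apply[OF bcomp_hom[OF g2 g1] f] sharp_apply[OF g2 sharp_free[OF g1 f]])
qed

lemma bcomp_level_right_apply:
 assumes x: "x : free_on (upward p q)" and s: "s : free_on (level p p)"
 shows "bcomp \<delta> x s w = (\<Sum>u\<in>upward p q. \<Sum>\<tau>\<in>perms p. x u * s (pd p \<tau>) * of_bool (dcomp u (pd p \<tau>) = w))"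
proof -
 have "bcomp \<delta> x s w = (\<Sum>u\<in>brauer p q. x u * bcomp \<delta> (delta u) s w)"
  by (rule bcomp_expand_left[OF upward_hom[OF x] level_hom[OF s]])
 also have "... = (\<Sum>u\<in>upward p q. x u * bcomp \<delta> (delta u) s w)"
  by (rule sum.mono_neutral_right[OF finite_brauer]) (use free_onD[OF x] in \<open>auto simp: upward_def\<close>)
 finally show ?thesis
  by (simp add: bcomp_upward_level_apply[OF _ s] sum_distrib_left mult.assoc)
qed

lemma bcomp_level_right_free:
 assumes x: "x : free_on (upward p q)" and s: "s : free_on (level p p)"
 shows "bcomp \<delta> x s : free_on (upward p q)"
 unfolding free_on_finite[OF finite_upward] bcomp_level_right_apply[OF assms]
 by (intro allI impI sum.neutral ballI) (auto dest: upward_dcomp[OF _ perm_upward])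

text \<open>Linearity over the group algebra: by \<open>sharp_coeff_perm\<close> a permutation on
  the source diagram may be traded for its inverse on the target diagram.\<close>

lemma sharp_bcomp_right:
 assumes g: "g : hom_brauer q q'" and f: "f : free_on (upward p q)" and s: "s : free_on (level p p)"
 shows "sharp \<delta> p q q' g (bcomp \<delta> f s) = bcomp \<delta> (sharp \<delta> p q q' g f) s"
proof
 fix w
 note fs = bcomp_level_right_free[OF f s] and gf = sharp_free[OF g f]
 let ?P = "pd p"
 show "sharp \<delta> p q q' g (bcomp \<delta> f s) w = bcomp \<delta> (sharp \<delta> p q q' g f) s w"
 proof (cases "w : upward p q'")
  case w: True
  have "sharp \<delta> p q q' g (bcomp \<delta> f s) w = (\<Sum>v\<in>upward p q. \<Sum>u\<in>upward p q. \<Sum>\<tau>\<in>perms p.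
    f u * s (?P \<tau>) * of_bool (dcomp u (?P \<tau>) = v) * sharp_coeff \<delta> g w v)"
   using w by (simp add: sharp_apply[OF g fs] bcomp_level_right_apply[OF f s] sum_distrib_right)
  also have "... = (\<Sum>u\<in>upward p q. \<Sum>\<tau>\<in>perms p. \<Sum>v\<in>upward p q.
    f u * s (?P \<tau>) * of_bool (dcomp u (?P \<tau>) = v) * sharp_coeff \<delta> g w v)"
   by (subst sum.swap, intro sum.cong refl, rule sum.swap)
  also have "... = (\<Sum>u\<in>upward p q. \<Sum>\<tau>\<in>perms p. f u * s (?P \<tau>) * sharp_coeff \<delta> g w (dcomp u (?P \<tau>)))"
  proof (intro sum.cong refl)
   fix u \<tau> assume "u : upward p q" "\<tau> : perms p"
   then have "dcomp u (?P \<tau>) : upward p q" by (auto intro: upward_dcomp[OF _ perm_upward])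
   then show "(\<Sum>v\<in>upward p q. f u * s (?P \<tau>) * of_bool (dcomp u (?P \<tau>) = v) * sharp_coeff \<delta> g w v) =
     f u * s (?P \<tau>) * sharp_coeff \<delta> g w (dcomp u (?P \<tau>))"
    by (subst sum.remove[OF finite_upward]) (auto intro!: sum.neutral)
  qed
  also have "... = (\<Sum>\<tau>\<in>perms p. \<Sum>u\<in>upward p q. f u * s (?P \<tau>) * sharp_coeff \<delta> g (dcomp w (?P (iv \<tau>))) u)"
  proof (subst sum.swap, intro sum.cong refl)
   fix u \<tau> assume u: "u : upward p q" and "\<tau> : perms p"
   then have \<tau>: "\<tau> permutes {..<p}" by simp
   have "sharp_coeff \<delta> g w (dcomp u (?P \<tau>)) = sharp_coeff \<delta> g (dcomp (dcomp w (?P (iv \<tau>))) (?P \<tau>)) (dcomp u (?P \<tau>))"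
    by (simp add: dcomp_perm_cancel(2)[OF upward_brauer[OF w] \<tau>])
   also have "... = sharp_coeff \<delta> g (dcomp w (?P (iv \<tau>))) u"
    by (rule sharp_coeff_perm[OF dcomp_brauer[OF upward_brauer[OF w] perm_diagram_brauer[OF permutes_inv[OF \<tau>]]]
       upward_brauer[OF u] g \<tau>])
   finally show "f u * s (?P \<tau>) * sharp_coeff \<delta> g w (dcomp u (?P \<tau>)) =
     f u * s (?P \<tau>) * sharp_coeff \<delta> g (dcomp w (?P (iv \<tau>))) u" by simp
  qed
  also have "... = (\<Sum>\<tau>\<in>perms p. s (?P \<tau>) * sharp \<delta> p q q' g f (dcomp w (?P (iv \<tau>))))"
   using w by (intro sum.cong refl)
    (simp add: sharp_apply[OF g f] upward_dcomp perm_upward permutes_inv sum_distrib_left mult_ac)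
  also have "... = (\<Sum>\<tau>\<in>perms p. \<Sum>v\<in>upward p q'. sharp \<delta> p q q' g f v * s (?P \<tau>) * of_bool (dcomp v (?P \<tau>) = w))"
  proof (intro sum.cong refl)
   fix \<tau> assume "\<tau> : perms p"
   then have \<tau>: "\<tau> permutes {..<p}" by simp
   let ?v = "dcomp w (?P (iv \<tau>))"
   have v: "?v : upward p q'" by (rule upward_dcomp[OF w perm_upward[OF permutes_inv[OF \<tau>]]])
   have iff: "dcomp v (?P \<tau>) = w \<longleftrightarrow> v = ?v" if "v : upward p q'" for v
    using dcomp_perm_cancel(1)[OF upward_brauer[OF that] \<tau>] dcomp_perm_cancel(2)[OF upward_brauer[OF w] \<tau>] by metis
   have "(\<Sum>v\<in>upward p q'. sharp \<delta> p q q' g f v * s (?P \<tau>) * of_bool (dcomp v (?P \<tau>) = w)) =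
     (\<Sum>v\<in>upward p q'. sharp \<delta> p q q' g f v * s (?P \<tau>) * of_bool (v = ?v))"
    by (intro sum.cong refl) (simp add: iff)
   also have "... = s (?P \<tau>) * sharp \<delta> p q q' g f ?v"
    by (subst sum_of_bool_pick[OF finite_upward v]) (rule mult.commute)
   finally show "s (?P \<tau>) * sharp \<delta> p q q' g f ?v =
     (\<Sum>v\<in>upward p q'. sharp \<delta> p q q' g f v * s (?P \<tau>) * of_bool (dcomp v (?P \<tau>) = w))" by simp
  qed
  also have "... = bcomp \<delta> (sharp \<delta> p q q' g f) s w"
   unfolding bcomp_level_right_apply[OF gf s] by (rule sum.swap)
  finally show ?thesis .
 next
  case False
  then show ?thesis
   using free_onD[OF sharp_free[OF g fs]] free_onD[OF bcomp_level_right_free[OF gf s]] by simp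
 qed
qed

section \<open>Contractions\<close>

definition cindex :: "nat => nat => nat => nat" where
 "cindex i j k = card {m. m < k & m ~= i & m ~= j}"

lemma bij_cindex:
 assumes "i < p" "j < p" "i ~= j"
 shows "bij_betw (cindex i j) ({..<p} - {i, j}) {..<p - 2}"
proof -
 let ?K = "{..<p} - {i, j}"
 have lt: "cindex i j k < cindex i j k'" if "k < k'" "k ~= i" "k ~= j" for k k'
  unfolding cindex_def by (rule psubset_card_mono) (use that in auto)
 have inj: "inj_on (cindex i j) ?K"
 proof (rule inj_onI)
  fix k k' assume k: "k : ?K" "k' : ?K" and eq: "cindex i j k = cindex i j k'"
  show "k = k'"
   using lt[of k k'] lt[of k' k] k eq by (cases k k' rule: linorder_cases) auto
 qed
 have cK: "card ?K = p - 2" using assms by (simp add: card_Diff_subset)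
 have "cindex i j ` ?K \<subseteq> {..<p - 2}"
 proof (rule image_subsetI)
  fix k assume k: "k : ?K"
  have "cindex i j k < card ?K"
   unfolding cindex_def by (rule psubset_card_mono) (use k in auto)
  then show "cindex i j k : {..<p - 2}" using cK by simp
 qed
 moreover have "card (cindex i j ` ?K) = card {..<p - 2}" using card_image[OF inj] cK by simp
 ultimately have "cindex i j ` ?K = {..<p - 2}" by (intro card_subset_eq) auto
 then show ?thesis using inj by (simp add: bij_betw_def)
qed

context
 fixes p i j :: nat
 assumes ij: "i < p" "j < p" "i ~= j"
begin

private definition "cm x = (case x of
  Top k => if k = i then Top j else if k = j then Top i else Bot (cindex i j k)
 | Bot m => Top (the_inv_into ({..<p} - {i, j}) (cindex i j) m))"

private lemma cm: "matching (points p (p - 2)) cm"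
proof -
 let ?K = "{..<p} - {i, j}" and ?inv = "the_inv_into ({..<p} - {i, j}) (cindex i j)"
 note b = bij_cindex[OF ij]
 have 1: "cindex i j k < p - 2" "?inv (cindex i j k) = k" if "k < p" "k ~= i" "k ~= j" for k
  using that b the_inv_into_f_f[of "cindex i j" ?K k] by (auto simp: bij_betw_def)
 have 2: "?inv m < p" "?inv m ~= i" "?inv m ~= j" "cindex i j (?inv m) = m" if "m < p - 2" for m
 proof -
  have "?inv m : ?K" using bij_betw_the_inv_into[OF b] that by (auto simp: bij_betw_def)
  then show "?inv m < p" "?inv m ~= i" "?inv m ~= j" by auto
  show "cindex i j (?inv m) = m"
   by (rule f_the_inv_into_f) (use b that in \<open>auto simp: bij_betw_def\<close>)
 qed
 show ?thesis
  unfolding matching_def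
 proof
  fix x assume x: "x : points p (p - 2)"
  show "cm x : points p (p - 2) & cm x ~= x & cm (cm x) = x"
   by (cases x) (use x ij 1 2 in \<open>auto simp: cm_def\<close>)
 qed
qed

private lemma contraction_eq: "contraction p i j = {{x, cm x} | x. x : points p (p - 2)}"
proof -
 let ?K = "{..<p} - {i, j}" and ?inv = "the_inv_into ({..<p} - {i, j}) (cindex i j)"
 note b = bij_cindex[OF ij]
 have "{{x, cm x} | x. x : points p (p - 2)} = (%x. {x, cm x}) ` points p (p - 2)" by (rule Setcompr_eq_image)
 also have "... = (%k. {Top k, cm (Top k)}) ` {..<p} \<union> (%m. {Bot m, cm (Bot m)}) ` {..<p - 2}"
  by (simp only: points_def image_Un image_image)
 also have "{..<p} = {i, j} \<union> ?K" using ij by auto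
 also have "(%k. {Top k, cm (Top k)}) ` ({i, j} \<union> ?K) = {{Top i, Top j}} \<union> (%k. {Top k, Bot (cindex i j k)}) ` ?K"
 proof -
  have "(%k. {Top k, cm (Top k)}) ` {i, j} = {{Top i, Top j}}"
   using ij by (simp add: cm_def insert_commute)
  moreover have "(%k. {Top k, cm (Top k)}) ` ?K = (%k. {Top k, Bot (cindex i j k)}) ` ?K"
   by (intro image_cong refl) (simp add: cm_def)
  ultimately show ?thesis by (simp only: image_Un)
 qed
 also have "(%m. {Bot m, cm (Bot m)}) ` {..<p - 2} = (%k. {Top k, Bot (cindex i j k)}) ` ?K"
 proof -
  have im: "{..<p - 2} = cindex i j ` ?K" using b by (simp add: bij_betw_def)
  have "(%m. {Bot m, cm (Bot m)}) ` {..<p - 2} = (%k. {Bot (cindex i j k), cm (Bot (cindex i j k))}) ` ?K"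
   unfolding im image_image ..
  also have "... = (%k. {Top k, Bot (cindex i j k)}) ` ?K"
  proof (intro image_cong refl)
   fix k assume "k : ?K"
   then have "cm (Bot (cindex i j k)) = Top k"
    using the_inv_into_f_f[of "cindex i j" ?K k] b by (simp add: cm_def bij_betw_def)
   then show "{Bot (cindex i j k), cm (Bot (cindex i j k))} = {Top k, Bot (cindex i j k)}"
    by (simp only: insert_commute)
  qed
  finally show ?thesis .
 qed
 finally have "{{x, cm x} | x. x : points p (p - 2)} = {{Top i, Top j}} \<union> (%k. {Top k, Bot (cindex i j k)}) ` ?K"
  by (simp only: Un_assoc Un_absorb)
 moreover have "(%k. {Top k, Bot (cindex i j k)}) ` ?K =
   {{Top k, Bot (card {m. m < k & m ~= i & m ~= j})} | k. k < p & k ~= i & k ~= j}"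
  unfolding cindex_def Setcompr_eq_image[symmetric] by (intro Collect_cong ex_cong1 conj_cong refl) simp
 ultimately show ?thesis by (simp only: contraction_def insert_is_Un[symmetric])
qed

lemma contraction_brauer: "contraction p i j : brauer p (p - 2)"
 by (rule matching_brauer(1)[OF cm contraction_eq])

lemma mate_contraction:
 "mate (contraction p i j) (Top i) = Top j"
 "mate (contraction p i j) (Top j) = Top i"
 "!!k. k < p ==> k ~= i ==> k ~= j ==> mate (contraction p i j) (Top k) = Bot (cindex i j k)"
 "!!m. m < p - 2 ==> mate (contraction p i j) (Bot m) = Top (the_inv_into ({..<p} - {i, j}) (cindex i j) m)"
 by (simp_all add: matching_brauer(2)[OF cm contraction_eq] cm_def ij ij(3)[symmetric])

lemma contraction_downward: "contraction p i j : downward p (p - 2)"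
proof -
 have "\<not> {Bot m, Bot n} : contraction p i j" for m n
  unfolding pair_iff_mate[OF contraction_brauer] by (auto simp: mate_contraction)
 then show ?thesis using contraction_brauer by (simp add: downward_def)
qed

lemma lab_contraction:
 "lab p (p - 2) (contraction p i j) a b \<longleftrightarrow> a i = a j & (\<forall>k<p. k ~= i & k ~= j --> b (cindex i j k) = a k)"
proof
 assume l: "lab p (p - 2) (contraction p i j) a b"
 show "a i = a j & (\<forall>k<p. k ~= i & k ~= j --> b (cindex i j k) = a k)"
 proof (intro conjI allI impI)
  show "a i = a j" using lab_mate[OF l, of "Top i"] ij by (simp add: mate_contraction)
  fix k assume "k < p" "k ~= i & k ~= j"
  then show "b (cindex i j k) = a k" using lab_mate[OF l, of "Top k"] by (simp add: mate_contraction)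
 qed
next
 assume r: "a i = a j & (\<forall>k<p. k ~= i & k ~= j --> b (cindex i j k) = a k)"
 show "lab p (p - 2) (contraction p i j) a b"
 proof (rule labI[OF contraction_brauer])
  fix x y assume "{x, y} : contraction p i j"
  then have "{x, y} = {Top i, Top j} | (\<exists>k. {x, y} = {Top k, Bot (cindex i j k)} & k < p & k ~= i & k ~= j)"
   by (simp only: contraction_def cindex_def insert_iff mem_Collect_eq)
  then show "case_point a b x = case_point a b y"
   unfolding doubleton_eq_iff using r by (elim disjE exE conjE) simp_all
 qed
qed

text \<open>Capping a pair of bottom points and inserting it again restores the diagram, apart from
  the closed loop that \<open>dcomp\<close> discards. So such a diagram factors through
  \<open>p - 2\<close> points.\<close>

lemma dcomp_contraction_bot:
 assumes u: "u : brauer q p" and pr: "{Bot i, Bot j} : u"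
 shows "dcomp (bar (contraction p i j)) (dcomp (contraction p i j) u) = u"
proof (rule brauer_eq_lab)
 note c = contraction_brauer and cb = bar_brauer[OF contraction_brauer]
 note cu = dcomp_brauer[OF c u]
 show "dcomp (bar (contraction p i j)) (dcomp (contraction p i j) u) : brauer q p" by (rule dcomp_brauer[OF cb cu])
 show "u : brauer q p" by (rule u)
 fix a b
 show "lab q p (dcomp (bar (contraction p i j)) (dcomp (contraction p i j) u)) a b \<longleftrightarrow> lab q p u a b"
  unfolding lab_dcomp[OF cb cu] lab_dcomp[OF c u] lab_bar[OF c] lab_contraction
 proof
  assume "\<exists>kp. (\<exists>b'. lab q p u a b' & b' i = b' j & (\<forall>k<p. k ~= i & k ~= j --> kp (cindex i j k) = b' k)) &
    b i = b j & (\<forall>k<p. k ~= i & k ~= j --> kp (cindex i j k) = b k)"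
  then obtain b' where b': "lab q p u a b'" "b i = b j" "!!k. k < p ==> k ~= i ==> k ~= j ==> b' k = b k" by metis
  show "lab q p u a b"
  proof (rule labI[OF u])
   fix x y assume xy: "{x, y} : u"
   note un = brauer_pair_unique[OF u]
   have pr': "{Bot j, Bot i} : u" using pr by (simp add: insert_commute)
   have yx: "{y, x} : u" using xy by (simp add: insert_commute)
   show "case_point a b x = case_point a b y"
   proof (cases "x : {Bot i, Bot j} | y : {Bot i, Bot j}")
    case True
    then consider "x = Bot i" | "x = Bot j" | "y = Bot i" | "y = Bot j" by blast
    then have "x = Bot i & y = Bot j | x = Bot j & y = Bot i"
    proof cases
     case 1 then show ?thesis using un[OF pr, of y] xy by simp
    next
     case 2 then show ?thesis using un[OF pr', of y] xy by simp
    next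
     case 3 then show ?thesis using un[OF pr, of x] yx by simp
    next
     case 4 then show ?thesis using un[OF pr', of x] yx by simp
    qed
    then show ?thesis using b'(2) by (elim disjE conjE) simp_all
   next
    case False
    have "case_point a b z = case_point a b' z" if "z : points q p" "z \<notin> {Bot i, Bot j}" for z
     using that b'(3) by (cases z) auto
    then show ?thesis
     using False lab_pair[OF u b'(1) xy] brauer_pairD[OF u xy] by simp
   qed
  qed
 next
  assume l: "lab q p u a b"
  have bij: "b i = b j" using lab_pair[OF u l pr] by simp
  define kp where "kp m = b (the_inv_into ({..<p} - {i, j}) (cindex i j) m)" for m
  have "kp (cindex i j k) = b k" if "k < p" "k ~= i" "k ~= j" for k
   using the_inv_into_f_f[of "cindex i j" "{..<p} - {i, j}" k] bij_cindex[OF ij] that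
   by (simp add: kp_def bij_betw_def)
  then show "\<exists>kp. (\<exists>b'. lab q p u a b' & b' i = b' j & (\<forall>k<p. k ~= i & k ~= j --> kp (cindex i j k) = b' k)) &
    b i = b j & (\<forall>k<p. k ~= i & k ~= j --> kp (cindex i j k) = b k)"
   using l bij by blast
 qed
qed

lemma bar_contraction_upward: "bar (contraction p i j) : upward (p - 2) p"
 using bar_upward[OF contraction_brauer] contraction_downward by simp

lemma dcomp_contraction_top:
 assumes u: "u : brauer p q" and pr: "{Top i, Top j} : u"
 shows "dcomp (dcomp u (bar (contraction p i j))) (contraction p i j) = u"
proof -
 have "{Bot i, Bot j} : bar u" using pr by (simp add: pair_bar)
 from arg_cong[OF dcomp_contraction_bot[OF bar_brauer[OF u] this], of bar]
 show ?thesis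
  using bar_dcomp[OF bar_brauer[OF contraction_brauer] dcomp_brauer[OF contraction_brauer bar_brauer[OF u]]]
   bar_dcomp[OF contraction_brauer bar_brauer[OF u]] by simp
qed

end

section \<open>Forms and monomial bases\<close>

locale form_space = vector_space scale
 for scale :: "'k::field_char_0 => 'v::ab_group_add => 'v" +
 fixes \<omega> :: "'v => 'v => 'k" and e :: 'k
 assumes finite_span: "\<exists>S. finite S & span S = UNIV"
  and lin_right: "!!x. Vector_Spaces.linear scale (*) (\<omega> x)"
  and lin_left: "!!y. Vector_Spaces.linear scale (*) (%x. \<omega> x y)"
  and nondeg: "!!x. (!!y. \<omega> x y = 0) ==> x = 0"
  and e_cases: "e = 1 | e = -1"
  and sym_e: "!!x y. \<omega> x y = e * \<omega> y x"
begin

abbreviation "tn \<equiv> tensors scale"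
abbreviation "N \<equiv> traceless scale \<omega> e"

lemma ee: "e * e = 1" using e_cases by auto

lemma e_nz: "e ~= 0" using e_cases by auto

lemma linear_dual_iff: "Vector_Spaces.linear scale (*) \<psi> \<longleftrightarrow> (\<forall>x y. \<psi> (x + y) = \<psi> x + \<psi> y) & (\<forall>c x. \<psi> (scale c x) = c * \<psi> x)"
proof -
 have "vector_space ((*) :: 'k => 'k => 'k)" by unfold_locales (simp_all add: algebra_simps)
 then show ?thesis using vector_space_axioms by (auto simp: Vector_Spaces.linear_iff)
qed

lemma w_add_right [simp]: "\<omega> x (y + z) = \<omega> x y + \<omega> x z"
 and w_scale_right [simp]: "\<omega> x (scale c y) = c * \<omega> x y"
 using lin_right[of x] unfolding linear_dual_iff by blast+

lemma w_add_left [simp]: "\<omega> (x + y) z = \<omega> x z + \<omega> y z"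
 and w_scale_left [simp]: "\<omega> (scale c x) z = c * \<omega> x z"
 using lin_left[of z] unfolding linear_dual_iff by blast+

lemma w_zero [simp]: "\<omega> 0 x = 0" "\<omega> x 0 = 0"
 using w_scale_left[of 0 0 x] w_scale_right[of x 0 0] by simp_all

lemma w_minus [simp]: "\<omega> (- x) y = - \<omega> x y" "\<omega> x (- y) = - \<omega> x y"
 using w_scale_left[of "-1" x y] w_scale_right[of x "-1" y] by simp_all

lemma w_diff [simp]: "\<omega> (x - y) z = \<omega> x z - \<omega> y z" "\<omega> x (y - z) = \<omega> x y - \<omega> x z"
 using w_add_left[of x "-y" z] w_add_right[of x y "-z"] by simp_all

lemma w_sum_left: "\<omega> (\<Sum>i\<in>A. f i) z = (\<Sum>i\<in>A. \<omega> (f i) z)"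
 by (induction A rule: infinite_finite_induct) auto

lemma w_sum_right: "\<omega> z (\<Sum>i\<in>A. f i) = (\<Sum>i\<in>A. \<omega> z (f i))"
 by (induction A rule: infinite_finite_induct) auto

text \<open>Bases whose Gram matrix is monomial: orthogonal ones for \<open>e = 1\<close>, symplectic ones for \<open>e = -1\<close>.\<close>

definition mono_family :: "nat => (nat => 'v) => (nat => nat) => (nat => 'k) => bool" where
 "mono_family n b \<iota> a \<longleftrightarrow>
   (\<forall>k<n. \<iota> k < n & \<iota> (\<iota> k) = k & a k ~= 0 & (e = 1 --> \<iota> k = k) & (e = -1 --> a k = 1 | a k = -1)) &
   (\<forall>k<n. \<forall>l<n. \<omega> (b k) (b l) = (if l = \<iota> k then a k else 0))"

lemma mono_familyI:
 assumes "!!k. k < n ==> \<iota> k < n" "!!k. k < n ==> \<iota> (\<iota> k) = k" "!!k. k < n ==> a k ~= 0"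
  "!!k. k < n ==> e = 1 ==> \<iota> k = k" "!!k. k < n ==> e = -1 ==> a k = 1 | a k = -1"
  "!!k l. k < n ==> l < n ==> \<omega> (b k) (b l) = (if l = \<iota> k then a k else 0)"
 shows "mono_family n b \<iota> a"
 unfolding mono_family_def using assms by blast

text \<open>Dual in the left argument: \<open>\<omega> (U k) (b l)\<close> will be the Kronecker
  delta. As the Gram matrix is monomial, the dual of \<open>b k\<close> is a multiple of
  \<open>b (\<iota> k)\<close>.\<close>

definition dual_family :: "(nat => 'v) => (nat => nat) => (nat => 'k) => nat => 'v" where
 "dual_family b \<iota> a k = scale (inverse (a (\<iota> k))) (b (\<iota> k))"

lemma dual_family_pairing:
 assumes "mono_family n b \<iota> a" "k < n" "l < n"
 shows "\<omega> (dual_family b \<iota> a k) (b l) = (if k = l then 1 else 0)"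
proof -
 have k: "\<iota> k < n" "\<iota> (\<iota> k) = k" "a (\<iota> k) ~= 0" using assms by (auto simp: mono_family_def)
 have "\<omega> (b (\<iota> k)) (b l) = (if l = \<iota> (\<iota> k) then a (\<iota> k) else 0)"
  using assms k(1) by (auto simp: mono_family_def)
 then show ?thesis using k by (cases "k = l") (simp_all add: dual_family_def)
qed

lemma dual_family_coeff:
 assumes "mono_family n b \<iota> a" "k < n"
 shows "\<omega> (dual_family b \<iota> a k) (\<Sum>l<n. scale (c l) (b l)) = c k"
proof -
 have "\<omega> (dual_family b \<iota> a k) (\<Sum>l<n. scale (c l) (b l)) = (\<Sum>l<n. c l * (if k = l then 1 else 0))"
  unfolding w_sum_right by (intro sum.cong refl) (simp add: dual_family_pairing[OF assms])
 then show ?thesis using assms(2) by (simp add: if_distrib[of "%t. _ * t"] cong: if_cong)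
qed

lemma mono_family_bound:
 assumes "mono_family n b \<iota> a" "finite S" "span S = UNIV"
 shows "n <= card S"
proof -
 let ?U = "dual_family b \<iota> a"
 have inj: "inj_on b {..<n}"
 proof (rule inj_onI)
  fix k l assume "k : {..<n}" "l : {..<n}" "b k = b l"
  then show "k = l" using dual_family_pairing[OF assms(1), of k k] dual_family_pairing[OF assms(1), of k l]
   by (auto split: if_splits)
 qed
 have "independent (b ` {..<n})"
 proof (rule independent_if_scalars_zero)
  fix f x assume z: "(\<Sum>x\<in>b ` {..<n}. scale (f x) x) = 0" and "x : b ` {..<n}"
  then obtain k where k: "k < n" "x = b k" by auto
  have "(\<Sum>l<n. scale (f (b l)) (b l)) = 0" using z by (simp add: sum.reindex[OF inj])
  then show "f x = 0" using dual_family_coeff[OF assms(1) k(1), of "%l. f (b l)"] k(2) by simp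
 qed simp
 then have "card (b ` {..<n}) <= card S"
  using independent_span_bound[OF assms(2), of "b ` {..<n}"] assms(3) by auto
 then show ?thesis by (simp add: card_image[OF inj])
qed

text \<open>\<open>P\<close> projects onto the orthogonal complement of the family, and
  nondegeneracy gives the nonzero vector \<open>P v\<close> a partner there. In the symmetric case a
  non-isotropic vector of the complement is adjoined, in the skew case a hyperbolic pair.\<close>

lemma mono_family_extend:
 assumes m: "mono_family n b \<iota> a" and v: "v ~= (\<Sum>k<n. scale (\<omega> (dual_family b \<iota> a k) v) (b k))"
 shows "\<exists>n' b' \<iota>' a'. n < n' & mono_family n' b' \<iota>' a'"
proof -
 let ?U = "dual_family b \<iota> a"
 define P where "P x = x - (\<Sum>k<n. scale (\<omega> (?U k) x) (b k))" for x
 have \<iota>: "\<iota> k < n" "\<iota> (\<iota> k) = k" "a k ~= 0" "e = 1 --> \<iota> k = k" "e = -1 --> a k = 1 | a k = -1" if "k < n" for k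
  using m that by (auto simp: mono_family_def)
 have gram: "\<omega> (b k) (b l) = (if l = \<iota> k then a k else 0)" if "k < n" "l < n" for k l
  using m that by (auto simp: mono_family_def)
 have UP: "\<omega> (?U k) (P x) = 0" if "k < n" for k x
  using dual_family_coeff[OF m that] by (simp add: P_def)
 have bP: "\<omega> (b k) (P x) = 0" if k: "k < n" for k x
 proof -
  have "b k = scale (a k) (?U (\<iota> k))"
   using \<iota>[OF k] by (simp add: dual_family_def)
  then show ?thesis using UP[OF \<iota>(1)[OF k]] by simp
 qed
 have Pb: "\<omega> (P x) (b k) = 0" if "k < n" for k x
  using bP[OF that] sym_e[of "P x" "b k"] by simp
 have PP: "\<omega> (P x) (P y) = \<omega> (P x) y" for x y
  using Pb by (simp add: P_def[of y] w_sum_right)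
 have "P v ~= 0" using v by (simp add: P_def)
 then obtain y where "\<omega> (P v) y ~= 0" using nondeg by blast
 then have vy: "\<omega> (P v) (P y) ~= 0" by (simp add: PP)
 show ?thesis
 proof (cases "e = 1")
  case True
  \<comment> \<open>Otherwise polarisation gives
    \<open>2 * \<omega> (P v) (P y) = 0\<close>.\<close>
  have "\<exists>x. \<omega> (P x) (P x) ~= 0"
  proof (rule ccontr)
   assume "\<not> (\<exists>x. \<omega> (P x) (P x) ~= 0)"
   then have z: "\<omega> (P x) (P x) = 0" for x by blast
   have "P (v + y) = P v + P y"
    by (simp add: P_def sum.distrib scale_left_distrib algebra_simps)
   then have "\<omega> (P v) (P y) + \<omega> (P y) (P v) = 0"
    using z[of "v + y"] z[of v] z[of y] by (simp add: add.commute)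
   then show False using vy sym_e[of "P y" "P v"] True by simp
  qed
  then obtain x where x: "\<omega> (P x) (P x) ~= 0" by blast
  have "mono_family (Suc n) (b(n := P x)) (\<iota>(n := n)) (a(n := \<omega> (P x) (P x)))"
  proof (rule mono_familyI)
   fix k l assume kl: "k < Suc n" "l < Suc n"
   show "\<omega> ((b(n := P x)) k) ((b(n := P x)) l) = (if l = (\<iota>(n := n)) k then (a(n := \<omega> (P x) (P x))) k else 0)"
    using kl gram[of k l] bP[of k x] Pb[of l x] \<iota>(1)[of k] by (cases "k = n"; cases "l = n") auto
  next
   fix k assume "k < Suc n"
   then consider "k < n" | "k = n" by linarith
   then show "(\<iota>(n := n)) k < Suc n" "(\<iota>(n := n)) ((\<iota>(n := n)) k) = k" "(a(n := \<omega> (P x) (P x))) k ~= 0"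
    "e = 1 ==> (\<iota>(n := n)) k = k" "e = -1 ==> (a(n := \<omega> (P x) (P x))) k = 1 | (a(n := \<omega> (P x) (P x))) k = -1"
    by (cases; use x \<iota>[of k] True in simp)+
  qed
  then show ?thesis by blast
 next
  case False
  then have em: "e = -1" using e_cases by blast
  \<comment> \<open>A hyperbolic pair: the scaling of \<open>P y\<close> achieves
    \<open>\<omega> u w = 1\<close>.\<close>
  define u w where "u = P v" and "w = scale (inverse (\<omega> (P v) (P y))) (P y)"
  have z: "\<omega> x x = 0" for x
  proof -
   have "2 * \<omega> x x = 0" using sym_e[of x x] em by simp
   then show ?thesis by simp
  qed
  have uw: "\<omega> u w = 1" "\<omega> w u = -1" using vy sym_e[of w u] em by (simp_all add: u_def w_def)
  have o: "\<omega> (b k) u = 0" "\<omega> (b k) w = 0" "\<omega> u (b k) = 0" "\<omega> w (b k) = 0" if "k < n" for k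
   using bP[OF that] Pb[OF that] by (simp_all add: u_def w_def)
  have "mono_family (Suc (Suc n)) (b(n := u, Suc n := w)) (\<iota>(n := Suc n, Suc n := n)) (a(n := 1, Suc n := -1))"
  proof (rule mono_familyI)
   fix k l assume kl: "k < Suc (Suc n)" "l < Suc (Suc n)"
   then have ck: "k < n | k = n | k = Suc n" and cl: "l < n | l = n | l = Suc n" by linarith+
   have \<iota>n: "n ~= \<iota> k" "Suc n ~= \<iota> k" if "k < n" using \<iota>(1)[OF that] by linarith+
   from ck cl show "\<omega> ((b(n := u, Suc n := w)) k) ((b(n := u, Suc n := w)) l) =
     (if l = (\<iota>(n := Suc n, Suc n := n)) k then (a(n := 1, Suc n := -1)) k else 0)"
    by (elim disjE) (use gram[of k l] o[of k] o[of l] \<iota>n z uw in simp_all)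
  next
   fix k assume "k < Suc (Suc n)"
   then consider "k < n" | "k = n" | "k = Suc n" by linarith
   then show "(\<iota>(n := Suc n, Suc n := n)) k < Suc (Suc n)"
    "(\<iota>(n := Suc n, Suc n := n)) ((\<iota>(n := Suc n, Suc n := n)) k) = k" "(a(n := 1, Suc n := -1)) k ~= 0"
    "e = 1 ==> (\<iota>(n := Suc n, Suc n := n)) k = k"
    "e = -1 ==> (a(n := 1, Suc n := -1)) k = 1 | (a(n := 1, Suc n := -1)) k = -1"
    by (cases; use \<iota>[of k] False in simp)+
  qed
  then show ?thesis by (metis lessI less_SucI)
 qed
qed

text \<open>A family of maximal size exists because sizes are bounded by a finite spanning set; a
  vector outside its span would allow an extension.\<close>

lemma mono_basis_exists:
 obtains n b \<iota> a where "mono_family n b \<iota> a" "!!v. v = (\<Sum>k<n. scale (\<omega> (dual_family b \<iota> a k) v) (b k))"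
proof -
 obtain S where S: "finite S" "span S = UNIV" using finite_span by blast
 define Q where "Q n \<longleftrightarrow> (\<exists>b \<iota> a. mono_family n b \<iota> a)" for n
 have "Q 0" by (auto simp: Q_def mono_family_def)
 moreover have "Q n ==> n <= card S" for n
  using mono_family_bound S by (auto simp: Q_def)
 ultimately obtain n where n: "Q n" "!!n'. Q n' ==> n' <= n"
  using Nat.ex_has_greatest_nat[of Q 0 "card S"] by blast
 then obtain b \<iota> a where m: "mono_family n b \<iota> a" by (auto simp: Q_def)
 have "v = (\<Sum>k<n. scale (\<omega> (dual_family b \<iota> a k) v) (b k))" for v
  using mono_family_extend[OF m, of v] n(2) unfolding Q_def by (meson leD)
 then show ?thesis using that[OF m] by blast
qed

end

section \<open>A fixed monomial basis with its dual, and multilinear forms\<close>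

locale mono_basis = form_space scale \<omega> e
 for scale :: "'k::field_char_0 => 'v::ab_group_add => 'v" and \<omega> :: "'v => 'v => 'k" and e :: 'k +
 fixes n :: nat and b :: "nat => 'v" and \<iota> :: "nat => nat" and a :: "nat => 'k"
 assumes mono: "mono_family n b \<iota> a"
  and expand_b: "!!v. v = (\<Sum>k<n. scale (\<omega> (dual_family b \<iota> a k) v) (b k))"
begin

abbreviation U :: "nat => 'v" where "U \<equiv> dual_family b \<iota> a"

lemma U_b: "k < n ==> l < n ==> \<omega> (U k) (b l) = (if k = l then 1 else 0)"
 by (rule dual_family_pairing[OF mono])

lemma expand_w: "\<omega> u v = (\<Sum>k<n. \<omega> u (b k) * \<omega> (U k) v)"
proof -
 have "\<omega> u v = \<omega> u (\<Sum>k<n. scale (\<omega> (U k) v) (b k))" by (rule arg_cong[OF expand_b])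
 also have "... = (\<Sum>k<n. \<omega> u (b k) * \<omega> (U k) v)" by (simp add: w_sum_right mult.commute)
 finally show ?thesis .
qed

lemma expand_U: "u = (\<Sum>k<n. scale (\<omega> u (b k)) (U k))"
proof -
 have "\<omega> (u - (\<Sum>k<n. scale (\<omega> u (b k)) (U k))) v = 0" for v
  unfolding w_diff w_sum_left w_scale_left expand_w[of u v] by simp
 then have "u - (\<Sum>k<n. scale (\<omega> u (b k)) (U k)) = 0" by (rule nondeg)
 then show ?thesis by (rule iffD1[OF right_minus_eq])
qed

text \<open>A loop pairs \<open>b i\<close> with \<open>U i\<close> in the order opposite to
  duality, which is where the factor \<open>e\<close> of the loop value comes from.\<close>

lemma contraction_form: "contraction_data \<omega> e (e * of_nat n) {..<n} b U"
proof
 have "(\<Sum>i<n. \<omega> (b i) (U i)) = (\<Sum>i<n. e)"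
 proof (intro sum.cong refl)
  fix i assume "i : {..<n}"
  then show "\<omega> (b i) (U i) = e" using sym_e[of "b i" "U i"] U_b[of i i] by simp
 qed
 then show "(\<Sum>i<n. \<omega> (b i) (U i)) = e * of_nat n" by (simp add: mult.commute)
 show "e * e = 1" by (rule ee)
 show "\<omega> u v = e * \<omega> v u" for u v by (rule sym_e)
 show "(\<Sum>i<n. \<omega> u (b i) * \<omega> (U i) v) = \<omega> u v" for u v by (rule expand_w[symmetric])
qed simp

lemma dim_n: "dim (UNIV :: 'v set) = n"
proof -
 have "inj_on b {..<n}"
 proof (rule inj_onI)
  fix k l assume "k : {..<n}" "l : {..<n}" "b k = b l"
  then show "k = l" using U_b[of k k] U_b[of k l] by (auto split: if_splits)
 qed
 moreover have "independent (b ` {..<n})"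
 proof (rule independent_if_scalars_zero)
  fix f x assume z: "(\<Sum>x\<in>b ` {..<n}. scale (f x) x) = 0" and "x : b ` {..<n}"
  then obtain k where k: "k < n" "x = b k" by auto
  have "(\<Sum>l<n. scale (f (b l)) (b l)) = 0" using z by (simp add: sum.reindex[OF \<open>inj_on b {..<n}\<close>])
  then show "f x = 0" using dual_family_coeff[OF mono k(1), of "%l. f (b l)"] k(2) by simp
 qed simp
 moreover have "UNIV \<subseteq> span (b ` {..<n})"
 proof
  fix v :: 'v
  have "(\<Sum>k<n. scale (\<omega> (U k) v) (b k)) : span (b ` {..<n})"
   by (intro span_sum span_scale span_base) auto
  then show "v : span (b ` {..<n})" by (rule ssubst[OF expand_b, of "%v. v : span (b ` {..<n})"])
 qed
 ultimately show ?thesis using dim_unique[of "b ` {..<n}" UNIV n] by (simp add: card_image)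
qed

definition mlin :: "'s set => (('s => 'v) => 'k) => bool" where
 "mlin S F \<longleftrightarrow> (\<forall>i\<in>S. \<forall>l x y c. F (l(i := x + scale c y)) = F (l(i := x)) + c * F (l(i := y)))"

lemma mlin_sum:
 assumes "mlin S F" "i : S" "finite A"
 shows "F (l(i := (\<Sum>k\<in>A. scale (c k) (f k)))) = (\<Sum>k\<in>A. c k * F (l(i := f k)))"
proof -
 have z: "F (l(i := 0)) = 0"
 proof -
  have "F (l(i := 0 + scale (-1) 0)) = F (l(i := 0)) + (-1) * F (l(i := 0))"
   using assms(1,2) unfolding mlin_def by blast
  then show ?thesis by simp
 qed
 show ?thesis using assms(3)
 proof (induction A)
  case (insert k A)
  have "F (l(i := (\<Sum>k\<in>A. scale (c k) (f k)) + scale (c k) (f k))) =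
    F (l(i := (\<Sum>k\<in>A. scale (c k) (f k)))) + c k * F (l(i := f k))"
   using assms(1,2) unfolding mlin_def by blast
  moreover have "(\<Sum>k\<in>insert k A. scale (c k) (f k)) = (\<Sum>k\<in>A. scale (c k) (f k)) + scale (c k) (f k)"
   using insert.hyps by (simp add: add.commute)
  ultimately show ?case by (simp only: insert.IH sum.insert[OF insert.hyps] add.commute)
 qed (simp only: sum.empty z)
qed

definition spread :: "'s set => ('s => 'v) => ('s => 'v) => 's => 'v" where
 "spread S f l i = (if i : S then f i else l i)"

text \<open>The coordinate functions are arbitrary since both expansions occur: along
  \<open>b\<close> with coefficients \<open>\<omega> (U k) v\<close>, and along \<open>U\<close>
  with coefficients \<open>\<omega> u (b k)\<close>.\<close>

lemma mlin_expand:
 fixes C :: "nat => 'v => 'k" and D :: "nat => 'v"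
 assumes CD: "!!v. v = (\<Sum>k<n. scale (C k v) (D k))"
 shows "finite S ==> mlin S F ==> F l = (\<Sum>kp\<in>PiE S (%_. {..<n}). (\<Prod>i\<in>S. C (kp i) (l i)) * F (spread S (D o kp) l))"
proof (induction S arbitrary: F l rule: finite_induct)
 case empty
 have "spread {} f l = l" for f by (auto simp: spread_def)
 then show ?case by simp
next
 case (insert x S)
 have ml: "mlin S F" using insert.prems by (auto simp: mlin_def)
 have "F l = (\<Sum>kp\<in>PiE S (%_. {..<n}). (\<Prod>i\<in>S. C (kp i) (l i)) * F (spread S (D o kp) l))"
  by (rule insert.IH[OF ml])
 also have "... = (\<Sum>kp\<in>PiE S (%_. {..<n}). \<Sum>k<n. (\<Prod>i\<in>insert x S. C ((kp(x := k)) i) (l i)) *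
   F (spread (insert x S) (D o kp(x := k)) l))"
 proof (intro sum.cong refl)
  fix kp
  have "F (spread S (D o kp) l) = F ((spread S (D o kp) l)(x := \<Sum>k<n. scale (C k (l x)) (D k)))"
  proof -
   have "spread S (D o kp) l = (spread S (D o kp) l)(x := l x)"
    by (rule ext) (simp add: spread_def insert.hyps)
   also have "... = (spread S (D o kp) l)(x := \<Sum>k<n. scale (C k (l x)) (D k))"
    by (rule arg_cong[OF CD])
   finally show ?thesis by (rule arg_cong)
  qed
  also have "... = (\<Sum>k<n. C k (l x) * F ((spread S (D o kp) l)(x := D k)))"
   by (rule mlin_sum[OF insert.prems]) simp_all
  also have "... = (\<Sum>k<n. C k (l x) * F (spread (insert x S) (D o kp(x := k)) l))"
  proof (intro sum.cong refl arg_cong[where f = "%t. _ * F t"] ext)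
   fix k i show "((spread S (D o kp) l)(x := D k)) i = spread (insert x S) (D o kp(x := k)) l i"
    by (simp add: spread_def)
  qed
  finally have F: "F (spread S (D o kp) l) = (\<Sum>k<n. C k (l x) * F (spread (insert x S) (D o kp(x := k)) l))" .
  have "(\<Prod>i\<in>insert x S. C ((kp(x := k)) i) (l i)) = C k (l x) * (\<Prod>i\<in>S. C (kp i) (l i))" for k
  proof -
   have "(\<Prod>i\<in>S. C ((kp(x := k)) i) (l i)) = (\<Prod>i\<in>S. C (kp i) (l i))"
    by (intro prod.cong refl) (use insert.hyps in auto)
   then show ?thesis using insert.hyps by simp
  qed
  then show "(\<Prod>i\<in>S. C (kp i) (l i)) * F (spread S (D o kp) l) = (\<Sum>k<n. (\<Prod>i\<in>insert x S. C ((kp(x := k)) i) (l i)) *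
   F (spread (insert x S) (D o kp(x := k)) l))"
   unfolding F by (simp add: sum_distrib_left mult_ac)
 qed
 also have "... = (\<Sum>kp\<in>PiE (insert x S) (%_. {..<n}). (\<Prod>i\<in>insert x S. C (kp i) (l i)) * F (spread (insert x S) (D o kp) l))"
  by (rule sum_PiE_insert[symmetric]) (use insert.hyps in auto)
 finally show ?case .
qed

text \<open>The label at \<open>x\<close> enters only through the chord at \<open>x\<close>, whose
  factor is recorded at its left end \<open>y\<close>.\<close>

lemma mlin_mweight:
 assumes fin: "finite S" and m: "matching S \<tau>" and inj: "inj_on pos S"
 shows "mlin S (mweight e \<omega> pos S \<tau>)"
 unfolding mlin_def
proof (intro ballI allI)
 fix x and l :: "'a => 'v" and u v :: 'v and c :: 'k
 assume x: "x : S"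
 note mx = matchingD[OF m x]
 define y where "y = (if pos x < pos (\<tau> x) then x else \<tau> x)"
 have px: "pos x ~= pos (\<tau> x)" using inj mx x by (auto simp: inj_on_def)
 have y: "y : S" using x mx by (simp add: y_def)
 have rest: "(\<Prod>z\<in>S - {y}. pair_weight \<omega> pos \<tau> (l(x := w)) z) = (\<Prod>z\<in>S - {y}. pair_weight \<omega> pos \<tau> l z)" for w
 proof (intro prod.cong refl)
  fix z assume z: "z : S - {y}"
  show "pair_weight \<omega> pos \<tau> (l(x := w)) z = pair_weight \<omega> pos \<tau> l z"
  proof (cases "pos z < pos (\<tau> z)")
   case True
   have "z ~= x" using z True by (auto simp: y_def)
   moreover have "\<tau> z ~= x"
   proof
    assume tz: "\<tau> z = x"
    then have "z = \<tau> x" using matchingD(3)[OF m, of z] z by simp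
    then show False using z True tz px by (auto simp: y_def split: if_splits)
   qed
   ultimately show ?thesis by (simp add: pair_weight_def)
  qed (simp add: pair_weight_def)
 qed
 have split: "mweight e \<omega> pos S \<tau> (l(x := w)) = (\<Prod>a\<in>S. \<Prod>c\<in>S. cross_sign e pos \<tau> a c) *
   (\<Prod>z\<in>S - {y}. pair_weight \<omega> pos \<tau> l z) * pair_weight \<omega> pos \<tau> (l(x := w)) y" for w
  unfolding mweight_def prod.remove[OF fin y, of "pair_weight \<omega> pos \<tau> (l(x := w))"] rest by (simp add: mult_ac)
 have "pair_weight \<omega> pos \<tau> (l(x := u + scale c v)) y =
   pair_weight \<omega> pos \<tau> (l(x := u)) y + c * pair_weight \<omega> pos \<tau> (l(x := v)) y"
 proof (cases "pos x < pos (\<tau> x)")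
  case True
  then show ?thesis using mx by (simp add: y_def pair_weight_def)
 next
  case False
  then have "pos (\<tau> x) < pos x" using px by simp
  then show ?thesis using mx False by (simp add: y_def pair_weight_def)
 qed
 then show "mweight e \<omega> pos S \<tau> (l(x := u + scale c v)) = mweight e \<omega> pos S \<tau> (l(x := u)) + c * mweight e \<omega> pos S \<tau> (l(x := v))"
  unfolding split by (simp add: algebra_simps)
qed

section \<open>Tensors\<close>

lemma dual_iff: "\<psi> : dual scale \<longleftrightarrow> (\<forall>x y. \<psi> (x + y) = \<psi> x + \<psi> y) & (\<forall>c x. \<psi> (scale c x) = c * \<psi> x)"
 by (simp add: dual_def linear_dual_iff)

lemma w_dual [simp]: "\<omega> u : dual scale" by (simp add: dual_iff)

text \<open>The inverse of \<open>\<omega>\<close> viewed as a map from \<open>V\<close> to its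
  dual.\<close>

definition rep :: "('v => 'k) => 'v" where
 "rep \<psi> = (\<Sum>k<n. scale (\<psi> (b k)) (U k))"

lemma dual_sum:
 assumes "\<psi> : dual scale"
 shows "\<psi> (\<Sum>k\<in>A. scale (c k) (f k)) = (\<Sum>k\<in>A. c k * \<psi> (f k))"
proof -
 have "\<psi> 0 = 0" using assms by (metis dual_iff mult_zero_left scale_zero_left)
 then show ?thesis using assms by (induction A rule: infinite_finite_induct) (auto simp: dual_iff)
qed

lemma w_rep: "\<psi> : dual scale ==> \<omega> (rep \<psi>) = \<psi>"
proof
 fix v assume d: "\<psi> : dual scale"
 have "\<psi> v = \<psi> (\<Sum>k<n. scale (\<omega> (U k) v) (b k))" by (rule arg_cong[OF expand_b])
 also have "... = \<omega> (rep \<psi>) v" by (simp add: dual_sum[OF d] rep_def w_sum_left mult.commute)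
 finally show "\<omega> (rep \<psi>) v = \<psi> v" by simp
qed

lemma rep_w: "rep (\<omega> u) = u"
 unfolding rep_def by (rule expand_U[symmetric])

definition flats :: "nat => (nat => 'v) => ('v => 'k) list" where
 "flats p l = map (%i. \<omega> (l i)) [0..<p]"

lemma flats_simps [simp]: "length (flats p l) = p" "set (flats p l) \<subseteq> dual scale" "i < p ==> flats p l ! i = \<omega> (l i)"
 by (auto simp: flats_def)

lemma flats_rep:
 assumes "length \<psi>s = p" "set \<psi>s \<subseteq> dual scale"
 shows "\<psi>s = flats p (%i. rep (\<psi>s ! i))"
proof (rule nth_equalityI)
 fix i assume i: "i < length \<psi>s"
 then have "\<psi>s ! i : dual scale" using assms(2) nth_mem by blast
 then show "\<psi>s ! i = flats p (%i. rep (\<psi>s ! i)) ! i" using i assms(1) by (simp add: w_rep)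
qed (simp add: assms)

lemma flats_upd: "i < p ==> flats p (l(i := x)) = (flats p l)[i := \<omega> x]"
 by (rule nth_equalityI) (auto simp: nth_list_update)

lemma flats_cong: "(!!i. i < p ==> l i = l' i) ==> flats p l = flats p l'"
 by (simp add: flats_def)

text \<open>Through \<omega>, a form on functionals is read as a multilinear function of vectors. In
  this reading the action of diagrams is given by \<open>bracket\<close>.\<close>

definition ev :: "nat => ('k, 'v) tensor => (nat => 'v) => 'k" where
 "ev p t l = t (flats p l)"

lemma ev_add: "ev p (s + t) l = ev p s l + ev p t l" by (simp add: ev_def)
lemma ev_scale: "ev p (fscale c t) l = c * ev p t l" by (simp add: ev_def)
lemma ev_sum: "ev p (\<Sum>i\<in>A. F i) l = (\<Sum>i\<in>A. ev p (F i) l)" by (simp add: ev_def sum_apply)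
lemma ev_zero: "ev p 0 l = 0" by (simp add: ev_def)

lemma ev_cong: "(!!i. i < p ==> l i = l' i) ==> ev p t l = ev p t l'"
 unfolding ev_def by (metis flats_cong)

lemma w_comb: "\<omega> (x + scale c y) = \<omega> x + fscale c (\<omega> y)"
 by (rule ext) simp

lemma tensorI:
 assumes "!!\<psi>s. \<not> (length \<psi>s = p & set \<psi>s \<subseteq> dual scale) ==> t \<psi>s = 0" "mlin {..<p} (ev p t)"
 shows "t : tn p"
 unfolding tensors_def
proof (intro CollectI conjI allI ballI impI)
 fix \<psi>s i \<phi> \<psi> c assume i: "i < p" and d: "\<phi> : dual scale" "\<psi> : dual scale" and \<psi>s: "length \<psi>s = p & set \<psi>s \<subseteq> dual scale"
 let ?l = "%i. rep (\<psi>s ! i)"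
 have u: "\<psi>s[i := \<omega> x] = flats p (?l(i := x))" for x
  unfolding flats_upd[OF i] using flats_rep[of \<psi>s p] \<psi>s by simp
 have "\<phi> + fscale c \<psi> = \<omega> (rep \<phi> + scale c (rep \<psi>))" by (simp only: w_comb w_rep[OF d(1)] w_rep[OF d(2)])
 then have "t (\<psi>s[i := \<phi> + fscale c \<psi>]) = ev p t (?l(i := rep \<phi> + scale c (rep \<psi>)))"
  by (simp only: u ev_def)
 also have "... = ev p t (?l(i := rep \<phi>)) + c * ev p t (?l(i := rep \<psi>))"
  using assms(2) i unfolding mlin_def by blast
 also have "... = t (\<psi>s[i := \<phi>]) + c * t (\<psi>s[i := \<psi>])"
  unfolding ev_def u[symmetric] by (simp only: w_rep[OF d(1)] w_rep[OF d(2)])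
 finally show "t (\<psi>s[i := \<phi> + fscale c \<psi>]) = t (\<psi>s[i := \<phi>]) + c * t (\<psi>s[i := \<psi>])" .
qed (use assms(1) in blast)

lemma tensor_zero: "t : tn p ==> \<not> (length \<psi>s = p & set \<psi>s \<subseteq> dual scale) ==> t \<psi>s = 0"
 unfolding tensors_def by blast

lemma tensor_mlin: "t : tn p ==> mlin {..<p} (ev p t)"
 unfolding mlin_def
proof (intro ballI allI)
 fix i l x y c assume t: "t : tn p" and i: "i : {..<p}"
 then have i: "i < p" by simp
 have "t ((flats p l)[i := \<omega> x + fscale c (\<omega> y)]) = t ((flats p l)[i := \<omega> x]) + c * t ((flats p l)[i := \<omega> y])"
  using t i w_dual flats_simps(1,2) unfolding tensors_def by blast
 then show "ev p t (l(i := x + scale c y)) = ev p t (l(i := x)) + c * ev p t (l(i := y))"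
  by (simp only: ev_def flats_upd[OF i] w_comb)
qed

lemma tensor_eqI:
 assumes "s : tn p" "t : tn p" "!!l. ev p s l = ev p t l"
 shows "s = t"
proof
 fix \<psi>s
 show "s \<psi>s = t \<psi>s"
 proof (cases "length \<psi>s = p & set \<psi>s \<subseteq> dual scale")
  case True
  then have "\<psi>s = flats p (%i. rep (\<psi>s ! i))" by (intro flats_rep) auto
  then show ?thesis using assms(3)[of "%i. rep (\<psi>s ! i)"] by (simp add: ev_def)
 qed (use tensor_zero assms(1,2) in metis)
qed

lemma tensor_add: "s : tn p ==> t : tn p ==> s + t : tn p"
 by (intro tensorI) (auto simp: tensor_zero mlin_def ev_add algebra_simps dest!: tensor_mlin)

lemma tensor_scale: "t : tn p ==> fscale c t : tn p"
 by (intro tensorI) (auto simp: tensor_zero mlin_def ev_scale algebra_simps dest!: tensor_mlin)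

lemma tensor_0: "0 : tn p"
 by (intro tensorI) (auto simp: mlin_def ev_zero)

lemma tensor_diff: "s : tn p ==> t : tn p ==> s - t : tn p"
proof -
 assume "s : tn p" "t : tn p"
 then have "s + fscale (-1) t : tn p" by (intro tensor_add tensor_scale)
 moreover have "s + fscale (-1) t = s - t" by (rule ext) simp
 ultimately show ?thesis by simp
qed

lemma tensor_sum: "(!!i. i : A ==> F i : tn p) ==> (\<Sum>i\<in>A. F i) : tn p"
 by (induction A rule: infinite_finite_induct) (auto intro: tensor_add tensor_0)

definition vlist :: "nat => (nat => 'v) => 'v list" where
 "vlist p l = map l [0..<p]"

lemma vlist_simps [simp]: "length (vlist p l) = p" "i < p ==> vlist p l ! i = l i"
 by (auto simp: vlist_def)

lemma vlist_nth: "length vs = p ==> vs = vlist p (%i. vs ! i)"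
 by (rule nth_equalityI) auto

lemma ev_pure: "ev p (pure scale (vlist p v)) l = (\<Prod>i<p. \<omega> (l i) (v i))"
 by (simp add: ev_def pure_def)

lemma pure_tensor: "length vs = p ==> pure scale vs : tn p"
proof -
 assume p: "length vs = p"
 have "mlin {..<p} (ev p (pure scale (vlist p (%i. vs ! i))))"
  unfolding mlin_def ev_pure
 proof (intro ballI allI)
  fix i l x y c assume i: "i : {..<p}"
  have split: "(\<Prod>j<p. \<omega> ((l(i := z)) j) (vs ! j)) = \<omega> z (vs ! i) * (\<Prod>j\<in>{..<p} - {i}. \<omega> (l j) (vs ! j))" for z
   by (subst prod.remove[OF _ i]) (auto intro!: prod.cong)
  show "(\<Prod>j<p. \<omega> ((l(i := x + scale c y)) j) (vs ! j)) =
    (\<Prod>j<p. \<omega> ((l(i := x)) j) (vs ! j)) + c * (\<Prod>j<p. \<omega> ((l(i := y)) j) (vs ! j))"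
   unfolding split by (simp add: algebra_simps)
 qed
 then show ?thesis
  unfolding vlist_nth[OF p, symmetric] by (intro tensorI) (auto simp: pure_def p)
qed

lemma ev_expand:
 assumes "t : tn p"
 shows "ev p t l = (\<Sum>kp\<in>PiE {..<p} (%_. {..<n}). (\<Prod>i<p. \<omega> (l i) (b (kp i))) * ev p t (U o kp))"
proof -
 have "ev p t l = (\<Sum>kp\<in>PiE {..<p} (%_. {..<n}). (\<Prod>i<p. \<omega> (l i) (b (kp i))) * ev p t (spread {..<p} (U o kp) l))"
  by (rule mlin_expand[of "%k v. \<omega> v (b k)" U]) (rule expand_U, simp, rule tensor_mlin[OF assms])
 moreover have "ev p t (spread {..<p} (U o kp) l) = ev p t (U o kp)" for kp
  by (rule ev_cong) (simp add: spread_def)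
 ultimately show ?thesis by (simp only:)
qed

lemma tensor_expand:
 assumes "t : tn p"
 shows "t = (\<Sum>kp\<in>PiE {..<p} (%_. {..<n}). fscale (ev p t (U o kp)) (pure scale (vlist p (b o kp))))"
proof (rule tensor_eqI[OF assms])
 show "(\<Sum>kp\<in>PiE {..<p} (%_. {..<n}). fscale (ev p t (U o kp)) (pure scale (vlist p (b o kp)))) : tn p"
  by (intro tensor_sum tensor_scale pure_tensor vlist_simps)
 fix l
 show "ev p t l = ev p (\<Sum>kp\<in>PiE {..<p} (%_. {..<n}). fscale (ev p t (U o kp)) (pure scale (vlist p (b o kp)))) l"
  unfolding ev_sum ev_scale ev_pure by (subst ev_expand[OF assms]) (simp only: mult.commute o_apply)
qed

lemma linear_on_sum:
 assumes L: "linear_on (tn p) L" and F: "!!i. i : A ==> F i : tn p"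
 shows "L (\<Sum>i\<in>A. fscale (c i) (F i)) = (\<Sum>i\<in>A. fscale (c i) (L (F i)))"
proof -
 have "fscale 0 (0 :: ('k, 'v) tensor) = 0" "!!t :: ('k, 'v) tensor. fscale 0 t = 0" by (auto simp: fscale_def)
 then have z: "L 0 = 0" using L tensor_0[of p] by (metis linear_on_def)
 show ?thesis using F
 proof (induction A rule: infinite_finite_induct)
  case (insert i A)
  have "L (fscale (c i) (F i) + (\<Sum>i\<in>A. fscale (c i) (F i))) = L (fscale (c i) (F i)) + L (\<Sum>i\<in>A. fscale (c i) (F i))"
   using L insert.prems tensor_scale tensor_sum unfolding linear_on_def by (metis (no_types, lifting) insertCI)
  moreover have "L (fscale (c i) (F i)) = fscale (c i) (L (F i))"
   using L insert.prems unfolding linear_on_def by blast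
  moreover have "L (\<Sum>i\<in>A. fscale (c i) (F i)) = (\<Sum>i\<in>A. fscale (c i) (L (F i)))"
   by (rule insert.IH) (use insert.prems in blast)
  ultimately show ?case by (simp only: sum.insert[OF insert.hyps])
 next
  case (infinite A)
  show ?case by (simp only: sum.infinite[OF infinite.hyps(1)] z)
 next
  case empty
  show ?case by (simp only: sum.empty z)
 qed
qed

lemma linear_on_eq:
 assumes "linear_on (tn p) L" "linear_on (tn p) L'"
  and "!!vs. length vs = p ==> L (pure scale vs) = L' (pure scale vs)" and t: "t : tn p"
 shows "L t = L' t"
proof -
 have pt: "pure scale (vlist p (b o kp)) : tn p" for kp by (rule pure_tensor) simp
 show ?thesis
  by (subst (1 2) tensor_expand[OF t])
   (simp only: linear_on_sum[OF assms(1) pt] linear_on_sum[OF assms(2) pt] assms(3)[OF vlist_simps(1)])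
qed

end

section \<open>The functor to tensor spaces\<close>

lemma prod_if_const:
 fixes e :: "'k::comm_monoid_mult"
 assumes "finite A"
 shows "(\<Prod>x\<in>A. if P x then e else 1) = e ^ card {x : A. P x}"
proof -
 have "e ^ card {x : A. P x} = (\<Prod>x\<in>{x : A. P x}. e)" by simp
 also have "... = (\<Prod>x\<in>A. if P x then e else 1)" by (rule prod.inter_filter[OF assms])
 finally show ?thesis by simp
qed

text \<open>Reversal of the order turns the quadruple \<open>(a, c, b, d)\<close> into a crossing
  whose left ends are \<open>d\<close> and \<open>b\<close>.\<close>

lemma crossings_eq:
 assumes f: "f : brauer p q"
 shows "crossings f = card {(x, y) : points p q \<times> points p q. crosses ppos (mate f) x y}"
proof -
 let ?X = "{(x, y) : points p q \<times> points p q. crosses ppos (mate f) x y}"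
 let ?h = "%(x, y). (mate f y, mate f x, y, x)"
 note m = matchingD[OF matching_mate[OF f]]
 have c: "cpos x < cpos y \<longleftrightarrow> ppos y < ppos x" for x y by (cases x; cases y) auto
 have "{(a, c, b, d). {a, b} : f & {c, d} : f & cpos a < cpos c & cpos c < cpos b & cpos b < cpos d} = ?h ` ?X"
 proof (intro equalityI subsetI)
  fix z assume "z : {(a, c, b, d). {a, b} : f & {c, d} : f & cpos a < cpos c & cpos c < cpos b & cpos b < cpos d}"
  then obtain a c' b d where z: "z = (a, c', b, d)" "{a, b} : f" "{c', d} : f"
   "cpos a < cpos c'" "cpos c' < cpos b" "cpos b < cpos d" by blast
  have "{b, a} : f" "{d, c'} : f" using z(2,3) by (simp_all add: insert_commute)
  then have bd: "b : points p q" "a = mate f b" "d : points p q" "c' = mate f d"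
   using pair_iff_mate[OF f] by auto
  then have "(d, b) : ?X" using z(4-6) by (simp add: crosses_def c)
  then show "z : ?h ` ?X" unfolding z(1) bd(2,4) by (rule rev_image_eqI) simp
 next
  fix z assume "z : ?h ` ?X"
  then obtain x y where xy: "z = (mate f y, mate f x, y, x)" "x : points p q" "y : points p q" "crosses ppos (mate f) x y"
   by auto
  have "{mate f y, y} : f" "{mate f x, x} : f"
   using pair_iff_mate[OF f] xy(2,3) by (auto simp: insert_commute)
  then show "z : {(a, c, b, d). {a, b} : f & {c, d} : f & cpos a < cpos c & cpos c < cpos b & cpos b < cpos d}"
   using xy(1,4) by (simp add: crosses_def c)
 qed
 moreover have "inj_on ?h ?X" by (rule inj_onI) (simp split: prod.splits)
 ultimately show ?thesis by (simp add: crossings_def card_image)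
qed

lemma prod_cross_sign:
 assumes f: "f : brauer p q"
 shows "(\<Prod>x\<in>points p q. \<Prod>y\<in>points p q. cross_sign e ppos (mate f) x y) = e ^ crossings f"
proof -
 have "(\<Prod>x\<in>points p q. \<Prod>y\<in>points p q. cross_sign e ppos (mate f) x y) =
  (\<Prod>z\<in>points p q \<times> points p q. if crosses ppos (mate f) (fst z) (snd z) then e else 1)"
  by (simp add: prod.cartesian_product cross_sign_def case_prod_unfold)
 also have "... = e ^ card {z : points p q \<times> points p q. crosses ppos (mate f) (fst z) (snd z)}"
  by (rule prod_if_const) simp
 also have "{z : points p q \<times> points p q. crosses ppos (mate f) (fst z) (snd z)} =
   {(x, y) : points p q \<times> points p q. crosses ppos (mate f) x y}" by auto
 finally show ?thesis by (simp only: crossings_eq[OF f])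
qed

lemma prod_image_pairs:
 assumes "!!i j i' j'. (i, j) : A ==> (i', j') : A ==> h i j = h i' j' ==> i = i' & j = j'"
  and "!!i j. (i, j) : A ==> g (h i j) = k i j"
 shows "(\<Prod>x\<in>(%(i, j). h i j) ` A. g x) = (\<Prod>(i, j)\<in>A. k i j)"
proof (subst prod.reindex)
 show "inj_on (%(i, j). h i j) A" unfolding inj_on_def using assms(1) by fast
 show "prod (g o (%(i, j). h i j)) A = (\<Prod>(i, j)\<in>A. k i j)"
  by (rule prod.cong) (use assms(2) in auto)
qed

lemma bracket_cong:
 assumes "f : brauer p q" "!!i. i < p ==> v i = v' i" "!!j. j < q ==> l j = l' j"
 shows "bracket e w p q f v l = bracket e w p q f v' l'"
 unfolding bracket_def
 by (rule mweight_cong[OF matching_mate[OF assms(1)] refl]) (use assms(2,3) in \<open>auto simp: points_def\<close>)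

text \<open>A pair of bottom points \<open>m < n\<close> is oriented from \<open>n\<close> to \<open>m\<close> by \<open>ppos\<close>, and a pair of a top and
 a bottom point from bottom to top.\<close>

lemma bracket_prod:
 assumes f: "f : brauer p q"
 shows "bracket e w p q f v l = e ^ crossings f *
  (\<Prod>(i, j)\<in>{(i, j). i < j & {Top i, Top j} : f}. w (v i) (v j)) *
  (\<Prod>(k, j)\<in>{(k, j). {Top k, Bot j} : f}. w (l j) (v k)) *
  (\<Prod>(m, n)\<in>{(m, n). m < n & {Bot m, Bot n} : f}. w (l n) (l m))"
proof -
 note m = matchingD[OF matching_mate[OF f]]
 let ?TT = "{(i, j). i < j & {Top i, Top j} : f}" and ?TB = "{(k, j). {Top k, Bot j} : f}"
  and ?BB = "{(m, n). m < n & {Bot m, Bot n} : f}"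
 let ?P = "{x : points p q. ppos x < ppos (mate f x)}"
 let ?w = "%x. w (case_point v l x) (case_point v l (mate f x))"
 have p: "{x, y} : f \<longleftrightarrow> x : points p q & y = mate f x" for x y by (rule pair_iff_mate[OF f])
 have p': "{x, y} : f \<longleftrightarrow> y : points p q & x = mate f y" for x y
  using p[of y x] by (simp add: insert_commute)
 have "bracket e w p q f v l = e ^ crossings f * (\<Prod>x\<in>?P. ?w x)"
  unfolding bracket_def mweight_def prod_cross_sign[OF f] pair_weight_def
  by (simp add: prod.inter_filter)
 also have "?P = (%(i, j). Top i) ` ?TT \<union> (%(k, j). Bot j) ` ?TB \<union> (%(m, n). Bot n) ` ?BB"
 proof (intro equalityI subsetI)
  fix x assume x: "x : ?P"
  show "x : (%(i, j). Top i) ` ?TT \<union> (%(k, j). Bot j) ` ?TB \<union> (%(m, n). Bot n) ` ?BB"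
  proof (cases x)
   case (Top i)
   show ?thesis
   proof (cases "mate f x")
    case (Top j)
    then have "(i, j) : ?TT" using x \<open>x = Top i\<close> p[of x "Top j"] by simp
    then show ?thesis using \<open>x = Top i\<close> by (auto intro: rev_image_eqI)
   next
    case (Bot j)
    then show ?thesis using x \<open>x = Top i\<close> by simp
   qed
  next
   case (Bot j)
   show ?thesis
   proof (cases "mate f x")
    case (Top k)
    then have "(k, j) : ?TB" using x \<open>x = Bot j\<close> p'[of "Top k" x] by simp
    then show ?thesis using \<open>x = Bot j\<close> by (auto intro: rev_image_eqI)
   next
    case (Bot k)
    then have "(k, j) : ?BB" using x \<open>x = Bot j\<close> p'[of "Bot k" x] by simp
    then show ?thesis using \<open>x = Bot j\<close> by (auto intro: rev_image_eqI)
   qed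
  qed
 next
  fix x assume "x : (%(i, j). Top i) ` ?TT \<union> (%(k, j). Bot j) ` ?TB \<union> (%(m, n). Bot n) ` ?BB"
  then consider i j where "x = Top i" "i < j" "{Top i, Top j} : f" | k j where "x = Bot j" "{Top k, Bot j} : f"
   | k j where "x = Bot j" "k < j" "{Bot k, Bot j} : f" by auto
  then show "x : ?P"
  proof cases
   case 1
   then show ?thesis using p[of "Top i" "Top j"] by (metis (mono_tags, lifting) mem_Collect_eq of_nat_less_iff ppos.simps(1))
  next
   case 2
   then have "x : points p q" "mate f x = Top k" using p'[of "Top k" "Bot j"] by auto
   then show ?thesis using 2(1) by simp
  next
   case 3
   then have "x : points p q" "mate f x = Bot k" using p'[of "Bot k" "Bot j"] by auto
   then show ?thesis using 3(1,2) by simp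
  qed
 qed
 also have "(\<Prod>x\<in>.... ?w x) = (\<Prod>x\<in>(%(i, j). Top i) ` ?TT. ?w x) * (\<Prod>x\<in>(%(k, j). Bot j) ` ?TB. ?w x) *
   (\<Prod>x\<in>(%(m, n). Bot n) ` ?BB. ?w x)"
 proof -
  have finT: "finite ?TT" "finite ?TB" "finite ?BB"
  proof -
   have "?TT \<subseteq> {..<p} \<times> {..<p}" "?TB \<subseteq> {..<p} \<times> {..<q}" "?BB \<subseteq> {..<q} \<times> {..<q}"
    using brauer_pairD(2,3)[OF f] by fastforce+
   then show "finite ?TT" "finite ?TB" "finite ?BB" by (auto intro: finite_subset)
  qed
  have d: "((%(i, j). Top i) ` ?TT \<union> (%(k, j). Bot j) ` ?TB) \<inter> (%(m, n). Bot n) ` ?BB = {}"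
   "(%(i, j). Top i) ` ?TT \<inter> (%(k, j). Bot j) ` ?TB = {}"
  proof -
   have "False" if "{Top k, Bot j} : f" "{Bot m, Bot j} : f" for k j m
    using p'[of "Top k" "Bot j"] p'[of "Bot m" "Bot j"] that by (metis point.distinct(1))
   then show "((%(i, j). Top i) ` ?TT \<union> (%(k, j). Bot j) ` ?TB) \<inter> (%(m, n). Bot n) ` ?BB = {}" by auto
   show "(%(i, j). Top i) ` ?TT \<inter> (%(k, j). Bot j) ` ?TB = {}" by auto
  qed
  show ?thesis
   by (subst prod.union_disjoint[OF _ _ d(1)], simp_all add: finT, subst prod.union_disjoint[OF _ _ d(2)], simp_all add: finT)
 qed
 also have "(\<Prod>x\<in>(%(i, j). Top i) ` ?TT. ?w x) = (\<Prod>(i, j)\<in>?TT. w (v i) (v j))"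
 proof (rule prod_image_pairs)
  fix i j i' j' assume "(i, j) : ?TT" "(i', j') : ?TT" "Top i = Top i'"
  then have "{Top i, Top j} : f" "{Top i, Top j'} : f" "i = i'" by auto
  then show "i = i' & j = j'" using p by (metis point.inject(1))
 next
  fix i j assume "(i, j) : ?TT"
  then have "mate f (Top i) = Top j" using p[of "Top i" "Top j"] by simp
  then show "?w (Top i) = w (v i) (v j)" by simp
 qed
 also have "(\<Prod>x\<in>(%(k, j). Bot j) ` ?TB. ?w x) = (\<Prod>(k, j)\<in>?TB. w (l j) (v k))"
 proof (rule prod_image_pairs)
  fix k j k' j' assume "(k, j) : ?TB" "(k', j') : ?TB" "Bot j = Bot j'"
  then have "{Top k, Bot j} : f" "{Top k', Bot j} : f" "j = j'" by auto
  then show "k = k' & j = j'" using p' by (metis point.inject(1))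
 next
  fix k j assume "(k, j) : ?TB"
  then have "mate f (Bot j) = Top k" using p'[of "Top k" "Bot j"] by simp
  then show "?w (Bot j) = w (l j) (v k)" by simp
 qed
 also have "(\<Prod>x\<in>(%(m, n). Bot n) ` ?BB. ?w x) = (\<Prod>(m, n)\<in>?BB. w (l n) (l m))"
 proof (rule prod_image_pairs)
  fix k j k' j' assume "(k, j) : ?BB" "(k', j') : ?BB" "Bot j = Bot j'"
  then have "{Bot k, Bot j} : f" "{Bot k', Bot j} : f" "j = j'" by auto
  then show "k = k' & j = j'" using p' by (metis point.inject(2))
 next
  fix k j assume "(k, j) : ?BB"
  then have "mate f (Bot j) = Bot k" using p'[of "Bot k" "Bot j"] by simp
  then show "?w (Bot j) = w (l j) (l k)" by simp
 qed
 finally show ?thesis by (simp add: mult.assoc)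
qed

context mono_basis
begin

lemma mlin_bracket_top:
 assumes "f : brauer p q"
 shows "mlin {..<p} (%v. bracket e \<omega> p q f v l)"
 unfolding mlin_def
proof (intro ballI allI)
 fix i v x y c assume "i : {..<p}"
 then have i: "Top i : points p q" by simp
 have u: "case_point (v(i := z)) l = (case_point v l)(Top i := z)" for z :: 'v
  by (auto split: point.splits)
 show "bracket e \<omega> p q f (v(i := x + scale c y)) l = bracket e \<omega> p q f (v(i := x)) l + c * bracket e \<omega> p q f (v(i := y)) l"
  using mlin_mweight[OF points_simps(3) matching_mate[OF assms] inj_ppos] i
  unfolding bracket_def u mlin_def by blast
qed

lemma mlin_bracket_bot:
 assumes "f : brauer p q"
 shows "mlin {..<q} (bracket e \<omega> p q f v)"
 unfolding mlin_def
proof (intro ballI allI)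
 fix i l x y c assume "i : {..<q}"
 then have i: "Bot i : points p q" by simp
 have u: "case_point v (l(i := z)) = (case_point v l)(Bot i := z)" for z :: 'v
  by (auto split: point.splits)
 show "bracket e \<omega> p q f v (l(i := x + scale c y)) = bracket e \<omega> p q f v (l(i := x)) + c * bracket e \<omega> p q f v (l(i := y))"
  using mlin_mweight[OF points_simps(3) matching_mate[OF assms] inj_ppos] i
  unfolding bracket_def u mlin_def by blast
qed

lemma bracket_expand_top:
 assumes f: "f : brauer p q"
 shows "bracket e \<omega> p q f v l = (\<Sum>kp\<in>PiE {..<p} (%_. {..<n}). (\<Prod>i<p. \<omega> (U (kp i)) (v i)) * bracket e \<omega> p q f (b o kp) l)"
proof -
 have "bracket e \<omega> p q f v l = (\<Sum>kp\<in>PiE {..<p} (%_. {..<n}). (\<Prod>i<p. \<omega> (U (kp i)) (v i)) * bracket e \<omega> p q f (spread {..<p} (b o kp) v) l)"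
  by (rule mlin_expand[of "%k. \<omega> (U k)" b, where F = "%v. bracket e \<omega> p q f v l"]) (rule expand_b, simp, rule mlin_bracket_top[OF f])
 moreover have "bracket e \<omega> p q f (spread {..<p} (b o kp) v) l = bracket e \<omega> p q f (b o kp) l" for kp
  by (rule bracket_cong[OF f]) (simp_all add: spread_def)
 ultimately show ?thesis by (simp only:)
qed

text \<open>The defining condition feeds the second factor with \<open>%y. \<omega> y u\<close>,
  which is \<open>\<omega> (scale e u)\<close>. Exchanging the arguments absorbs this
  \<open>e\<close> and reverses the order.\<close>

lemma omega_star_w: "omega_star scale \<omega> [\<omega> u, \<omega> v] = \<omega> v u"
proof -
 let ?P = "%t. t : tn 2 & (\<forall>u. \<forall>\<psi>\<in>dual scale. t [\<psi>, %y. \<omega> y u] = \<psi> u)"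
 define t0 :: "('k, 'v) tensor" where
  "t0 \<psi>s = (if length \<psi>s = 2 & set \<psi>s \<subseteq> dual scale then \<omega> (rep (\<psi>s ! 1)) (rep (\<psi>s ! 0)) else 0)" for \<psi>s
 have ev0: "ev 2 t0 l = \<omega> (l 1) (l 0)" for l by (simp add: ev_def t0_def rep_w)
 have right: "(%y. \<omega> y u) = \<omega> (scale e u)" for u
  by (rule ext) (simp add: sym_e[of _ u])
 have "t0 : tn 2"
 proof (rule tensorI)
  show "mlin {..<2} (ev 2 t0)"
   unfolding mlin_def ev0
  proof (intro ballI allI)
   fix i :: nat and l x y c assume "i : {..<2}"
   then consider "i = 0" | "i = 1" by fastforce
   then show "\<omega> ((l(i := x + scale c y)) 1) ((l(i := x + scale c y)) 0) =
    \<omega> ((l(i := x)) 1) ((l(i := x)) 0) + c * \<omega> ((l(i := y)) 1) ((l(i := y)) 0)"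
    by cases simp_all
  qed
 qed (auto simp: t0_def)
 moreover have "t0 [\<psi>, %y. \<omega> y u] = \<psi> u" if "\<psi> : dual scale" for \<psi> u
 proof -
  have "t0 [\<psi>, \<omega> (scale e u)] = \<omega> (scale e u) (rep \<psi>)" using that by (simp add: t0_def rep_w)
  also have "... = \<omega> (rep \<psi>) u" using sym_e[of "rep \<psi>" u] by simp
  finally show ?thesis by (simp add: right w_rep[OF that])
 qed
 ultimately have P0: "?P t0" by blast
 have uniq: "t = t0" if t: "?P t" for t
 proof (rule tensor_eqI[of _ 2])
  fix l :: "nat => 'v"
  have fl: "flats 2 l = [\<omega> (l 0), \<omega> (l 1)]" by (simp add: flats_def numeral_2_eq_2)
  have l1: "\<omega> (l 1) = (%y. \<omega> y (scale e (l 1)))"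
   by (rule ext) (simp only: w_scale_right, rule sym_e)
  have *: "s [\<omega> (l 0), \<omega> (l 1)] = \<omega> (l 0) (scale e (l 1))" if "?P s" for s
  proof -
   have "s [\<omega> (l 0), %y. \<omega> y (scale e (l 1))] = \<omega> (l 0) (scale e (l 1))" using that w_dual by blast
   then show ?thesis by (simp only: l1)
  qed
  show "ev 2 t l = ev 2 t0 l" unfolding ev_def fl by (simp only: *[OF t] *[OF P0])
 next
  show "t : tn 2" "t0 : tn 2" using t P0 by blast+
 qed
 have "omega_star scale \<omega> = t0"
  unfolding omega_star_def by (rule the_equality) (rule P0, rule uniq, assumption)
 then show ?thesis by (simp add: t0_def rep_w)
qed

lemma diagram_on_pure_flats:
 assumes f: "f : brauer p q"
 shows "diagram_on_pure scale \<omega> e q f (vlist p v) (flats q l) = bracket e \<omega> p q f v l"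
proof -
 have D: "diagram_on_pure scale \<omega> e q f (vlist p v) (flats q l) = e ^ crossings f *
   (\<Prod>(i, j)\<in>{(i, j). i < j & {Top i, Top j} : f}. \<omega> (vlist p v ! i) (vlist p v ! j)) *
   (\<Prod>(k, j)\<in>{(k, j). {Top k, Bot j} : f}. (flats q l ! j) (vlist p v ! k)) *
   (\<Prod>(m, n)\<in>{(m, n). m < n & {Bot m, Bot n} : f}. omega_star scale \<omega> [flats q l ! m, flats q l ! n])"
  by (simp add: diagram_on_pure_def)
 have T: "i < p" if "{Top i, y} : f" for i y using brauer_pairD(2)[OF f that] by simp
 have T': "i < p" if "{y, Top i} : f" for i y using brauer_pairD(3)[OF f that] by simp
 have B: "j < q" if "{Bot j, y} : f" for j y using brauer_pairD(2)[OF f that] by simp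
 have B': "j < q" if "{y, Bot j} : f" for j y using brauer_pairD(3)[OF f that] by simp
 have "(\<Prod>(i, j)\<in>{(i, j). i < j & {Top i, Top j} : f}. \<omega> (vlist p v ! i) (vlist p v ! j)) =
   (\<Prod>(i, j)\<in>{(i, j). i < j & {Top i, Top j} : f}. \<omega> (v i) (v j))"
  by (intro prod.cong refl, clarify) (simp add: T T')
 moreover have "(\<Prod>(k, j)\<in>{(k, j). {Top k, Bot j} : f}. (flats q l ! j) (vlist p v ! k)) =
   (\<Prod>(k, j)\<in>{(k, j). {Top k, Bot j} : f}. \<omega> (l j) (v k))"
  by (intro prod.cong refl, clarify) (simp add: T B')
 moreover have "(\<Prod>(m, n)\<in>{(m, n). m < n & {Bot m, Bot n} : f}. omega_star scale \<omega> [flats q l ! m, flats q l ! n]) =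
   (\<Prod>(m, n)\<in>{(m, n). m < n & {Bot m, Bot n} : f}. \<omega> (l n) (l m))"
  by (intro prod.cong refl, clarify) (simp add: B B' omega_star_w)
 ultimately show ?thesis by (simp only: D bracket_prod[OF f])
qed

lemma ev_diagram_on_pure:
 "f : brauer p q ==> ev q (diagram_on_pure scale \<omega> e q f (vlist p v)) l = bracket e \<omega> p q f v l"
 by (simp add: ev_def diagram_on_pure_flats)

lemma diagram_on_pure_tensor:
 assumes f: "f : brauer p q" and "length vs = p"
 shows "diagram_on_pure scale \<omega> e q f vs : tn q"
proof -
 have "mlin {..<q} (ev q (diagram_on_pure scale \<omega> e q f (vlist p (%i. vs ! i))))"
  using mlin_bracket_bot[OF f] ev_diagram_on_pure[OF f] by presburger
 then show ?thesis
  unfolding vlist_nth[OF assms(2), symmetric] by (intro tensorI) (auto simp: diagram_on_pure_def)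
qed

text \<open>The linear extension from pure tensors in coordinates; the witness for the
  \<open>THE\<close> in \<open>diagram_map\<close>.\<close>

definition dmap :: "nat => nat => diagram => ('k, 'v) tensor => ('k, 'v) tensor" where
 "dmap p q f = restrict (%t. \<Sum>kp\<in>PiE {..<p} (%_. {..<n}).
   fscale (ev p t (U o kp)) (diagram_on_pure scale \<omega> e q f (vlist p (b o kp)))) (tn p)"

lemma fscale_add: "fscale (c + d) x = fscale c x + fscale d x" by (rule ext) (simp add: distrib_right)
lemma fscale_fscale: "fscale c (fscale d x) = fscale (c * d) x" by (rule ext) (simp add: mult.assoc)
lemma fscale_add_right: "fscale c (x + y) = fscale c x + fscale c y" by (rule ext) (simp add: distrib_left)
lemma fscale_sum_right: "fscale c (\<Sum>i\<in>A. T i) = (\<Sum>i\<in>A. fscale c (T i))"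
 by (rule ext) (simp add: sum_apply sum_distrib_left)
lemma fscale_one: "fscale 1 x = x" by (rule ext) simp
lemma fscale_zero_left: "fscale 0 x = 0" by (rule ext) simp
lemma fscale_zero_right: "fscale c 0 = 0" by (rule ext) simp

lemma dmap_linear: "linear_on (tn p) (dmap p q f)"
 unfolding linear_on_def
proof (intro conjI ballI allI)
 fix s t assume st: "s : tn p" "t : tn p"
 show "dmap p q f (s + t) = dmap p q f s + dmap p q f t"
  using st tensor_add[OF st] by (simp only: dmap_def restrict_apply if_True ev_add fscale_add sum.distrib)
next
 fix c t assume t: "t : tn p"
 show "dmap p q f (fscale c t) = fscale c (dmap p q f t)"
  using t tensor_scale[OF t] by (simp only: dmap_def restrict_apply if_True ev_scale fscale_fscale[symmetric] fscale_sum_right)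
qed

lemma ev_dmap:
 assumes f: "f : brauer p q" and t: "t : tn p"
 shows "ev q (dmap p q f t) l = (\<Sum>kp\<in>PiE {..<p} (%_. {..<n}). ev p t (U o kp) * bracket e \<omega> p q f (b o kp) l)"
 using t by (simp only: dmap_def restrict_apply if_True ev_sum ev_scale ev_diagram_on_pure[OF f])

lemma dmap_tensor:
 assumes f: "f : brauer p q" and t: "t : tn p"
 shows "dmap p q f t : tn q"
 using t by (simp only: dmap_def restrict_apply if_True)
  (intro tensor_sum tensor_scale diagram_on_pure_tensor[OF f] vlist_simps)

lemma dmap_pure:
 assumes f: "f : brauer p q" and p: "length vs = p"
 shows "dmap p q f (pure scale vs) = diagram_on_pure scale \<omega> e q f vs"
proof (rule tensor_eqI)
 note pt = pure_tensor[OF p]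
 show "dmap p q f (pure scale vs) : tn q" by (rule dmap_tensor[OF f pt])
 show "diagram_on_pure scale \<omega> e q f vs : tn q" by (rule diagram_on_pure_tensor[OF f p])
 fix l
 let ?v = "%i. vs ! i"
 have vs: "vs = vlist p ?v" by (rule vlist_nth[OF p])
 have "ev p (pure scale vs) (U o kp) = (\<Prod>i<p. \<omega> (U (kp i)) (vs ! i))" for kp
  by (subst vs) (simp add: ev_pure)
 then have "ev q (dmap p q f (pure scale vs)) l = bracket e \<omega> p q f ?v l"
  by (simp only: ev_dmap[OF f pt] bracket_expand_top[OF f, of ?v])
 also have "... = ev q (diagram_on_pure scale \<omega> e q f vs) l"
  by (subst vs) (rule ev_diagram_on_pure[OF f, symmetric])
 finally show "ev q (dmap p q f (pure scale vs)) l = ev q (diagram_on_pure scale \<omega> e q f vs) l" .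
qed

lemma diagram_map_eq:
 assumes f: "f : brauer p q"
 shows "diagram_map scale \<omega> e p q f = dmap p q f"
 unfolding diagram_map_def
proof (rule the_equality)
 show "dmap p q f : extensional (tn p) & linear_on (tn p) (dmap p q f) &
  (\<forall>vs. length vs = p --> dmap p q f (pure scale vs) = diagram_on_pure scale \<omega> e q f vs)"
 proof (intro conjI allI impI)
  show "dmap p q f : extensional (tn p)" by (simp add: dmap_def)
 qed (simp_all only: dmap_linear dmap_pure[OF f])
 fix L assume L: "L : extensional (tn p) & linear_on (tn p) L &
  (\<forall>vs. length vs = p --> L (pure scale vs) = diagram_on_pure scale \<omega> e q f vs)"
 show "L = dmap p q f"
 proof (rule extensionalityI[of _ "tn p"])
  show "L : extensional (tn p)" "dmap p q f : extensional (tn p)" using L by (auto simp: dmap_def)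
  show "L t = dmap p q f t" if "t : tn p" for t
   by (rule linear_on_eq[OF _ dmap_linear _ that]) (use L dmap_pure[OF f] in auto)
 qed
qed

abbreviation "F \<equiv> F_mor scale \<omega> e"

lemma F_sum:
 assumes "x : hom_brauer p q"
 shows "F p q x t = (\<Sum>f\<in>brauer p q. fscale (x f) (dmap p q f t))"
proof -
 have s: "supp x \<subseteq> brauer p q" using assms by (auto simp: hom_brauer_def free_on_def)
 have "F p q x t = (\<Sum>f\<in>supp x. fscale (x f) (dmap p q f t))"
  unfolding F_mor_def by (intro sum.cong refl) (use s diagram_map_eq in auto)
 also have "... = (\<Sum>f\<in>brauer p q. fscale (x f) (dmap p q f t))"
  by (rule sum.mono_neutral_left[OF finite_brauer s]) (auto simp: supp_def fscale_zero_left)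
 finally show ?thesis .
qed

lemma F_delta: "f : brauer p q ==> F p q (delta f) t = dmap p q f t"
 by (simp add: F_mor_def supp_delta delta_apply diagram_map_eq fscale_one)

lemma F_tensor: "x : hom_brauer p q ==> t : tn p ==> F p q x t : tn q"
 unfolding F_sum by (intro tensor_sum tensor_scale dmap_tensor)

lemma F_add_right:
 assumes "x : hom_brauer p q" "s : tn p" "t : tn p"
 shows "F p q x (s + t) = F p q x s + F p q x t"
 using dmap_linear[of p q] assms(2,3) unfolding F_sum[OF assms(1)] linear_on_def
 by (simp add: fscale_add_right sum.distrib)

lemma F_scale_right:
 assumes "x : hom_brauer p q" "t : tn p"
 shows "F p q x (fscale c t) = fscale c (F p q x t)"
proof -
 have "dmap p q f (fscale c t) = fscale c (dmap p q f t)" for f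
  using dmap_linear[of p q f] assms(2) unfolding linear_on_def by blast
 then show ?thesis
  unfolding F_sum[OF assms(1)] fscale_sum_right by (simp only: fscale_fscale mult.commute)
qed

lemma F_add_left:
 assumes "x : hom_brauer p q" "y : hom_brauer p q"
 shows "F p q (x + y) t = F p q x t + F p q y t"
proof -
 have "x + y : hom_brauer p q" using assms free_on_add by (auto simp: hom_brauer_def)
 then show ?thesis by (simp add: F_sum assms fscale_add sum.distrib)
qed

lemma F_scale_left:
 assumes "x : hom_brauer p q"
 shows "F p q (fscale c x) t = fscale c (F p q x t)"
proof -
 have "fscale c x : hom_brauer p q" using assms free_on_fscale by (auto simp: hom_brauer_def)
 then show ?thesis by (simp only: F_sum assms fscale_apply fscale_fscale[symmetric] fscale_sum_right)
qed

text \<open>The coordinates of the intermediate tensor are its values at \<open>U\<close>, and they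
  multiply the brackets of \<open>f\<close> at \<open>b\<close>; the sum over words of length
  \<open>q\<close> is exactly the contraction in \<open>bracket_dcomp\<close>.\<close>

lemma dmap_dcomp:
 assumes f: "f : brauer q r" and g: "g : brauer p q" and t: "t : tn p"
 shows "dmap q r f (dmap p q g t) = fscale ((e * of_nat n) ^ loops f g) (dmap p r (dcomp f g) t)"
proof (rule tensor_eqI[of _ r])
 note fg = dcomp_brauer[OF f g]
 show "dmap q r f (dmap p q g t) : tn r" by (intro dmap_tensor f g t)
 show "fscale ((e * of_nat n) ^ loops f g) (dmap p r (dcomp f g) t) : tn r"
  by (intro tensor_scale dmap_tensor fg t)
 fix l
 have "ev r (dmap q r f (dmap p q g t)) l = (\<Sum>\<mu>\<in>PiE {..<q} (%_. {..<n}). \<Sum>kp\<in>PiE {..<p} (%_. {..<n}).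
   ev p t (U o kp) * (bracket e \<omega> q r f (b o \<mu>) l * bracket e \<omega> p q g (b o kp) (U o \<mu>)))"
  by (simp only: ev_dmap[OF f dmap_tensor[OF g t]] ev_dmap[OF g t] sum_distrib_right mult_ac) (simp only: sum_distrib_left mult_ac)
 also have "... = (\<Sum>kp\<in>PiE {..<p} (%_. {..<n}). ev p t (U o kp) *
   (\<Sum>\<mu>\<in>PiE {..<q} (%_. {..<n}). bracket e \<omega> q r f (b o \<mu>) l * bracket e \<omega> p q g (b o kp) (U o \<mu>)))"
  unfolding sum_distrib_left by (rule sum.swap)
 also have "... = (e * of_nat n) ^ loops f g * (\<Sum>kp\<in>PiE {..<p} (%_. {..<n}). ev p t (U o kp) * bracket e \<omega> p r (dcomp f g) (b o kp) l)"
  unfolding bracket_dcomp[OF f g contraction_form] by (simp add: sum_distrib_left mult_ac)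
 also have "... = ev r (fscale ((e * of_nat n) ^ loops f g) (dmap p r (dcomp f g) t)) l"
  by (simp only: ev_scale ev_dmap[OF fg t])
 finally show "ev r (dmap q r f (dmap p q g t)) l = ..." .
qed

lemma ev_F: "x : hom_brauer p q ==> ev q (F p q x t) l = (\<Sum>f\<in>brauer p q. x f * ev q (dmap p q f t) l)"
 by (simp add: F_sum ev_sum ev_scale)

lemma F_bcomp:
 assumes x: "x : hom_brauer q r" and y: "y : hom_brauer p q" and t: "t : tn p"
 shows "F p r (bcomp (e * of_nat n) x y) t = F q r x (F p q y t)"
proof (rule tensor_eqI[of _ r])
 note xy = bcomp_hom[OF x y, of "e * of_nat n"]
 show "F p r (bcomp (e * of_nat n) x y) t : tn r" by (rule F_tensor[OF xy t])
 show "F q r x (F p q y t) : tn r" by (intro F_tensor x y t)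
 fix l
 have "dmap q r f (F p q y t) = (\<Sum>g\<in>brauer p q. fscale (y g) (dmap q r f (dmap p q g t)))" if "f : brauer q r" for f
  unfolding F_sum[OF y] by (rule linear_on_sum[OF dmap_linear]) (rule dmap_tensor[OF _ t])
 then have "ev r (F q r x (F p q y t)) l =
   (\<Sum>f\<in>brauer q r. \<Sum>g\<in>brauer p q. x f * (y g * ev r (dmap q r f (dmap p q g t)) l))"
  by (simp add: ev_F[OF x] ev_sum ev_scale sum_distrib_left)
 also have "... = (\<Sum>f\<in>brauer q r. \<Sum>g\<in>brauer p q. x f * y g * ((e * of_nat n) ^ loops f g * ev r (dmap p r (dcomp f g) t) l))"
  by (intro sum.cong refl) (simp add: dmap_dcomp[OF _ _ t] ev_scale mult.assoc)
 also have "... = ev r (F p r (bcomp (e * of_nat n) x y) t) l"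
  by (simp only: ev_F[OF xy] sum_bcomp[OF x y])
 finally show "ev r (F p r (bcomp (e * of_nat n) x y) t) l = ev r (F q r x (F p q y t)) l" by simp
qed

lemma bracket_id: "bracket e \<omega> p p (pd p id) v l = (\<Prod>i<p. \<omega> (l i) (v i))"
proof -
 let ?d = "pd p id"
 note d = perm_diagram_brauer[OF permutes_id[of "{..<p}"]] and s = pair_strand[OF perm_upward[OF permutes_id[of "{..<p}"]]]
 have pr: "{Top k, Bot j} : ?d \<longleftrightarrow> k < p & j = k" for k j
  using s[of k j] strand_perm[OF permutes_id[of "{..<p}"], of k] by auto
 have tt: "{Top i, Top j} \<notin> ?d" "{Bot i, Bot j} \<notin> ?d" for i j
  using perm_upward[OF permutes_id[of "{..<p}"]] perm_downward[OF permutes_id[of "{..<p}"]]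
  by (auto simp: upward_def downward_def)
 have "crossings ?d = 0"
 proof -
  have "\<not> crosses ppos (mate ?d) x y" if "x : points p p" "y : points p p" for x y
   using that by (cases x; cases y) (auto simp: crosses_def mate_perm[OF permutes_id[of "{..<p}"]])
  then have "{(x, y) : points p p \<times> points p p. crosses ppos (mate ?d) x y} = {}" by blast
  then show ?thesis by (simp only: crossings_eq[OF d] card.empty)
 qed
 moreover have "{(k, j). k < p & j = k} = (%k. (k, k)) ` {..<p}" by auto
 then have "(\<Prod>(k, j)\<in>{(k, j). k < p & j = k}. \<omega> (l j) (v k)) = (\<Prod>k<p. \<omega> (l k) (v k))"
  by (simp add: prod.reindex inj_on_def)
 ultimately show ?thesis unfolding bracket_prod[OF d] by (simp add: pr tt)
qed

lemma F_bid:
 assumes t: "t : tn p"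
 shows "F p p (bid p) t = t"
proof (rule tensor_eqI[of _ p])
 note d = perm_diagram_brauer[OF permutes_id[of "{..<p}"]]
 show "F p p (bid p) t : tn p" by (rule F_tensor[OF bid_hom t])
 show "ev p (F p p (bid p) t) l = ev p t l" for l
  unfolding bid_def F_delta[OF d] ev_dmap[OF d t] bracket_id ev_expand[OF t, of l] by (simp add: mult.commute)
qed (rule t)

section \<open>The isometry group\<close>

abbreviation "G \<equiv> isometry_group scale \<omega>"

lemma isometryD:
 assumes "g : G"
 shows "g (x + y) = g x + g y" "g (scale c x) = scale c (g x)" "bij g" "\<omega> (g x) (g y) = \<omega> x y"
proof -
 have l: "Vector_Spaces.linear scale scale g" using assms by (simp add: isometry_group_def)
 show "g (x + y) = g x + g y" "g (scale c x) = scale c (g x)"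
  using l by (auto simp: Vector_Spaces.linear_iff)
 show "bij g" "\<omega> (g x) (g y) = \<omega> x y" using assms by (auto simp: isometry_group_def)
qed

lemma isometryI:
 assumes "!!x y. g (x + y) = g x + g y" "!!c x. g (scale c x) = scale c (g x)" "bij g" "!!x y. \<omega> (g x) (g y) = \<omega> x y"
 shows "g : G"
 using assms vector_space_axioms by (auto simp: isometry_group_def Vector_Spaces.linear_iff)

lemma isometry_inv:
 assumes "g : G"
 shows "iv g : G" "g (iv g x) = x" "iv g (g x) = x"
proof -
 note d = isometryD[OF assms]
 show gi: "g (iv g x) = x" for x using d(3) by (simp add: bij_is_surj surj_f_inv_f)
 show ig: "iv g (g x) = x" for x using d(3) by (simp add: bij_is_inj)
 show "iv g : G"
 proof (rule isometryI)
  show "iv g (x + y) = iv g x + iv g y" for x y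
   by (metis d(1) gi ig)
  show "iv g (scale c x) = scale c (iv g x)" for c x
   by (metis d(2) gi ig)
  show "bij (iv g)" using d(3) by (rule bij_imp_bij_inv)
  show "\<omega> (iv g x) (iv g y) = \<omega> x y" for x y by (metis d(4) gi)
 qed
qed

lemma dual_comp:
 assumes "g : G"
 shows "\<psi> o g : dual scale \<longleftrightarrow> \<psi> : dual scale"
proof
 assume "\<psi> : dual scale"
 then show "\<psi> o g : dual scale" using isometryD(1,2)[OF assms] by (simp add: dual_iff)
next
 assume d: "\<psi> o g : dual scale"
 have "\<psi> = (\<psi> o g) o iv g" by (rule ext) (simp add: isometry_inv(2)[OF assms])
 moreover have "(\<psi> o g) o iv g : dual scale"
  using d isometryD(1,2)[OF isometry_inv(1)[OF assms]] by (simp only: dual_iff o_apply) simp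
 ultimately show "\<psi> : dual scale" by simp
qed

lemma dual_map: "g : G ==> set (map (%\<psi>. \<psi> o g) \<psi>s) \<subseteq> dual scale \<longleftrightarrow> set \<psi>s \<subseteq> dual scale"
 by (simp add: subset_eq dual_comp)

lemma w_comp: "g : G ==> \<omega> u o g = \<omega> (iv g u)"
 by (rule ext) (metis comp_apply isometryD(4) isometry_inv(2))

lemma map_flats_act: "g : G ==> map (%\<psi>. \<psi> o g) (flats p l) = flats p (iv g o l)"
 by (simp add: flats_def w_comp)

text \<open>Acting on a tensor precomposes the functionals with \<open>g\<close>, which under
  \<omega> means applying the inverse isometry to the labels.\<close>

lemma ev_act: "g : G ==> ev p (tensor_act g t) l = ev p t (iv g o l)"
 by (simp only: ev_def tensor_act_def map_flats_act)

lemma act_tensor: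
 assumes g: "g : G" and t: "t : tn p"
 shows "tensor_act g t : tn p"
proof (rule tensorI)
 fix \<psi>s assume "\<not> (length \<psi>s = p & set \<psi>s \<subseteq> dual scale)"
 then have "\<not> (length (map (%\<psi>. \<psi> o g) \<psi>s) = p & set (map (%\<psi>. \<psi> o g) \<psi>s) \<subseteq> dual scale)"
  unfolding dual_map[OF g] length_map .
 then show "tensor_act g t \<psi>s = 0" unfolding tensor_act_def by (rule tensor_zero[OF t])
next
 note i = isometryD(1,2)[OF isometry_inv(1)[OF g]]
 show "mlin {..<p} (ev p (tensor_act g t))"
  unfolding mlin_def ev_act[OF g]
 proof (intro ballI allI)
  fix j l x y c assume "j : {..<p}"
  have u: "iv g o l(j := z) = (iv g o l)(j := iv g z)" for z by (rule fun_upd_comp)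
  show "ev p t (iv g o l(j := x + scale c y)) =
   ev p t (iv g o l(j := x)) + c * ev p t (iv g o l(j := y))"
   using tensor_mlin[OF t] \<open>j : {..<p}\<close> unfolding u i mlin_def by blast
 qed
qed

lemma act_add: "tensor_act g (s + t) = tensor_act g s + tensor_act g t" by (rule ext) (simp add: tensor_act_def)
lemma act_scale: "tensor_act g (fscale c t) = fscale c (tensor_act g t)" by (rule ext) (simp add: tensor_act_def)
lemma act_zero: "tensor_act g 0 = 0" by (rule ext) (simp add: tensor_act_def)

lemma act_id: "tensor_act id t = t" by (rule ext) (simp add: tensor_act_def)

lemma act_comp: "tensor_act (g o h) t = tensor_act g (tensor_act h t)"
 by (rule ext) (simp add: tensor_act_def o_def)

lemma act_pure:
 assumes g: "g : G"
 shows "tensor_act g (pure scale vs) = pure scale (map g vs)"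
proof
 fix \<psi>s
 show "tensor_act g (pure scale vs) \<psi>s = pure scale (map g vs) \<psi>s"
 proof (cases "length \<psi>s = length vs & set \<psi>s \<subseteq> dual scale")
  case True
  then show ?thesis using dual_map[OF g, of \<psi>s] by (simp add: tensor_act_def pure_def)
 next
  case False
  then have "\<not> (length (map (%\<psi>. \<psi> o g) \<psi>s) = length vs & set (map (%\<psi>. \<psi> o g) \<psi>s) \<subseteq> dual scale)"
   unfolding dual_map[OF g] length_map .
  then show ?thesis using False by (simp only: tensor_act_def pure_def if_False length_map)
 qed
qed

lemma bracket_isometry:
 assumes "g : G"
 shows "bracket e \<omega> p q f (g o v) (g o l) = bracket e \<omega> p q f v l"
proof -
 have "case_point (g o v) (g o l) = g o case_point v l" by (rule ext) (simp split: point.split)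
 moreover have "pair_weight \<omega> ppos (mate f) (g o h) = pair_weight \<omega> ppos (mate f) h" for h
  by (rule ext) (simp add: pair_weight_def isometryD(4)[OF assms])
 ultimately show ?thesis by (simp only: bracket_def mweight_def)
qed

lemma dmap_act:
 assumes g: "g : G" and f: "f : brauer p q" and t: "t : tn p"
 shows "dmap p q f (tensor_act g t) = tensor_act g (dmap p q f t)"
proof (rule linear_on_eq[OF _ _ _ t])
 have D: "dmap p q f (s + t) = dmap p q f s + dmap p q f t" "dmap p q f (fscale c t) = fscale c (dmap p q f t)"
  if "s : tn p" "t : tn p" for s t c
  using dmap_linear[of p q f] that unfolding linear_on_def by blast+
 show "linear_on (tn p) (%t. dmap p q f (tensor_act g t))"
  unfolding linear_on_def by (simp add: D act_add act_scale act_tensor[OF g])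
 show "linear_on (tn p) (%t. tensor_act g (dmap p q f t))"
  unfolding linear_on_def by (simp add: D act_add act_scale)
 fix vs :: "'v list" assume vs: "length vs = p"
 show "dmap p q f (tensor_act g (pure scale vs)) = tensor_act g (dmap p q f (pure scale vs))"
 proof (rule tensor_eqI[of _ q])
  show "dmap p q f (tensor_act g (pure scale vs)) : tn q" "tensor_act g (dmap p q f (pure scale vs)) : tn q"
   by (intro dmap_tensor act_tensor f g pure_tensor vs)+
  fix l
  have v: "vs = vlist p (%i. vs ! i)" "map g vs = vlist p (g o (%i. vs ! i))"
   using vs by (auto intro!: nth_equalityI)
  have "ev q (dmap p q f (tensor_act g (pure scale vs))) l = bracket e \<omega> p q f (g o (%i. vs ! i)) l"
   by (simp only: act_pure[OF g] v(2) dmap_pure[OF f vlist_simps(1)] ev_diagram_on_pure[OF f])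
  also have "... = bracket e \<omega> p q f (g o (%i. vs ! i)) (g o (iv g o l))"
   by (rule arg_cong[where f = "bracket e \<omega> p q f _"]) (auto simp: isometry_inv(2)[OF g])
  also have "... = bracket e \<omega> p q f (%i. vs ! i) (iv g o l)"
   by (rule bracket_isometry[OF g])
  also have "... = ev q (dmap p q f (pure scale vs)) (iv g o l)"
   unfolding dmap_pure[OF f vs] by (subst v(1)) (rule ev_diagram_on_pure[OF f, symmetric])
  finally show "ev q (dmap p q f (tensor_act g (pure scale vs))) l = ev q (tensor_act g (dmap p q f (pure scale vs))) l"
   by (simp only: ev_act[OF g])
 qed
qed

lemma act_sum: "tensor_act g (\<Sum>i\<in>A. T i) = (\<Sum>i\<in>A. tensor_act g (T i))"
 by (rule ext) (simp add: tensor_act_def sum_apply)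

lemma F_act:
 assumes g: "g : G" and x: "x : hom_brauer p q" and t: "t : tn p"
 shows "F p q x (tensor_act g t) = tensor_act g (F p q x t)"
 unfolding F_sum[OF x] act_sum by (intro sum.cong refl) (simp only: dmap_act[OF g _ t] act_scale)

end

section \<open>Positivity over the rationals\<close>

abbreviation words :: "'s set => nat => ('s => nat) set" where
 "words S n \<equiv> PiE S (%_. {..<n})"

lemma finite_words: "finite S ==> finite (words S n)" by (simp add: finite_PiE)

lemma words_upd: "w : words S n ==> i : S ==> m < n ==> w(i := m) : words S n"
 by (auto simp: PiE_def extensional_def)

lemma words_lt: "w : words S n ==> i : S ==> w i < n" by auto

text \<open>Each word with letter \<open>m\<close> at \<open>i\<close> is hit by the
  \<open>n\<close> words that differ from it at most there.\<close>

lemma sum_words_upd: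
 fixes h :: "('s => nat) => 'r::comm_ring_1"
 assumes "finite S" "i : S" "m < n"
 shows "(\<Sum>w\<in>words S n. h (w(i := m))) = of_nat n * (\<Sum>w\<in>words S n. of_bool (w i = m) * h w)"
proof -
 let ?T = "S - {i}"
 have S: "S = insert i ?T" using assms(2) by auto
 have T: "finite ?T" "i \<notin> ?T" using assms(1) by auto
 have "(\<Sum>w\<in>words S n. h (w(i := m))) = (\<Sum>kp\<in>words ?T n. \<Sum>c<n. h ((kp(i := c))(i := m)))"
  by (subst S, rule sum_PiE_insert) (use T in auto)
 also have "... = of_nat n * (\<Sum>kp\<in>words ?T n. h (kp(i := m)))"
  by (simp add: sum_distrib_left)
 also have "(\<Sum>kp\<in>words ?T n. h (kp(i := m))) = (\<Sum>kp\<in>words ?T n. \<Sum>c<n. of_bool ((kp(i := c)) i = m) * h (kp(i := c)))"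
 proof (intro sum.cong refl)
  fix kp
  have "(\<Sum>c<n. of_bool ((kp(i := c)) i = m) * h (kp(i := c))) = (\<Sum>c<n. h (kp(i := c)) * of_bool (c = m))"
   by (intro sum.cong refl) (simp add: mult.commute)
  also have "... = h (kp(i := m))" by (rule sum_of_bool_pick) (use assms(3) in auto)
  finally show "h (kp(i := m)) = (\<Sum>c<n. of_bool ((kp(i := c)) i = m) * h (kp(i := c)))" by simp
 qed
 also have "... = (\<Sum>w\<in>words S n. of_bool (w i = m) * h w)"
  by (subst (2) S, rule sum_PiE_insert[symmetric]) (use T in auto)
 finally show ?thesis .
qed

lemma sum_words_upd2:
 fixes h :: "('s => nat) => 'r::comm_ring_1"
 assumes S: "finite S" "i : S" "j : S" "i ~= j" and m: "m < n" "k < n"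
 shows "(\<Sum>w\<in>words S n. h (w(i := m, j := k))) =
  of_nat n * of_nat n * (\<Sum>w\<in>words S n. of_bool (w i = m & w j = k) * h w)"
proof -
 have "(\<Sum>w\<in>words S n. h (w(i := m, j := k))) = of_nat n * (\<Sum>w\<in>words S n. of_bool (w i = m) * h (w(j := k)))"
  by (rule sum_words_upd[OF S(1,2) m(1), of "%w. h (w(j := k))"])
 also have "(\<Sum>w\<in>words S n. of_bool (w i = m) * h (w(j := k))) =
   (\<Sum>w\<in>words S n. of_bool ((w(j := k)) i = m) * h (w(j := k)))"
  using S(4) by simp
 also have "... = of_nat n * (\<Sum>w\<in>words S n. of_bool (w j = k) * (of_bool (w i = m) * h w))"
  by (rule sum_words_upd[OF S(1,3) m(2), of "%w. of_bool (w i = m) * h w"])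
 also have "(\<Sum>w\<in>words S n. of_bool (w j = k) * (of_bool (w i = m) * h w)) = (\<Sum>w\<in>words S n. of_bool (w i = m & w j = k) * h w)"
  by (intro sum.cong refl) auto
 finally show ?thesis by (simp only: mult.assoc)
qed

text \<open>A combinatorial model of contraction: words are multi-indices, \<open>\<iota>\<close>
  says which basis vectors are paired, and \<open>s\<close> holds the signs left in the Gram matrix
  after rescaling.\<close>

locale rational_traces =
 fixes n p :: nat and \<iota> :: "nat => nat" and s :: "nat => rat" and er :: rat
 assumes \<iota>: "!!k. k < n ==> \<iota> k < n" and s: "!!k. k < n ==> s k * s k = 1" and er: "er * er = 1"
begin

abbreviation "W \<equiv> words {..<p} n"

text \<open>Contraction of two slots, kept as a function of full words that ignores the letters at
  \<open>i\<close> and \<open>j\<close>. This convention produces the factors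
  \<open>of_nat n\<close> in the adjunction below.\<close>

definition trq :: "nat => nat => ((nat => nat) => rat) => (nat => nat) => rat" where
 "trq i j x w = (\<Sum>m<n. s m * x (w(i := m, j := \<iota> m)))"

definition prs :: "(nat \<times> nat) set" where "prs = {(i, j). i < j & j < p}"

definition casq :: "((nat => nat) => rat) => (nat => nat) => rat" where
 "casq x w = er * (\<Sum>(i, j)\<in>prs. of_bool (w j = \<iota> (w i)) * (s (w i) * trq i j x w))"

lemma finite_prs: "finite prs"
 by (rule finite_subset[of _ "{..<p} \<times> {..<p}"]) (auto simp: prs_def)

lemma trq_upd: "i ~= j ==> trq i j x (w(i := m, j := k)) = trq i j x w"
 unfolding trq_def by (intro sum.cong refl arg_cong[where f = "%t. _ * x t"]) (auto simp: fun_upd_def)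

text \<open>Up to the factor \<open>of_nat n * of_nat n\<close>, inserting the invariant tensor is
  adjoint to contracting.\<close>

lemma trq_pairing:
 assumes ij: "i < j" "j < p"
 shows "(\<Sum>w\<in>W. trq i j y w * trq i j x w) =
  of_nat n * of_nat n * (\<Sum>w\<in>W. y w * (of_bool (w j = \<iota> (w i)) * (s (w i) * trq i j x w)))"
proof -
 have ij': "i ~= j" "i : {..<p}" "j : {..<p}" using ij by auto
 have "(\<Sum>w\<in>W. trq i j y w * trq i j x w) = (\<Sum>w\<in>W. \<Sum>m<n. s m * (y (w(i := m, j := \<iota> m)) * trq i j x (w(i := m, j := \<iota> m))))"
  unfolding trq_upd[OF ij'(1)] unfolding trq_def[of i j y] by (simp add: sum_distrib_right mult.assoc)
 also have "... = (\<Sum>m<n. s m * (\<Sum>w\<in>W. y (w(i := m, j := \<iota> m)) * trq i j x (w(i := m, j := \<iota> m))))"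
  by (subst sum.swap) (simp add: sum_distrib_left)
 also have "... = (\<Sum>m<n. s m * (of_nat n * of_nat n * (\<Sum>w\<in>W. of_bool (w i = m & w j = \<iota> m) * (y w * trq i j x w))))"
 proof (intro sum.cong refl)
  fix m assume "m : {..<n}"
  then have m: "m < n" by simp
  have "(\<Sum>w\<in>W. y (w(i := m, j := \<iota> m)) * trq i j x (w(i := m, j := \<iota> m))) =
    of_nat n * of_nat n * (\<Sum>w\<in>W. of_bool (w i = m & w j = \<iota> m) * (y w * trq i j x w))"
   by (rule sum_words_upd2[OF _ ij'(2,3,1) m \<iota>[OF m], of "%w. y w * trq i j x w"]) simp
  then show "s m * (\<Sum>w\<in>W. y (w(i := m, j := \<iota> m)) * trq i j x (w(i := m, j := \<iota> m))) =
    s m * (of_nat n * of_nat n * (\<Sum>w\<in>W. of_bool (w i = m & w j = \<iota> m) * (y w * trq i j x w)))" by simp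
 qed
 also have "... = of_nat n * of_nat n * (\<Sum>m<n. \<Sum>w\<in>W. (s m * (y w * trq i j x w)) * of_bool (w i = m & w j = \<iota> m))"
  unfolding sum_distrib_left by (intro sum.cong refl) (simp only: mult_ac)
 also have "(\<Sum>m<n. \<Sum>w\<in>W. (s m * (y w * trq i j x w)) * of_bool (w i = m & w j = \<iota> m)) =
   (\<Sum>w\<in>W. \<Sum>m<n. (s m * (y w * trq i j x w) * of_bool (w j = \<iota> m)) * of_bool (m = w i))"
 proof -
  have pt: "(s m * (y w * trq i j x w)) * of_bool (w i = m & w j = \<iota> m) =
    (s m * (y w * trq i j x w) * of_bool (w j = \<iota> m)) * of_bool (m = w i)" for w m
   by (cases "w i = m") auto
  show ?thesis unfolding pt by (rule sum.swap)
 qed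
 also have "... = (\<Sum>w\<in>W. y w * (of_bool (w j = \<iota> (w i)) * (s (w i) * trq i j x w)))"
 proof (intro sum.cong refl)
  fix w assume "w : W"
  then have "w i < n" by (rule words_lt[OF _ ij'(2)])
  then show "(\<Sum>m<n. (s m * (y w * trq i j x w) * of_bool (w j = \<iota> m)) * of_bool (m = w i)) =
    y w * (of_bool (w j = \<iota> (w i)) * (s (w i) * trq i j x w))"
   by (subst sum_of_bool_pick[OF finite_lessThan]) (simp, simp only: mult_ac)
 qed
 finally show ?thesis .
qed

text \<open>Shows that \<open>casq\<close> is symmetric and, up to the sign \<open>er\<close>,
  positive semidefinite.\<close>

lemma casq_pairing:
 "of_nat n * of_nat n * (\<Sum>w\<in>W. y w * casq x w) = er * (\<Sum>(i, j)\<in>prs. \<Sum>w\<in>W. trq i j y w * trq i j x w)"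
proof -
 have "(\<Sum>w\<in>W. y w * casq x w) = (\<Sum>w\<in>W. \<Sum>z\<in>prs. er * (y w * (of_bool (w (snd z) = \<iota> (w (fst z))) * (s (w (fst z)) * trq (fst z) (snd z) x w))))"
  by (simp add: casq_def case_prod_unfold sum_distrib_left mult.left_commute)
 also have "... = (\<Sum>z\<in>prs. er * (\<Sum>w\<in>W. y w * (of_bool (w (snd z) = \<iota> (w (fst z))) * (s (w (fst z)) * trq (fst z) (snd z) x w))))"
  by (subst sum.swap) (simp add: sum_distrib_left)
 finally have eq: "(\<Sum>w\<in>W. y w * casq x w) = (\<Sum>z\<in>prs. er *
   (\<Sum>w\<in>W. y w * (of_bool (w (snd z) = \<iota> (w (fst z))) * (s (w (fst z)) * trq (fst z) (snd z) x w))))" .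
 have "of_nat n * of_nat n * (\<Sum>w\<in>W. y w * casq x w) = (\<Sum>z\<in>prs. er * (of_nat n * of_nat n *
   (\<Sum>w\<in>W. y w * (of_bool (w (snd z) = \<iota> (w (fst z))) * (s (w (fst z)) * trq (fst z) (snd z) x w)))))"
  unfolding eq sum_distrib_left[of _ _ prs] by (intro sum.cong refl) (simp only: mult_ac)
 also have "... = (\<Sum>z\<in>prs. er * (\<Sum>w\<in>W. trq (fst z) (snd z) y w * trq (fst z) (snd z) x w))"
 proof (intro sum.cong refl)
  fix z assume "z : prs"
  then have "fst z < snd z" "snd z < p" by (auto simp: prs_def)
  from trq_pairing[OF this, of y x]
  show "er * (of_nat n * of_nat n * (\<Sum>w\<in>W. y w * (of_bool (w (snd z) = \<iota> (w (fst z))) * (s (w (fst z)) * trq (fst z) (snd z) x w)))) =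
   er * (\<Sum>w\<in>W. trq (fst z) (snd z) y w * trq (fst z) (snd z) x w)" by simp
 qed
 finally show ?thesis by (simp add: case_prod_unfold sum_distrib_left)
qed

text \<open>With \<open>y = x\<close> the pairing is a sum of squares of rationals, so all its terms
  vanish.\<close>

lemma casq_zero_trq:
 assumes z: "!!w. w : W ==> casq x w = 0" and ij: "i < j" "j < p" and w: "w : W"
 shows "trq i j x w = 0"
proof -
 have er0: "er ~= 0" using er by (metis mult_zero_left zero_neq_one)
 have "er * (\<Sum>(i, j)\<in>prs. \<Sum>w\<in>W. trq i j x w * trq i j x w) = 0"
  using casq_pairing[of x x] z by simp
 then have s0: "(\<Sum>z\<in>prs. \<Sum>w\<in>W. trq (fst z) (snd z) x w * trq (fst z) (snd z) x w) = 0"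
  using er0 by (simp only: mult_eq_0_iff case_prod_unfold simp_thms)
 have "(i, j) : prs" using ij by (simp add: prs_def)
 from sum_nonneg_0[OF finite_prs _ s0 this]
 have "(\<Sum>w\<in>W. trq i j x w * trq i j x w) = 0" by (simp add: sum_nonneg)
 then have "\<forall>w\<in>W. trq i j x w * trq i j x w = 0"
  by (subst (asm) sum_nonneg_eq_0_iff) (auto simp: finite_words)
 then show ?thesis using w by simp
qed

text \<open>A semidefinite symmetric operator has no nilpotent part: all contractions of
  \<open>casq x\<close> vanish, hence \<open>casq x\<close> is orthogonal to the image of
  \<open>casq\<close>, in particular to itself.\<close>

lemma casq_casq_zero:
 assumes z: "!!w. w : W ==> casq (casq x) w = 0" and w: "w : W"
 shows "casq x w = 0"
proof (cases "n = 0")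
 case True
 then have "p = 0" using w by (cases p) auto
 then show ?thesis unfolding casq_def prs_def by simp
next
 case False
 have "trq i j (casq x) w = 0" if "i < j" "j < p" "w : W" for i j w
  by (rule casq_zero_trq[OF z that])
 then have "(\<Sum>(i, j)\<in>prs. \<Sum>w\<in>W. trq i j (casq x) w * trq i j x w) = 0"
  by (intro sum.neutral) (auto simp: prs_def)
 then have "of_nat n * of_nat n * (\<Sum>w\<in>W. casq x w * casq x w) = 0"
  using casq_pairing[of "casq x" x] by simp
 then have "(\<Sum>w\<in>W. casq x w * casq x w) = 0" using False by simp
 then have "\<forall>w\<in>W. casq x w * casq x w = 0"
  by (subst (asm) sum_nonneg_eq_0_iff) (auto simp: finite_words)
 then show ?thesis using w by simp
qed

end

section \<open>The Casimir operator on words\<close>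

lemma sum_words_swap:
 fixes x :: "('s => nat) => rat"
 assumes S: "finite S" "i : S" "j : S" "i ~= j"
 shows "(\<Sum>w\<in>words S n. \<Sum>l<n. of_bool (w i = w j) * (x (w(i := l)) * x (w(j := l)))) =
  (\<Sum>w\<in>words S n. x w * x (w(i := w j, j := w i)))"
proof -
 let ?T = "S - {i, j}"
 have Sij: "S = insert j (insert i ?T)" using S by auto
 have T: "finite ?T" "i \<notin> ?T" "j \<notin> insert i ?T" "finite (insert i ?T)" using S by auto
 have split: "(\<Sum>w\<in>words S n. h w) = (\<Sum>kp\<in>words ?T n. \<Sum>a<n. \<Sum>c<n. h (kp(i := a, j := c)))"
  for h :: "('s => nat) => rat"
  by (subst Sij, subst sum_PiE_insert[OF finite_lessThan T(4,3)], subst sum_PiE_insert[OF finite_lessThan T(1,2)]) (rule refl)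
 have "(\<Sum>w\<in>words S n. \<Sum>l<n. of_bool (w i = w j) * (x (w(i := l)) * x (w(j := l)))) =
   (\<Sum>kp\<in>words ?T n. \<Sum>a<n. \<Sum>c<n. \<Sum>l<n. of_bool (a = c) * (x (kp(i := l, j := c)) * x (kp(i := a, j := l))))"
  unfolding split using S(4) by (simp add: fun_upd_twist)
 also have "... = (\<Sum>kp\<in>words ?T n. \<Sum>c<n. \<Sum>l<n. \<Sum>a<n. x (kp(i := l, j := c)) * x (kp(i := a, j := l)) * of_bool (a = c))"
  by (rule sum.cong[OF refl], subst sum_swap3, simp only: mult.commute)
 \<comment> \<open>The condition \<open>a = c\<close> removes one sum; the letters \<open>l\<close>,
   \<open>c\<close> then stand at \<open>i\<close>, \<open>j\<close> in the first factor and
   exchanged in the second.\<close>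
 also have "... = (\<Sum>kp\<in>words ?T n. \<Sum>c<n. \<Sum>l<n. x (kp(i := l, j := c)) * x (kp(i := c, j := l)))"
  by (intro sum.cong refl sum_of_bool_pick) auto
 also have "... = (\<Sum>kp\<in>words ?T n. \<Sum>l<n. \<Sum>c<n. x (kp(i := l, j := c)) * x (kp(i := c, j := l)))"
  by (rule sum.cong[OF refl]) (rule sum.swap)
 also have "... = (\<Sum>w\<in>words S n. x w * x (w(i := w j, j := w i)))"
  unfolding split using S(4) by (simp add: fun_upd_twist)
 finally show ?thesis .
qed

text \<open>The Casimir operator of \<open>gl\<^sub>n\<close>, written as a sum of squares of the operators replacing letters.\<close>

lemma casimir_squares:
 fixes x :: "('s => nat) => rat"
 assumes S: "finite S"
 shows "(\<Sum>w\<in>words S n. \<Sum>l<n. \<Sum>k<n. (\<Sum>i\<in>S. of_bool (w i = k) * x (w(i := l)))\<^sup>2) =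
  of_nat (card S) * of_nat n * (\<Sum>w\<in>words S n. x w * x w) +
  (\<Sum>i\<in>S. \<Sum>j\<in>S - {i}. \<Sum>w\<in>words S n. x w * x (w(i := w j, j := w i)))"
proof -
 let ?W = "words S n"
 let ?f = "%i j w l. of_bool (w i = w j) * (x (w(i := l)) * x (w(j := l)))"
 have "(\<Sum>k<n. (\<Sum>i\<in>S. of_bool (w i = k) * x (w(i := l)))\<^sup>2) = (\<Sum>i\<in>S. \<Sum>j\<in>S. ?f i j w l)"
  if w: "w : ?W" for w l
 proof -
  have "(\<Sum>k<n. (\<Sum>i\<in>S. of_bool (w i = k) * x (w(i := l)))\<^sup>2) =
    (\<Sum>k<n. \<Sum>i\<in>S. \<Sum>j\<in>S. (of_bool (w j = k) * (x (w(i := l)) * x (w(j := l)))) * of_bool (k = w i))"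
   unfolding power2_eq_square sum_product by (intro sum.cong refl) auto
  also have "... = (\<Sum>i\<in>S. \<Sum>j\<in>S. \<Sum>k<n. (of_bool (w j = k) * (x (w(i := l)) * x (w(j := l)))) * of_bool (k = w i))"
   by (rule sum_swap3)
  also have "... = (\<Sum>i\<in>S. \<Sum>j\<in>S. ?f i j w l)"
  proof (intro sum.cong refl)
   fix i j assume "i : S"
   then show "(\<Sum>k<n. (of_bool (w j = k) * (x (w(i := l)) * x (w(j := l)))) * of_bool (k = w i)) = ?f i j w l"
    using words_lt[OF w] by (subst sum_of_bool_pick) (auto simp: eq_commute)
  qed
  finally show ?thesis .
 qed
 then have "(\<Sum>w\<in>?W. \<Sum>l<n. \<Sum>k<n. (\<Sum>i\<in>S. of_bool (w i = k) * x (w(i := l)))\<^sup>2) =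
   (\<Sum>w\<in>?W. \<Sum>l<n. \<Sum>i\<in>S. \<Sum>j\<in>S. ?f i j w l)" by simp
 also have "... = (\<Sum>i\<in>S. \<Sum>j\<in>S. \<Sum>w\<in>?W. \<Sum>l<n. ?f i j w l)"
 proof -
  have "(\<Sum>w\<in>?W. \<Sum>l<n. \<Sum>i\<in>S. \<Sum>j\<in>S. ?f i j w l) = (\<Sum>w\<in>?W. \<Sum>i\<in>S. \<Sum>j\<in>S. \<Sum>l<n. ?f i j w l)"
   by (rule sum.cong[OF refl]) (rule sum_swap3)
  also have "... = (\<Sum>i\<in>S. \<Sum>j\<in>S. \<Sum>w\<in>?W. \<Sum>l<n. ?f i j w l)" by (rule sum_swap3)
  finally show ?thesis .
 qed
 also have "... = (\<Sum>i\<in>S. (\<Sum>w\<in>?W. \<Sum>l<n. ?f i i w l) + (\<Sum>j\<in>S - {i}. \<Sum>w\<in>?W. \<Sum>l<n. ?f i j w l))"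
  by (intro sum.cong refl sum.remove S)
 also have "... = (\<Sum>i\<in>S. of_nat n * (\<Sum>w\<in>?W. x w * x w) + (\<Sum>j\<in>S - {i}. \<Sum>w\<in>?W. x w * x (w(i := w j, j := w i))))"
 proof (rule sum.cong[OF refl])
  fix i assume i: "i : S"
  have "(\<Sum>w\<in>?W. \<Sum>l<n. ?f i i w l) = (\<Sum>l<n. \<Sum>w\<in>?W. x (w(i := l)) * x (w(i := l)))"
   by (subst sum.swap) simp
  also have "... = (\<Sum>l<n. of_nat n * (\<Sum>w\<in>?W. of_bool (w i = l) * (x w * x w)))"
   by (intro sum.cong refl) (rule sum_words_upd[OF S i, of _ n "%w. x w * x w"], simp)
  also have "... = of_nat n * (\<Sum>w\<in>?W. \<Sum>l<n. (x w * x w) * of_bool (l = w i))"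
   by (subst sum.swap) (simp add: sum_distrib_left mult_ac eq_commute)
  also have "(\<Sum>w\<in>?W. \<Sum>l<n. (x w * x w) * of_bool (l = w i)) = (\<Sum>w\<in>?W. x w * x w)"
   by (intro sum.cong refl sum_of_bool_pick) (use i words_lt in auto)
  finally have 1: "(\<Sum>w\<in>?W. \<Sum>l<n. ?f i i w l) = of_nat n * (\<Sum>w\<in>?W. x w * x w)" .
  have 2: "(\<Sum>w\<in>?W. \<Sum>l<n. ?f i j w l) = (\<Sum>w\<in>?W. x w * x (w(i := w j, j := w i)))" if "j : S - {i}" for j
   by (rule sum_words_swap[OF S i]) (use that in auto)
  show "(\<Sum>w\<in>?W. \<Sum>l<n. ?f i i w l) + (\<Sum>j\<in>S - {i}. \<Sum>w\<in>?W. \<Sum>l<n. ?f i j w l) =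
    of_nat n * (\<Sum>w\<in>?W. x w * x w) + (\<Sum>j\<in>S - {i}. \<Sum>w\<in>?W. x w * x (w(i := w j, j := w i)))"
   unfolding 1 by (rule arg_cong[where f = "%t. _ + t"], rule sum.cong[OF refl], rule 2)
 qed
 finally show ?thesis by (simp add: sum.distrib)
qed

text \<open>Summed against \<open>x\<close>, the hypothesis turns the transposition terms of
  \<open>casimir_squares\<close> into a multiple of the norm \<open>N\<close>, leaving
  \<open>Q = of_nat (card S) * er * N\<close>. For \<open>er = -1\<close> this contradicts
  \<open>Q \<ge> 0\<close> unless \<open>N = 0\<close>. For \<open>er = 1\<close> part of the
  squares already amounts to at least twice that value, because each letter of a word in the support
  is repeated.\<close>

lemma casimir_zero:
 fixes x :: "('s => nat) => rat"
 assumes S: "finite S" "S ~= {}" and er: "er = 1 | er = -1"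
  and cas: "!!i w. i : S ==> w : words S n ==> (of_nat n - er) * x w + (\<Sum>j\<in>S - {i}. x (w(i := w j, j := w i))) = 0"
  and mult: "!!w i. er = 1 ==> w : words S n ==> x w ~= 0 ==> i : S ==> \<exists>j\<in>S. j ~= i & w j = w i"
  and w: "w : words S n"
 shows "x w = 0"
proof -
 let ?W = "words S n"
 let ?m = "of_nat (card S) :: rat"
 define N where "N = (\<Sum>w\<in>?W. x w * x w)"
 define Q where "Q = (\<Sum>w\<in>?W. \<Sum>l<n. \<Sum>k<n. (\<Sum>i\<in>S. of_bool (w i = k) * x (w(i := l)))\<^sup>2)"
 have N0: "N \<ge> 0" unfolding N_def by (intro sum_nonneg) simp
 have m0: "?m > 0" using S by (simp add: card_gt_0_iff)
 have "(\<Sum>i\<in>S. \<Sum>j\<in>S - {i}. \<Sum>w\<in>?W. x w * x (w(i := w j, j := w i))) = (\<Sum>i\<in>S. - (of_nat n - er) * N)"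
 proof (intro sum.cong refl)
  fix i assume i: "i : S"
  have "(\<Sum>j\<in>S - {i}. \<Sum>w\<in>?W. x w * x (w(i := w j, j := w i))) = (\<Sum>w\<in>?W. x w * (\<Sum>j\<in>S - {i}. x (w(i := w j, j := w i))))"
   by (subst sum.swap) (simp add: sum_distrib_left)
  also have "... = (\<Sum>w\<in>?W. x w * (- (of_nat n - er) * x w))"
  proof (intro sum.cong refl)
   fix w assume "w : ?W"
   from minus_unique[OF cas[OF i this], symmetric]
   have "(\<Sum>j\<in>S - {i}. x (w(i := w j, j := w i))) = - (of_nat n - er) * x w" by (simp only: mult_minus_left)
   then show "x w * (\<Sum>j\<in>S - {i}. x (w(i := w j, j := w i))) = x w * (- (of_nat n - er) * x w)" by simp
  qed
  also have "... = - (of_nat n - er) * N" unfolding N_def sum_distrib_left by (intro sum.cong refl) (simp add: mult_ac)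
  finally show "(\<Sum>j\<in>S - {i}. \<Sum>w\<in>?W. x w * x (w(i := w j, j := w i))) = - (of_nat n - er) * N" .
 qed
 then have Q: "Q = ?m * er * N"
  unfolding Q_def casimir_squares[OF S(1)] N_def[symmetric] by (simp add: algebra_simps)
 have "N = 0"
 proof (cases "er = -1")
  case True
  have "Q \<ge> 0" unfolding Q_def by (intro sum_nonneg) simp
  then have "?m * N <= 0" using Q True by simp
  then show ?thesis using N0 m0 by (metis leD linorder_neqE_linordered_idom mult_pos_pos)
 next
  case False
  then have e1: "er = 1" using er by simp
  have "(\<Sum>w\<in>?W. 2 * ?m * (x w * x w)) <= Q"
   unfolding Q_def
  proof (rule sum_mono)
   fix w assume w: "w : ?W"
   let ?c = "%k. (\<Sum>i\<in>S. of_bool (w i = k) :: rat)"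
   \<comment> \<open>Only the squares with \<open>k = l\<close> are kept; replacing a letter by
     itself leaves the word unchanged.\<close>
   have "(\<Sum>l<n. (\<Sum>i\<in>S. of_bool (w i = l) * x (w(i := l)))\<^sup>2) <=
     (\<Sum>l<n. \<Sum>k<n. (\<Sum>i\<in>S. of_bool (w i = k) * x (w(i := l)))\<^sup>2)"
    by (intro sum_mono member_le_sum) auto
   moreover have cx: "(\<Sum>i\<in>S. of_bool (w i = l) * x (w(i := l))) = ?c l * x w" for l
    unfolding sum_distrib_right by (intro sum.cong refl) auto
   have "(\<Sum>l<n. (\<Sum>i\<in>S. of_bool (w i = l) * x (w(i := l)))\<^sup>2) = (\<Sum>l<n. (?c l)\<^sup>2) * (x w * x w)"
    unfolding cx power_mult_distrib power2_eq_square[of "x w"] by (rule sum_distrib_right[symmetric])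
   ultimately have le: "(\<Sum>l<n. (?c l)\<^sup>2) * (x w * x w) <= (\<Sum>l<n. \<Sum>k<n. (\<Sum>i\<in>S. of_bool (w i = k) * x (w(i := l)))\<^sup>2)"
    by (simp only:)
   show "2 * ?m * (x w * x w) <= (\<Sum>l<n. \<Sum>k<n. (\<Sum>i\<in>S. of_bool (w i = k) * x (w(i := l)))\<^sup>2)"
   proof (cases "x w = 0")
    case True
    then show ?thesis by (simp add: sum_nonneg)
   next
    case False
    \<comment> \<open>Squared multiplicities add up to the sum, over the positions, of the
      multiplicity of the letter there, and each of these is at least 2.\<close>
    have "(\<Sum>l<n. (?c l)\<^sup>2) = (\<Sum>l<n. \<Sum>i\<in>S. ?c l * of_bool (w i = l))"
     unfolding power2_eq_square by (simp only: sum_distrib_left)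
    also have "... = (\<Sum>i\<in>S. \<Sum>l<n. ?c l * of_bool (w i = l))" by (rule sum.swap)
    also have "... = (\<Sum>i\<in>S. ?c (w i))"
    proof (intro sum.cong refl)
     fix i assume "i : S"
     have "(\<Sum>l<n. ?c l * of_bool (w i = l)) = (\<Sum>l<n. ?c l * of_bool (l = w i))"
      by (intro sum.cong refl) auto
     also have "... = ?c (w i)" by (rule sum_of_bool_pick) (use words_lt[OF w \<open>i : S\<close>] in auto)
     finally show "(\<Sum>l<n. ?c l * of_bool (w i = l)) = ?c (w i)" .
    qed
    also have "... \<ge> (\<Sum>i\<in>S. 2)"
    proof (rule sum_mono)
     fix i assume i: "i : S"
     obtain j where j: "j : S" "j ~= i" "w j = w i" using mult[OF e1 w False i] by blast
     have "(\<Sum>k\<in>{i, j}. of_bool (w k = w i) :: rat) <= ?c (w i)"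
      by (rule sum_mono2) (use S i j in auto)
     then show "2 <= ?c (w i)" using j by simp
    qed
    finally have "2 * ?m <= (\<Sum>l<n. (?c l)\<^sup>2)" by (simp add: mult.commute)
    then show ?thesis using le mult_right_mono[of "2 * ?m" "\<Sum>l<n. (?c l)\<^sup>2" "x w * x w"] by simp
   qed
  qed
  then have "2 * ?m * N <= ?m * N" using Q e1 by (simp add: N_def sum_distrib_left)
  then have "?m * N <= 0" by (simp add: mult.commute)
  then show ?thesis using N0 m0 by (metis leD linorder_neqE_linordered_idom mult_pos_pos)
 qed
 then have "\<forall>w\<in>?W. x w * x w = 0"
  unfolding N_def by (subst (asm) sum_nonneg_eq_0_iff) (auto simp: finite_words S(1))
 then show ?thesis using w by simp
qed

text \<open>Rational linear functionals on the field separate points; applied to coordinates they transfer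
 statements about rational matrices from the rationals to the field.\<close>

lemma rational_functional:
 fixes y :: "'k::field_char_0"
 assumes "y ~= 0"
 obtains \<phi> :: "'k => rat" where "!!u v. \<phi> (u + v) = \<phi> u + \<phi> v" "!!q u. \<phi> (of_rat q * u) = q * \<phi> u" "\<phi> y ~= 0"
proof -
 interpret K: vector_space "%(q::rat) (u::'k). of_rat q * u"
  by unfold_locales (simp_all add: algebra_simps of_rat_add of_rat_mult)
 interpret Q: vector_space "(*) :: rat => rat => rat"
  by unfold_locales (simp_all add: algebra_simps)
 interpret KQ: vector_space_pair "%(q::rat) (u::'k). of_rat q * u" "(*) :: rat => rat => rat" ..
 have "K.independent {y}" using assms by (simp add: K.independent_insert)
 from KQ.linear_independent_extend[OF this, of "%_. 1"]
 obtain g where g: "Vector_Spaces.linear (%(q::rat) (u::'k). of_rat q * u) (*) g" "g y = 1" by blast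
 then have "g (u + v) = g u + g v" "g (of_rat q * u) = q * g u" for u v q
  by (simp_all add: Vector_Spaces.linear_iff)
 then show ?thesis using that[of g] g(2) by simp
qed

section \<open>Invariant multilinear forms\<close>

text \<open>Two polynomials in \<open>t\<close> agree off the finitely many zeros of
  \<open>1 + t * t * D\<close>, hence everywhere since the field is infinite. They differ by the
  sign of \<open>t\<close>, so the linear coefficient of their difference is twice the claimed
  sum.\<close>

lemma poly_coeff_zero:
 fixes c :: "'r set => 'k::field_char_0"
 assumes fin: "finite S" and D: "!!t. 1 + t * t * D ~= 0 ==>
   (\<Sum>R\<in>Pow S. t ^ card R * c R) = (\<Sum>R\<in>Pow S. (- t) ^ card R * c R)"
 shows "(\<Sum>j\<in>S. c {j}) = 0"
proof -
 define Q where "Q = (\<Sum>R\<in>Pow S. monom (c R) (card R) - monom ((-1) ^ card R * c R) (card R))"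
 have pQ: "poly Q t = (\<Sum>R\<in>Pow S. t ^ card R * c R) - (\<Sum>R\<in>Pow S. (- t) ^ card R * c R)" for t
  by (simp add: Q_def poly_sum poly_monom sum_subtractf power_minus[of t] mult_ac)
 have "poly [:1, 0, D:] t ~= 0 ==> poly Q t = 0" for t
  using D[of t] by (simp add: pQ mult_ac)
 then have sub: "UNIV \<subseteq> {t. poly [:1, 0, D:] t = 0} \<union> {t. poly Q t = 0}" by blast
 have "Q = 0"
 proof (rule ccontr)
  assume "Q ~= 0"
  then have "finite {t. poly Q t = 0}" by (rule poly_roots_finite)
  moreover have "finite {t. poly [:1, 0, D:] t = 0}" by (rule poly_roots_finite) simp
  ultimately have "finite (UNIV :: 'k set)" using sub by (meson finite_UnI finite_subset)
  then show False using infinite_UNIV_char_0 by blast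
 qed
 then have "0 = coeff Q 1" by simp
 also have "... = (\<Sum>R\<in>Pow S. if card R = 1 then 2 * c R else 0)"
  unfolding Q_def coeff_sum by (intro sum.cong refl) simp
 also have "... = (\<Sum>R\<in>{R : Pow S. card R = 1}. 2 * c R)"
  by (rule sum.inter_filter[symmetric]) (simp add: fin)
 also have "{R : Pow S. card R = 1} = (%j. {j}) ` S"
  by (auto simp: card_1_singleton_iff)
 also have "(\<Sum>R\<in>(%j. {j}) ` S. 2 * c R) = 2 * (\<Sum>j\<in>S. c {j})"
  by (simp add: sum.reindex sum_distrib_left)
 finally show ?thesis by simp
qed

context mono_basis
begin

definition supported :: "'s set => (('s => 'v) => 'k) => bool" where
 "supported S \<Theta> \<longleftrightarrow> (\<forall>l l'. (\<forall>i\<in>S. l i = l' i) --> \<Theta> l = \<Theta> l')"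

lemma supportedD: "supported S \<Theta> ==> (!!i. i : S ==> l i = l' i) ==> \<Theta> l = \<Theta> l'"
 unfolding supported_def by blast

definition invariant :: "(('s => 'v) => 'k) => bool" where
 "invariant \<Theta> \<longleftrightarrow> (\<forall>g\<in>G. \<forall>l. \<Theta> (g o l) = \<Theta> l)"

text \<open>Contraction by a pair of dual bases. The result remains a function of all labels,
  although those at \<open>i\<close> and \<open>j\<close> are overwritten.\<close>

definition con :: "'s => 's => (('s => 'v) => 'k) => ('s => 'v) => 'k" where
 "con i j \<Theta> l = (\<Sum>k<n. \<Theta> (l(i := b k, j := U k)))"

lemma mlinD: "mlin S F' ==> i : S ==> F' (l(i := x + scale c y)) = F' (l(i := x)) + c * F' (l(i := y))"
 unfolding mlin_def by blast

lemma mlin_mono: "mlin S F' ==> T \<subseteq> S ==> mlin T F'" unfolding mlin_def by blast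

lemma mlin_zero:
 assumes "mlin S F'" "i : S"
 shows "F' (l(i := 0)) = 0"
 using mlinD[OF assms, of l 0 "-1" 0] by simp

lemma mlin_scale:
 assumes "mlin S F'" "i : S"
 shows "F' (l(i := scale c y)) = c * F' (l(i := y))"
 using mlinD[OF assms, of l 0 c y] mlin_zero[OF assms, of l] by simp

lemma mlin_diff:
 assumes "mlin S F'" "i : S"
 shows "F' (l(i := x - scale c y)) = F' (l(i := x)) - c * F' (l(i := y))"
 using mlinD[OF assms, of l x "- c" y] by (simp add: scale_minus_left)

lemma mlin_binomial:
 "finite S ==> mlin S F' ==> F' (%i. if i : S then l i + scale t (h i) else l i) =
   (\<Sum>R\<in>Pow S. t ^ card R * F' (%i. if i : R then h i else l i))"
proof (induction S arbitrary: l rule: finite_induct)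
 case (insert x S)
 have ml: "mlin S F'" using insert.prems by (rule mlin_mono) auto
 let ?L = "%l. F' (%i. if i : S then l i + scale t (h i) else l i)"
 have e1: "(%i. if i : insert x S then l i + scale t (h i) else l i) =
   (%i. if i : S then l i + scale t (h i) else l i)(x := l x + scale t (h x))"
  using insert.hyps by auto
 have e2: "(%i. if i : S then l i + scale t (h i) else l i)(x := l x) = (%i. if i : S then l i + scale t (h i) else l i)"
  using insert.hyps by auto
 have e3: "(%i. if i : S then l i + scale t (h i) else l i)(x := h x) =
   (%i. if i : S then (l(x := h x)) i + scale t (h i) else (l(x := h x)) i)"
  using insert.hyps by auto
 have "F' (%i. if i : insert x S then l i + scale t (h i) else l i) = ?L l + t * ?L (l(x := h x))"
  unfolding e1 mlinD[OF insert.prems insertI1] e2 e3 ..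
 also have "... = (\<Sum>R\<in>Pow S. t ^ card R * F' (%i. if i : R then h i else l i)) +
   t * (\<Sum>R\<in>Pow S. t ^ card R * F' (%i. if i : R then h i else (l(x := h x)) i))"
  by (simp only: insert.IH[OF ml])
 also have "t * (\<Sum>R\<in>Pow S. t ^ card R * F' (%i. if i : R then h i else (l(x := h x)) i)) =
   (\<Sum>R\<in>Pow S. t ^ card (insert x R) * F' (%i. if i : insert x R then h i else l i))"
  unfolding sum_distrib_left
 proof (intro sum.cong refl)
  fix R assume R: "R : Pow S"
  then have "x \<notin> R" "finite R" using insert.hyps finite_subset by auto
  moreover have "(%i. if i : R then h i else (l(x := h x)) i) = (%i. if i : insert x R then h i else l i)" by auto
  ultimately show "t * (t ^ card R * F' (%i. if i : R then h i else (l(x := h x)) i)) =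
   t ^ card (insert x R) * F' (%i. if i : insert x R then h i else l i)" by (simp add: mult.assoc)
 qed
 also have "... = (\<Sum>R\<in>insert x ` Pow S. t ^ card R * F' (%i. if i : R then h i else l i))"
 proof (subst sum.reindex)
  show "inj_on (insert x) (Pow S)" using insert.hyps by (auto simp: inj_on_def)
 qed simp
 also have "(\<Sum>R\<in>Pow S. t ^ card R * F' (%i. if i : R then h i else l i)) +
   (\<Sum>R\<in>insert x ` Pow S. t ^ card R * F' (%i. if i : R then h i else l i)) =
   (\<Sum>R\<in>Pow (insert x S). t ^ card R * F' (%i. if i : R then h i else l i))"
  unfolding Pow_insert by (rule sum.union_disjoint[symmetric]) (use insert.hyps in auto)
 finally show ?case .
qed simp

section \<open>Skew maps, Cayley transforms and infinitesimal invariance\<close>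

definition skew :: "'v => 'v => 'v => 'v" where
 "skew u v y = scale (\<omega> y u) v - scale (e * \<omega> y v) u"

text \<open>On the span of \<open>u\<close> and \<open>v\<close>, which contains the image of
  \<open>skew u v\<close>, the square of \<open>skew u v\<close> is the scalar
  \<open>- disc u v\<close>. This yields the cubic relation below.\<close>

definition disc :: "'v => 'v => 'k" where
 "disc u v = e * (\<omega> u u * \<omega> v v) - \<omega> u v * \<omega> u v"

lemma skew_linear: "skew u v (x + y) = skew u v x + skew u v y" "skew u v (scale c x) = scale c (skew u v x)"
 "skew u v (x - y) = skew u v x - skew u v y"
 by (simp_all add: skew_def scale_left_distrib scale_right_diff_distrib scale_left_diff_distrib algebra_simps)

lemma skew_skew: "\<omega> (skew u v y) z = - \<omega> y (skew u v z)"
proof -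
 have "\<omega> z u = e * \<omega> u z" "\<omega> z v = e * \<omega> v z" by (rule sym_e)+
 then show ?thesis using ee by (simp add: skew_def algebra_simps)
qed

lemma skew_cube: "skew u v (skew u v (skew u v y)) = scale (- disc u v) (skew u v y)"
proof -
 have vu: "\<omega> v u = e * \<omega> u v" by (rule sym_e)
 have Xu: "skew u v u = scale (\<omega> u u) v - scale (e * \<omega> u v) u" by (simp add: skew_def)
 have Xv: "skew u v v = scale (e * \<omega> u v) v - scale (e * \<omega> v v) u" by (simp add: skew_def vu)
 have e2: "e * (e * t) = t" for t using ee by (metis mult.assoc mult_1)
 have XXu: "skew u v (skew u v u) = scale (- disc u v) u"
  unfolding Xu skew_linear Xv Xu
  by (simp add: disc_def scale_right_diff_distrib scale_left_diff_distrib algebra_simps e2)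
 have XXv: "skew u v (skew u v v) = scale (- disc u v) v"
  unfolding Xv skew_linear Xv Xu
  by (simp add: disc_def scale_right_diff_distrib scale_left_diff_distrib algebra_simps e2)
 have Xy: "skew u v y = scale (\<omega> y u) v - scale (e * \<omega> y v) u" by (rule skew_def)
 show ?thesis
  unfolding Xy skew_linear XXu XXv
  by (simp add: scale_right_diff_distrib mult.commute)
qed

text \<open>The Cayley transform of \<open>t\<close> times the skew map \<open>skew u v\<close>, which maps
 \<open>y - t skew u v y\<close> to \<open>y + t skew u v y\<close>.\<close>

definition cayley :: "'v => 'v => 'k => 'v => 'v" where
 "cayley u v t y = y + scale (2 * t / (1 + t * t * disc u v)) (skew u v y) +
   scale (2 * t * t / (1 + t * t * disc u v)) (skew u v (skew u v y))"

text \<open>Write \<open>X\<close> for \<open>skew u v\<close>. By the cubic relation the inverse of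
  \<open>1 - t X\<close> is a quadratic polynomial in \<open>X\<close>, which explains the
  coefficients and the denominator of \<open>cayley\<close>.\<close>

lemma cayley_maps:
 assumes "1 + t * t * disc u v ~= 0"
 shows "cayley u v t (z - scale t (skew u v z)) = z + scale t (skew u v z)"
proof -
 let ?k = "1 + t * t * disc u v" and ?X = "skew u v"
 define A C where "A = 2 * t / ?k" and "C = 2 * t * t / ?k"
 have AC: "C = t * A" by (simp add: A_def C_def mult_ac)
 have A: "A * ?k = 2 * t" using assms by (simp add: A_def)
 have "cayley u v t (z - scale t (?X z)) = z - scale t (?X z) + scale A (?X z - scale t (?X (?X z))) +
   scale C (?X (?X z) - scale t (?X (?X (?X z))))"
  by (simp only: cayley_def A_def[symmetric] C_def[symmetric] skew_linear)
 also have "... = z - scale t (?X z) + scale A (?X z) + scale (C * t * disc u v) (?X z)"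
  by (simp add: skew_cube AC scale_right_diff_distrib algebra_simps)
 also have "... = z + scale (A * ?k - t) (?X z)"
  by (simp add: AC scale_left_distrib scale_left_diff_distrib algebra_simps)
 finally show ?thesis by (simp add: A)
qed

lemma cayley_isometry:
 assumes k: "1 + t * t * disc u v ~= 0"
 shows "cayley u v t : G"
proof (rule isometryI)
 let ?k = "1 + t * t * disc u v" and ?X = "skew u v" and ?g = "cayley u v t"
 define A C where "A = 2 * t / ?k" and "C = 2 * t * t / ?k"
 have g: "?g y = y + scale A (?X y) + scale C (?X (?X y))" for y
  by (simp only: cayley_def A_def C_def)
 show "?g (x + y) = ?g x + ?g y" for x y
  by (simp add: g skew_linear scale_right_distrib algebra_simps)
 show "?g (scale c x) = scale c (?g x)" for c x
  by (simp add: g skew_linear scale_right_distrib mult_ac)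
 show iso: "\<omega> (?g x) (?g y) = \<omega> x y" for x y
 proof -
  have s1: "\<omega> x (?X y) = - \<omega> (?X x) y" by (simp add: skew_skew)
  have s2: "\<omega> (?X (?X x)) y = - \<omega> (?X x) (?X y)" by (rule skew_skew)
  have s3: "\<omega> x (?X (?X y)) = - \<omega> (?X x) (?X y)" by (simp add: skew_skew)
  have s4: "\<omega> (?X (?X x)) (?X y) = - \<omega> (?X x) (?X (?X y))" by (rule skew_skew)
  have s5: "\<omega> (?X (?X x)) (?X (?X y)) = disc u v * \<omega> (?X x) (?X y)"
  proof -
   have "\<omega> (?X (?X x)) (?X (?X y)) = - \<omega> (?X (?X (?X x))) (?X y)" by (simp add: skew_skew)
   then show ?thesis by (simp add: skew_cube)
  qed
  \<comment> \<open>By skewness and the cubic relation all correction terms are multiples of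
    \<open>\<omega> (?X x) (?X y)\<close>; this is their total coefficient.\<close>
  have coeff: "A * A - 2 * C + C * C * disc u v = 0"
  proof -
   have "C = t * A" by (simp add: A_def C_def mult_ac)
   then have "A * A - 2 * C + C * C * disc u v = A * (A * ?k - 2 * t)" by (simp add: algebra_simps)
   moreover have "A * ?k = 2 * t" using k by (simp add: A_def)
   ultimately show ?thesis by simp
  qed
  have "\<omega> (?g x) (?g y) = \<omega> x y + (A * A - 2 * C + C * C * disc u v) * \<omega> (?X x) (?X y)"
   unfolding g w_add_left w_add_right w_scale_left w_scale_right s5 s4 s3 s2 s1
   by (simp add: algebra_simps)
  then show ?thesis by (simp add: coeff)
 qed
 show "bij ?g"
 proof (rule bijI)
  show "inj ?g"
  proof (rule injI)
   fix x y assume eq: "?g x = ?g y"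
   have "\<omega> (x - y) z = 0" for z
    using iso[of x z] iso[of y z] eq by simp
   then show "x = y" using nondeg[of "x - y"] by simp
  qed
  have "\<exists>z. ?g z = y" for y
  proof -
   define B where "B = t / ?k"
   \<comment> \<open>The solution of \<open>z + scale t (?X z) = y\<close>, again from the inverse
     of \<open>1 + t X\<close> as a quadratic polynomial in \<open>X\<close>.\<close>
   define z where "z = y - scale B (?X y) + scale (t * B) (?X (?X y))"
   have tk: "B * ?k = t" using k by (simp add: B_def)
   have "z + scale t (?X z) = y + scale (t - B - t * t * B * disc u v) (?X y)"
    by (simp add: z_def skew_linear skew_cube scale_right_distrib scale_right_diff_distrib
      scale_left_distrib scale_left_diff_distrib algebra_simps)
   also have "t - B - t * t * B * disc u v = t - B * ?k" by (simp add: algebra_simps)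
   also have "... = 0" by (simp only: tk diff_self)
   finally have "y = z + scale t (?X z)" by simp
   then show ?thesis using cayley_maps[OF k, of z] by metis
  qed
  then show "surj ?g" by (metis surjI)
 qed
qed

text \<open>Differentiation without limits: an isometry carries the labels \<open>y - t X y\<close>
  to \<open>y + t X y\<close>, so the values of \<Theta> there, expanded as polynomials in
  \<open>t\<close>, agree and their linear coefficients can be compared.\<close>

lemma infinitesimal:
 assumes S: "finite S" and ml: "mlin S \<Theta>" and sup: "supported S \<Theta>" and inv: "invariant \<Theta>"
 shows "(\<Sum>j\<in>S. \<Theta> (l(j := skew u v (l j)))) = 0"
proof -
 let ?X = "skew u v"
 define c where "c R = \<Theta> (%i. if i : R then ?X (l i) else l i)" for R
 have "(\<Sum>R\<in>Pow S. t ^ card R * c R) = (\<Sum>R\<in>Pow S. (- t) ^ card R * c R)" if k: "1 + t * t * disc u v ~= 0" for t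
 proof -
  have "(\<Sum>R\<in>Pow S. t ^ card R * c R) = \<Theta> (%i. if i : S then l i + scale t (?X (l i)) else l i)"
   unfolding c_def by (rule mlin_binomial[OF S ml, symmetric])
  also have "... = \<Theta> (cayley u v t o (%i. if i : S then l i + scale (- t) (?X (l i)) else l i))"
  proof (rule supportedD[OF sup])
   fix i assume "i : S"
   then show "(if i : S then l i + scale t (?X (l i)) else l i) =
     (cayley u v t o (%i. if i : S then l i + scale (- t) (?X (l i)) else l i)) i"
    using cayley_maps[OF k, of "l i"] by (simp add: scale_minus_left)
  qed
  also have "... = \<Theta> (%i. if i : S then l i + scale (- t) (?X (l i)) else l i)"
   using inv cayley_isometry[OF k] unfolding invariant_def by blast
  also have "... = (\<Sum>R\<in>Pow S. (- t) ^ card R * c R)"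
   unfolding c_def by (rule mlin_binomial[OF S ml])
  finally show ?thesis .
 qed
 then have "(\<Sum>j\<in>S. c {j}) = 0" by (rule poly_coeff_zero[OF S])
 moreover have "c {j} = \<Theta> (l(j := ?X (l j)))" for j
  unfolding c_def by (rule arg_cong[where f = \<Theta>]) auto
 ultimately show ?thesis by simp
qed

text \<open>A Casimir computation: \<open>b k\<close> is put into slot \<open>i\<close>,
  infinitesimal invariance is applied for \<open>skew (U k) (l i)\<close>, and the results are
  summed over \<open>k\<close>. Slot \<open>i\<close> gives a scalar. Any other slot
  \<open>j\<close> gives the exchange of the labels at \<open>i\<close> and \<open>j\<close> minus a
  multiple of a contraction, which is zero by hypothesis.\<close>

lemma casimir_relation:
 assumes S: "finite S" and ml: "mlin S \<Theta>" and sup: "supported S \<Theta>" and inv: "invariant \<Theta>"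
  and con0: "!!j l. j : S ==> j ~= i ==> con i j \<Theta> l = 0" and i: "i : S"
 shows "(of_nat n - e) * \<Theta> l + (\<Sum>j\<in>S - {i}. \<Theta> (l(i := l j, j := l i))) = 0"
proof -
 let ?v = "l i"
 have "(\<Sum>k<n. \<Sum>j\<in>S. \<Theta> ((l(i := b k))(j := skew (U k) ?v ((l(i := b k)) j)))) = (\<Sum>k<n. 0)"
  by (intro sum.cong refl infinitesimal[OF S ml sup inv])
 then have z: "(\<Sum>j\<in>S. \<Sum>k<n. \<Theta> ((l(i := b k))(j := skew (U k) ?v ((l(i := b k)) j)))) = 0"
  by (subst sum.swap) simp
 have ti: "(\<Sum>k<n. \<Theta> ((l(i := b k))(i := skew (U k) ?v ((l(i := b k)) i)))) = (e * of_nat n - 1) * \<Theta> l"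
 proof -
  have "\<Theta> ((l(i := b k))(i := skew (U k) ?v ((l(i := b k)) i))) = e * \<Theta> l - \<omega> ?v (b k) * \<Theta> (l(i := U k))"
   if "k < n" for k
  proof -
   have bU: "\<omega> (b k) (U k) = e" using sym_e[of "b k" "U k"] U_b[OF that that] by simp
   have "e * \<omega> (b k) ?v = \<omega> ?v (b k)" by (rule sym_e[symmetric])
   then have "skew (U k) ?v (b k) = scale e ?v - scale (\<omega> ?v (b k)) (U k)" by (simp add: skew_def bU)
   then show ?thesis using mlin_diff[OF ml i, of l "scale e ?v" "\<omega> ?v (b k)" "U k"] mlin_scale[OF ml i, of l e ?v] by simp
  qed
  then have "(\<Sum>k<n. \<Theta> ((l(i := b k))(i := skew (U k) ?v ((l(i := b k)) i)))) =
   (\<Sum>k<n. e * \<Theta> l) - (\<Sum>k<n. \<omega> ?v (b k) * \<Theta> (l(i := U k)))"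
   by (simp add: sum_subtractf)
  also have "(\<Sum>k<n. \<omega> ?v (b k) * \<Theta> (l(i := U k))) = \<Theta> (l(i := (\<Sum>k<n. scale (\<omega> ?v (b k)) (U k))))"
   by (rule mlin_sum[OF ml i, symmetric]) simp
  also have "... = \<Theta> l" by (simp only: expand_U[symmetric] fun_upd_triv)
  also have "(\<Sum>k<n. e * \<Theta> l) - \<Theta> l = (e * of_nat n - 1) * \<Theta> l" by (simp add: algebra_simps)
  finally show ?thesis .
 qed
 have tj: "(\<Sum>k<n. \<Theta> ((l(i := b k))(j := skew (U k) ?v ((l(i := b k)) j)))) = e * \<Theta> (l(i := l j, j := l i))"
  if j: "j : S" "j ~= i" for j
 proof -
  have "\<Theta> ((l(i := b k))(j := skew (U k) ?v ((l(i := b k)) j))) =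
   e * (\<omega> (U k) (l j) * \<Theta> ((l(j := ?v))(i := b k))) - (e * \<omega> (l j) ?v) * \<Theta> (l(i := b k, j := U k))" for k
  proof -
   have "skew (U k) ?v (l j) = scale (e * \<omega> (U k) (l j)) ?v - scale (e * \<omega> (l j) ?v) (U k)"
    by (simp only: skew_def sym_e[of "l j" "U k"])
   then show ?thesis
    using mlin_diff[OF ml j(1), of "l(i := b k)" "scale (e * \<omega> (U k) (l j)) ?v" "e * \<omega> (l j) ?v" "U k"]
     mlin_scale[OF ml j(1), of "l(i := b k)" "e * \<omega> (U k) (l j)" ?v] j(2)
    by (simp add: fun_upd_twist mult.assoc)
  qed
  then have "(\<Sum>k<n. \<Theta> ((l(i := b k))(j := skew (U k) ?v ((l(i := b k)) j)))) =
   e * (\<Sum>k<n. \<omega> (U k) (l j) * \<Theta> ((l(j := ?v))(i := b k))) - (e * \<omega> (l j) ?v) * con i j \<Theta> l"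
   by (simp only: sum_subtractf sum_distrib_left con_def)
  also have "(\<Sum>k<n. \<omega> (U k) (l j) * \<Theta> ((l(j := ?v))(i := b k))) =
    \<Theta> ((l(j := ?v))(i := (\<Sum>k<n. scale (\<omega> (U k) (l j)) (b k))))"
   by (rule mlin_sum[OF ml i, symmetric]) simp
  also have "... = \<Theta> ((l(j := ?v))(i := l j))" by (simp only: expand_b[symmetric])
  finally show ?thesis unfolding con0[OF j] mult_zero_right diff_0_right fun_upd_twist[OF j(2)] .
 qed
 have tjs: "(\<Sum>j\<in>S - {i}. \<Sum>k<n. \<Theta> ((l(i := b k))(j := skew (U k) ?v ((l(i := b k)) j)))) =
   (\<Sum>j\<in>S - {i}. e * \<Theta> (l(i := l j, j := l i)))"
  by (intro sum.cong refl tj) auto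
 have "(e * of_nat n - 1) * \<Theta> l + (\<Sum>j\<in>S - {i}. e * \<Theta> (l(i := l j, j := l i))) = 0"
  using z unfolding sum.remove[OF S i] ti tjs .
 then have "e * ((e * of_nat n - 1) * \<Theta> l + e * (\<Sum>j\<in>S - {i}. \<Theta> (l(i := l j, j := l i)))) = 0"
  by (simp add: sum_distrib_left)
 moreover have "e * ((e * of_nat n - 1) * x + e * y) = (of_nat n - e) * x + y" for x y
  using e_cases by (auto simp: algebra_simps)
 ultimately show ?thesis by simp
qed

lemma iota: "k < n ==> \<iota> k < n" "k < n ==> \<iota> (\<iota> k) = k" "k < n ==> a k ~= 0"
 "k < n ==> e = 1 ==> \<iota> k = k" "k < n ==> e = -1 ==> a k = 1 | a k = -1"
 "k < n ==> l < n ==> \<omega> (b k) (b l) = (if l = \<iota> k then a k else 0)"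
 using mono unfolding mono_family_def by blast+

text \<open>For \<open>e = 1\<close> the dual vector \<open>U k\<close> is a multiple of
  \<open>b k\<close>, and this is the orthogonal reflection along \<open>b k\<close>.\<close>

definition reflect :: "nat => 'v => 'v" where
 "reflect k y = y - scale (2 * \<omega> (U k) y) (b k)"

lemma reflect_b: "k < n ==> l < n ==> reflect k (b l) = (if k = l then - b l else b l)"
 by (simp add: reflect_def U_b) (metis (no_types) add_diff_cancel_left' diff_zero mult_2 scale_left_distrib scale_one minus_diff_eq one_add_one scale_left_commute)

lemma reflect_isometry:
 assumes e1: "e = 1" and k: "k < n"
 shows "reflect k : G"
proof (rule isometryI)
 show "reflect k (x + y) = reflect k x + reflect k y" for x y
  by (simp add: reflect_def distrib_left scale_left_distrib)
 show "reflect k (scale c x) = scale c (reflect k x)" for c x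
  by (simp add: reflect_def scale_right_diff_distrib mult_ac)
 have ak: "a k ~= 0" "\<iota> k = k" "\<omega> (b k) (b k) = a k" using iota[OF k] iota(6)[OF k k] e1 by simp_all
 have bU: "b k = scale (a k) (U k)" using ak by (simp add: dual_family_def)
 have b1: "\<omega> (b k) y = a k * \<omega> (U k) y" for y by (subst bU) simp
 have b2: "\<omega> y (b k) = a k * \<omega> (U k) y" for y using sym_e[of y "b k"] e1 b1 by simp
 show "\<omega> (reflect k x) (reflect k y) = \<omega> x y" for x y
  unfolding reflect_def w_diff w_scale_left w_scale_right b1 b2[of x] using U_b[OF k k] by (simp add: algebra_simps)
 have "reflect k (reflect k y) = y" for y
  by (simp add: reflect_def U_b[OF k k] scale_left_diff_distrib algebra_simps scale_left_distrib[symmetric])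
 then show "bij (reflect k)" by (intro o_bij[of "reflect k"]) auto
qed

text \<open>On basis words the Casimir relation has integer coefficients, so the images of the
  values under a rational functional satisfy \<open>casimir_zero\<close>. For \<open>e = 1\<close>,
  reflecting along a letter that occurs only once changes the sign of the value; hence every letter
  of a word with nonzero value is repeated.\<close>

lemma invariant_zero:
 assumes S: "finite S" "S ~= {}" and ml: "mlin S \<Theta>" and sup: "supported S \<Theta>" and inv: "invariant \<Theta>"
  and con0: "!!i j l. i : S ==> j : S ==> i ~= j ==> con i j \<Theta> l = 0"
 shows "\<Theta> l = 0"
proof -
 have word: "\<Theta> (b o w) = 0" if w: "w : words S n" for w
 proof (rule ccontr)
  assume "\<Theta> (b o w) ~= 0"
  then obtain \<phi> :: "'k => rat" where \<phi>: "!!u v. \<phi> (u + v) = \<phi> u + \<phi> v" "!!q u. \<phi> (of_rat q * u) = q * \<phi> u"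
   "\<phi> (\<Theta> (b o w)) ~= 0" by (rule rational_functional) (rule that; simp)
  have \<phi>0: "\<phi> 0 = 0" using \<phi>(2)[of 0 0] by simp
  have \<phi>sum: "\<phi> (\<Sum>i\<in>A. f i) = (\<Sum>i\<in>A. \<phi> (f i))" for A and f :: "'a => 'k"
   by (induction A rule: infinite_finite_induct) (simp_all add: \<phi>(1) \<phi>0)
  define er :: rat where "er = (if e = 1 then 1 else -1)"
  have ere: "of_rat er = e" "er = 1 | er = -1" using e_cases by (auto simp: er_def)
  define x where "x w = \<phi> (\<Theta> (b o w))" for w
  have "x w = 0"
  proof (rule casimir_zero[OF S ere(2) _ _ w])
   fix i w assume i: "i : S" and "w : words S n"
   have "(of_nat n - e) * \<Theta> (b o w) + (\<Sum>j\<in>S - {i}. \<Theta> ((b o w)(i := (b o w) j, j := (b o w) i))) = 0"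
    by (rule casimir_relation[OF S(1) ml sup inv con0[OF i] i]) auto
   moreover have "(b o w)(i := (b o w) j, j := (b o w) i) = b o (w(i := w j, j := w i))" for j by auto
   moreover have "of_nat n - e = of_rat (of_nat n - er)" by (simp add: ere(1) of_rat_diff)
   ultimately have "\<phi> (of_rat (of_nat n - er) * \<Theta> (b o w) + (\<Sum>j\<in>S - {i}. \<Theta> (b o (w(i := w j, j := w i))))) = \<phi> 0"
    by simp
   then show "(of_nat n - er) * x w + (\<Sum>j\<in>S - {i}. x (w(i := w j, j := w i))) = 0"
    by (simp only: \<phi>(1,2) \<phi>sum \<phi>0 x_def)
  next
   fix w i assume er1: "er = 1" and w: "w : words S n" and xw: "x w ~= 0" and i: "i : S"
   then have e1: "e = 1" using ere(1) by simp
   show "\<exists>j\<in>S. j ~= i & w j = w i"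
   proof (rule ccontr)
    assume no: "\<not> (\<exists>j\<in>S. j ~= i & w j = w i)"
    have wi: "w i < n" using w i by auto
    have "\<Theta> (b o w) = \<Theta> (reflect (w i) o (b o w))"
     using inv reflect_isometry[OF e1 wi] unfolding invariant_def by metis
    also have "... = \<Theta> ((b o w)(i := scale (-1) (b (w i))))"
    proof (rule supportedD[OF sup])
     fix j assume j: "j : S"
     then have "w j < n" using w by auto
     then show "(reflect (w i) o (b o w)) j = ((b o w)(i := scale (-1) (b (w i)))) j"
      using no j reflect_b[OF wi, of "w j"] by auto
    qed
    also have "... = - \<Theta> (b o w)"
     using mlin_scale[OF ml i, of "b o w" "-1" "b (w i)"] by (simp add: fun_upd_idem)
    finally have "\<Theta> (b o w) = 0" by simp
    then show False using xw by (simp add: x_def \<phi>0)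
   qed
  qed
  then show False using \<phi>(3) by (simp add: x_def)
 qed
 have "\<Theta> l = (\<Sum>kp\<in>words S n. (\<Prod>i\<in>S. \<omega> (U (kp i)) (l i)) * \<Theta> (spread S (b o kp) l))"
  by (rule mlin_expand[of "%k. \<omega> (U k)" b]) (rule expand_b, rule S(1), rule ml)
 also have "... = 0"
 proof (intro sum.neutral ballI)
  fix kp assume kp: "kp : words S n"
  have "\<Theta> (spread S (b o kp) l) = \<Theta> (b o kp)" by (rule supportedD[OF sup]) (simp add: spread_def)
  then show "(\<Prod>i\<in>S. \<omega> (U (kp i)) (l i)) * \<Theta> (spread S (b o kp) l) = 0" by (simp add: word[OF kp])
 qed
 finally show ?thesis .
qed

lemma con_mlin:
 assumes ml: "mlin S \<Theta>" and ij: "i ~= j"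
 shows "mlin (S - {i, j}) (con i j \<Theta>)"
 unfolding mlin_def
proof (intro ballI allI)
 fix k l x y c assume k: "k : S - {i, j}"
 then have kS: "k : S" and tw: "(l(k := z))(i := p', j := q') = (l(i := p', j := q'))(k := z)" for z p' q' :: 'v
  by auto
 show "con i j \<Theta> (l(k := x + scale c y)) = con i j \<Theta> (l(k := x)) + c * con i j \<Theta> (l(k := y))"
  unfolding con_def tw mlinD[OF ml kS] by (simp only: sum.distrib sum_distrib_left)
qed

lemma con_supported:
 assumes sup: "supported S \<Theta>"
 shows "supported (S - {i, j}) (con i j \<Theta>)"
 unfolding supported_def
proof (intro allI impI)
 fix l l' :: "'a => 'v" assume "\<forall>k\<in>S - {i, j}. l k = l' k"
 then show "con i j \<Theta> l = con i j \<Theta> l'"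
  unfolding con_def by (intro sum.cong refl supportedD[OF sup]) auto
qed

text \<open>The contraction does not depend on the choice of dual bases: expanding the moved bases
  along the old ones yields two mutually inverse matrices, whose product \<open>expand_w\<close>
  evaluates.\<close>

lemma con_invariant:
 assumes ml: "mlin S \<Theta>" and inv: "invariant \<Theta>" and ij: "i : S" "j : S" "i ~= j"
 shows "invariant (con i j \<Theta>)"
 unfolding invariant_def
proof (intro ballI allI)
 fix g and l :: "'a => 'v" assume g: "g : G"
 let ?h = "iv g"
 note gi = isometry_inv[OF g]
 have "con i j \<Theta> (g o l) = (\<Sum>k<n. \<Theta> (l(i := ?h (b k), j := ?h (U k))))"
  unfolding con_def
 proof (intro sum.cong refl)
  fix k
  have "(g o l)(i := b k, j := U k) = g o (l(i := ?h (b k), j := ?h (U k)))"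
   by (rule ext) (simp add: gi(2))
  then show "\<Theta> ((g o l)(i := b k, j := U k)) = \<Theta> (l(i := ?h (b k), j := ?h (U k)))"
   using inv g unfolding invariant_def by simp
 qed
 also have "... = (\<Sum>k<n. \<Sum>m<n. \<Sum>m'<n. \<omega> (U m) (?h (b k)) * (\<omega> (?h (U k)) (b m') * \<Theta> (l(i := b m, j := U m'))))"
 proof (intro sum.cong refl)
  fix k
  have "\<Theta> (l(i := ?h (b k), j := ?h (U k))) = \<Theta> ((l(j := ?h (U k)))(i := \<Sum>m<n. scale (\<omega> (U m) (?h (b k))) (b m)))"
   by (simp only: expand_b[symmetric] fun_upd_twist[OF ij(3)])
  also have "... = (\<Sum>m<n. \<omega> (U m) (?h (b k)) * \<Theta> ((l(j := ?h (U k)))(i := b m)))"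
   by (rule mlin_sum[OF ml ij(1)]) simp
  also have "... = (\<Sum>m<n. \<omega> (U m) (?h (b k)) * (\<Sum>m'<n. \<omega> (?h (U k)) (b m') * \<Theta> (l(i := b m, j := U m'))))"
  proof (intro sum.cong refl)
   fix m
   have "\<Theta> ((l(j := ?h (U k)))(i := b m)) = \<Theta> ((l(i := b m))(j := \<Sum>m'<n. scale (\<omega> (?h (U k)) (b m')) (U m')))"
    by (simp only: expand_U[symmetric] fun_upd_twist[OF ij(3)])
   also have "... = (\<Sum>m'<n. \<omega> (?h (U k)) (b m') * \<Theta> (l(i := b m, j := U m')))"
    by (rule mlin_sum[OF ml ij(2)]) simp
   finally show "\<omega> (U m) (?h (b k)) * \<Theta> ((l(j := ?h (U k)))(i := b m)) =
    \<omega> (U m) (?h (b k)) * (\<Sum>m'<n. \<omega> (?h (U k)) (b m') * \<Theta> (l(i := b m, j := U m')))" by simp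
  qed
  finally show "\<Theta> (l(i := ?h (b k), j := ?h (U k))) =
   (\<Sum>m<n. \<Sum>m'<n. \<omega> (U m) (?h (b k)) * (\<omega> (?h (U k)) (b m') * \<Theta> (l(i := b m, j := U m'))))"
   by (simp only: sum_distrib_left)
 qed
 also have "... = (\<Sum>m<n. \<Sum>m'<n. \<Sum>k<n. \<omega> (U m) (?h (b k)) * (\<omega> (?h (U k)) (b m') * \<Theta> (l(i := b m, j := U m'))))"
  by (rule sum_swap3)
 also have "... = (\<Sum>m<n. \<Sum>m'<n. \<Theta> (l(i := b m, j := U m')) * of_bool (m' = m))"
 proof (intro sum.cong refl)
  fix m m' assume "m : {..<n}" "m' : {..<n}"
  then have m: "m < n" "m' < n" by auto
  have "(\<Sum>k<n. \<omega> (U m) (?h (b k)) * \<omega> (?h (U k)) (b m')) = (\<Sum>k<n. \<omega> (g (U m)) (b k) * \<omega> (U k) (g (b m')))"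
  proof (intro sum.cong refl)
   fix k
   have "\<omega> (U m) (?h (b k)) = \<omega> (g (U m)) (b k)"
    using isometryD(4)[OF g, of "U m" "?h (b k)"] by (simp add: gi(2))
   moreover have "\<omega> (?h (U k)) (b m') = \<omega> (U k) (g (b m'))"
    using isometryD(4)[OF g, of "?h (U k)" "b m'"] by (simp add: gi(2))
   ultimately show "\<omega> (U m) (?h (b k)) * \<omega> (?h (U k)) (b m') = \<omega> (g (U m)) (b k) * \<omega> (U k) (g (b m'))" by simp
  qed
  also have "... = \<omega> (g (U m)) (g (b m'))" by (rule expand_w[symmetric])
  also have "... = of_bool (m' = m)" using U_b[OF m] isometryD(4)[OF g, of "U m" "b m'"] by auto
  finally have "(\<Sum>k<n. \<omega> (U m) (?h (b k)) * \<omega> (?h (U k)) (b m')) = of_bool (m' = m)" .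
  moreover have "(\<Sum>k<n. \<omega> (U m) (?h (b k)) * (\<omega> (?h (U k)) (b m') * \<Theta> (l(i := b m, j := U m')))) =
    (\<Sum>k<n. \<omega> (U m) (?h (b k)) * \<omega> (?h (U k)) (b m')) * \<Theta> (l(i := b m, j := U m'))"
   by (simp only: sum_distrib_right mult.assoc)
  ultimately show "(\<Sum>k<n. \<omega> (U m) (?h (b k)) * (\<omega> (?h (U k)) (b m') * \<Theta> (l(i := b m, j := U m')))) =
    \<Theta> (l(i := b m, j := U m')) * of_bool (m' = m)"
   by (simp only: mult.commute)
 qed
 also have "... = (\<Sum>m<n. \<Theta> (l(i := b m, j := U m)))"
  by (intro sum.cong refl sum_of_bool_pick) auto
 finally show "con i j \<Theta> (g o l) = con i j \<Theta> l" by (simp only: con_def)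
qed

lemma con_commute:
 assumes "i ~= i'" "i ~= j'" "j ~= i'" "j ~= j'"
 shows "con i j (con i' j' \<Theta>) l = con i' j' (con i j \<Theta>) l"
proof -
 have tw: "(l(i := x, j := y))(i' := x', j' := y') = (l(i' := x', j' := y'))(i := x, j := y)" for x y x' y' :: 'v
  using assms by auto
 show ?thesis unfolding con_def tw by (rule sum.swap)
qed

lemma con_zero: "con i j (%_. 0) l = 0" by (simp add: con_def)

text \<open>There are no nonzero equivariant maps from fewer slots \<open>A\<close> to traceless tensors in the slots \<open>P\<close>.\<close>

lemma invariant_traceless_zero:
 assumes "finite A" "finite P" "A \<inter> P = {}" "card A < card P"
  and "mlin (A \<union> P) \<Theta>" "supported (A \<union> P) \<Theta>" "invariant \<Theta>"
  and "!!i j l. i : P ==> j : P ==> i ~= j ==> con i j \<Theta> l = 0"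
 shows "\<Theta> = (%_. 0)"
 using assms
proof (induction "card A + card P" arbitrary: A P \<Theta> rule: less_induct)
 case less
 note fin = less.prems(1,2) and dis = less.prems(3) and ml = less.prems(5) and sup = less.prems(6) and inv = less.prems(7)
 have P0: "P ~= {}" using less.prems(4) by auto
 have con0: "con i j \<Theta> = (%_. 0)" if ij: "i : A \<union> P" "j : A \<union> P" "i ~= j" for i j
 proof (cases "i : P & j : P")
  case True
  then show ?thesis using less.prems(8) ij(3) by blast
 next
  case False
  \<comment> \<open>A contraction that involves \<open>A\<close> removes two slots of
    \<open>A\<close>, or one slot from each side. Either way \<open>P'\<close> still has more slots
    than \<open>A'\<close>.\<close>
  define A' where "A' = A - {i, j}"
  define P' where "P' = P - {i, j}"
  have AP: "A' \<union> P' = (A \<union> P) - {i, j}" by (auto simp: A'_def P'_def)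
  have cards: "card A' < card P' & card A' + card P' < card A + card P"
  proof -
   consider "i : A" "j : A" | "i : A" "j : P" | "i : P" "j : A" using False ij by blast
   then show ?thesis
   proof cases
    case 1
    then have "P' = P" using dis by (auto simp: P'_def)
    moreover have "card A' < card A" unfolding A'_def using 1 fin by (intro psubset_card_mono) auto
    ultimately show ?thesis using less.prems(4) by simp
   next
    case 2
    then have "A' = A - {i}" "P' = P - {j}" using dis by (auto simp: A'_def P'_def)
    then have "card A' = card A - 1" "card P' = card P - 1" using 2 fin by simp_all
    moreover have "card A > 0" using 2 fin by (auto simp: card_gt_0_iff)
    ultimately show ?thesis using less.prems(4) by linarith
   next
    case 3
    then have "A' = A - {j}" "P' = P - {i}" using dis by (auto simp: A'_def P'_def)
    then have "card A' = card A - 1" "card P' = card P - 1" using 3 fin by simp_all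
    moreover have "card A > 0" using 3 fin by (auto simp: card_gt_0_iff)
    ultimately show ?thesis using less.prems(4) by linarith
   qed
  qed
  show ?thesis
  proof (rule less.hyps)
   show "card A' + card P' < card A + card P" "card A' < card P'" using cards by auto
   show "finite A'" "finite P'" "A' \<inter> P' = {}" using fin dis by (auto simp: A'_def P'_def)
   show "mlin (A' \<union> P') (con i j \<Theta>)" unfolding AP by (rule con_mlin[OF ml ij(3)])
   show "supported (A' \<union> P') (con i j \<Theta>)" unfolding AP by (rule con_supported[OF sup])
   show "invariant (con i j \<Theta>)" by (rule con_invariant[OF ml inv ij])
   fix i' j' l assume "i' : P'" "j' : P'" "i' ~= j'"
   then have ij': "i' : P" "j' : P" "i' ~= i" "i' ~= j" "j' ~= i" "j' ~= j" by (auto simp: P'_def)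
   \<comment> \<open>Disjoint contractions commute, so tracelessness in the remaining slots is
     inherited.\<close>
   have "con i' j' \<Theta> = (%_. 0)" using less.prems(8)[OF ij'(1,2) \<open>i' ~= j'\<close>] by blast
   then show "con i' j' (con i j \<Theta>) l = 0"
    using con_commute[of i' i j j' \<Theta> l] ij' by (simp add: con_zero)
  qed
 qed
 show ?case
 proof
  fix l
  show "\<Theta> l = 0"
  proof (rule invariant_zero[OF _ _ ml sup inv])
   show "finite (A \<union> P)" "A \<union> P ~= {}" using fin P0 by auto
   show "con i j \<Theta> l = 0" if "i : A \<union> P" "j : A \<union> P" "i ~= j" for i j l
    using con0[OF that] by simp
  qed
 qed
qed

end

section \<open>The projection onto traceless tensors\<close>

interpretation FS: vector_space "fscale :: 'k::field => ('x => 'k) => 'x => 'k"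
 by unfold_locales (simp_all add: fun_eq_iff plus_fun_def algebra_simps)

interpretation FSP: vector_space_pair "fscale :: 'k::field => ('x => 'k) => 'x => 'k"
 "fscale :: 'k::field => ('x => 'k) => 'x => 'k" ..

text \<open>If the square of \<open>A\<close> has the same kernel as \<open>A\<close>, then
  \<open>A\<close> is injective on its image, and by dimension it maps this image onto
  itself.\<close>

lemma fitting:
 fixes A :: "('x => 'k::field) => 'x => 'k"
 assumes add: "!!s t. A (s + t) = A s + A t" and sc: "!!c t. A (fscale c t) = fscale c (A t)"
  and fin: "finite S" and im: "!!t. t : S ==> A t : FS.span S"
  and ker: "!!t. t : FS.span S ==> A (A t) = 0 ==> A t = 0"
  and t: "t : FS.span S"
 shows "\<exists>z\<in>FS.span S. A t = A (A z)"
proof -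
 have lin: "Vector_Spaces.linear fscale fscale A"
  using add sc FS.vector_space_axioms by (simp add: Vector_Spaces.linear_iff)
 have img: "FS.span (A ` T) = A ` FS.span T" for T by (rule FSP.linear_span_image[OF lin])
 obtain B where B: "B \<subseteq> A ` S" "FS.independent B" "A ` S \<subseteq> FS.span B"
  by (rule FS.maximal_independent_subset)
 have R: "FS.span B = A ` FS.span S"
  unfolding img[symmetric]
  using FS.span_minimal[OF B(3) FS.subspace_span] FS.span_mono[OF B(1)] by (rule subset_antisym[rotated])
 have finB: "finite B" using B(1) fin by (meson finite_imageI finite_subset)
 have E: "A x : FS.span S" if "x : FS.span S" for x
 proof -
  have "A ` FS.span S \<subseteq> FS.span S"
   unfolding img[symmetric] by (rule FS.span_minimal[OF _ FS.subspace_span]) (use im in auto)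
  then show ?thesis using that by auto
 qed
 have inj: "inj_on A (FS.span B)"
 proof (rule inj_onI)
  fix x y assume xy: "x : FS.span B" "y : FS.span B" "A x = A y"
  then have "x - y : A ` FS.span S" using FS.span_diff[OF xy(1,2)] R by simp
  then obtain z where z: "z : FS.span S" "x - y = A z" by auto
  have "A (A z) = 0" using FSP.linear_diff[OF lin, of x y] xy(3) z(2) by simp
  then show "x = y" using ker[OF z(1)] z(2) by simp
 qed
 have ind: "FS.independent (A ` B)" by (rule FSP.linear_independent_injective_image[OF lin B(2) inj])
 have crd: "card (A ` B) = card B"
  by (rule card_image) (rule inj_on_subset[OF inj FS.span_superset])
 have AB: "A ` B \<subseteq> FS.span B"
 proof
  fix y assume "y : A ` B"
  then obtain x where x: "x : B" "y = A x" by auto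
  have "x : A ` FS.span S" using FS.span_base[OF x(1)] unfolding R .
  then obtain z where z: "x = A z" "z : FS.span S" by (rule imageE)
  show "y : FS.span B" unfolding R x(2) z(1) by (intro imageI E z(2))
 qed
 \<comment> \<open>An independent subset with as many elements as the basis \<open>B\<close> must
   span.\<close>
 have full: "FS.span B \<subseteq> FS.span (A ` B)"
 proof
  fix v assume v: "v : FS.span B"
  show "v : FS.span (A ` B)"
  proof (rule ccontr)
   assume nv: "v \<notin> FS.span (A ` B)"
   then have "FS.independent (insert v (A ` B))" by (rule FS.independent_insertI[OF _ ind])
   moreover have "insert v (A ` B) \<subseteq> FS.span B" using v AB by simp
   ultimately have "card (insert v (A ` B)) <= card B"
    using FS.independent_span_bound[OF finB] by blast
   moreover have "v \<notin> A ` B" by (rule contra_subsetD[OF FS.span_superset nv])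
   ultimately show False using finB crd by simp
  qed
 qed
 have "A t : FS.span B" using t R by simp
 then have "A t : FS.span (A ` B)" using full by (rule subsetD[rotated])
 then have "A t : A ` (A ` FS.span S)" unfolding img R .
 then show ?thesis by (elim imageE) (rule bexI, simp_all)
qed

context mono_basis
begin

section \<open>Caps and cups as operations on slots\<close>

lemma con_cong:
 assumes "!!k. k < p ==> k ~= i ==> k ~= j ==> l k = l' k"
 shows "con i j (ev p t) l = con i j (ev p t) l'"
 unfolding con_def by (intro sum.cong refl ev_cong) (use assms in auto)

lemma con_ev:
 assumes t: "t : tn p" and ij: "i < p" "j < p" "i ~= j"
 shows "con i j (ev p t) l = e * (\<Sum>kp\<in>words {..<p} n. \<omega> (b (kp i)) (b (kp j)) *
  (\<Prod>k\<in>{..<p} - {i, j}. \<omega> (l k) (b (kp k))) * ev p t (U o kp))"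
proof -
 have S: "{..<p} = insert i (insert j ({..<p} - {i, j}))" using ij by auto
 have pr: "(\<Prod>k<p. \<omega> ((l(i := x, j := y)) k) (c k)) = \<omega> x (c i) * (\<omega> y (c j) * (\<Prod>k\<in>{..<p} - {i, j}. \<omega> (l k) (c k)))"
  for x y c
 proof -
  have "(\<Prod>k<p. \<omega> ((l(i := x, j := y)) k) (c k)) = \<omega> x (c i) * (\<omega> y (c j) * (\<Prod>k\<in>{..<p} - {i, j}. \<omega> ((l(i := x, j := y)) k) (c k)))"
   by (subst S) (use ij in simp)
  also have "(\<Prod>k\<in>{..<p} - {i, j}. \<omega> ((l(i := x, j := y)) k) (c k)) = (\<Prod>k\<in>{..<p} - {i, j}. \<omega> (l k) (c k))"
   by (rule prod.cong) auto
  finally show ?thesis .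
 qed
 have bU: "(\<Sum>m<n. \<omega> (b m) x * \<omega> (U m) y) = e * \<omega> x y" for x y
  unfolding expand_w[of x y] sum_distrib_left by (intro sum.cong refl) (simp only: sym_e[of "b _" x] mult.assoc)
 have "con i j (ev p t) l = (\<Sum>m<n. \<Sum>kp\<in>words {..<p} n. (\<Prod>k<p. \<omega> ((l(i := b m, j := U m)) k) (b (kp k))) * ev p t (U o kp))"
  unfolding con_def by (intro sum.cong refl ev_expand[OF t])
 also have "... = (\<Sum>kp\<in>words {..<p} n. \<Sum>m<n. (\<Prod>k<p. \<omega> ((l(i := b m, j := U m)) k) (b (kp k))) * ev p t (U o kp))"
  by (rule sum.swap)
 also have "... = (\<Sum>kp\<in>words {..<p} n. (\<Sum>m<n. \<omega> (b m) (b (kp i)) * \<omega> (U m) (b (kp j))) *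
   ((\<Prod>k\<in>{..<p} - {i, j}. \<omega> (l k) (b (kp k))) * ev p t (U o kp)))"
  unfolding pr sum_distrib_right by (simp only: mult.assoc)
 finally show ?thesis unfolding bU sum_distrib_left by (simp only: mult.assoc)
qed

lemma con_swap:
 assumes t: "t : tn p" and ij: "i < p" "j < p" "i ~= j"
 shows "con j i (ev p t) l = e * con i j (ev p t) l"
 unfolding con_ev[OF t ij] con_ev[OF t ij(2,1) ij(3)[symmetric]] insert_commute[of j i] sum_distrib_left
 by (intro sum.cong refl) (simp only: sym_e[of "b (_ j)" "b (_ i)"] mult.assoc)

context
 fixes p i j :: nat
 assumes ij: "i < j" "j < p"
begin

private lemma ij': "i < p" "j < p" "i ~= j" using ij by auto

text \<open>The additional factor \<open>e\<close> arises because \<open>con\<close> pairs the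
  vectors \<open>b m\<close> from the left: \<open>\<omega> (b m) x\<close> has to be turned around
  before the sum over \<open>m\<close> collapses.\<close>

lemma ev_dmap_contraction:
 assumes t: "t : tn p"
 shows "ev (p - 2) (dmap p (p - 2) (contraction p i j) t) l =
  e ^ Suc (crossings (contraction p i j)) * con i j (ev p t) (%k. l (cindex i j k))"
proof -
 let ?c = "contraction p i j" and ?S = "{..<p} - {i, j}"
 have c: "?c : brauer p (p - 2)" by (rule contraction_brauer[OF ij'])
 have 1: "{(i', j'). i' < j' & {Top i', Top j'} : ?c} = {(i, j)}"
  using ij by (auto simp: contraction_def doubleton_eq_iff)
 have 2: "{(k, m). {Top k, Bot m} : ?c} = (%k. (k, cindex i j k)) ` ?S"
  by (auto simp: contraction_def cindex_def doubleton_eq_iff)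
 have 3: "{(k, m). k < m & {Bot k, Bot m} : ?c} = {}"
  by (auto simp: contraction_def doubleton_eq_iff)
 have br: "bracket e \<omega> p (p - 2) ?c v l = e ^ crossings ?c * (\<omega> (v i) (v j) * (\<Prod>k\<in>?S. \<omega> (l (cindex i j k)) (v k)))" for v
 proof -
  have "(\<Prod>(k, m)\<in>(%k. (k, cindex i j k)) ` ?S. \<omega> (l m) (v k)) = (\<Prod>k\<in>?S. \<omega> (l (cindex i j k)) (v k))"
   by (subst prod.reindex) (auto simp: inj_on_def)
  then show ?thesis unfolding bracket_prod[OF c] 1 2 3 by (simp add: mult.assoc)
 qed
 have eY: "e ^ Suc (crossings ?c) * (e * y) = e ^ crossings ?c * y" for y
  using ee by (simp add: mult_ac)
 have "ev (p - 2) (dmap p (p - 2) ?c t) l = e ^ crossings ?c * (\<Sum>kp\<in>words {..<p} n. \<omega> (b (kp i)) (b (kp j)) *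
  (\<Prod>k\<in>?S. \<omega> (l (cindex i j k)) (b (kp k))) * ev p t (U o kp))"
  unfolding ev_dmap[OF c t] br o_apply sum_distrib_left by (intro sum.cong refl) (simp only: mult_ac)
 then show ?thesis unfolding con_ev[OF t ij'] eY .
qed

lemma ev_dmap_bar_contraction:
 assumes s: "s : tn (p - 2)"
 shows "ev p (dmap (p - 2) p (bar (contraction p i j)) s) L =
  e ^ crossings (bar (contraction p i j)) * (\<omega> (L j) (L i) *
   ev (p - 2) s (%m. L (the_inv_into ({..<p} - {i, j}) (cindex i j) m)))"
proof -
 let ?c = "contraction p i j" and ?S = "{..<p} - {i, j}" and ?L = "%m. L (the_inv_into ({..<p} - {i, j}) (cindex i j) m)"
 have c: "bar ?c : brauer (p - 2) p" by (rule bar_brauer[OF contraction_brauer[OF ij']])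
 have 1: "{(k, m). k < m & {Top k, Top m} : bar ?c} = {}"
  unfolding pair_bar by (auto simp: contraction_def doubleton_eq_iff)
 have 2: "{(k, m). {Top k, Bot m} : bar ?c} = (%k. (cindex i j k, k)) ` ?S"
  unfolding pair_bar by (auto simp: contraction_def cindex_def doubleton_eq_iff)
 have 3: "{(k, m). k < m & {Bot k, Bot m} : bar ?c} = {(i, j)}"
  unfolding pair_bar using ij by (auto simp: contraction_def doubleton_eq_iff)
 have br: "bracket e \<omega> (p - 2) p (bar ?c) v L = e ^ crossings (bar ?c) * ((\<Prod>m<p - 2. \<omega> (?L m) (v m)) * \<omega> (L j) (L i))" for v
 proof -
  have "(\<Prod>(k, m)\<in>(%k. (cindex i j k, k)) ` ?S. \<omega> (L m) (v k)) = (\<Prod>k\<in>?S. \<omega> (L k) (v (cindex i j k)))"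
   by (subst prod.reindex) (auto simp: inj_on_def)
  also have "... = (\<Prod>k\<in>?S. \<omega> (?L (cindex i j k)) (v (cindex i j k)))"
  proof (rule prod.cong[OF refl])
   fix k assume "k : ?S"
   then have "the_inv_into ?S (cindex i j) (cindex i j k) = k"
    by (rule the_inv_into_f_f[OF bij_betw_imp_inj_on[OF bij_cindex[OF ij']]])
   then show "\<omega> (L k) (v (cindex i j k)) = \<omega> (?L (cindex i j k)) (v (cindex i j k))" by simp
  qed
  also have "... = (\<Prod>m<p - 2. \<omega> (?L m) (v m))"
   by (rule prod.reindex_bij_betw[OF bij_cindex[OF ij']])
  finally show ?thesis unfolding bracket_prod[OF c] 1 2 3 by (simp add: mult.assoc)
 qed
 have "ev p (dmap (p - 2) p (bar ?c) s) L = e ^ crossings (bar ?c) * (\<omega> (L j) (L i) *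
   (\<Sum>kp\<in>words {..<p - 2} n. (\<Prod>m<p - 2. \<omega> (?L m) (b (kp m))) * ev (p - 2) s (U o kp)))"
  unfolding ev_dmap[OF c s] br o_apply sum_distrib_left by (intro sum.cong refl) (simp only: mult_ac)
 then show ?thesis unfolding ev_expand[OF s, of ?L, symmetric] .
qed

lemma con_cindex:
 "con i j (ev p t) (%k. L (the_inv_into ({..<p} - {i, j}) (cindex i j) (cindex i j k))) = con i j (ev p t) L"
proof (rule con_cong)
 fix k assume "k < p" "k ~= i" "k ~= j"
 then have "the_inv_into ({..<p} - {i, j}) (cindex i j) (cindex i j k) = k"
  by (intro the_inv_into_f_f[OF bij_betw_imp_inj_on[OF bij_cindex[OF ij']]]) auto
 then show "L (the_inv_into ({..<p} - {i, j}) (cindex i j) (cindex i j k)) = L k" by simp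
qed

lemma dmap_contraction_zero_iff:
 assumes t: "t : tn p"
 shows "dmap p (p - 2) (contraction p i j) t = 0 \<longleftrightarrow> (\<forall>l. con i j (ev p t) l = 0)"
proof
 assume z: "dmap p (p - 2) (contraction p i j) t = 0"
 show "\<forall>l. con i j (ev p t) l = 0"
 proof
  fix L
  have "e ^ Suc (crossings (contraction p i j)) * con i j (ev p t) L = 0"
   using ev_dmap_contraction[OF t, of "%m. L (the_inv_into ({..<p} - {i, j}) (cindex i j) m)"]
   unfolding z ev_zero con_cindex[of t L] by (rule sym)
  then show "con i j (ev p t) L = 0" using e_nz by simp
 qed
next
 assume "\<forall>l. con i j (ev p t) l = 0"
 then show "dmap p (p - 2) (contraction p i j) t = 0"
  by (intro tensor_eqI[OF dmap_tensor[OF contraction_brauer[OF ij'] t] tensor_0])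
   (simp add: ev_dmap_contraction[OF t] ev_zero)
qed

end

lemma traceless_con:
 "t : N p \<longleftrightarrow> t : tn p & (\<forall>i j. i < j & j < p --> (\<forall>l. con i j (ev p t) l = 0))"
proof -
 have "F p (p - 2) (delta (contraction p i j)) t = dmap p (p - 2) (contraction p i j) t" if "i < j" "j < p" for i j
  by (rule F_delta, rule contraction_brauer) (use that in auto)
 then show ?thesis unfolding traceless_def using dmap_contraction_zero_iff[where t = t and p = p] by auto
qed

lemma traceless_tensor: "t : N p ==> t : tn p"
 by (simp add: traceless_def)

lemma con_traceless:
 assumes t: "t : N p" and ij: "i < p" "j < p" "i ~= j"
 shows "con i j (ev p t) l = 0"
proof (cases "i < j")
 case True
 then show ?thesis using t ij unfolding traceless_con by blast
next
 case False
 then have "j < i" using ij by simp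
 then have "con j i (ev p t) l = 0" using t ij unfolding traceless_con by blast
 then show ?thesis using con_swap[OF traceless_tensor[OF t] ij(2,1) ij(3)[symmetric], of l] by simp
qed

lemma dmap_add: "s : tn p ==> t : tn p ==> dmap p q f (s + t) = dmap p q f s + dmap p q f t"
 using dmap_linear[of p q f] unfolding linear_on_def by blast

lemma dmap_fscale: "t : tn p ==> dmap p q f (fscale c t) = fscale c (dmap p q f t)"
 using dmap_linear[of p q f] unfolding linear_on_def by blast

lemma dmap_zero: "dmap p q f 0 = 0"
 using dmap_fscale[OF tensor_0, of p q f 0] by (simp only: fscale_zero_left)

section \<open>The operator \<open>cas\<close> and its kernel\<close>

abbreviation "prs p \<equiv> {(i :: nat, j). i < j & j < p}"

text \<open>The exponent cancels the crossing signs of cap and cup together with the extra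
  \<open>e\<close> of \<open>ev_dmap_contraction\<close>, so that \<open>ev_cas\<close> is free of
  signs.\<close>

definition cas :: "nat => ('k, 'v) tensor => ('k, 'v) tensor" where
 "cas p t = (\<Sum>z\<in>prs p. fscale (e ^ Suc (crossings (contraction p (fst z) (snd z)) + crossings (bar (contraction p (fst z) (snd z)))))
   (dmap (p - 2) p (bar (contraction p (fst z) (snd z))) (dmap p (p - 2) (contraction p (fst z) (snd z)) t)))"

lemma cas_parts:
 assumes "z : prs p"
 shows "contraction p (fst z) (snd z) : brauer p (p - 2)" "bar (contraction p (fst z) (snd z)) : brauer (p - 2) p"
proof -
 show "contraction p (fst z) (snd z) : brauer p (p - 2)" by (rule contraction_brauer) (use assms in auto)
 then show "bar (contraction p (fst z) (snd z)) : brauer (p - 2) p" by (rule bar_brauer)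
qed

lemma cas_tensor: "t : tn p ==> cas p t : tn p"
 unfolding cas_def by (intro tensor_sum tensor_scale dmap_tensor cas_parts)

lemma cas_add: "s : tn p ==> t : tn p ==> cas p (s + t) = cas p s + cas p t"
 unfolding cas_def sum.distrib[symmetric]
 by (intro sum.cong refl) (simp only: dmap_add dmap_tensor cas_parts fscale_add_right)

lemma cas_scale: "t : tn p ==> cas p (fscale c t) = fscale c (cas p t)"
 unfolding cas_def fscale_sum_right
 by (intro sum.cong refl) (simp only: dmap_fscale dmap_tensor cas_parts fscale_fscale mult.commute)

lemma cas_linear: "linear_on (tn p) (cas p)"
 unfolding linear_on_def by (simp add: cas_add cas_scale)

lemma diff_fscale: "s - t = s + fscale (-1) t" for s :: "('k, 'v) tensor"
 by (rule ext) simp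

lemma cas_diff: "s : tn p ==> t : tn p ==> cas p (s - t) = cas p s - cas p t"
 unfolding diff_fscale by (simp only: cas_add cas_scale tensor_scale)

lemma cas_act:
 assumes g: "g : G" and t: "t : tn p"
 shows "cas p (tensor_act g t) = tensor_act g (cas p t)"
 unfolding cas_def act_sum act_scale
 by (intro sum.cong refl) (simp only: dmap_act[OF g] cas_parts t dmap_tensor)

lemma ev_cas:
 assumes t: "t : tn p"
 shows "ev p (cas p t) L = (\<Sum>z\<in>prs p. \<omega> (L (snd z)) (L (fst z)) * con (fst z) (snd z) (ev p t) L)"
 unfolding cas_def ev_sum ev_scale
proof (intro sum.cong refl)
 fix z assume z: "z : prs p"
 let ?i = "fst z" and ?j = "snd z"
 let ?c = "contraction p ?i ?j"
 have ij: "?i < ?j" "?j < p" using z by auto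
 have ek: "e ^ k * (e ^ k * x) = x" for k x
  using ee by (simp add: mult.assoc[symmetric] power_mult_distrib[symmetric])
 have "ev p (dmap (p - 2) p (bar ?c) (dmap p (p - 2) ?c t)) L =
   e ^ crossings (bar ?c) * (\<omega> (L ?j) (L ?i) * (e ^ Suc (crossings ?c) * con ?i ?j (ev p t) L))"
  unfolding ev_dmap_bar_contraction[OF ij dmap_tensor[OF cas_parts(1)[OF z] t]]
   ev_dmap_contraction[OF ij t] con_cindex[OF ij, of t L] by (rule refl)
 note br = this
 have eq: "e ^ Suc (u + v) * (e ^ v * (x * (e ^ Suc u * y))) = e ^ Suc u * (e ^ Suc u * (e ^ v * (e ^ v * (x * y))))"
  for u v x y by (simp add: power_add mult_ac)
 show "e ^ Suc (crossings ?c + crossings (bar ?c)) * ev p (dmap (p - 2) p (bar ?c) (dmap p (p - 2) ?c t)) L =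
   \<omega> (L ?j) (L ?i) * con ?i ?j (ev p t) L"
  unfolding br eq by (simp only: ek)
qed

lemma a_iota: "k < n ==> a (\<iota> k) = e * a k"
 using sym_e[of "b (\<iota> k)" "b k"] by (simp add: iota)

lemma b_U: "k < n ==> b k = scale (a k) (U (\<iota> k))"
 by (simp add: dual_family_def iota)

lemma w_UU: "x < n ==> y < n ==> \<omega> (U y) (U x) = of_bool (y = \<iota> x) * inverse (a (\<iota> x))"
proof -
 assume xy: "x < n" "y < n"
 have "\<omega> (U y) (U x) = inverse (a (\<iota> x)) * \<omega> (U y) (b (\<iota> x))"
  unfolding dual_family_def[of b \<iota> a x] by (rule w_scale_right)
 then show ?thesis using U_b[OF xy(2) iota(1)[OF xy(1)]] by simp
qed

lemma con_coord:
 assumes t: "t : tn p" and ij: "i < p" "j < p" "i ~= j"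
 shows "con i j (ev p t) (U o w) = e * (\<Sum>m<n. a m * ev p t (U o w(i := m, j := \<iota> m)))"
proof -
 have "con i j (ev p t) (U o w) = (\<Sum>k<n. a k * ev p t (U o w(i := \<iota> k, j := k)))"
  unfolding con_def
 proof (intro sum.cong refl)
  fix k assume "k : {..<n}"
  then have "(U o w)(i := b k, j := U k) = ((U o w)(j := U k))(i := scale (a k) (U (\<iota> k)))"
   using b_U[of k] ij(3) by (auto simp: fun_eq_iff)
  moreover have "((U o w)(j := U k))(i := U (\<iota> k)) = U o w(i := \<iota> k, j := k)"
   using ij(3) by (auto simp: fun_eq_iff)
  ultimately show "ev p t ((U o w)(i := b k, j := U k)) = a k * ev p t (U o w(i := \<iota> k, j := k))"
   using mlin_scale[OF tensor_mlin[OF t], of i "(U o w)(j := U k)" "a k" "U (\<iota> k)"] ij(1) by simp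
 qed
 also have "... = (\<Sum>m<n. a (\<iota> m) * ev p t (U o w(i := \<iota> (\<iota> m), j := \<iota> m)))"
 proof (rule sum.reindex_bij_betw[symmetric])
  show "bij_betw \<iota> {..<n} {..<n}" by (rule bij_betw_byWitness[where f' = \<iota>]) (auto simp: iota)
 qed
 also have "... = e * (\<Sum>m<n. a m * ev p t (U o w(i := m, j := \<iota> m)))"
  unfolding sum_distrib_left by (intro sum.cong refl) (simp add: a_iota iota mult.assoc)
 finally show ?thesis .
qed

lemma cas_coord:
 assumes t: "t : tn p" and w: "w : words {..<p} n"
 shows "ev p (cas p t) (U o w) = (\<Sum>z\<in>prs p. of_bool (w (snd z) = \<iota> (w (fst z))) *
   (inverse (a (w (fst z))) * (\<Sum>m<n. a m * ev p t (U o w(fst z := m, snd z := \<iota> m)))))"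
 unfolding ev_cas[OF t]
proof (intro sum.cong refl)
 fix z assume z: "z : prs p"
 then have ij: "fst z < p" "snd z < p" "fst z ~= snd z" by auto
 have w': "w (fst z) < n" "w (snd z) < n" using w ij by auto
 have "inverse (a (\<iota> (w (fst z)))) * (e * y) = inverse (a (w (fst z))) * y" for y
  unfolding a_iota[OF w'(1)] using e_cases by auto
 moreover have uu: "\<omega> ((U o w) (snd z)) ((U o w) (fst z)) =
   of_bool (w (snd z) = \<iota> (w (fst z))) * inverse (a (\<iota> (w (fst z))))"
  using w_UU[OF w'] by simp
 ultimately show "\<omega> ((U o w) (snd z)) ((U o w) (fst z)) * con (fst z) (snd z) (ev p t) (U o w) =
   of_bool (w (snd z) = \<iota> (w (fst z))) * (inverse (a (w (fst z))) * (\<Sum>m<n. a m * ev p t (U o w(fst z := m, snd z := \<iota> m))))"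
  unfolding con_coord[OF t ij] uu by (simp only: mult.assoc)
qed

text \<open>For symmetric forms the coordinates are rescaled by monomials in the \<open>a k\<close>, after which the
 operator \<open>cas\<close> has rational matrix entries.\<close>

definition rs :: "nat => rat" where "rs k = (if e = 1 then 1 else if a k = 1 then 1 else -1)"

definition dil :: "nat => (nat => nat) => 'k" where
 "dil p w = (if e = 1 then \<Prod>k<n. a k ^ (card {i : {..<p}. w i = k} div 2) else 1)"

lemma dil_nz: "dil p w ~= 0" by (simp add: dil_def iota)

lemma rs_sq: "rs k * rs k = 1" by (simp add: rs_def)

text \<open>For \<open>e = 1\<close> the two new letters are equal, so they raise the halved
  multiplicity of \<open>m\<close> by exactly one, whatever the parity of its other occurrences;
  \<open>D\<close> collects the letters at the other positions. For \<open>e = -1\<close> the signs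
  \<open>rs\<close> already equal the Gram entries.\<close>

lemma dil_upd:
 assumes ij: "i < p" "j < p" "i ~= j"
 obtains D where "D ~= 0" "!!m. m < n ==> of_rat (rs m) * dil p (w(i := m, j := \<iota> m)) = a m * D"
proof (cases "e = 1")
 case True
 define c where "c k = card {l : {..<p} - {i, j}. w l = k}" for k
 define D where "D = (\<Prod>k<n. a k ^ (c k div 2))"
 have "D ~= 0" by (simp add: D_def iota)
 moreover have "of_rat (rs m) * dil p (w(i := m, j := \<iota> m)) = a m * D" if m: "m < n" for m
 proof -
  have "card {l : {..<p}. (w(i := m, j := m)) l = k} = c k + (if k = m then 2 else 0)" for k
  proof -
   have "{l : {..<p}. (w(i := m, j := m)) l = k} = {l : {..<p} - {i, j}. w l = k} \<union> (if k = m then {i, j} else {})"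
    using ij by (auto split: if_splits)
   moreover have "card ({l : {..<p} - {i, j}. w l = k} \<union> (if k = m then {i, j} else {})) = c k + card (if k = m then {i, j} else {})"
    unfolding c_def by (rule card_Un_disjoint) (auto split: if_splits)
   ultimately show ?thesis using ij(3) by simp
  qed
  then have "dil p (w(i := m, j := \<iota> m)) = (\<Prod>k<n. a k ^ (c k div 2) * (if k = m then a k else 1))"
   using iota(4)[OF m True] True unfolding dil_def by (auto intro!: prod.cong)
  also have "... = D * a m" using m by (simp add: prod.distrib D_def prod.delta)
  moreover have "rs m = 1" unfolding rs_def using True by simp
  ultimately show ?thesis by (simp only: of_rat_1 mult_1 mult.commute)
 qed
 ultimately show ?thesis using that by blast
next
 case False
 then have e: "e = -1" using e_cases by simp
 have "of_rat (rs m) * dil p (w(i := m, j := \<iota> m)) = a m * 1" if "m < n" for m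
  using iota(5)[OF that e] False by (auto simp: rs_def dil_def)
 then show ?thesis using that[of 1] by simp
qed

lemma rational_traces_rs: "rational_traces n \<iota> rs 1"
 by unfold_locales (auto simp: iota rs_sq)

lemma dil_cas:
 assumes t: "t : tn p" and w: "w : words {..<p} n"
 shows "dil p w * ev p (cas p t) (U o w) = (\<Sum>z\<in>prs p. of_rat (of_bool (w (snd z) = \<iota> (w (fst z))) * rs (w (fst z))) *
   (\<Sum>m<n. of_rat (rs m) * (dil p (w(fst z := m, snd z := \<iota> m)) * ev p t (U o w(fst z := m, snd z := \<iota> m)))))"
 unfolding cas_coord[OF t w] sum_distrib_left[of _ _ "prs p"]
proof (intro sum.cong refl)
 fix z assume z: "z : prs p"
 let ?i = "fst z" and ?j = "snd z"
 have ij: "?i < p" "?j < p" "?i ~= ?j" using z by auto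
 let ?X = "%m. ev p t (U o w(?i := m, ?j := \<iota> m))" and ?x = "w ?i"
 have x: "?x < n" using w ij by auto
 show "dil p w * (of_bool (w ?j = \<iota> ?x) * (inverse (a ?x) * (\<Sum>m<n. a m * ?X m))) =
   of_rat (of_bool (w ?j = \<iota> ?x) * rs ?x) * (\<Sum>m<n. of_rat (rs m) * (dil p (w(?i := m, ?j := \<iota> m)) * ?X m))"
 proof (cases "w ?j = \<iota> ?x")
  case True
  obtain D where D: "D ~= 0" "!!m. m < n ==> of_rat (rs m) * dil p (w(?i := m, ?j := \<iota> m)) = a m * D"
   by (rule dil_upd[OF ij, where w = w]) (rule that; blast)
  have "w(?i := ?x, ?j := \<iota> ?x) = w" using True by (metis fun_upd_triv)
  then have "of_rat (rs ?x) * dil p w = a ?x * D" using D(2)[OF x] by simp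
  then have "of_rat (rs ?x * rs ?x) * dil p w = of_rat (rs ?x) * (a ?x * D)" by (simp add: of_rat_mult mult.assoc)
  then have dw: "dil p w = of_rat (rs ?x) * (a ?x * D)" by (simp add: rs_sq)
  have "(\<Sum>m<n. of_rat (rs m) * (dil p (w(?i := m, ?j := \<iota> m)) * ?X m)) = (\<Sum>m<n. D * (a m * ?X m))"
  proof (intro sum.cong refl)
   fix m assume "m : {..<n}"
   then have "of_rat (rs m) * dil p (w(?i := m, ?j := \<iota> m)) * ?X m = a m * D * ?X m" using D(2)[of m] by simp
   then show "of_rat (rs m) * (dil p (w(?i := m, ?j := \<iota> m)) * ?X m) = D * (a m * ?X m)" by (simp only: mult_ac)
  qed
  then have "(\<Sum>m<n. of_rat (rs m) * (dil p (w(?i := m, ?j := \<iota> m)) * ?X m)) = D * (\<Sum>m<n. a m * ?X m)"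
   by (simp only: sum_distrib_left)
  moreover have "a ?x * D * (inverse (a ?x) * Y) = D * Y" for Y using iota(3)[OF x] by simp
  ultimately show ?thesis using True unfolding dw by (simp add: mult.assoc)
 qed simp
qed

text \<open>After rescaling by \<open>dil\<close>, \<open>cas\<close> acts on coordinates through a
  rational matrix and hence commutes with rational functionals on the field.\<close>

lemma phi_cas:
 assumes \<phi>: "!!u v. \<phi> (u + v) = \<phi> u + \<phi> v" "!!q u. \<phi> (of_rat q * u) = q * \<phi> u"
  and t: "t : tn p" and w: "w : words {..<p} n"
 shows "\<phi> (dil p w * ev p (cas p t) (U o w)) = rational_traces.casq n p \<iota> rs 1 (%w. \<phi> (dil p w * ev p t (U o w))) w"
proof -
 interpret RT: rational_traces n p \<iota> rs 1 by (rule rational_traces_rs)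
 have \<phi>0: "\<phi> 0 = 0" using \<phi>(2)[of 0 0] by simp
 have \<phi>sum: "\<phi> (\<Sum>i\<in>A. f i) = (\<Sum>i\<in>A. \<phi> (f i))" for A and f :: "'z => 'k"
  by (induction A rule: infinite_finite_induct) (simp_all add: \<phi>(1) \<phi>0)
 have \<phi>sum2: "\<phi> (\<Sum>i\<in>A. f i) = (\<Sum>i\<in>A. \<phi> (f i))" for A and f :: "nat => 'k"
  by (induction A rule: infinite_finite_induct) (simp_all add: \<phi>(1) \<phi>0)
 have \<phi>sum3: "\<phi> (\<Sum>i\<in>A. f i) = (\<Sum>i\<in>A. \<phi> (f i))" for A and f :: "nat \<times> nat => 'k"
  by (induction A rule: infinite_finite_induct) (simp_all add: \<phi>(1) \<phi>0)
 show ?thesis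
  unfolding dil_cas[OF t w] \<phi>sum3 \<phi>(2) \<phi>sum2 RT.casq_def RT.trq_def RT.prs_def case_prod_unfold mult_1
  by (simp only: mult.assoc case_prod_unfold)
qed

lemma tensor_zeroI:
 assumes t: "t : tn p" and z: "!!w. w : words {..<p} n ==> ev p t (U o w) = 0"
 shows "t = 0"
proof -
 have "t = (\<Sum>kp\<in>words {..<p} n. fscale (ev p t (U o kp)) (pure scale (vlist p (b o kp))))"
  by (rule tensor_expand[OF t])
 also have "... = 0" by (intro sum.neutral ballI) (simp only: z fscale_zero_left)
 finally show ?thesis .
qed

text \<open>A nonzero coordinate would be detected by a rational functional, which turns the claim
  into \<open>casq_casq_zero\<close>.\<close>

lemma cas_cas_zero:
 assumes t: "t : tn p" and z: "cas p (cas p t) = 0"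
 shows "cas p t = 0"
proof (rule tensor_zeroI[OF cas_tensor[OF t]])
 interpret RT: rational_traces n p \<iota> rs 1 by (rule rational_traces_rs)
 fix w assume w: "w : words {..<p} n"
 show "ev p (cas p t) (U o w) = 0"
 proof (rule ccontr)
  assume "ev p (cas p t) (U o w) ~= 0"
  then have "dil p w * ev p (cas p t) (U o w) ~= 0" using dil_nz by simp
  then obtain \<phi> :: "'k => rat" where \<phi>: "!!u v. \<phi> (u + v) = \<phi> u + \<phi> v" "!!q u. \<phi> (of_rat q * u) = q * \<phi> u"
   "\<phi> (dil p w * ev p (cas p t) (U o w)) ~= 0" by (rule rational_functional) (rule that; simp)
  define x where "x w = \<phi> (dil p w * ev p t (U o w))" for w
  have xc: "\<phi> (dil p v * ev p (cas p t) (U o v)) = RT.casq x v" if "v : words {..<p} n" for v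
   unfolding x_def by (rule phi_cas[OF \<phi>(1,2) t that])
  have "RT.casq (RT.casq x) v = 0" if v: "v : words {..<p} n" for v
  proof -
   \<comment> \<open>\<open>casq\<close> reads its argument only at words, and there
     \<open>RT.casq x\<close> agrees with the functional of the coordinates of
     \<open>cas p t\<close>.\<close>
   have "RT.casq (RT.casq x) v = RT.casq (%w. \<phi> (dil p w * ev p (cas p t) (U o w))) v"
    unfolding RT.casq_def[of "RT.casq x"] RT.casq_def[of "%w. \<phi> (dil p w * ev p (cas p t) (U o w))"] RT.trq_def
   proof (intro arg_cong[where f = "(*) 1"] sum.cong refl)
    fix z assume "z : RT.prs"
    then obtain i j where zij: "z = (i, j)" "i < p" "j < p" by (auto simp: RT.prs_def)
    have eq: "RT.casq x (v(i := m, j := \<iota> m)) = \<phi> (dil p (v(i := m, j := \<iota> m)) * ev p (cas p t) (U o v(i := m, j := \<iota> m)))"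
     if "m < n" for m
     by (rule xc[symmetric]) (intro words_upd v, use zij that iota in auto)
    have "(\<Sum>m<n. rs m * RT.casq x (v(i := m, j := \<iota> m))) =
      (\<Sum>m<n. rs m * \<phi> (dil p (v(i := m, j := \<iota> m)) * ev p (cas p t) (U o v(i := m, j := \<iota> m))))"
     by (intro sum.cong refl) (simp only: eq lessThan_iff)
    then show "(case z of (i, j) => of_bool (v j = \<iota> (v i)) * (rs (v i) * (\<Sum>m<n. rs m * RT.casq x (v(i := m, j := \<iota> m))))) =
     (case z of (i, j) => of_bool (v j = \<iota> (v i)) * (rs (v i) * (\<Sum>m<n. rs m *
      \<phi> (dil p (v(i := m, j := \<iota> m)) * ev p (cas p t) (U o v(i := m, j := \<iota> m))))))"
     unfolding zij prod.case by (simp only:)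
   qed
   also have "... = \<phi> (dil p v * ev p (cas p (cas p t)) (U o v))"
    by (rule phi_cas[OF \<phi>(1,2) cas_tensor[OF t] v, symmetric])
   also have "... = 0" unfolding z ev_zero using \<phi>(2)[of 0 0] by simp
   finally show ?thesis .
  qed
  then have "RT.casq x w = 0" by (rule RT.casq_casq_zero[OF _ w])
  then show False using xc[OF w] \<phi>(3) by simp
 qed
qed

text \<open>That \<open>cas p t = 0\<close> forces every single contraction to vanish is positivity:
  \<open>casq_zero_trq\<close> on coordinates, followed by multilinear expansion to arbitrary
  labels.\<close>

lemma traceless_cas: "t : N p \<longleftrightarrow> t : tn p & cas p t = 0"
proof
 assume t: "t : N p"
 have "dmap p (p - 2) (contraction p (fst z) (snd z)) t = 0" if z: "z : prs p" for z
  using t that dmap_contraction_zero_iff[of "fst z" "snd z" p t] unfolding traceless_con by auto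
 then have "cas p t = 0" unfolding cas_def by (intro sum.neutral ballI) (simp only: dmap_zero fscale_zero_right)
 then show "t : tn p & cas p t = 0" using traceless_tensor[OF t] by simp
next
 assume "t : tn p & cas p t = 0"
 then have t: "t : tn p" and c0: "cas p t = 0" by auto
 interpret RT: rational_traces n p \<iota> rs 1 by (rule rational_traces_rs)
 have coord: "con i j (ev p t) (U o w) = 0" if ij: "i < j" "j < p" and w: "w : words {..<p} n" for i j w
 proof -
  have ij': "i < p" "j < p" "i ~= j" using ij by auto
  obtain D where D: "D ~= 0" "!!m. m < n ==> of_rat (rs m) * dil p (w(i := m, j := \<iota> m)) = a m * D"
   by (rule dil_upd[OF ij', where w = w]) (rule that; blast)
  let ?X = "%m. ev p t (U o w(i := m, j := \<iota> m))"
  have DX: "D * (\<Sum>m<n. a m * ?X m) = (\<Sum>m<n. of_rat (rs m) * (dil p (w(i := m, j := \<iota> m)) * ?X m))"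
   unfolding sum_distrib_left
  proof (intro sum.cong refl)
   fix m assume "m : {..<n}"
   then have "of_rat (rs m) * dil p (w(i := m, j := \<iota> m)) * ?X m = a m * D * ?X m" using D(2)[of m] by simp
   then show "D * (a m * ?X m) = of_rat (rs m) * (dil p (w(i := m, j := \<iota> m)) * ?X m)" by (simp only: mult_ac)
  qed
  have "(\<Sum>m<n. a m * ?X m) = 0"
  proof (rule ccontr)
   assume "(\<Sum>m<n. a m * ?X m) ~= 0"
   then have "D * (\<Sum>m<n. a m * ?X m) ~= 0" using D(1) by simp
   then obtain \<phi> :: "'k => rat" where \<phi>: "!!u v. \<phi> (u + v) = \<phi> u + \<phi> v" "!!q u. \<phi> (of_rat q * u) = q * \<phi> u"
    "\<phi> (D * (\<Sum>m<n. a m * ?X m)) ~= 0" by (rule rational_functional) (rule that; simp)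
   have \<phi>0: "\<phi> 0 = 0" using \<phi>(2)[of 0 0] by simp
   have \<phi>sum: "\<phi> (\<Sum>i\<in>A. f i) = (\<Sum>i\<in>A. \<phi> (f i))" for A and f :: "nat => 'k"
    by (induction A rule: infinite_finite_induct) (simp_all add: \<phi>(1) \<phi>0)
   define x where "x w = \<phi> (dil p w * ev p t (U o w))" for w
   have "RT.casq x v = 0" if v: "v : words {..<p} n" for v
    using phi_cas[OF \<phi>(1,2) t v] unfolding x_def c0 ev_zero mult_zero_right \<phi>0 by simp
   then have "RT.trq i j x w = 0" by (rule RT.casq_zero_trq[OF _ ij w])
   then have "\<phi> (D * (\<Sum>m<n. a m * ?X m)) = 0"
    unfolding DX \<phi>sum \<phi>(2) RT.trq_def x_def .
   then show False using \<phi>(3) by simp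
  qed
  then show ?thesis unfolding con_coord[OF t ij'] by simp
 qed
 have "con i j (ev p t) l = 0" if ij: "i < j" "j < p" for i j l
 proof -
  have ij': "i < p" "j < p" "i ~= j" using ij by auto
  let ?S = "{..<p} - {i, j}"
  have ml: "mlin ?S (con i j (ev p t))" by (rule con_mlin[OF tensor_mlin[OF t] ij'(3)])
  have "con i j (ev p t) l = (\<Sum>kp\<in>PiE ?S (%_. {..<n}). (\<Prod>i\<in>?S. \<omega> (l i) (b (kp i))) * con i j (ev p t) (spread ?S (U o kp) l))"
   by (rule mlin_expand[of "%k u. \<omega> u (b k)" U]) (rule expand_U, simp, rule ml)
  also have "... = 0"
  proof (intro sum.neutral ballI)
   fix kp assume kp: "kp : PiE ?S (%_. {..<n})"
   show "(\<Prod>i\<in>?S. \<omega> (l i) (b (kp i))) * con i j (ev p t) (spread ?S (U o kp) l) = 0"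
   proof (cases "n = 0")
    case True
    then show ?thesis unfolding con_def by simp
   next
    case False
    \<comment> \<open>The contraction overwrites the letters at \<open>i\<close> and
      \<open>j\<close>; the filler 0 is a letter because \<open>n\<close> is positive here.\<close>
    define w where "w = (\<lambda>k\<in>{..<p}. if k : ?S then kp k else 0)"
    have w: "w : words {..<p} n"
     unfolding w_def using kp False by (auto simp: PiE_def Pi_def)
    have "con i j (ev p t) (spread ?S (U o kp) l) = con i j (ev p t) (U o w)"
     by (rule con_cong) (auto simp: spread_def w_def)
    then show ?thesis using coord[OF ij w] by simp
   qed
  qed
  finally show ?thesis .
 qed
 then show "t : N p" unfolding traceless_con using t by blast
qed

text \<open>Then \<open>t - cas p z\<close> is traceless: this is the splitting of the tensor power
  into kernel and image of \<open>cas p\<close>.\<close>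

lemma cas_decomp:
 assumes t: "t : tn p"
 shows "\<exists>z\<in>tn p. cas p t = cas p (cas p z)"
proof -
 define P where "P kp = pure scale (vlist p (b o kp))" for kp :: "nat => nat"
 let ?S = "P ` words {..<p} n"
 \<comment> \<open>\<open>fitting\<close> asks for a map that is linear on the whole function space;
   the coordinate formula extends \<open>cas p\<close> from tensors to such a map.\<close>
 define A where "A t = (\<Sum>kp\<in>words {..<p} n. fscale (ev p t (U o kp)) (cas p (P kp)))" for t
 have Pt: "P kp : tn p" for kp unfolding P_def by (rule pure_tensor) simp
 have A: "A t = cas p t" if "t : tn p" for t
 proof -
  have "cas p t = cas p (\<Sum>kp\<in>words {..<p} n. fscale (ev p t (U o kp)) (P kp))"
   unfolding P_def by (rule arg_cong[OF tensor_expand[OF that]])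
  also have "... = A t" unfolding A_def by (rule linear_on_sum[OF cas_linear Pt])
  finally show ?thesis by simp
 qed
 have span1: "s : FS.span ?S" if "s : tn p" for s
 proof -
  have "(\<Sum>kp\<in>words {..<p} n. fscale (ev p s (U o kp)) (P kp)) : FS.span ?S"
   by (intro FS.span_sum FS.span_scale FS.span_base imageI)
  then show ?thesis using tensor_expand[OF that] unfolding P_def by simp
 qed
 have span2: "s : tn p" if "s : FS.span ?S" for s
 proof -
  have "FS.span ?S \<subseteq> tn p"
   by (rule FS.span_minimal) (use Pt in \<open>auto intro!: FS.subspaceI simp: tensor_0 tensor_add tensor_scale\<close>)
  then show ?thesis using that by auto
 qed
 have "\<exists>z\<in>FS.span ?S. A t = A (A z)"
 proof (rule fitting)
  show "A (s + t) = A s + A t" for s t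
   unfolding A_def ev_add fscale_add by (rule sum.distrib)
  show "A (fscale c t) = fscale c (A t)" for c t
   unfolding A_def ev_scale fscale_sum_right fscale_fscale ..
  show "finite ?S" by (simp add: finite_words)
  show "A s : FS.span ?S" if "s : ?S" for s
  proof -
   have "s : tn p" using that Pt by auto
   then show ?thesis using span1[OF cas_tensor] A by simp
  qed
  show "A s = 0" if "s : FS.span ?S" "A (A s) = 0" for s
   using cas_cas_zero[OF span2[OF that(1)]] that(2) A[OF span2[OF that(1)]] A[OF cas_tensor[OF span2[OF that(1)]]] by simp
  show "t : FS.span ?S" by (rule span1[OF t])
 qed
 then obtain z where z: "z : FS.span ?S" "A t = A (A z)" by blast
 then have "cas p t = cas p (cas p z)"
  using A[OF t] A[OF span2[OF z(1)]] A[OF cas_tensor[OF span2[OF z(1)]]] by simp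
 then show ?thesis using span2[OF z(1)] by blast
qed

text \<open>The subtracted term does not depend on the choice of \<open>z\<close>, since
  \<open>cas p\<close> is injective on its image.\<close>

definition proj :: "nat => ('k, 'v) tensor => ('k, 'v) tensor" where
 "proj p = restrict (%t. t - cas p (SOME z. z : tn p & cas p t = cas p (cas p z))) (tn p)"

lemma traceless_add: "s : N p ==> t : N p ==> s + t : N p"
 unfolding traceless_cas by (simp add: tensor_add cas_add)

lemma traceless_scale: "t : N p ==> fscale c t : N p"
 unfolding traceless_cas by (simp only: tensor_scale cas_scale fscale_zero_right simp_thms)

lemma traceless_0: "0 : N p"
 using traceless_cas[of 0 p] cas_scale[OF tensor_0, of p 0] by (simp only: tensor_0 fscale_zero_left simp_thms)

lemma traceless_act: "g : G ==> t : N p ==> tensor_act g t : N p"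
 unfolding traceless_cas by (simp add: act_tensor cas_act act_zero)

lemma proj_decomp:
 assumes t: "t : tn p"
 obtains z where "z : tn p" "proj p t : N p" "t = proj p t + cas p z"
proof -
 define z where "z = (SOME z. z : tn p & cas p t = cas p (cas p z))"
 have "\<exists>z. z : tn p & cas p t = cas p (cas p z)" using cas_decomp[OF t] by blast
 from someI_ex[OF this] have "z : tn p & cas p t = cas p (cas p z)" unfolding z_def .
 then have z: "z : tn p" "cas p t = cas p (cas p z)" by auto
 have p: "proj p t = t - cas p z" using t by (simp add: proj_def z_def)
 have "proj p t : N p"
  unfolding traceless_cas p using z t by (simp add: tensor_diff cas_tensor cas_diff)
 then show ?thesis using that[OF z(1)] p by simp
qed

lemma proj_eqI:
 assumes y: "y : N p" and z: "z : tn p"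
 shows "proj p (y + cas p z) = y"
proof -
 let ?t = "y + cas p z"
 have yt: "y : tn p" "cas p y = 0" using y unfolding traceless_cas by auto
 have t: "?t : tn p" by (intro tensor_add yt cas_tensor z)
 obtain z' where z': "z' : tn p" "proj p ?t : N p" "?t = proj p ?t + cas p z'"
  by (rule proj_decomp[OF t])
 have pt: "proj p ?t : tn p" "cas p (proj p ?t) = 0" using z'(2) unfolding traceless_cas by auto
 have eq: "cas p (z - z') = proj p ?t - y"
  using z'(3) by (simp add: cas_diff z z'(1) algebra_simps)
 then have "cas p (cas p (z - z')) = 0" by (simp add: cas_diff pt yt)
 then have "cas p (z - z') = 0" by (rule cas_cas_zero[OF tensor_diff[OF z z'(1)]])
 then show ?thesis using eq by simp
qed

lemma proj_traceless: "t : tn p ==> proj p t : N p"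
 by (rule proj_decomp)

lemma proj_id: "t : N p ==> proj p t = t"
 using proj_eqI[of t p 0] cas_scale[OF tensor_0, of p 0] by (simp add: tensor_0 fscale_zero_left)

lemma proj_linear: "linear_on (tn p) (proj p)"
 unfolding linear_on_def
proof (intro conjI ballI allI)
 fix s t assume s: "s : tn p" and t: "t : tn p"
 obtain z where z: "z : tn p" "proj p s : N p" "s = proj p s + cas p z" by (rule proj_decomp[OF s])
 obtain z' where z': "z' : tn p" "proj p t : N p" "t = proj p t + cas p z'" by (rule proj_decomp[OF t])
 have "s + t = (proj p s + cas p z) + (proj p t + cas p z')" using z(3) z'(3) by simp
 also have "... = (proj p s + proj p t) + cas p (z + z')" by (simp add: cas_add z(1) z'(1))
 finally show "proj p (s + t) = proj p s + proj p t"
  using proj_eqI[OF traceless_add[OF z(2) z'(2)] tensor_add[OF z(1) z'(1)]] by simp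
next
 fix c t assume t: "t : tn p"
 obtain z where z: "z : tn p" "proj p t : N p" "t = proj p t + cas p z" by (rule proj_decomp[OF t])
 have "fscale c t = fscale c (proj p t + cas p z)" using z(3) by simp
 also have "... = fscale c (proj p t) + cas p (fscale c z)" by (simp only: cas_scale z(1) fscale_add_right)
 finally show "proj p (fscale c t) = fscale c (proj p t)"
  using proj_eqI[OF traceless_scale[OF z(2)] tensor_scale[OF z(1)]] by simp
qed

lemma proj_add: "s : tn p ==> t : tn p ==> proj p (s + t) = proj p s + proj p t"
 and proj_scale: "t : tn p ==> proj p (fscale c t) = fscale c (proj p t)"
 using proj_linear[of p] unfolding linear_on_def by blast+

lemma proj_act:
 assumes g: "g : G" and t: "t : tn p"
 shows "proj p (tensor_act g t) = tensor_act g (proj p t)"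
proof -
 obtain z where z: "z : tn p" "proj p t : N p" "t = proj p t + cas p z" by (rule proj_decomp[OF t])
 have "tensor_act g t = tensor_act g (proj p t + cas p z)" using z(3) by simp
 also have "... = tensor_act g (proj p t) + cas p (tensor_act g z)" by (simp only: act_add cas_act[OF g z(1)])
 finally show ?thesis using proj_eqI[OF traceless_act[OF g z(2)] act_tensor[OF g z(1)]] by simp
qed

section \<open>Equivariant maps into traceless tensors\<close>

lemma equivariant_zero:
 assumes lin: "linear_on (tn m) L" and L: "!!s. s : tn m ==> L s : N p"
  and act: "!!g s. g : G ==> s : tn m ==> L (tensor_act g s) = tensor_act g (L s)"
  and mp: "m < p" and s: "s : tn m"
 shows "L s = 0"
proof -
 define P where "P v = pure scale (vlist m v)" for v :: "nat => 'v"
 have Pt: "P v : tn m" for v unfolding P_def by (rule pure_tensor) simp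
 have LP: "L (P v) : tn p" for v by (rule traceless_tensor[OF L[OF Pt]])
 have P_lin: "P (v(i := x + scale c y)) = P (v(i := x)) + fscale c (P (v(i := y)))" if i: "i < m" for v i x c y
 proof (rule tensor_eqI[OF Pt tensor_add[OF Pt tensor_scale[OF Pt]]])
  fix l
  have pr: "ev m (P (v(i := z))) l = \<omega> (l i) z * (\<Prod>k\<in>{..<m} - {i}. \<omega> (l k) (v k))" for z
  proof -
   have "ev m (P (v(i := z))) l = \<omega> (l i) z * (\<Prod>k\<in>{..<m} - {i}. \<omega> (l k) ((v(i := z)) k))"
    unfolding P_def ev_pure using prod.remove[of "{..<m}" i "%k. \<omega> (l k) ((v(i := z)) k)"] i by simp
   also have "(\<Prod>k\<in>{..<m} - {i}. \<omega> (l k) ((v(i := z)) k)) = (\<Prod>k\<in>{..<m} - {i}. \<omega> (l k) (v k))"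
    by (rule prod.cong) auto
   finally show ?thesis .
  qed
  show "ev m (P (v(i := x + scale c y))) l = ev m (P (v(i := x)) + fscale c (P (v(i := y)))) l"
   unfolding ev_add ev_scale pr w_add_right w_scale_right by (simp only: distrib_right mult.assoc)
 qed
 \<comment> \<open>Left slots are fed to \<open>L\<close> as a pure tensor, right slots evaluate the
   result. Tracelessness of the values of \<open>L\<close> concerns the right slots, which outnumber
   the left ones.\<close>
 define \<Theta> where "\<Theta> l = ev p (L (P (l o Inl))) (l o Inr)" for l :: "nat + nat => 'v"
 let ?A = "Inl ` {..<m} :: (nat + nat) set" and ?P = "Inr ` {..<p} :: (nat + nat) set"
 have upd: "(l(Inl i := x)) o Inl = (l o Inl)(i := x)" "(l(Inl i := x)) o Inr = l o Inr"
  "(l(Inr i := x)) o Inr = (l o Inr)(i := x)" "(l(Inr i := x)) o Inl = l o Inl" for l :: "nat + nat => 'v" and i x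
  by auto
 have "\<Theta> = (%_. 0)"
 proof (rule invariant_traceless_zero[of ?A ?P])
  show "finite ?A" "finite ?P" "?A \<inter> ?P = {}" by auto
  show "card ?A < card ?P" using mp by (simp add: card_image)
  show "mlin (?A \<union> ?P) \<Theta>"
   unfolding mlin_def
  proof (intro ballI allI)
   fix z l x y c assume "z : ?A \<union> ?P"
   then consider i where "z = Inl i" "i < m" | i where "z = Inr i" "i < p" by auto
   then show "\<Theta> (l(z := x + scale c y)) = \<Theta> (l(z := x)) + c * \<Theta> (l(z := y))"
   proof cases
    case 1
    have "L (P ((l o Inl)(i := x + scale c y))) = L (P ((l o Inl)(i := x))) + fscale c (L (P ((l o Inl)(i := y))))"
     unfolding P_lin[OF 1(2)] using lin Pt tensor_scale[OF Pt] unfolding linear_on_def by simp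
    then show ?thesis unfolding \<Theta>_def 1(1) upd by (simp only: ev_add ev_scale)
   next
    case 2
    show ?thesis unfolding \<Theta>_def 2(1) upd by (rule mlinD[OF tensor_mlin[OF LP]]) (use 2(2) in simp)
   qed
  qed
  show "supported (?A \<union> ?P) \<Theta>"
   unfolding supported_def
  proof (intro allI impI)
   fix l l' :: "nat + nat => 'v" assume eq: "\<forall>i\<in>?A \<union> ?P. l i = l' i"
   then have "vlist m (l o Inl) = vlist m (l' o Inl)" by (auto simp: vlist_def)
   moreover have "ev p t (l o Inr) = ev p t (l' o Inr)" for t by (rule ev_cong) (use eq in auto)
   ultimately show "\<Theta> l = \<Theta> l'" by (simp add: \<Theta>_def P_def)
  qed
  show "invariant \<Theta>"
   unfolding invariant_def
  proof (intro ballI allI)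
   fix g and l :: "nat + nat => 'v" assume g: "g : G"
   have "P ((g o l) o Inl) = tensor_act g (P (l o Inl))"
    unfolding P_def act_pure[OF g] by (simp add: vlist_def comp_assoc)
   then have "\<Theta> (g o l) = ev p (tensor_act g (L (P (l o Inl)))) ((g o l) o Inr)"
    unfolding \<Theta>_def using act[OF g Pt] by simp
   also have "... = ev p (L (P (l o Inl))) (iv g o ((g o l) o Inr))" by (rule ev_act[OF g])
   also have "iv g o ((g o l) o Inr) = l o Inr" using isometry_inv(3)[OF g] by (auto simp: fun_eq_iff)
   finally show "\<Theta> (g o l) = \<Theta> l" by (simp only: \<Theta>_def)
  qed
  fix z z' l assume "z : ?P" "z' : ?P" "z ~= z'"
  then obtain i j where ij: "z = Inr i" "z' = Inr j" "i < p" "j < p" "i ~= j" by auto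
  have "con z z' \<Theta> l = con i j (ev p (L (P (l o Inl)))) (l o Inr)"
   unfolding con_def \<Theta>_def ij(1,2) upd ..
  then show "con z z' \<Theta> l = 0" using con_traceless[OF L[OF Pt] ij(3-5)] by simp
 qed
 then have \<Theta>0: "\<Theta> l = 0" for l by simp
 have "L (P v) = 0" for v
 proof (rule tensor_eqI[OF LP tensor_0])
  fix l
  have "\<Theta> (case_sum v l) = ev p (L (P v)) l" unfolding \<Theta>_def by (simp add: comp_def)
  then show "ev p (L (P v)) l = ev p 0 l" using \<Theta>0 by (simp add: ev_zero)
 qed
 then have "L (pure scale vs) = 0" if "length vs = m" for vs
  using vlist_nth[OF that] unfolding P_def by metis
 then show ?thesis
  by (intro linear_on_eq[OF lin _ _ s, of "%_. 0"]) (simp_all add: linear_on_def fscale_zero_right)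
qed

text \<open>Formulated for any equivariant map into the traceless tensors, as it serves the
  uniqueness of the projection as well as \<open>proj\<close> itself.\<close>

lemma equivariant_dmap_bar_zero:
 assumes lin: "linear_on (tn p) \<pi>" and im: "\<pi> ` tn p \<subseteq> N p"
  and act: "\<forall>g\<in>G. \<forall>t\<in>tn p. \<pi> (tensor_act g t) = tensor_act g (\<pi> t)"
  and d: "d : brauer m p" and mp: "m < p" and s: "s : tn m"
 shows "\<pi> (dmap m p d s) = 0"
proof (rule equivariant_zero[where L = "%s. \<pi> (dmap m p d s)", OF _ _ _ mp s])
 show "linear_on (tn m) (%s. \<pi> (dmap m p d s))"
  using lin unfolding linear_on_def by (simp add: dmap_add dmap_fscale dmap_tensor[OF d])
 show "\<pi> (dmap m p d s) : N p" if "s : tn m" for s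
  using im dmap_tensor[OF d that] by auto
 show "\<pi> (dmap m p d (tensor_act g s)) = tensor_act g (\<pi> (dmap m p d s))" if "g : G" "s : tn m" for g s
  using act dmap_act[OF that(1) d that(2)] that(1) dmap_tensor[OF d that(2)] by simp
qed

text \<open>Each summand of \<open>cas p\<close> factors through \<open>p - 2\<close> slots, so
  every equivariant projection kills the image of \<open>cas p\<close> and is fixed by its values on
  traceless tensors.\<close>

lemma traceless_proj_eq: "traceless_proj scale \<omega> e p = proj p"
proof -
 let ?Q = "%\<pi>. \<pi> : extensional (tn p) & linear_on (tn p) \<pi> &
   \<pi> ` tn p \<subseteq> N p & (\<forall>t\<in>N p. \<pi> t = t) &
   (\<forall>g\<in>G. \<forall>t\<in>tn p. \<pi> (tensor_act g t) = tensor_act g (\<pi> t))"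
 have P0: "?Q (proj p)"
  using proj_linear proj_traceless proj_id proj_act by (auto simp: proj_def)
 have uniq: "\<pi> = proj p" if Q: "?Q \<pi>" for \<pi>
 proof (rule extensionalityI)
  show "\<pi> : extensional (tn p)" "proj p : extensional (tn p)" using Q P0 by auto
  fix t assume t: "t : tn p"
  obtain z where z: "z : tn p" "proj p t : N p" "t = proj p t + cas p z" by (rule proj_decomp[OF t])
  have "\<pi> (cas p z) = 0"
   unfolding cas_def
  proof (subst linear_on_sum[of p])
   show "linear_on (tn p) \<pi>" using Q by simp
   show "dmap (p - 2) p (bar (contraction p (fst y) (snd y))) (dmap p (p - 2) (contraction p (fst y) (snd y)) z) : tn p"
    if "y : prs p" for y
    by (intro dmap_tensor cas_parts[OF that] z)
   show "(\<Sum>y\<in>prs p. fscale (e ^ Suc (crossings (contraction p (fst y) (snd y)) + crossings (bar (contraction p (fst y) (snd y)))))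
     (\<pi> (dmap (p - 2) p (bar (contraction p (fst y) (snd y))) (dmap p (p - 2) (contraction p (fst y) (snd y)) z)))) = 0"
   proof (intro sum.neutral ballI)
    fix y assume y: "y : prs p"
    have "\<pi> (dmap (p - 2) p (bar (contraction p (fst y) (snd y))) (dmap p (p - 2) (contraction p (fst y) (snd y)) z)) = 0"
    proof (rule equivariant_dmap_bar_zero)
     show "linear_on (tn p) \<pi>" "\<pi> ` tn p \<subseteq> N p"
      "\<forall>g\<in>G. \<forall>t\<in>tn p. \<pi> (tensor_act g t) = tensor_act g (\<pi> t)" using Q by auto
     show "bar (contraction p (fst y) (snd y)) : brauer (p - 2) p" by (rule cas_parts(2)[OF y])
     show "p - 2 < p" using y by auto
     show "dmap p (p - 2) (contraction p (fst y) (snd y)) z : tn (p - 2)"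
      by (intro dmap_tensor cas_parts[OF y] z)
    qed
    then show "fscale (e ^ Suc (crossings (contraction p (fst y) (snd y)) + crossings (bar (contraction p (fst y) (snd y)))))
     (\<pi> (dmap (p - 2) p (bar (contraction p (fst y) (snd y))) (dmap p (p - 2) (contraction p (fst y) (snd y)) z))) = 0"
     by (simp only: fscale_zero_right)
   qed
  qed
  moreover have "\<pi> (proj p t + cas p z) = \<pi> (proj p t) + \<pi> (cas p z)"
   using Q traceless_tensor[OF z(2)] cas_tensor[OF z(1)] unfolding linear_on_def by blast
  ultimately show "\<pi> t = proj p t" using z(2,3) Q by simp
 qed
 show ?thesis
  unfolding traceless_proj_def by (rule the_equality) (rule P0, rule uniq, assumption)
qed

lemma proj_dmap_less:
 assumes "d : brauer m p" "m < p" "s : tn m"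
 shows "proj p (dmap m p d s) = 0"
 by (rule equivariant_dmap_bar_zero[OF proj_linear _ _ assms]) (auto simp: proj_traceless proj_act)

text \<open>A pair of bottom points makes \<open>d\<close> factor through \<open>p - 2\<close>
  slots.\<close>

lemma proj_not_downward:
 assumes d: "d : brauer q p" "d \<notin> downward q p" and s: "s : tn q"
 shows "proj p (dmap q p d s) = 0"
proof -
 obtain i j where pr: "{Bot i, Bot j} : d" using d by (auto simp: downward_def)
 have part: "partition_on (Top ` {..<q} \<union> Bot ` {..<p}) d" "card {Bot i, Bot j} = 2"
  using d(1) pr by (auto simp: brauer_def)
 have "{Bot i, Bot j} \<subseteq> Top ` {..<q} \<union> Bot ` {..<p}" using partition_onD1[OF part(1)] pr by blast
 then have ij: "i < p" "j < p" "i ~= j" using part(2) by auto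
 let ?c = "contraction p i j"
 have c: "?c : brauer p (p - 2)" by (rule contraction_brauer[OF ij])
 have bc: "bar ?c : brauer (p - 2) p" by (rule bar_brauer[OF c])
 have cd: "dcomp ?c d : brauer q (p - 2)" by (rule dcomp_brauer[OF c d(1)])
 have "dmap (p - 2) p (bar ?c) (dmap q (p - 2) (dcomp ?c d) s) = dmap q p d s"
  unfolding dmap_dcomp[OF bc cd s] loops_upward[OF bar_contraction_upward[OF ij] cd] dcomp_contraction_bot[OF ij d(1) pr]
  by (simp only: power_0 fscale_one)
 moreover have "p - 2 < p" using ij by auto
 ultimately show ?thesis using proj_dmap_less[OF bc _ dmap_tensor[OF cd s]] by simp
qed

lemma dmap_traceless_contraction:
 assumes t: "t : N p" and ij: "i < p" "j < p" "i ~= j"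
 shows "dmap p (p - 2) (contraction p i j) t = 0"
proof (cases "i < j")
 case True
 show ?thesis
  using con_traceless[OF t ij] dmap_contraction_zero_iff[OF True ij(2) traceless_tensor[OF t]] by blast
next
 case False
 then have ji: "j < i" using ij by simp
 have "contraction p i j = contraction p j i" unfolding contraction_def by (simp add: insert_commute conj_commute)
 then show ?thesis
  using con_traceless[OF t ij(2,1)] ij(3) dmap_contraction_zero_iff[OF ji ij(1) traceless_tensor[OF t]] by auto
qed

text \<open>A pair of top points makes \<open>d\<close> begin with a contraction.\<close>

lemma traceless_not_upward:
 assumes d: "d : brauer p q" "d \<notin> upward p q" and t: "t : N p"
 shows "dmap p q d t = 0"
proof -
 obtain i j where pr: "{Top i, Top j} : d" using d by (auto simp: upward_def)
 have part: "partition_on (Top ` {..<p} \<union> Bot ` {..<q}) d" "card {Top i, Top j} = 2"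
  using d(1) pr by (auto simp: brauer_def)
 have "{Top i, Top j} \<subseteq> Top ` {..<p} \<union> Bot ` {..<q}" using partition_onD1[OF part(1)] pr by blast
 then have ij: "i < p" "j < p" "i ~= j" using part(2) by auto
 let ?c = "contraction p i j"
 have c: "?c : brauer p (p - 2)" by (rule contraction_brauer[OF ij])
 have bc: "bar ?c : brauer (p - 2) p" by (rule bar_brauer[OF c])
 have dc: "dcomp d (bar ?c) : brauer (p - 2) q" by (rule dcomp_brauer[OF d(1) bc])
 have "dmap p q d t = dmap (p - 2) q (dcomp d (bar ?c)) (dmap p (p - 2) ?c t)"
  unfolding dmap_dcomp[OF dc c traceless_tensor[OF t]] loops_downward[OF dc contraction_downward[OF ij]]
   dcomp_contraction_top[OF ij d(1) pr]
  by (simp only: power_0 fscale_one)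
 then show ?thesis by (simp only: dmap_traceless_contraction[OF t ij] dmap_zero)
qed

text \<open>Contracting a permuted tensor is the action of a diagram with fewer bottom than top
  points, and such a diagram is never upward.\<close>

lemma perm_traceless:
 assumes \<sigma>: "\<sigma> permutes {..<p}" and t: "t : N p"
 shows "dmap p p (pd p \<sigma>) t : N p"
proof -
 note P = perm_diagram_brauer[OF \<sigma>]
 have tt: "dmap p p (pd p \<sigma>) t : tn p" by (rule dmap_tensor[OF P traceless_tensor[OF t]])
 have "dmap p (p - 2) (contraction p i j) (dmap p p (pd p \<sigma>) t) = 0" if ij: "i < j" "j < p" for i j
 proof -
  have ij': "i < p" "j < p" "i ~= j" using ij by auto
  have c: "contraction p i j : brauer p (p - 2)" by (rule contraction_brauer[OF ij'])
  have cd: "dcomp (contraction p i j) (pd p \<sigma>) : brauer p (p - 2)" by (rule dcomp_brauer[OF c P])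
  have "dcomp (contraction p i j) (pd p \<sigma>) \<notin> upward p (p - 2)" using upward_le[of _ p "p - 2"] ij by fastforce
  from traceless_not_upward[OF cd this t] show ?thesis
   unfolding dmap_dcomp[OF c P traceless_tensor[OF t]] by (simp only: fscale_zero_right)
 qed
 then show ?thesis unfolding traceless_con using tt dmap_contraction_zero_iff[OF _ _ tt] by blast
qed

text \<open>On traceless tensors both sides agree. The image of \<open>cas p\<close> goes to zero,
  as a permuted cup still factors through \<open>p - 2\<close> slots.\<close>

lemma proj_perm:
 assumes \<sigma>: "\<sigma> permutes {..<p}" and t: "t : tn p"
 shows "proj p (dmap p p (pd p \<sigma>) t) = dmap p p (pd p \<sigma>) (proj p t)"
proof -
 note P = perm_diagram_brauer[OF \<sigma>]
 let ?s = "dmap p p (pd p \<sigma>)"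
 obtain z where z: "z : tn p" "proj p t : N p" "t = proj p t + cas p z" by (rule proj_decomp[OF t])
 have "linear_on (tn p) (%x. proj p (?s x))"
  unfolding linear_on_def by (simp add: proj_add proj_scale dmap_add dmap_fscale dmap_tensor[OF P])
 note lin = linear_on_sum[OF this]
 have c0: "proj p (?s (cas p z)) = 0"
  unfolding cas_def
 proof (subst lin)
  show "dmap (p - 2) p (bar (contraction p (fst y) (snd y))) (dmap p (p - 2) (contraction p (fst y) (snd y)) z) : tn p"
   if "y : prs p" for y
   by (intro dmap_tensor cas_parts[OF that] z)
  show "(\<Sum>y\<in>prs p. fscale (e ^ Suc (crossings (contraction p (fst y) (snd y)) + crossings (bar (contraction p (fst y) (snd y)))))
    (proj p (?s (dmap (p - 2) p (bar (contraction p (fst y) (snd y))) (dmap p (p - 2) (contraction p (fst y) (snd y)) z))))) = 0"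
  proof (intro sum.neutral ballI)
   fix y assume y: "y : prs p"
   let ?c = "contraction p (fst y) (snd y)"
   have cz: "dmap p (p - 2) ?c z : tn (p - 2)" by (intro dmap_tensor cas_parts[OF y] z)
   have lt: "p - 2 < p" using y by auto
   have "proj p (?s (dmap (p - 2) p (bar ?c) (dmap p (p - 2) ?c z))) = 0"
    unfolding dmap_dcomp[OF P cas_parts(2)[OF y] cz]
     proj_scale[OF dmap_tensor[OF dcomp_brauer[OF P cas_parts(2)[OF y]] cz]]
     proj_dmap_less[OF dcomp_brauer[OF P cas_parts(2)[OF y]] lt cz] by (rule fscale_zero_right)
   then show "fscale (e ^ Suc (crossings ?c + crossings (bar ?c))) (proj p (?s (dmap (p - 2) p (bar ?c) (dmap p (p - 2) ?c z)))) = 0"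
    by (simp only: fscale_zero_right)
  qed
 qed
 have "proj p (?s t) = proj p (?s (proj p t + cas p z))" using z(3) by simp
 also have "... = proj p (?s (proj p t)) + proj p (?s (cas p z))"
  using traceless_tensor[OF z(2)] cas_tensor[OF z(1)] by (simp add: dmap_add proj_add dmap_tensor[OF P])
 also have "... = ?s (proj p t)" unfolding c0 proj_id[OF perm_traceless[OF \<sigma> z(2)]] by simp
 finally show ?thesis .
qed

end

section \<open>Linear maps out of free modules\<close>

definition fext :: "('a => 'b => 'k::field) => ('a => 'k) => 'b => 'k" where
 "fext \<beta> x = (\<Sum>a\<in>supp x. fscale (x a) (\<beta> a))"

lemma fext_sum: "finite A ==> supp x \<subseteq> A ==> fext \<beta> x = (\<Sum>a\<in>A. fscale (x a) (\<beta> a))"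
 unfolding fext_def by (rule sum.mono_neutral_left) (auto simp: supp_def)

lemma supp_free: "x : free_on S ==> finite (supp x)" by (simp add: free_on_def)

lemma fext_add:
 assumes "finite (supp x)" "finite (supp y)"
 shows "fext \<beta> (x + y) = fext \<beta> x + fext \<beta> y"
proof -
 let ?A = "supp x \<union> supp y"
 have A: "finite ?A" "supp x \<subseteq> ?A" "supp y \<subseteq> ?A" "supp (x + y) \<subseteq> ?A" using assms by (auto simp: supp_def)
 show ?thesis
  unfolding fext_sum[OF A(1,2)] fext_sum[OF A(1,3)] fext_sum[OF A(1,4)]
  by (simp add: FS.scale_left_distrib sum.distrib)
qed

lemma fext_scale:
 assumes "finite (supp x)"
 shows "fext \<beta> (fscale c x) = fscale c (fext \<beta> x)"
proof -
 have A: "supp (fscale c x) \<subseteq> supp x" by (auto simp: supp_def)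
 show ?thesis unfolding fext_sum[OF assms A] fext_sum[OF assms subset_refl] by (simp only: FS.scale_sum_right FS.scale_scale fscale_apply)
qed

lemma fext_delta: "fext \<beta> (delta a) = \<beta> a"
 by (simp add: fext_def supp_delta delta_apply)

lemma fext_zero: "fext \<beta> (0 :: 'a => 'b::field) = 0"
proof -
 have "supp (0 :: 'a => 'b) = {}" by (simp add: supp_def)
 then show ?thesis by (simp only: fext_def sum.empty)
qed

lemma diff_fscale1: "s - t = s + fscale (-1) t" for s t :: "'a => 'k::comm_ring_1"
 by (rule ext) simp

lemma fext_diff:
 assumes "finite (supp x)" "finite (supp y)"
 shows "fext \<beta> (x - y) = fext \<beta> x - fext \<beta> y"
proof -
 have "finite (supp (fscale (-1) y))" using assms(2) by (simp add: supp_def)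
 then show ?thesis unfolding diff_fscale1 using assms by (simp only: fext_add fext_scale)
qed

lemma finite_supp_delta: "finite (supp (delta a :: 'a => 'k::comm_ring_1))" by (simp add: supp_delta)

lemma subspace_free_on: "FS.subspace (free_on S)"
 by (rule FS.subspaceI) (simp_all only: free_on_zero free_on_add free_on_fscale)

lemma fext_lincomb: "finite A ==> fext \<beta> (\<Sum>a\<in>A. fscale (c a) (delta (g a))) = (\<Sum>a\<in>A. fscale (c a) (\<beta> (g a)))"
proof (induction A rule: finite_induct)
 case (insert x A)
 have "(\<Sum>a\<in>A. fscale (c a) (delta (g a))) : free_on UNIV" by (intro free_on_sum free_on_fscale free_on_delta) simp
 then have 1: "finite (supp (\<Sum>a\<in>A. fscale (c a) (delta (g a))))" by (rule supp_free)
 have "fscale (c x) (delta (g x)) : free_on UNIV" by (intro free_on_fscale free_on_delta) simp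
 then have 2: "finite (supp (fscale (c x) (delta (g x))))" by (rule supp_free)
 show ?case unfolding sum.insert[OF insert.hyps] fext_add[OF 2 1] insert.IH fext_scale[OF finite_supp_delta] fext_delta ..
qed (simp only: sum.empty fext_zero)

lemma free_expand:
 assumes "finite S" "x : free_on S"
 shows "x = (\<Sum>a\<in>S. fscale (x a) (delta a))"
proof
 fix y
 have "(\<Sum>a\<in>S. x a * (if y = a then 1 else 0)) = (if y : S then x y else 0)"
  using assms(1) by (simp add: if_distrib[of "%t. _ * t"] sum.delta' cong: if_cong)
 then show "x y = (\<Sum>a\<in>S. fscale (x a) (delta a)) y"
  using free_onD[OF assms(2), of y] by (simp add: sum_apply delta_apply)
qed

lemma free_map_fext: "free_map \<phi> = fext (%a. delta (\<phi> a))"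
 by (rule ext) (simp only: free_map_def fext_def)

lemma fext_free_map: "finite (supp x) ==> fext \<beta> (free_map \<phi> x) = fext (%a. \<beta> (\<phi> a)) x"
 unfolding free_map_def fext_def[of "%a. \<beta> (\<phi> a)"] by (rule fext_lincomb)

lemma free_map_free:
 assumes "x : free_on S" "!!a. a : S ==> \<phi> a : T"
 shows "free_map \<phi> x : free_on T"
 unfolding free_map_def by (intro free_on_sum free_on_fscale free_on_delta assms(2)) (use assms(1) in \<open>auto simp: free_on_def\<close>)

text \<open>With \<open>Q\<close> the zero space this produces functions on the tensor product, with
  \<open>Q\<close> another space of relations it produces maps between tensor products.\<close>

lemma fext_relations:
 assumes Q: "FS.subspace Q"
  and b1: "!!m m' n. m : M ==> m' : M ==> n : N ==> \<beta> (m + m', n) - \<beta> (m, n) - \<beta> (m', n) : Q"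
  and b2: "!!m n n'. m : M ==> n : N ==> n' : N ==> \<beta> (m, n + n') - \<beta> (m, n) - \<beta> (m, n') : Q"
  and b3: "!!c m n. m : M ==> n : N ==> \<beta> (fscale c m, n) - fscale c (\<beta> (m, n)) : Q"
  and b4: "!!c m n. m : M ==> n : N ==> \<beta> (m, fscale c n) - fscale c (\<beta> (m, n)) : Q"
  and b5: "!!m s n. m : M ==> s : S ==> n : N ==> \<beta> (rmul m s, n) - \<beta> (m, lmul s n) : Q"
  and x: "x : tensor_relations M N S rmul lmul"
 shows "fext \<beta> x : Q"
proof -
 \<comment> \<open>\<open>fext\<close> is additive on functions of finite support, so finite support
   is made part of the subspace.\<close>
 define P where "P = {x : free_on UNIV. fext \<beta> x : Q}"
 have sub: "FS.subspace P"
  unfolding P_def by (rule FS.subspaceI)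
   (auto simp: fext_zero fext_add[OF supp_free supp_free] fext_scale[OF supp_free] free_on_zero free_on_add free_on_fscale
    FS.subspace_0[OF Q] FS.subspace_add[OF Q] FS.subspace_scale[OF Q])
 note d = free_on_delta[OF UNIV_I]
 note fd = FS.subspace_diff[OF subspace_free_on]
 have c1: "delta a - delta b - delta c : P" if "\<beta> a - \<beta> b - \<beta> c : Q" for a b c
  using that fd[OF d d] fd[OF fd[OF d d] d] by (simp add: P_def fext_diff supp_free[OF d] supp_free[OF fd[OF d d]] fext_delta)
 have c2: "delta a - fscale c (delta b) : P" if "\<beta> a - fscale c (\<beta> b) : Q" for a b c
  using that fd[OF d free_on_fscale[OF d]]
  by (simp add: P_def fext_diff supp_free[OF d] supp_free[OF free_on_fscale[OF d]] fext_delta fext_scale)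
 have c3: "delta a - delta b : P" if "\<beta> a - \<beta> b : Q" for a b
  using that fd[OF d d] by (simp add: P_def fext_diff supp_free[OF d] fext_delta)
 have "tensor_relations M N S rmul lmul \<subseteq> P"
  unfolding tensor_relations_def
 proof (rule FS.span_minimal[OF _ sub], intro Un_least)
  show "{delta (m + m', n) - delta (m, n) - delta (m', n) | m m' n. m : M & m' : M & n : N} \<subseteq> P"
   by clarify (rule c1, rule b1)
  show "{delta (m, n + n') - delta (m, n) - delta (m, n') | m n n'. m : M & n : N & n' : N} \<subseteq> P"
   by clarify (rule c1, rule b2)
  show "{delta (fscale c m, n) - fscale c (delta (m, n)) | c m n. m : M & n : N} \<subseteq> P"
   by clarify (rule c2, rule b3)
  show "{delta (m, fscale c n) - fscale c (delta (m, n)) | c m n. m : M & n : N} \<subseteq> P"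
   by clarify (rule c2, rule b4)
  show "{delta (rmul m s, n) - delta (m, lmul s n) | m s n. m : M & s : S & n : N} \<subseteq> P"
   by clarify (rule c3, rule b5)
 qed
 then show ?thesis using x by (auto simp: P_def)
qed

lemma tensor_relations_base:
 assumes "m : M" "n : N"
 shows "m' : M ==> delta (m + m', n) - delta (m, n) - delta (m', n) : tensor_relations M N S rmul lmul"
  and "n' : N ==> delta (m, n + n') - delta (m, n) - delta (m, n') : tensor_relations M N S rmul lmul"
  and "delta (fscale c m, n) - fscale c (delta (m, n)) : tensor_relations M N S rmul lmul"
  and "delta (m, fscale c n) - fscale c (delta (m, n)) : tensor_relations M N S rmul lmul"
  and "s : S ==> delta (rmul m s, n) - delta (m, lmul s n) : tensor_relations M N S rmul lmul"
 using assms unfolding tensor_relations_def by (blast intro!: FS.span_base)+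

section \<open>Quotients and modules\<close>

lemma coset_eq:
 assumes R: "FS.subspace R"
 shows "coset R x = coset R y \<longleftrightarrow> x - y : R"
proof
 assume "coset R x = coset R y"
 moreover have "x : coset R x" by (simp add: coset_def FS.subspace_0[OF R])
 ultimately show "x - y : R" by (simp add: coset_def)
next
 assume xy: "x - y : R"
 show "coset R x = coset R y"
 proof (rule Set.set_eqI)
  fix z
  have "z - y = (z - x) + (x - y)" "z - x = (z - y) - (x - y)" by simp_all
  then show "z : coset R x \<longleftrightarrow> z : coset R y"
   unfolding coset_def mem_Collect_eq using FS.subspace_add[OF R _ xy] FS.subspace_diff[OF R _ xy] by metis
 qed
qed

lemma coset_self: "FS.subspace R ==> x : coset R x"
 by (simp add: coset_def FS.subspace_0)

lemma quotient_map_coset: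
 assumes R: "FS.subspace R" "FS.subspace R'" and h: "!!y. y - x : R' ==> h y - h x : R"
 shows "quotient_map R h (coset R' x) = coset R (h x)"
proof -
 have "coset R (h y) = coset R (h x)" if "y : coset R' x" for y
  using that h unfolding coset_eq[OF R(1)] by (simp add: coset_def)
 then show ?thesis unfolding quotient_map_def using coset_self[OF R(2), of x] by blast
qed

lemma coset_add:
 assumes R: "FS.subspace R"
 shows "(\<Union>u\<in>coset R x. \<Union>v\<in>coset R y. coset R (u + v)) = coset R (x + y)"
proof -
 have eq: "coset R (u + v) = coset R (x + y)" if "u : coset R x" "v : coset R y" for u v
 proof -
  have "(u + v) - (x + y) = (u - x) + (v - y)" by simp
  also have "... : R" by (rule FS.subspace_add[OF R]) (use that in \<open>simp_all add: coset_def\<close>)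
  finally show ?thesis unfolding coset_eq[OF R] .
 qed
 have "(\<Union>u\<in>coset R x. \<Union>v\<in>coset R y. coset R (u + v)) = (\<Union>u\<in>coset R x. \<Union>v\<in>coset R y. coset R (x + y))"
  by (rule SUP_cong[OF refl], rule SUP_cong[OF refl], rule eq)
 moreover have "coset R z ~= {}" for z using coset_self[OF R, of z] by blast
 ultimately show ?thesis by simp
qed

lemma gmoduleI:
 fixes M :: "('k::field, 'v, 'm) gmod"
 assumes "!!x y. x : carrier M ==> y : carrier M ==> x \<oplus>\<^bsub>M\<^esub> y : carrier M" "\<zero>\<^bsub>M\<^esub> : carrier M"
  "!!x y z. x : carrier M ==> y : carrier M ==> z : carrier M ==> (x \<oplus>\<^bsub>M\<^esub> y) \<oplus>\<^bsub>M\<^esub> z = x \<oplus>\<^bsub>M\<^esub> (y \<oplus>\<^bsub>M\<^esub> z)"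
  "!!x y. x : carrier M ==> y : carrier M ==> x \<oplus>\<^bsub>M\<^esub> y = y \<oplus>\<^bsub>M\<^esub> x"
  "!!x. x : carrier M ==> \<zero>\<^bsub>M\<^esub> \<oplus>\<^bsub>M\<^esub> x = x" "!!x. x : carrier M ==> (- 1) \<odot>\<^bsub>M\<^esub> x \<oplus>\<^bsub>M\<^esub> x = \<zero>\<^bsub>M\<^esub>"
  "!!c x. x : carrier M ==> c \<odot>\<^bsub>M\<^esub> x : carrier M"
  "!!c d x. x : carrier M ==> (c + d) \<odot>\<^bsub>M\<^esub> x = c \<odot>\<^bsub>M\<^esub> x \<oplus>\<^bsub>M\<^esub> d \<odot>\<^bsub>M\<^esub> x"
  "!!c x y. x : carrier M ==> y : carrier M ==> c \<odot>\<^bsub>M\<^esub> (x \<oplus>\<^bsub>M\<^esub> y) = c \<odot>\<^bsub>M\<^esub> x \<oplus>\<^bsub>M\<^esub> c \<odot>\<^bsub>M\<^esub> y"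
  "!!c d x. x : carrier M ==> (c * d) \<odot>\<^bsub>M\<^esub> x = c \<odot>\<^bsub>M\<^esub> (d \<odot>\<^bsub>M\<^esub> x)" "!!x. x : carrier M ==> 1 \<odot>\<^bsub>M\<^esub> x = x"
  and g: "!!g x. g : G ==> x : carrier M ==> act M g x : carrier M"
  "!!g x y. g : G ==> x : carrier M ==> y : carrier M ==> act M g (x \<oplus>\<^bsub>M\<^esub> y) = act M g x \<oplus>\<^bsub>M\<^esub> act M g y"
  "!!g c x. g : G ==> x : carrier M ==> act M g (c \<odot>\<^bsub>M\<^esub> x) = c \<odot>\<^bsub>M\<^esub> act M g x"
  "!!x. x : carrier M ==> act M id x = x"
  "!!g h x. g : G ==> h : G ==> x : carrier M ==> act M (g o h) x = act M g (act M h x)"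
 shows "gmodule G M"
proof -
 have "abelian_group M"
  by (rule abelian_groupI; (rule assms(1-5); assumption)?; (use assms(6,7) in blast)?)
 then have "Module.module (ring_of_type_algebra :: 'k ring) M"
  by (intro moduleI cring_from_type_algebra) (simp_all add: ring_of_type_algebra_def assms(1-11))
 then show ?thesis unfolding gmodule_def using g by blast
qed

section \<open>Inverting the Gram matrix\<close>

text \<open>The Gram determinant is formed over integer polynomials and only afterwards evaluated;
  as ring homomorphisms commute with determinants, the evaluated matrix is invertible over the
  field.\<close>

lemma det_on_inverse:
 fixes A :: "'i => 'i => 'r::comm_ring_1" and \<phi> :: "'r => 'k::field"
 assumes hom: "comm_ring_hom \<phi>" and fin: "finite I" and nz: "\<phi> (det_on I A) ~= 0"
 shows "\<exists>C. \<forall>x\<in>I. \<forall>y\<in>I. (\<Sum>z\<in>I. \<phi> (A x z) * C z y) = of_bool (x = y)"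
proof -
 define xs where "xs = (SOME xs. distinct xs & set xs = I)"
 have "\<exists>xs. distinct xs & set xs = I" using finite_distinct_list[OF fin] by blast
 from someI_ex[OF this] have xs: "distinct xs" "set xs = I" unfolding xs_def by auto
 define m where "m = length xs"
 define B where "B = map_mat \<phi> (Matrix.mat m m (%(i, j). A (xs ! i) (xs ! j)))"
 have B: "B : carrier_mat m m" by (simp add: B_def)
 have "Determinant.det B = \<phi> (det_on I A)"
  unfolding B_def det_on_def xs_def[symmetric] m_def Let_def by (rule comm_ring_hom.hom_det[OF hom])
 then have "B : Units (ring_mat TYPE('k) m ())" using det_non_zero_imp_unit[OF B] nz by metis
 then obtain C where C: "C : carrier_mat m m" "B * C = 1\<^sub>m m" by (auto simp: Units_def ring_mat_def)
 have bij: "bij_betw ((!) xs) {..<m} I" by (rule bij_betw_nth) (simp_all add: xs m_def)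
 let ?k = "the_inv_into {..<m} ((!) xs)"
 have k: "?k (xs ! i) = i" if "i < m" for i
  by (rule the_inv_into_f_f[OF bij_betw_imp_inj_on[OF bij]]) (use that in simp)
 have ent: "(\<Sum>z\<in>I. \<phi> (A x z) * C $$ (?k z, ?k y)) = of_bool (x = y)" if xy: "x : I" "y : I" for x y
 proof -
  have ix: "I = (!) xs ` {..<m}" using bij by (simp add: bij_betw_def)
  obtain i where i: "i < m" "x = xs ! i" using xy(1) unfolding ix by auto
  obtain j where j: "j < m" "y = xs ! j" using xy(2) unfolding ix by auto
  have "(\<Sum>z\<in>I. \<phi> (A x z) * C $$ (?k z, ?k y)) = (\<Sum>l<m. \<phi> (A x (xs ! l)) * C $$ (?k (xs ! l), ?k y))"
   by (rule sum.reindex_bij_betw[OF bij, symmetric])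
  also have "... = (\<Sum>l<m. \<phi> (A (xs ! i) (xs ! l)) * C $$ (l, j))"
   by (intro sum.cong refl) (simp add: k i j)
  also have "... = (\<Sum>l\<in>{0..<m}. B $$ (i, l) * C $$ (l, j))"
   unfolding atLeast0LessThan by (intro sum.cong refl) (simp add: B_def i(1))
  also have "... = (B * C) $$ (i, j)"
  proof -
   have dims: "dim_row B = m" "dim_col B = m" "dim_row C = m" "dim_col C = m"
    using carrier_matD[OF B] carrier_matD[OF C(1)] by auto
   have "(B * C) $$ (i, j) = scalar_prod (row B i) (col C j)"
    by (rule index_mult_mat(1)) (simp_all only: dims i(1) j(1))
   also have "... = (\<Sum>l\<in>{0..<m}. row B i $ l * col C j $ l)" by (simp only: scalar_prod_def dim_col dims)
   also have "... = (\<Sum>l\<in>{0..<m}. B $$ (i, l) * C $$ (l, j))"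
    by (intro sum.cong refl) (simp only: index_row(1) index_col dims i(1) j(1) atLeastLessThan_iff)
   finally show ?thesis by (rule sym)
  qed
  also have "... = of_bool (x = y)"
   using i j xs(1) unfolding C(2) by (simp add: nth_eq_iff_index_eq m_def)
  finally show ?thesis .
 qed
 show ?thesis by (intro exI[of _ "%z y. C $$ (?k z, ?k y)"] ballI ent)
qed

lemma comm_ring_hom_eval: "comm_ring_hom (%P. poly (map_poly of_int P) (x :: 'k::comm_ring_1))"
proof -
 have add: "map_poly of_int (p + q) = map_poly of_int p + (map_poly of_int q :: 'k poly)" for p q
  by (rule poly_eqI) (simp add: coeff_map_poly)
 have mult: "map_poly of_int (p * q) = map_poly of_int p * (map_poly of_int q :: 'k poly)" for p q
  by (rule poly_eqI) (simp add: coeff_map_poly coeff_mult)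
 show ?thesis by unfold_locales (simp_all add: add mult)
qed

lemma bilinear_ext_delta: "bilinear_ext \<beta> (delta a) (delta b) = \<beta> a b"
 unfolding bilinear_ext_def supp_delta by (rule ext) (simp add: delta_apply)

lemma gram_entry_eval:
 fixes x :: "'k::comm_ring_1"
 assumes g: "g : upward p q" and h: "h : upward p q" and \<tau>: "\<tau> permutes {..<p}" and \<sigma>: "\<sigma> permutes {..<p}"
 shows "poly (map_poly of_int (gram_entry p (h, \<sigma>) (g, \<tau>))) x =
  (if dcomp (bar h) g : level p p & dcomp (dcomp (bar h) g) (pd p \<tau>) = pd p \<sigma>
   then x ^ loops (bar h) g else 0)"
proof -
 let ?d = "dcomp (bar h) g" and ?x = "[:0, 1:] :: int poly"
 have xp: "poly (map_poly of_int (?x ^ l)) x = x ^ l" for l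
  by (simp add: monom_altdef[of 1, simplified, symmetric] map_poly_monom poly_monom)
 have pair: "bpair ?x p (delta (bar h)) (delta g) =
   (if ?d : level p p then fscale (?x ^ loops (bar h) g) (delta ?d) else 0)"
  unfolding bpair_def bilinear_ext_delta bpair_diagram_def bcomp_delta ..
 show ?thesis
 proof (cases "?d : level p p")
  case True
  then have "?d : upward p p" by (simp add: level_def)
  then have l0: "loops ?d (pd p \<tau>) = 0" by (rule loops_upward[OF _ perm_diagram_brauer[OF \<tau>]])
  have "gram_entry p (h, \<sigma>) (g, \<tau>) = ?x ^ loops (bar h) g * of_bool (pd p \<sigma> = dcomp ?d (pd p \<tau>))"
   unfolding gram_entry_def prod.case pair if_P[OF True] bcomp_def
   by (subst bilinear_ext_sum[of "{?d}" _ "{pd p \<tau>}"])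
    (simp_all add: free_on_fscale free_on_delta l0 delta_apply)
  then show ?thesis using True xp by (cases "pd p \<sigma> = dcomp ?d (pd p \<tau>)") auto
 next
  case False
  then show ?thesis
   unfolding gram_entry_def prod.case pair if_not_P[OF False] bcomp_def
   by (simp add: bilinear_ext_def supp_def)
 qed
qed

section \<open>Coordinates of the target functor\<close>

context mono_basis
begin

abbreviation dl :: 'k where "dl \<equiv> e * of_nat n"
abbreviation "M p q \<equiv> (free_on (upward p q) :: (diagram => 'k) set)"
abbreviation "Rl p q \<equiv> Ft_relations scale \<omega> e dl p q"
abbreviation "gn p q \<equiv> Ft_generators scale \<omega> e p q"
abbreviation "D p \<sigma> \<equiv> dmap p p (pd p \<sigma>)"

lemma linear_sum: "linear_on (tn p) L ==> (!!i. i : A ==> T i : tn p) ==> L (\<Sum>i\<in>A. T i) = (\<Sum>i\<in>A. L (T i))"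
 using linear_on_sum[of p L A T "%_. 1"] by (simp only: FS.scale_one)

lemma traceless_sum: "(!!i. i : A ==> T i : N p) ==> (\<Sum>i\<in>A. T i) : N p"
 by (induction A rule: infinite_finite_induct) (simp_all add: traceless_0 traceless_add)

lemma D_tensor: "\<sigma> permutes {..<p} ==> t : tn p ==> D p \<sigma> t : tn p"
 by (rule dmap_tensor[OF perm_diagram_brauer])

lemma D_id: "t : tn p ==> D p id t = t"
 using F_bid[of t p] F_delta[OF perm_diagram_brauer[OF permutes_id], of p t] by (simp only: bid_def)

lemma D_comp:
 assumes "\<rho> permutes {..<p}" "\<tau> permutes {..<p}" "t : tn p"
 shows "D p \<rho> (D p \<tau> t) = D p (\<rho> o \<tau>) t"
 unfolding dmap_dcomp[OF perm_diagram_brauer[OF assms(1)] perm_diagram_brauer[OF assms(2)] assms(3)]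
  loops_upward[OF perm_upward[OF assms(1)] perm_diagram_brauer[OF assms(2)]] perm_dcomp[OF assms(1,2)]
 by (simp only: power_0 fscale_one)

lemma F_level:
 assumes s: "s : free_on (level p p)"
 shows "F p p s t = (\<Sum>\<sigma>\<in>perms p. fscale (s (pd p \<sigma>)) (D p \<sigma> t))"
proof -
 have "F p p s t = (\<Sum>f\<in>level p p. fscale (s f) (dmap p p f t))"
  unfolding F_sum[OF level_hom[OF s]]
 proof (rule sum.mono_neutral_right[OF finite_brauer])
  show "level p p \<subseteq> brauer p p" by (auto simp: level_def intro: upward_brauer)
  show "\<forall>i\<in>brauer p p - level p p. fscale (s i) (dmap p p i t) = 0"
   using free_onD[OF s] by (auto simp: FS.scale_zero_left)
 qed
 then show ?thesis unfolding sum_level .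
qed

lemma F_level_traceless: "s : free_on (level p p) ==> t : N p ==> F p p s t : N p"
 unfolding F_level by (intro traceless_sum traceless_scale perm_traceless) auto

lemma subspace_Rl: "FS.subspace (Rl p q)"
 unfolding Ft_relations_def tensor_relations_def by (rule FS.subspace_span)

lemma gn_add: "x : gn p q ==> y : gn p q ==> x + y : gn p q"
 and gn_scale: "x : gn p q ==> fscale c x : gn p q"
 and gn_zero: "0 : gn p q"
 and gn_diff: "x : gn p q ==> y : gn p q ==> x - y : gn p q"
 unfolding Ft_generators_def
 by (rule free_on_add free_on_fscale free_on_zero FS.subspace_diff[OF subspace_free_on], assumption?, assumption?)+

lemma gn_delta: "f : M p q ==> t : N p ==> delta (f, t) : gn p q"
 unfolding Ft_generators_def by (rule free_on_delta) simp

lemma gn_sum: "(!!i. i : A ==> T i : gn p q) ==> (\<Sum>i\<in>A. T i) : gn p q"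
 unfolding Ft_generators_def by (rule free_on_sum)

lemma gn_supp: "x : gn p q ==> finite (supp x)"
 unfolding Ft_generators_def by (rule supp_free)

lemma Rl_base:
 assumes "f : M p q" "t : N p"
 shows "f' : M p q ==> delta (f + f', t) - delta (f, t) - delta (f', t) : Rl p q"
  and "t' : N p ==> delta (f, t + t') - delta (f, t) - delta (f, t') : Rl p q"
  and "delta (fscale c f, t) - fscale c (delta (f, t)) : Rl p q"
  and "delta (f, fscale c t) - fscale c (delta (f, t)) : Rl p q"
  and "s : free_on (level p p) ==> delta (bcomp dl f s, t) - delta (f, F p p s t) : Rl p q"
 unfolding Ft_relations_def
 by (rule tensor_relations_base(1)[OF assms], assumption) (rule tensor_relations_base(2)[OF assms], assumption,
  rule tensor_relations_base(3)[OF assms], rule tensor_relations_base(4)[OF assms], rule tensor_relations_base(5)[OF assms])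

lemma Rl_trans: "x - y : Rl p q ==> y - z : Rl p q ==> x - z : Rl p q"
 using FS.subspace_add[OF subspace_Rl, of "x - y" p q "y - z"] by simp

lemma Rl_sym: "x - y : Rl p q ==> y - x : Rl p q"
 using FS.subspace_neg[OF subspace_Rl, of "x - y" p q] by simp

lemma Rl_sum: "(!!i. i : A ==> x i - y i : Rl p q) ==> (\<Sum>i\<in>A. x i) - (\<Sum>i\<in>A. y i) : Rl p q"
 unfolding sum_subtractf[symmetric] by (rule FS.subspace_sum[OF subspace_Rl])

lemma Rl_scale: "x - y : Rl p q ==> fscale c x - fscale c y : Rl p q"
 unfolding FS.scale_right_diff_distrib[symmetric] by (rule FS.subspace_scale[OF subspace_Rl])

lemma Rl_sum_left:
 assumes t: "t : N p"
 shows "finite A ==> (!!a. a : A ==> m a : M p q) ==>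
  delta (\<Sum>a\<in>A. fscale (c a) (m a), t) - (\<Sum>a\<in>A. fscale (c a) (delta (m a, t))) : Rl p q"
proof (induction A rule: finite_induct)
 case empty
 have "delta (0, t) - 0 : Rl p q"
  using Rl_base(3)[OF free_on_zero t, where c = 0 and q = q] by (simp only: FS.scale_zero_left)
 then show ?case by (simp only: sum.empty)
next
 case (insert x A)
 let ?s = "\<Sum>a\<in>A. fscale (c a) (m a)"
 have mx: "m x : M p q" and s: "?s : M p q" using insert.prems by (auto intro!: free_on_sum free_on_fscale)
 have 1: "delta (fscale (c x) (m x) + ?s, t) - (delta (fscale (c x) (m x), t) + delta (?s, t)) : Rl p q"
  using Rl_base(1)[OF free_on_fscale[OF mx] t s, of "c x"] by (simp only: diff_diff_add)
 have IH: "delta (?s, t) - (\<Sum>a\<in>A. fscale (c a) (delta (m a, t))) : Rl p q"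
  by (rule insert.IH) (use insert.prems in blast)
 have 2: "(delta (fscale (c x) (m x), t) + delta (?s, t)) - (fscale (c x) (delta (m x, t)) + (\<Sum>a\<in>A. fscale (c a) (delta (m a, t)))) : Rl p q"
  using FS.subspace_add[OF subspace_Rl Rl_base(3)[OF mx t, of "c x"] IH] by (simp only: add_diff_add)
 show ?case unfolding sum.insert[OF insert.hyps] by (rule Rl_trans[OF 1 2])
qed

lemma Rl_sum_right:
 assumes f: "f : M p q"
 shows "finite A ==> (!!a. a : A ==> t a : N p) ==>
  delta (f, \<Sum>a\<in>A. fscale (c a) (t a)) - (\<Sum>a\<in>A. fscale (c a) (delta (f, t a))) : Rl p q"
proof (induction A rule: finite_induct)
 case empty
 have "delta (f, 0) - 0 : Rl p q"
  using Rl_base(4)[OF f traceless_0, where c = 0] by (simp only: FS.scale_zero_left)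
 then show ?case by (simp only: sum.empty)
next
 case (insert x A)
 let ?s = "\<Sum>a\<in>A. fscale (c a) (t a)"
 have tx: "t x : N p" and s: "?s : N p" using insert.prems by (auto intro!: traceless_sum traceless_scale)
 have 1: "delta (f, fscale (c x) (t x) + ?s) - (delta (f, fscale (c x) (t x)) + delta (f, ?s)) : Rl p q"
  using Rl_base(2)[OF f traceless_scale[OF tx] s, of "c x"] by (simp only: diff_diff_add)
 have IH: "delta (f, ?s) - (\<Sum>a\<in>A. fscale (c a) (delta (f, t a))) : Rl p q"
  by (rule insert.IH) (use insert.prems in blast)
 have 2: "(delta (f, fscale (c x) (t x)) + delta (f, ?s)) - (fscale (c x) (delta (f, t x)) + (\<Sum>a\<in>A. fscale (c a) (delta (f, t a)))) : Rl p q"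
  using FS.subspace_add[OF subspace_Rl Rl_base(4)[OF f tx, of "c x"] IH] by (simp only: add_diff_add)
 show ?case unfolding sum.insert[OF insert.hyps] by (rule Rl_trans[OF 1 2])
qed

text \<open>Every element of \<open>B\<^sup>+(p, q) \<otimes> V\<^sup>\<langle>p\<^sup>\<rangle>\<close> is uniquely a sum of tensors \<open>h \<otimes> t h\<close> over the monotone
 diagrams \<open>h\<close>; \<open>bta p f t h\<close> is the coordinate of \<open>f \<otimes> t\<close> at \<open>h\<close>.\<close>

definition bta :: "nat => (diagram => 'k) => ('k, 'v) tensor => diagram => ('k, 'v) tensor" where
 "bta p f t h = (\<Sum>\<sigma>\<in>perms p. fscale (f (dcomp h (pd p \<sigma>))) (D p \<sigma> t))"

definition psi :: "nat => diagram => ((diagram => 'k) \<times> ('k, 'v) tensor => 'k) => ('k, 'v) tensor" where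
 "psi p h = fext (%z. bta p (fst z) (snd z) h)"

lemma bta_traceless: "t : N p ==> bta p f t h : N p"
 unfolding bta_def by (intro traceless_sum traceless_scale perm_traceless) auto

lemma bta_add_left: "bta p (f + f') t h = bta p f t h + bta p f' t h"
 by (simp add: bta_def FS.scale_left_distrib sum.distrib)

lemma bta_scale_left: "bta p (fscale c f) t h = fscale c (bta p f t h)"
 by (simp only: bta_def FS.scale_sum_right FS.scale_scale fscale_apply)

lemma bta_linear: "linear_on (tn p) (%t. bta p f t h)"
 unfolding linear_on_def
proof (intro conjI ballI allI)
 fix s t assume "s : tn p" "t : tn p"
 then show "bta p f (s + t) h = bta p f s h + bta p f t h"
  by (simp add: bta_def dmap_add FS.scale_right_distrib sum.distrib)
next
 fix c t assume t: "t : tn p"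
 show "bta p f (fscale c t) h = fscale c (bta p f t h)"
  unfolding bta_def FS.scale_sum_right dmap_fscale[OF t] FS.scale_scale by (simp only: mult.commute)
qed

lemma bta_add_right: "s : N p ==> t : N p ==> bta p f (s + t) h = bta p f s h + bta p f t h"
 and bta_scale_right: "t : N p ==> bta p f (fscale c t) h = fscale c (bta p f t h)"
 using bta_linear[of p f h] traceless_tensor unfolding linear_on_def by blast+

lemma bcomp_level_at:
 assumes f: "f : M p q" and s: "s : free_on (level p p)" and h: "h : upward p q" and \<sigma>: "\<sigma> permutes {..<p}"
 shows "bcomp dl f s (dcomp h (pd p \<sigma>)) =
  (\<Sum>\<tau>\<in>perms p. s (pd p \<tau>) * f (dcomp h (pd p (\<sigma> o iv \<tau>))))"
proof -
 let ?w = "dcomp h (pd p \<sigma>)"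
 have w: "?w : upward p q" by (rule upward_dcomp[OF h perm_upward[OF \<sigma>]])
 have "bcomp dl f s ?w = (\<Sum>\<tau>\<in>perms p. \<Sum>u\<in>upward p q. f u * s (pd p \<tau>) * of_bool (dcomp u (pd p \<tau>) = ?w))"
  unfolding bcomp_level_right_apply[OF f s] by (rule sum.swap)
 also have "... = (\<Sum>\<tau>\<in>perms p. s (pd p \<tau>) * f (dcomp h (pd p (\<sigma> o iv \<tau>))))"
 proof (rule sum.cong[OF refl])
  fix \<tau> assume "\<tau> : perms p"
  then have \<tau>: "\<tau> permutes {..<p}" by simp
  let ?v = "dcomp ?w (pd p (iv \<tau>))"
  have v: "?v : upward p q" by (rule upward_dcomp[OF w perm_upward[OF permutes_inv[OF \<tau>]]])
  have "(dcomp u (pd p \<tau>) = ?w) = (u = ?v)" if "u : upward p q" for u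
   using dcomp_perm_cancel(1)[OF upward_brauer[OF that] \<tau>] dcomp_perm_cancel(2)[OF upward_brauer[OF w] \<tau>] by metis
  then have "(\<Sum>u\<in>upward p q. f u * s (pd p \<tau>) * of_bool (dcomp u (pd p \<tau>) = ?w)) =
    (\<Sum>u\<in>upward p q. f u * s (pd p \<tau>) * of_bool (u = ?v))"
   by (intro sum.cong refl) simp
  also have "... = f ?v * s (pd p \<tau>)" by (rule sum_of_bool_pick[OF finite_upward v])
  also have "?v = dcomp h (pd p (\<sigma> o iv \<tau>))"
   unfolding dcomp_assoc[OF upward_brauer[OF h] perm_diagram_brauer[OF \<sigma>] perm_diagram_brauer[OF permutes_inv[OF \<tau>]], symmetric]
    perm_dcomp[OF \<sigma> permutes_inv[OF \<tau>]] ..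
  finally show "(\<Sum>u\<in>upward p q. f u * s (pd p \<tau>) * of_bool (dcomp u (pd p \<tau>) = ?w)) =
   s (pd p \<tau>) * f (dcomp h (pd p (\<sigma> o iv \<tau>)))" by (simp only: mult.commute)
 qed
 finally show ?thesis .
qed

text \<open>The coordinates are balanced over the group algebra: in the double sum over
  permutations, \<sigma> is replaced by \<open>\<rho> o \<tau>\<close>.\<close>

lemma bta_bcomp:
 assumes f: "f : M p q" and s: "s : free_on (level p p)" and h: "h : upward p q" and t: "t : tn p"
 shows "bta p (bcomp dl f s) t h = bta p f (F p p s t) h"
proof -
 let ?f = "%\<rho>. f (dcomp h (pd p \<rho>))" and ?s = "%\<tau>. s (pd p \<tau>)"
 have "bta p (bcomp dl f s) t h = (\<Sum>\<sigma>\<in>perms p. \<Sum>\<tau>\<in>perms p. fscale (?s \<tau> * ?f (\<sigma> o iv \<tau>)) (D p \<sigma> t))"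
  unfolding bta_def FS.scale_sum_left[symmetric]
  by (rule sum.cong[OF refl]) (simp only: bcomp_level_at[OF f s h] mem_Collect_eq)
 also have "... = (\<Sum>\<tau>\<in>perms p. \<Sum>\<sigma>\<in>perms p. fscale (?s \<tau> * ?f (\<sigma> o iv \<tau>)) (D p \<sigma> t))" by (rule sum.swap)
 also have "... = (\<Sum>\<tau>\<in>perms p. \<Sum>\<rho>\<in>perms p. fscale (?s \<tau> * ?f \<rho>) (D p (\<rho> o \<tau>) t))"
 proof (rule sum.cong[OF refl])
  fix \<tau> assume "\<tau> : perms p"
  then have \<tau>: "\<tau> permutes {..<p}" by simp
  have c: "(\<rho> o \<tau>) o iv \<tau> = \<rho>" for \<rho> :: "nat => nat"
   using permutes_inv_o(1)[OF \<tau>] by (simp only: comp_assoc comp_id)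
  show "(\<Sum>\<sigma>\<in>perms p. fscale (?s \<tau> * ?f (\<sigma> o iv \<tau>)) (D p \<sigma> t)) = (\<Sum>\<rho>\<in>perms p. fscale (?s \<tau> * ?f \<rho>) (D p (\<rho> o \<tau>) t))"
   by (subst sum_permutations_compose_right[OF \<tau>]) (simp only: c)
 qed
 also have "... = (\<Sum>\<rho>\<in>perms p. \<Sum>\<tau>\<in>perms p. fscale (?s \<tau> * ?f \<rho>) (D p (\<rho> o \<tau>) t))" by (rule sum.swap)
 also have "... = (\<Sum>\<rho>\<in>perms p. fscale (?f \<rho>) (D p \<rho> (\<Sum>\<tau>\<in>perms p. fscale (?s \<tau>) (D p \<tau> t))))"
 proof (rule sum.cong[OF refl])
  fix \<rho> assume "\<rho> : perms p"
  then have \<rho>: "\<rho> permutes {..<p}" by simp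
  have "D p \<rho> (\<Sum>\<tau>\<in>perms p. fscale (?s \<tau>) (D p \<tau> t)) = (\<Sum>\<tau>\<in>perms p. fscale (?s \<tau>) (D p \<rho> (D p \<tau> t)))"
   by (rule linear_on_sum[OF dmap_linear]) (use D_tensor t in auto)
  also have "... = (\<Sum>\<tau>\<in>perms p. fscale (?s \<tau>) (D p (\<rho> o \<tau>) t))"
   by (rule sum.cong[OF refl]) (simp only: D_comp[OF \<rho> _ t] mem_Collect_eq)
  finally show "(\<Sum>\<tau>\<in>perms p. fscale (?s \<tau> * ?f \<rho>) (D p (\<rho> o \<tau>) t)) = fscale (?f \<rho>) (D p \<rho> (\<Sum>\<tau>\<in>perms p. fscale (?s \<tau>) (D p \<tau> t)))"
   by (simp only: FS.scale_sum_right FS.scale_scale mult.commute)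
 qed
 also have "... = bta p f (F p p s t) h" unfolding bta_def F_level[OF s] ..
 finally show ?thesis .
qed

lemma psi_Rl:
 assumes "x : Rl p q" and h: "h : upward p q"
 shows "psi p h x = 0"
proof -
 have "psi p h x : {0}"
  unfolding psi_def
 proof (rule fext_relations[OF FS.subspace_single_0 _ _ _ _ _ assms(1)[unfolded Ft_relations_def]])
  fix f t and s :: "diagram => 'k" assume "f : M p q" "s : free_on (level p p)" "t : N p"
  then show "bta p (fst (bcomp dl f s, t)) (snd (bcomp dl f s, t)) h - bta p (fst (f, F p p s t)) (snd (f, F p p s t)) h : {0}"
   using bta_bcomp[OF _ _ h traceless_tensor] by simp
 qed (simp_all only: fst_conv snd_conv bta_add_left bta_scale_left bta_add_right bta_scale_right singleton_iff diff_self add_diff_cancel_left')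
 then show ?thesis by simp
qed

lemma psi_add: "x : gn p q ==> y : gn p q ==> psi p' h (x + y) = psi p' h x + psi p' h y"
 and psi_diff: "x : gn p q ==> y : gn p q ==> psi p' h (x - y) = psi p' h x - psi p' h y"
 and psi_scale: "x : gn p q ==> psi p' h (fscale c x) = fscale c (psi p' h x)"
 unfolding psi_def using gn_supp by (simp_all only: fext_add fext_diff fext_scale)

lemma psi_zero: "psi p h 0 = 0" unfolding psi_def by (rule fext_zero)

lemma psi_traceless: "x : gn p q ==> psi p h x : N p"
 unfolding psi_def fext_def Ft_generators_def
 by (intro traceless_sum traceless_scale bta_traceless) (auto simp: free_on_def)

text \<open>Every upward diagram is a monotone one times a permutation, and the permutation moves
  across the tensor sign.\<close>

lemma Rl_expand:
 assumes f: "f : M p q" and t: "t : N p"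
 shows "delta (f, t) - (\<Sum>h\<in>um p q. delta (delta h, bta p f t h)) : Rl p q"
proof -
 have "delta (\<Sum>w\<in>upward p q. fscale (f w) (delta w), t) - (\<Sum>w\<in>upward p q. fscale (f w) (delta (delta w, t))) : Rl p q"
  by (rule Rl_sum_left[OF t finite_upward]) (rule free_on_delta)
 then have 1: "delta (f, t) - (\<Sum>w\<in>upward p q. fscale (f w) (delta (delta w, t))) : Rl p q"
  unfolding free_expand[OF finite_upward f, symmetric] .
 have 2: "(\<Sum>w\<in>upward p q. fscale (f w) (delta (delta w, t))) - (\<Sum>h\<in>um p q. delta (delta h, bta p f t h)) : Rl p q"
  unfolding sum_upward
 proof (rule Rl_sum)
  fix h assume "h : um p q"
  then have h: "h : upward p q" by (rule upward_mono_upward)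
  have dh: "delta h : M p q" by (rule free_on_delta[OF h])
  have 3: "(\<Sum>\<sigma>\<in>perms p. fscale (f (dcomp h (pd p \<sigma>))) (delta (delta (dcomp h (pd p \<sigma>)), t))) -
    (\<Sum>\<sigma>\<in>perms p. fscale (f (dcomp h (pd p \<sigma>))) (delta (delta h, D p \<sigma> t))) : Rl p q"
  proof (intro Rl_sum Rl_scale)
   fix \<sigma> assume "\<sigma> : perms p"
   then have \<sigma>: "\<sigma> permutes {..<p}" by simp
   have lv: "delta (pd p \<sigma>) : free_on (level p p)" by (rule free_on_delta) (use \<sigma> level_eq in auto)
   show "delta (delta (dcomp h (pd p \<sigma>)), t) - delta (delta h, D p \<sigma> t) : Rl p q"
    using Rl_base(5)[OF dh t lv]
    unfolding bcomp_delta loops_upward[OF h perm_diagram_brauer[OF \<sigma>]] F_delta[OF perm_diagram_brauer[OF \<sigma>]] power_0 fscale_one .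
  qed
  have 4: "delta (delta h, bta p f t h) - (\<Sum>\<sigma>\<in>perms p. fscale (f (dcomp h (pd p \<sigma>))) (delta (delta h, D p \<sigma> t))) : Rl p q"
   unfolding bta_def by (rule Rl_sum_right[OF dh finite_perms]) (use perm_traceless t in auto)
  show "(\<Sum>\<sigma>\<in>perms p. fscale (f (dcomp h (pd p \<sigma>))) (delta (delta (dcomp h (pd p \<sigma>)), t))) -
    delta (delta h, bta p f t h) : Rl p q"
   by (rule Rl_trans[OF 3 Rl_sym[OF 4]])
 qed
 show ?thesis by (rule Rl_trans[OF 1 2])
qed

lemma gn_expand:
 assumes x: "x : gn p q"
 shows "x - (\<Sum>h\<in>um p q. delta (delta h, psi p h x)) : Rl p q"
proof -
 let ?A = "supp x"
 have A: "finite ?A" by (rule gn_supp[OF x])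
 have el: "fst z : M p q" "snd z : N p" if "z : ?A" for z
  using x that unfolding Ft_generators_def free_on_def[of "M p q \<times> N p"] by auto
 have xe: "x = (\<Sum>z\<in>?A. fscale (x z) (delta z))" by (rule free_expand[OF A]) (simp add: free_on_def A)
 have 1: "(\<Sum>z\<in>?A. fscale (x z) (delta z)) - (\<Sum>z\<in>?A. fscale (x z) (\<Sum>h\<in>um p q. delta (delta h, bta p (fst z) (snd z) h))) : Rl p q"
 proof (intro Rl_sum Rl_scale)
  fix z assume z: "z : ?A"
  show "delta z - (\<Sum>h\<in>um p q. delta (delta h, bta p (fst z) (snd z) h)) : Rl p q"
   using Rl_expand[OF el[OF z]] by (simp only: prod.collapse)
 qed
 have 2: "(\<Sum>z\<in>?A. fscale (x z) (\<Sum>h\<in>um p q. delta (delta h, bta p (fst z) (snd z) h))) =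
   (\<Sum>h\<in>um p q. \<Sum>z\<in>?A. fscale (x z) (delta (delta h, bta p (fst z) (snd z) h)))"
  unfolding FS.scale_sum_right by (rule sum.swap)
 have 3: "(\<Sum>h\<in>um p q. delta (delta h, psi p h x)) -
   (\<Sum>h\<in>um p q. \<Sum>z\<in>?A. fscale (x z) (delta (delta h, bta p (fst z) (snd z) h))) : Rl p q"
  unfolding psi_def fext_def
  by (intro Rl_sum Rl_sum_right free_on_delta upward_mono_upward A bta_traceless el)
 show ?thesis
  using Rl_trans[OF 1[unfolded 2] Rl_sym[OF 3]] unfolding xe[symmetric] .
qed

text \<open>Coordinates vanish on the relations, and by \<open>gn_expand\<close> they determine an
  element modulo the relations. Equality in the quotient thus becomes equality of tensors.\<close>

lemma coset_Rl_eq: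
 assumes x: "x : gn p q" and y: "y : gn p q"
 shows "coset (Rl p q) x = coset (Rl p q) y \<longleftrightarrow> (\<forall>h\<in>um p q. psi p h x = psi p h y)"
 unfolding coset_eq[OF subspace_Rl]
proof
 assume xy: "x - y : Rl p q"
 show "\<forall>h\<in>um p q. psi p h x = psi p h y"
  using psi_Rl[OF xy upward_mono_upward] psi_diff[OF x y] by auto
next
 assume "\<forall>h\<in>um p q. psi p h x = psi p h y"
 then have "(\<Sum>h\<in>um p q. delta (delta h, psi p h x)) = (\<Sum>h\<in>um p q. delta (delta h, psi p h y))"
  by (intro sum.cong refl) auto
 from Rl_trans[OF gn_expand[OF x, unfolded this] Rl_sym[OF gn_expand[OF y]]] show "x - y : Rl p q" .
qed

lemma psi_free_map: "x : gn p q ==> psi p' h (free_map \<phi> x) = fext (%z. bta p' (fst (\<phi> z)) (snd (\<phi> z)) h) x"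
 unfolding psi_def using gn_supp by (rule fext_free_map)

lemma Rl_gn: "x : gn p q ==> y - x : Rl p q ==> y : gn p q"
proof -
 assume x: "x : gn p q" and yx: "y - x : Rl p q"
 have "Rl p q \<subseteq> gn p q"
  unfolding Ft_relations_def tensor_relations_def
 proof (rule FS.span_minimal)
  show "FS.subspace (gn p q)" unfolding Ft_generators_def by (rule subspace_free_on)
 qed (intro Un_least; clarify;
   intro gn_diff gn_scale gn_delta free_on_add free_on_fscale traceless_add traceless_scale bcomp_level_right_free F_level_traceless; assumption)
 then have "x + (y - x) : gn p q" using x yx by (intro gn_add) auto
 then show "y : gn p q" by simp
qed

text \<open>The tensor product of two maps that commute with the symmetric group. It is used for the
  isometry action, which is trivial on diagrams, and for \<open>sharp\<close>, which is trivial on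
  tensors.\<close>

lemma free_map_Rl:
 assumes A: "!!f. f : M p q ==> A f : M p q'" "!!f f'. f : M p q ==> f' : M p q ==> A (f + f') = A f + A f'"
   "!!c f. f : M p q ==> A (fscale c f) = fscale c (A f)"
   "!!f s. f : M p q ==> s : free_on (level p p) ==> A (bcomp dl f s) = bcomp dl (A f) s"
  and B: "!!t. t : N p ==> B t : N p" "!!t t'. t : N p ==> t' : N p ==> B (t + t') = B t + B t'"
   "!!c t. t : N p ==> B (fscale c t) = fscale c (B t)"
   "!!s t. s : free_on (level p p) ==> t : N p ==> B (F p p s t) = F p p s (B t)"
  and x: "x : gn p q"
 shows "free_map (%(f, t). (A f, B t)) x : gn p q'"
  and "quotient_map (Rl p q') (free_map (%(f, t). (A f, B t))) (coset (Rl p q) x) = coset (Rl p q') (free_map (%(f, t). (A f, B t)) x)"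
proof -
 show "free_map (%(f, t). (A f, B t)) x : gn p q'"
  using x unfolding Ft_generators_def by (rule free_map_free) (use A(1) B(1) in auto)
 show "quotient_map (Rl p q') (free_map (%(f, t). (A f, B t))) (coset (Rl p q) x) = coset (Rl p q') (free_map (%(f, t). (A f, B t)) x)"
 proof (rule quotient_map_coset[OF subspace_Rl subspace_Rl])
  fix y assume yx: "y - x : Rl p q"
  have "fext (%z. delta (case z of (f, t) => (A f, B t))) (y - x) : Rl p q'"
  proof (rule fext_relations[OF subspace_Rl _ _ _ _ _ yx[unfolded Ft_relations_def]], unfold prod.case)
   fix f f' t assume "f : M p q" "f' : M p q" "t : N p"
   then show "delta (A (f + f'), B t) - delta (A f, B t) - delta (A f', B t) : Rl p q'"
    by (simp only: A(2)) (intro Rl_base A B)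
  next
   fix f t t' assume "f : M p q" "t : N p" "t' : N p"
   then show "delta (A f, B (t + t')) - delta (A f, B t) - delta (A f, B t') : Rl p q'"
    by (simp only: B(2)) (intro Rl_base A B)
  next
   fix c f t assume "f : M p q" "t : N p"
   then show "delta (A (fscale c f), B t) - fscale c (delta (A f, B t)) : Rl p q'"
    by (simp only: A(3)) (intro Rl_base A B)
  next
   fix c f t assume "f : M p q" "t : N p"
   then show "delta (A f, B (fscale c t)) - fscale c (delta (A f, B t)) : Rl p q'"
    by (simp only: B(3)) (intro Rl_base A B)
  next
   fix f t and s :: "diagram => 'k" assume "f : M p q" "s : free_on (level p p)" "t : N p"
   then show "delta (A (bcomp dl f s), B t) - delta (A f, B (F p p s t)) : Rl p q'"
    by (simp only: A(4) B(4)) (intro Rl_base A B)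
  qed
  then show "free_map (%(f, t). (A f, B t)) y - free_map (%(f, t). (A f, B t)) x : Rl p q'"
   unfolding free_map_fext fext_diff[OF gn_supp[OF Rl_gn[OF x yx]] gn_supp[OF x]] .
 qed
qed

end

section \<open>The functors and the natural transformation\<close>

context mono_basis
begin

abbreviation "cs p q \<equiv> coset (Rl p q)"
abbreviation "Fo q \<equiv> Ft_obj scale \<omega> e dl q"
abbreviation "Fm \<equiv> Ft_mor scale \<omega> e dl"
abbreviation "Ph \<equiv> Phi scale \<omega> e dl"

section \<open>Coordinates of elements of the target functor\<close>

definition rp :: "nat => (nat => ((diagram => 'k) \<times> ('k, 'v) tensor => 'k) set) => nat => (diagram => 'k) \<times> ('k, 'v) tensor => 'k" where
 "rp q A p = (SOME x. x : gn p q & A p = cs p q x)"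

text \<open>By \<open>vec_eqI\<close> these coordinates separate elements of the direct sum, so the
  identities required of modules and functors are checked on them.\<close>

definition vec :: "nat => (nat => ((diagram => 'k) \<times> ('k, 'v) tensor => 'k) set) => nat => diagram => ('k, 'v) tensor" where
 "vec q A p h = psi p h (rp q A p)"

lemmas Ft_defs = Ft_obj_def sum_gmod_def Ft_summand_def quotient_gmod_def

lemma Fo_carrier: "carrier (Fo q) = PiE {p. p \<preceq> q} (%p. cs p q ` gn p q)"
 by (simp add: Ft_defs)

lemma rp_props:
 assumes "A : carrier (Fo q)" "p \<preceq> q"
 shows rp_gn: "rp q A p : gn p q" and rp_eq: "A p = cs p q (rp q A p)"
proof -
 have "A p : cs p q ` gn p q" using assms unfolding Fo_carrier by auto
 then have "\<exists>x. x : gn p q & A p = cs p q x" by auto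
 from someI_ex[OF this] show "rp q A p : gn p q" "A p = cs p q (rp q A p)" unfolding rp_def by auto
qed

lemma mk_carrier: "(!!p. p \<preceq> q ==> x p : gn p q) ==> (\<lambda>p\<in>{p. p \<preceq> q}. cs p q (x p)) : carrier (Fo q)"
 unfolding Fo_carrier by simp

lemma um_preceq: "h : um p q ==> p \<preceq> q"
 by (rule upward_preceq[OF upward_mono_upward])

lemma vec_mk:
 assumes x: "!!p. p \<preceq> q ==> x p : gn p q" and h: "h : um p q"
 shows "vec q (\<lambda>p\<in>{p. p \<preceq> q}. cs p q (x p)) p h = psi p h (x p)"
proof -
 let ?A = "\<lambda>p\<in>{p. p \<preceq> q}. cs p q (x p)"
 note p = um_preceq[OF h]
 have "?A p = cs p q (x p)" using p by simp
 then have "cs p q (rp q ?A p) = cs p q (x p)" using rp_eq[OF mk_carrier[OF x] p] by (simp only:)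
 from iffD1[OF coset_Rl_eq[OF rp_gn[OF mk_carrier[OF x] p] x[OF p]] this] show ?thesis unfolding vec_def using h by blast
qed

lemma vec_eqI:
 assumes A: "A : carrier (Fo q)" and B: "B : carrier (Fo q)"
  and eq: "!!p h. h : um p q ==> vec q A p h = vec q B p h"
 shows "A = B"
proof (rule PiE_ext[OF A[unfolded Fo_carrier] B[unfolded Fo_carrier]])
 fix p assume "p : {p. p \<preceq> q}"
 then have p: "p \<preceq> q" by simp
 have "cs p q (rp q A p) = cs p q (rp q B p)"
  unfolding coset_Rl_eq[OF rp_gn[OF A p] rp_gn[OF B p]] using eq unfolding vec_def by blast
 then show "A p = B p" using rp_eq[OF A p] rp_eq[OF B p] by simp
qed

lemma vec_traceless: "A : carrier (Fo q) ==> h : um p q ==> vec q A p h : N p"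
 unfolding vec_def by (rule psi_traceless[OF rp_gn[OF _ um_preceq]])

lemma Fo_add:
 assumes A: "A : carrier (Fo q)" and B: "B : carrier (Fo q)"
 shows "A \<oplus>\<^bsub>Fo q\<^esub> B = (\<lambda>p\<in>{p. p \<preceq> q}. cs p q (rp q A p + rp q B p))"
proof -
 have "A \<oplus>\<^bsub>Fo q\<^esub> B = (\<lambda>p\<in>{p. p \<preceq> q}. \<Union>x\<in>A p. \<Union>y\<in>B p. cs p q (x + y))" by (simp add: Ft_defs)
 also have "... = (\<lambda>p\<in>{p. p \<preceq> q}. cs p q (rp q A p + rp q B p))"
 proof (rule restrict_ext)
  fix p assume "p : {p. p \<preceq> q}"
  then have p: "p \<preceq> q" by simp
  show "(\<Union>x\<in>A p. \<Union>y\<in>B p. cs p q (x + y)) = cs p q (rp q A p + rp q B p)"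
   using coset_add[OF subspace_Rl[of p q], where x = "rp q A p" and y = "rp q B p"]
   unfolding rp_eq[OF A p, symmetric] rp_eq[OF B p, symmetric] .
 qed
 finally show ?thesis .
qed

lemma Fo_smult:
 assumes A: "A : carrier (Fo q)"
 shows "c \<odot>\<^bsub>Fo q\<^esub> A = (\<lambda>p\<in>{p. p \<preceq> q}. cs p q (fscale c (rp q A p)))"
proof -
 have "c \<odot>\<^bsub>Fo q\<^esub> A = (\<lambda>p\<in>{p. p \<preceq> q}. quotient_map (Rl p q) (fscale c) (A p))" by (simp add: Ft_defs)
 also have "... = (\<lambda>p\<in>{p. p \<preceq> q}. cs p q (fscale c (rp q A p)))"
 proof (rule restrict_ext)
  fix p assume "p : {p. p \<preceq> q}"
  then have p: "p \<preceq> q" by simp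
  have "quotient_map (Rl p q) (fscale c) (cs p q (rp q A p)) = cs p q (fscale c (rp q A p))"
   by (rule quotient_map_coset[OF subspace_Rl subspace_Rl]) (rule Rl_scale)
  then show "quotient_map (Rl p q) (fscale c) (A p) = cs p q (fscale c (rp q A p))"
   unfolding rp_eq[OF A p, symmetric] .
 qed
 finally show ?thesis .
qed

lemma act_fm:
 assumes g: "g : G" and x: "x : gn p q"
 shows "free_map (%(f, t). (f, tensor_act g t)) x : gn p q"
  and "quotient_map (Rl p q) (free_map (%(f, t). (f, tensor_act g t))) (cs p q x) = cs p q (free_map (%(f, t). (f, tensor_act g t)) x)"
 by (rule free_map_Rl[where A = "%f. f" and B = "tensor_act g", OF _ _ _ _ _ _ _ _ x];
   simp add: traceless_act[OF g] act_add act_scale F_act[OF g level_hom traceless_tensor])+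

lemma sharp_fm:
 assumes g: "g : hom_brauer q q'" and x: "x : gn p q"
 shows "free_map (%(f, t). (sharp dl p q q' g f, t)) x : gn p q'"
  and "quotient_map (Rl p q') (free_map (%(f, t). (sharp dl p q q' g f, t))) (cs p q x) = cs p q' (free_map (%(f, t). (sharp dl p q q' g f, t)) x)"
 by (rule free_map_Rl[where A = "sharp dl p q q' g" and B = "%t. t", OF _ _ _ _ _ _ _ _ x];
   simp add: sharp_free[OF g] sharp_add_right[OF g] sharp_scale_right[OF g] sharp_bcomp_right[OF g])+

lemma Fo_act:
 assumes A: "A : carrier (Fo q)" and g: "g : G"
 shows "act (Fo q) g A = (\<lambda>p\<in>{p. p \<preceq> q}. cs p q (free_map (%(f, t). (f, tensor_act g t)) (rp q A p)))"
proof -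
 have "act (Fo q) g A = (\<lambda>p\<in>{p. p \<preceq> q}. quotient_map (Rl p q) (free_map (%(f, t). (f, tensor_act g t))) (A p))"
  by (simp add: Ft_defs)
 also have "... = (\<lambda>p\<in>{p. p \<preceq> q}. cs p q (free_map (%(f, t). (f, tensor_act g t)) (rp q A p)))"
 proof (rule restrict_ext)
  fix p assume "p : {p. p \<preceq> q}"
  then have p: "p \<preceq> q" by simp
  show "quotient_map (Rl p q) (free_map (%(f, t). (f, tensor_act g t))) (A p) = cs p q (free_map (%(f, t). (f, tensor_act g t)) (rp q A p))"
   using act_fm(2)[OF g rp_gn[OF A p]] unfolding rp_eq[OF A p, symmetric] .
 qed
 finally show ?thesis .
qed

lemma Fo_zero: "\<zero>\<^bsub>Fo q\<^esub> = (\<lambda>p\<in>{p. p \<preceq> q}. cs p q 0)"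
 by (simp add: Ft_defs)

lemma Fm_eq:
 assumes g: "g : hom_brauer q q'" and A: "A : carrier (Fo q)"
 shows "Fm q q' g A = (\<lambda>p\<in>{p. p \<preceq> q'}. cs p q' (if p \<preceq> q then free_map (%(f, t). (sharp dl p q q' g f, t)) (rp q A p) else 0))"
 unfolding Ft_mor_def
proof (rule restrict_ext)
 fix p
 show "(if p \<preceq> q then quotient_map (Rl p q') (free_map (%(f, t). (sharp dl p q q' g f, t))) (A p) else \<zero>\<^bsub>Ft_summand scale \<omega> e dl p q'\<^esub>) =
   cs p q' (if p \<preceq> q then free_map (%(f, t). (sharp dl p q q' g f, t)) (rp q A p) else 0)"
 proof (cases "p \<preceq> q")
  case True
  show ?thesis
   using sharp_fm(2)[OF g rp_gn[OF A True]] unfolding rp_eq[OF A True, symmetric] if_P[OF True] .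
 next
  case False
  then show ?thesis by (simp add: Ft_summand_def quotient_gmod_def)
 qed
qed

lemma add_closed: "A : carrier (Fo q) ==> B : carrier (Fo q) ==> A \<oplus>\<^bsub>Fo q\<^esub> B : carrier (Fo q)"
 unfolding Fo_add by (rule mk_carrier) (intro gn_add rp_gn)

lemma smult_closed: "A : carrier (Fo q) ==> c \<odot>\<^bsub>Fo q\<^esub> A : carrier (Fo q)"
 unfolding Fo_smult by (rule mk_carrier) (intro gn_scale rp_gn)

lemma act_closed: "A : carrier (Fo q) ==> g : G ==> act (Fo q) g A : carrier (Fo q)"
 unfolding Fo_act by (rule mk_carrier) (intro act_fm rp_gn)

lemma zero_closed: "\<zero>\<^bsub>Fo q\<^esub> : carrier (Fo q)"
 unfolding Fo_zero by (rule mk_carrier) (rule gn_zero)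

lemma Fm_gn:
 assumes "g : hom_brauer q q'" "A : carrier (Fo q)"
 shows "(if p \<preceq> q then free_map (%(f, t). (sharp dl p q q' g f, t)) (rp q A p) else 0) : gn p q'"
 using sharp_fm(1)[OF assms(1) rp_gn[OF assms(2)]] gn_zero by simp

lemma Fm_closed: "g : hom_brauer q q' ==> A : carrier (Fo q) ==> Fm q q' g A : carrier (Fo q')"
 unfolding Fm_eq by (rule mk_carrier) (rule Fm_gn)

lemma vec_add:
 assumes "A : carrier (Fo q)" "B : carrier (Fo q)" and h: "h : um p q"
 shows "vec q (A \<oplus>\<^bsub>Fo q\<^esub> B) p h = vec q A p h + vec q B p h"
proof -
 have "vec q (A \<oplus>\<^bsub>Fo q\<^esub> B) p h = psi p h (rp q A p + rp q B p)"
  unfolding Fo_add[OF assms(1,2)] by (rule vec_mk[OF _ h]) (intro gn_add rp_gn assms(1,2))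
 also have "... = vec q A p h + vec q B p h"
  unfolding vec_def by (rule psi_add[OF rp_gn[OF assms(1) um_preceq[OF h]] rp_gn[OF assms(2) um_preceq[OF h]]])
 finally show ?thesis .
qed

lemma vec_smult:
 assumes "A : carrier (Fo q)" and h: "h : um p q"
 shows "vec q (c \<odot>\<^bsub>Fo q\<^esub> A) p h = fscale c (vec q A p h)"
proof -
 have "vec q (c \<odot>\<^bsub>Fo q\<^esub> A) p h = psi p h (fscale c (rp q A p))"
  unfolding Fo_smult[OF assms(1)] by (rule vec_mk[OF _ h]) (intro gn_scale rp_gn assms(1))
 also have "... = fscale c (vec q A p h)"
  unfolding vec_def by (rule psi_scale[OF rp_gn[OF assms(1) um_preceq[OF h]]])
 finally show ?thesis .
qed

lemma vec_zero: "h : um p q ==> vec q \<zero>\<^bsub>Fo q\<^esub> p h = 0"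
 unfolding Fo_zero by (subst vec_mk[where x = "%_. 0"]) (simp_all only: gn_zero psi_zero)

lemma bta_act:
 assumes g: "g : G" and t: "t : tn p"
 shows "bta p f (tensor_act g t) h = tensor_act g (bta p f t h)"
 unfolding bta_def act_sum act_scale
 by (rule sum.cong[OF refl]) (simp only: dmap_act[OF g perm_diagram_brauer t] mem_Collect_eq)

lemma vec_act:
 assumes A: "A : carrier (Fo q)" and g: "g : G" and h: "h : um p q"
 shows "vec q (act (Fo q) g A) p h = tensor_act g (vec q A p h)"
proof -
 note x = rp_gn[OF A um_preceq[OF h]]
 have "vec q (act (Fo q) g A) p h = psi p h (free_map (%(f, t). (f, tensor_act g t)) (rp q A p))"
  unfolding Fo_act[OF A g] by (rule vec_mk[OF act_fm(1)[OF g rp_gn[OF A]] h])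
 also have "... = tensor_act g (vec q A p h)"
  unfolding psi_free_map[OF x] unfolding vec_def psi_def fext_def act_sum act_scale
 proof (rule sum.cong[OF refl])
  fix z assume "z : supp (rp q A p)"
  then have "snd z : N p" using x unfolding Ft_generators_def free_on_def[of "M p q \<times> N p"] by auto
  then show "fscale (rp q A p z) (bta p (fst (case z of (f, t) => (f, tensor_act g t))) (snd (case z of (f, t) => (f, tensor_act g t))) h) =
    fscale (rp q A p z) (tensor_act g (bta p (fst z) (snd z) h))"
   by (simp only: case_prod_unfold fst_conv snd_conv bta_act[OF g traceless_tensor])
 qed
 finally show ?thesis .
qed

lemma fext_sum_delta: "finite A ==> fext \<beta> (\<Sum>a\<in>A. delta (k a)) = (\<Sum>a\<in>A. \<beta> (k a))"
 using fext_lincomb[of A \<beta> "%_. 1" k] by (simp only: FS.scale_one)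

text \<open>The chosen representative is exchanged for its expansion over monotone diagrams, which
  leaves the coset unchanged.\<close>

lemma vec_Fm:
 assumes g: "g : hom_brauer q q'" and A: "A : carrier (Fo q)" and h: "h : um p q'"
 shows "vec q' (Fm q q' g A) p h = (\<Sum>h'\<in>um p q. bta p (sharp dl p q q' g (delta h')) (vec q A p h') h)"
proof -
 have v: "vec q' (Fm q q' g A) p h = psi p h (if p \<preceq> q then free_map (%(f, t). (sharp dl p q q' g f, t)) (rp q A p) else 0)"
  unfolding Fm_eq[OF g A] by (rule vec_mk[OF Fm_gn[OF g A] h])
 show ?thesis
 proof (cases "p \<preceq> q")
  case False
  \<comment> \<open>With no monotone diagram at all, the empty sum matches the value 0 prescribed
    for a summand absent from the source.\<close>
  then have "um p q = {}" using um_preceq by blast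
  then show ?thesis unfolding v if_not_P[OF False] by (simp only: psi_zero sum.empty)
 next
  case True
  note x = rp_gn[OF A True]
  let ?y = "\<Sum>h'\<in>um p q. delta (delta h', vec q A p h')" and ?\<phi> = "%(f, t). (sharp dl p q q' g f, t)"
  have y: "?y : gn p q"
   by (intro gn_sum gn_delta free_on_delta upward_mono_upward vec_traceless[OF A])
  have "cs p q (rp q A p) = cs p q ?y"
   unfolding coset_eq[OF subspace_Rl] vec_def by (rule gn_expand[OF x])
  then have "cs p q' (free_map ?\<phi> (rp q A p)) = cs p q' (free_map ?\<phi> ?y)"
   using sharp_fm(2)[OF g x] sharp_fm(2)[OF g y] by (simp only:)
  then have "psi p h (free_map ?\<phi> (rp q A p)) = psi p h (free_map ?\<phi> ?y)"
   unfolding coset_Rl_eq[OF sharp_fm(1)[OF g x] sharp_fm(1)[OF g y]] using h by blast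
  also have "... = (\<Sum>h'\<in>um p q. bta p (sharp dl p q q' g (delta h')) (vec q A p h') h)"
   unfolding psi_free_map[OF y] fext_sum_delta[OF finite_upward_mono] by (simp only: prod.case fst_conv snd_conv)
  finally show ?thesis unfolding v if_P[OF True] .
 qed
qed

text \<open>By uniqueness of the factorisation, only the identity permutation takes a monotone
  diagram to a monotone one.\<close>

lemma bta_delta:
 assumes f: "f : um p q" and h: "h : um p q" and t: "t : tn p"
 shows "bta p (delta f) t h = (if f = h then t else 0)"
proof -
 have eq: "delta f (dcomp h (pd p \<sigma>)) = (if f = h & \<sigma> = id then 1 else (0 :: 'k))" if \<sigma>: "\<sigma> : perms p" for \<sigma>
 proof -
  have fid: "f = dcomp f (pd p id)" using dcomp_id_right[OF upward_brauer[OF upward_mono_upward[OF f]]] by simp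
  have "dcomp h (pd p \<sigma>) = f \<longleftrightarrow> h = f & \<sigma> = id"
   using upward_decomp_unique[OF h f _ permutes_id, of \<sigma>] \<sigma> fid by auto
  then show ?thesis by (auto simp: delta_apply)
 qed
 have "bta p (delta f) t h = (\<Sum>\<sigma>\<in>perms p. if \<sigma> = id then (if f = h then t else 0) else 0)"
  unfolding bta_def
 proof (rule sum.cong[OF refl])
  fix \<sigma> assume \<sigma>: "\<sigma> : perms p"
  show "fscale (delta f (dcomp h (pd p \<sigma>))) (D p \<sigma> t) = (if \<sigma> = id then (if f = h then t else 0) else 0)"
   unfolding eq[OF \<sigma>] using D_id[OF t] by (cases "f = h"; cases "\<sigma> = id") (simp_all only: simp_thms if_True if_False FS.scale_one FS.scale_zero_left)
 qed
 also have "... = (if f = h then t else 0)"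
  by (simp only: sum.delta[OF finite_perms]) (simp only: mem_Collect_eq permutes_id if_True)
 finally show ?thesis .
qed

section \<open>Naturality and injectivity in coordinates\<close>

lemma Ph_eq: "Ph q v = (\<lambda>p\<in>{p. p \<preceq> q}. cs p q (\<Sum>f\<in>um p q. delta (delta f, proj p (F q p (delta (bar f)) v))))"
 by (simp only: Phi_def traceless_proj_eq)

context
 fixes q :: nat and v :: "('k, 'v) tensor"
 assumes v: "v : tn q"
begin

lemma bar_um: "f : um p q ==> bar f : brauer q p"
 by (rule bar_brauer[OF upward_brauer[OF upward_mono_upward]])

lemma coord_traceless: "f : um p q ==> proj p (F q p (delta (bar f)) v) : N p"
 by (rule proj_traceless[OF F_tensor[OF delta_hom[OF bar_um] v]])

lemma Ph_gn: "(\<Sum>f\<in>um p q. delta (delta f, proj p (F q p (delta (bar f)) v))) : gn p q"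
 by (intro gn_sum gn_delta free_on_delta upward_mono_upward coord_traceless)

lemma Ph_carrier: "Ph q v : carrier (Fo q)"
 unfolding Ph_eq by (rule mk_carrier) (rule Ph_gn)

lemma vec_Ph:
 assumes h: "h : um p q"
 shows "vec q (Ph q v) p h = proj p (dmap q p (bar h) v)"
proof -
 have "vec q (Ph q v) p h = psi p h (\<Sum>f\<in>um p q. delta (delta f, proj p (F q p (delta (bar f)) v)))"
  unfolding Ph_eq by (rule vec_mk[OF Ph_gn h])
 also have "... = (\<Sum>f\<in>um p q. bta p (delta f) (proj p (F q p (delta (bar f)) v)) h)"
  unfolding psi_def fext_sum_delta[OF finite_upward_mono] by (simp only: fst_conv snd_conv)
 also have "... = (\<Sum>f\<in>um p q. if f = h then proj p (F q p (delta (bar h)) v) else 0)"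
 proof (rule sum.cong[OF refl])
  fix f assume f: "f : um p q"
  show "bta p (delta f) (proj p (F q p (delta (bar f)) v)) h = (if f = h then proj p (F q p (delta (bar h)) v) else 0)"
   using bta_delta[OF f h traceless_tensor[OF coord_traceless[OF f]]] by (cases "f = h") (simp_all only: if_True if_False simp_thms)
 qed
 also have "... = proj p (dmap q p (bar h) v)"
  using h by (simp only: sum.delta[OF finite_upward_mono] if_True F_delta[OF bar_um])
 finally show ?thesis .
qed

text \<open>The projection kills the non-downward terms of the composite of \<open>bar h\<close> and
  \<open>g\<close>, which are the terms that \<open>down_proj\<close> removes in
  \<open>sharp\<close>.\<close>

lemma proj_F:
 assumes g: "g : hom_brauer q q'" and h: "h : upward p q'"
 shows "proj p (dmap q' p (bar h) (F q q' g v)) = (\<Sum>u\<in>upward p q. fscale (sharp_coeff dl g h u) (proj p (dmap q p (bar u) v)))"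
proof -
 have bh: "bar h : brauer q' p" by (rule bar_brauer[OF upward_brauer[OF h]])
 let ?c = "bcomp dl (delta (bar h)) g"
 have c: "?c : hom_brauer q p" by (rule bcomp_hom[OF delta_hom[OF bh] g])
 have "proj p (dmap q' p (bar h) (F q q' g v)) = proj p (F q p ?c v)"
  unfolding F_bcomp[OF delta_hom[OF bh] g v] F_delta[OF bh] ..
 also have "... = (\<Sum>d\<in>brauer q p. fscale (?c d) (proj p (dmap q p d v)))"
  unfolding F_sum[OF c] by (rule linear_on_sum[OF proj_linear dmap_tensor[OF _ v]])
 also have "... = (\<Sum>d\<in>downward q p. fscale (?c d) (proj p (dmap q p d v)))"
 proof (rule sum.mono_neutral_right[OF finite_brauer])
  show "downward q p \<subseteq> brauer q p" using downward_brauer by blast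
  show "\<forall>d\<in>brauer q p - downward q p. fscale (?c d) (proj p (dmap q p d v)) = 0"
   using proj_not_downward[OF _ _ v] by (simp add: fscale_zero_right)
 qed
 finally show ?thesis unfolding sum_downward_bar sharp_coeff_def .
qed

text \<open>Over the orbit of a monotone \<open>f\<close>, a permutation acts on the projected
  tensor through its inverse. Shifting it into the coefficient by \<open>sharp_coeff_perm\<close>
  turns the orbit sum into a coordinate of \<open>sharp\<close>.\<close>

lemma natural:
 assumes g: "g : hom_brauer q q'"
 shows "Phi scale \<omega> e dl q' (F q q' g v) = Fm q q' g (Ph q v)"
proof (rule vec_eqI)
 have Fv: "F q q' g v : tn q'" by (rule F_tensor[OF g v])
 show "Ph q' (F q q' g v) : carrier (Fo q')" by (rule mono_basis.Ph_carrier[OF mono_basis_axioms Fv])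
 show "Fm q q' g (Ph q v) : carrier (Fo q')" by (rule Fm_closed[OF g Ph_carrier])
 fix p h assume hm: "h : um p q'"
 then have h: "h : upward p q'" by (rule upward_mono_upward)
 have "vec q' (Ph q' (F q q' g v)) p h = (\<Sum>u\<in>upward p q. fscale (sharp_coeff dl g h u) (proj p (dmap q p (bar u) v)))"
  unfolding mono_basis.vec_Ph[OF mono_basis_axioms Fv hm] by (rule proj_F[OF g h])
 also have "... = (\<Sum>f\<in>um p q. bta p (sharp dl p q q' g (delta f)) (proj p (dmap q p (bar f) v)) h)"
  unfolding sum_upward
 proof (rule sum.cong[OF refl])
  fix f assume fm: "f : um p q"
  then have f: "f : upward p q" by (rule upward_mono_upward)
  note fb = upward_brauer[OF f]
  have bf: "bar f : brauer q p" by (rule bar_um[OF fm])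
  let ?t = "proj p (dmap q p (bar f) v)"
  have 1: "proj p (dmap q p (bar (dcomp f (pd p \<tau>))) v) = D p (iv \<tau>) ?t" if \<tau>: "\<tau> permutes {..<p}" for \<tau>
  proof -
   note P = perm_diagram_brauer[OF permutes_inv[OF \<tau>]]
   have "dmap q p (bar (dcomp f (pd p \<tau>))) v = D p (iv \<tau>) (dmap q p (bar f) v)"
    unfolding bar_dcomp_perm[OF fb \<tau>] dmap_dcomp[OF P bf v] loops_upward[OF perm_upward[OF permutes_inv[OF \<tau>]] bf]
    by (simp only: power_0 fscale_one)
   then show ?thesis using proj_perm[OF permutes_inv[OF \<tau>] dmap_tensor[OF bf v]] by (simp only:)
  qed
  have "(\<Sum>\<tau>\<in>perms p. fscale (sharp_coeff dl g h (dcomp f (pd p \<tau>))) (proj p (dmap q p (bar (dcomp f (pd p \<tau>))) v))) =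
    (\<Sum>\<tau>\<in>perms p. fscale (sharp_coeff dl g h (dcomp f (pd p \<tau>))) (D p (iv \<tau>) ?t))"
   by (rule sum.cong[OF refl]) (simp only: 1 mem_Collect_eq)
  \<comment> \<open>Summing over inverses brings the orbit sum into the form of
    \<open>bta\<close>.\<close>
  also have "... = (\<Sum>\<sigma>\<in>perms p. fscale (sharp_coeff dl g h (dcomp f (pd p (iv \<sigma>)))) (D p (iv (iv \<sigma>)) ?t))"
   by (rule sum_permutations_inverse)
  also have "... = bta p (sharp dl p q q' g (delta f)) ?t h"
   unfolding bta_def
  proof (rule sum.cong[OF refl])
   fix \<sigma> assume "\<sigma> : perms p"
   then have \<sigma>: "\<sigma> permutes {..<p}" by simp
   let ?u = "dcomp f (pd p (iv \<sigma>))" and ?w = "dcomp h (pd p \<sigma>)"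
   have u: "?u : brauer p q" by (rule dcomp_brauer[OF fb perm_diagram_brauer[OF permutes_inv[OF \<sigma>]]])
   have w: "?w : upward p q'" by (rule upward_dcomp[OF h perm_upward[OF \<sigma>]])
   have "sharp dl p q q' g (delta f) ?w = (\<Sum>u\<in>upward p q. sharp_coeff dl g ?w u * of_bool (u = f))"
    unfolding sharp_apply[OF g free_on_delta[OF f]] if_P[OF w] by (intro sum.cong refl) (simp add: delta_apply)
   also have "... = sharp_coeff dl g ?w f" by (rule sum_of_bool_pick[OF finite_upward f])
   also have "... = sharp_coeff dl g h ?u"
    using sharp_coeff_perm[OF upward_brauer[OF h] u g \<sigma>] unfolding dcomp_perm_cancel(2)[OF fb \<sigma>] .
   finally show "fscale (sharp_coeff dl g h ?u) (D p (iv (iv \<sigma>)) ?t) = fscale (sharp dl p q q' g (delta f) ?w) (D p \<sigma> ?t)"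
    by (simp only: permutes_inv_inv[OF \<sigma>])
  qed
  finally show "(\<Sum>\<tau>\<in>perms p. fscale (sharp_coeff dl g h (dcomp f (pd p \<tau>))) (proj p (dmap q p (bar (dcomp f (pd p \<tau>))) v))) =
    bta p (sharp dl p q q' g (delta f)) ?t h" .
 qed
 also have "... = vec q' (Fm q q' g (Ph q v)) p h"
  unfolding vec_Fm[OF g Ph_carrier hm] by (rule sum.cong[OF refl]) (simp only: vec_Ph)
 finally show "vec q' (Ph q' (F q q' g v)) p h = vec q' (Fm q q' g (Ph q v)) p h" .
qed

lemma coords_zero:
 assumes z: "!!p h. h : um p q ==> proj p (dmap q p (bar h) v) = 0"
 shows "v = 0"
proof -
 \<comment> \<open>The projection commutes with permutations, so vanishing passes from the reflected
   monotone diagrams to all downward ones.\<close>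
 have u0: "proj p (dmap q p d v) = 0" if d: "d : downward q p" for d p
 proof -
  have db: "d : brauer q p" by (rule downward_brauer[OF d])
  have "bar d : upward p q" using bar_upward[OF db] d by simp
  then obtain h \<sigma> where h: "h : um p q" "\<sigma> permutes {..<p}" "bar d = dcomp h (pd p \<sigma>)"
   by (rule upward_decomp_exists)
  note hb = upward_brauer[OF upward_mono_upward[OF h(1)]]
  note bh = bar_um[OF h(1)] and P = perm_diagram_brauer[OF permutes_inv[OF h(2)]]
  have "d = dcomp (pd p (iv \<sigma>)) (bar h)"
   using bar_dcomp_perm[OF hb h(2)] unfolding h(3)[symmetric] bar_bar .
  then have "dmap q p d v = D p (iv \<sigma>) (dmap q p (bar h) v)"
   unfolding dmap_dcomp[OF P bh v] loops_upward[OF perm_upward[OF permutes_inv[OF h(2)]] bh]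
   by (simp only: power_0 fscale_one)
  then show ?thesis
   using proj_perm[OF permutes_inv[OF h(2)] dmap_tensor[OF bh v]] z[OF h(1)] by (simp only: dmap_zero)
 qed
 have "\<forall>d\<in>downward q p. dmap q p d v = 0" for p
 proof (induction p rule: less_induct)
  case (less p)
  show ?case
  proof
   fix d assume d: "d : downward q p"
   note db = downward_brauer[OF d]
   \<comment> \<open>Contracting after a downward diagram is a downward diagram to
     \<open>p - 2\<close> points, where the induction hypothesis applies. The traceless tensor
     obtained is its own projection, which is zero by \<open>u0\<close>.\<close>
   have "dmap p (p - 2) (contraction p i j) (dmap q p d v) = 0" if ij: "i < j" "j < p" for i j
   proof -
    have ij': "i < p" "j < p" "i ~= j" using ij by auto
    have "dcomp (contraction p i j) d : downward q (p - 2)"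
     by (rule downward_dcomp[OF contraction_downward[OF ij'] d])
    then have "dmap q (p - 2) (dcomp (contraction p i j) d) v = 0" using less.IH[of "p - 2"] ij by auto
    then show ?thesis unfolding dmap_dcomp[OF contraction_brauer[OF ij'] db v] by (simp only: fscale_zero_right)
   qed
   then have "dmap q p d v : N p"
    unfolding traceless_con using dmap_tensor[OF db v] dmap_contraction_zero_iff[OF _ _ dmap_tensor[OF db v]] by blast
   then show "dmap q p d v = 0" using proj_id u0[OF d] by metis
  qed
 qed
 then have "D q id v = 0" using perm_downward[OF permutes_id] by blast
 then show ?thesis using D_id[OF v] by simp
qed

end

end

context mono_basis
begin

section \<open>Module structures and functoriality\<close>

lemma gmodule_F: "gmodule G (F_obj scale q)"
 unfolding F_obj_def function_gmod_def
 by (rule gmoduleI)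
  (simp_all add: tensor_add tensor_0 tensor_scale FS.scale_left_distrib FS.scale_right_distrib act_tensor act_add act_scale act_id act_comp)

lemma gmodule_Ft: "gmodule G (Fo q)"
proof (rule gmoduleI)
 note cl = add_closed smult_closed act_closed zero_closed
 fix A B C g h and c d :: 'k
 assume A: "A : carrier (Fo q)"
 show "(- 1) \<odot>\<^bsub>Fo q\<^esub> A \<oplus>\<^bsub>Fo q\<^esub> A = \<zero>\<^bsub>Fo q\<^esub>"
  by (rule vec_eqI[where q = q]) (simp_all add: A cl vec_add vec_smult vec_zero)
 show "\<zero>\<^bsub>Fo q\<^esub> \<oplus>\<^bsub>Fo q\<^esub> A = A" by (rule vec_eqI[where q = q]) (simp_all add: A cl vec_add vec_zero)
 show "c \<odot>\<^bsub>Fo q\<^esub> A : carrier (Fo q)" by (rule smult_closed[OF A])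
 show "(c + d) \<odot>\<^bsub>Fo q\<^esub> A = c \<odot>\<^bsub>Fo q\<^esub> A \<oplus>\<^bsub>Fo q\<^esub> d \<odot>\<^bsub>Fo q\<^esub> A"
  by (rule vec_eqI[where q = q]) (simp_all add: A cl vec_add vec_smult FS.scale_left_distrib)
 show "(c * d) \<odot>\<^bsub>Fo q\<^esub> A = c \<odot>\<^bsub>Fo q\<^esub> (d \<odot>\<^bsub>Fo q\<^esub> A)"
  by (rule vec_eqI[where q = q]) (simp_all add: A cl vec_smult)
 show "1 \<odot>\<^bsub>Fo q\<^esub> A = A" by (rule vec_eqI[where q = q]) (simp_all add: A cl vec_smult)
 show "act (Fo q) id A = A"
 proof (rule vec_eqI[where q = q])
  have idG: "id : G" by (rule isometryI) simp_all
  show "act (Fo q) id A : carrier (Fo q)" "A : carrier (Fo q)" by (rule act_closed[OF A idG], rule A)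
  show "vec q (act (Fo q) id A) p h = vec q A p h" if "h : um p q" for p h
   by (simp only: vec_act[OF A idG that] act_id)
 qed
 assume B: "B : carrier (Fo q)"
 show "A \<oplus>\<^bsub>Fo q\<^esub> B : carrier (Fo q)" by (rule add_closed[OF A B])
 show "A \<oplus>\<^bsub>Fo q\<^esub> B = B \<oplus>\<^bsub>Fo q\<^esub> A" by (rule vec_eqI[where q = q]) (simp_all add: A B cl vec_add add.commute)
 show "c \<odot>\<^bsub>Fo q\<^esub> (A \<oplus>\<^bsub>Fo q\<^esub> B) = c \<odot>\<^bsub>Fo q\<^esub> A \<oplus>\<^bsub>Fo q\<^esub> c \<odot>\<^bsub>Fo q\<^esub> B"
  by (rule vec_eqI[where q = q]) (simp_all add: A B cl vec_add vec_smult FS.scale_right_distrib)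
 assume C: "C : carrier (Fo q)"
 show "(A \<oplus>\<^bsub>Fo q\<^esub> B) \<oplus>\<^bsub>Fo q\<^esub> C = A \<oplus>\<^bsub>Fo q\<^esub> (B \<oplus>\<^bsub>Fo q\<^esub> C)"
  by (rule vec_eqI[where q = q]) (simp_all add: A B C cl vec_add add.assoc)
next
 show "\<zero>\<^bsub>Fo q\<^esub> : carrier (Fo q)" by (rule zero_closed)
next
 fix A g assume g: "g : G" and A: "A : carrier (Fo q)"
 show "act (Fo q) g A : carrier (Fo q)" by (rule act_closed[OF A g])
 show "act (Fo q) g (c \<odot>\<^bsub>Fo q\<^esub> A) = c \<odot>\<^bsub>Fo q\<^esub> act (Fo q) g A" for c
  by (rule vec_eqI[where q = q]) (simp_all add: A g act_closed smult_closed vec_act vec_smult act_scale)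
 show "act (Fo q) g (A \<oplus>\<^bsub>Fo q\<^esub> B) = act (Fo q) g A \<oplus>\<^bsub>Fo q\<^esub> act (Fo q) g B" if "B : carrier (Fo q)" for B
  by (rule vec_eqI[where q = q]) (simp_all add: A g that act_closed add_closed vec_act vec_add act_add)
 fix h assume h: "h : G"
 have gh: "g o h : G"
  by (rule isometryI) (simp_all add: isometryD[OF g] isometryD[OF h] bij_comp)
 show "act (Fo q) (g o h) A = act (Fo q) g (act (Fo q) h A)"
  by (rule vec_eqI[where q = q]) (simp_all add: A g h gh act_closed vec_act act_comp)
qed

lemma Ph_hom: "gmod_hom G (F_obj scale q) (Fo q) (Ph q)"
proof -
 have add: "Ph q (s + t) = Ph q s \<oplus>\<^bsub>Fo q\<^esub> Ph q t" if s: "s : tn q" and t: "t : tn q" for s t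
 proof (rule vec_eqI)
  show "Ph q (s + t) : carrier (Fo q)" "Ph q s \<oplus>\<^bsub>Fo q\<^esub> Ph q t : carrier (Fo q)"
   by (intro Ph_carrier tensor_add s t add_closed)+
  fix p h assume h: "h : um p q"
  show "vec q (Ph q (s + t)) p h = vec q (Ph q s \<oplus>\<^bsub>Fo q\<^esub> Ph q t) p h"
   unfolding vec_add[OF Ph_carrier[OF s] Ph_carrier[OF t] h] vec_Ph[OF tensor_add[OF s t] h] vec_Ph[OF s h] vec_Ph[OF t h]
    dmap_add[OF s t] by (rule proj_add[OF dmap_tensor[OF bar_um[OF s h] s] dmap_tensor[OF bar_um[OF s h] t]])
 qed
 have sc: "Ph q (fscale c t) = c \<odot>\<^bsub>Fo q\<^esub> Ph q t" if t: "t : tn q" for c t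
 proof (rule vec_eqI)
  show "Ph q (fscale c t) : carrier (Fo q)" "c \<odot>\<^bsub>Fo q\<^esub> Ph q t : carrier (Fo q)"
   by (intro Ph_carrier tensor_scale t smult_closed)+
  fix p h assume h: "h : um p q"
  show "vec q (Ph q (fscale c t)) p h = vec q (c \<odot>\<^bsub>Fo q\<^esub> Ph q t) p h"
   unfolding vec_smult[OF Ph_carrier[OF t] h] vec_Ph[OF tensor_scale[OF t] h] vec_Ph[OF t h] dmap_fscale[OF t]
   by (rule proj_scale[OF dmap_tensor[OF bar_um[OF t h] t]])
 qed
 have ac: "Ph q (tensor_act g t) = act (Fo q) g (Ph q t)" if g: "g : G" and t: "t : tn q" for g t
 proof (rule vec_eqI)
  show "Ph q (tensor_act g t) : carrier (Fo q)" "act (Fo q) g (Ph q t) : carrier (Fo q)"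
   by (intro Ph_carrier act_tensor t act_closed g)+
  fix p h assume h: "h : um p q"
  show "vec q (Ph q (tensor_act g t)) p h = vec q (act (Fo q) g (Ph q t)) p h"
   unfolding vec_act[OF Ph_carrier[OF t] g h] vec_Ph[OF act_tensor[OF g t] h] vec_Ph[OF t h] dmap_act[OF g bar_um[OF t h] t]
   by (rule proj_act[OF g dmap_tensor[OF bar_um[OF t h] t]])
 qed
 show ?thesis
  unfolding gmod_hom_def F_obj_def function_gmod_def using add sc ac Ph_carrier by simp
qed

lemma Ph_inj: "inj_on (Ph q) (carrier (F_obj scale q))"
proof (rule inj_onI)
 fix s t assume "s : carrier (F_obj scale q)" "t : carrier (F_obj scale q)" and eq: "Ph q s = Ph q t"
 then have s: "s : tn q" and t: "t : tn q" by (simp_all add: F_obj_def function_gmod_def)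
 have "s - t = 0"
 proof (rule coords_zero[OF tensor_diff[OF s t]])
  fix p h assume h: "h : um p q"
  note st = dmap_tensor[OF bar_um[OF s h] s] dmap_tensor[OF bar_um[OF s h] t]
  have "proj p (dmap q p (bar h) s) = proj p (dmap q p (bar h) t)"
   using vec_Ph[OF s h] vec_Ph[OF t h] eq by simp
  then show "proj p (dmap q p (bar h) (s - t)) = 0"
   unfolding diff_fscale dmap_add[OF s tensor_scale[OF t]] dmap_fscale[OF t] proj_add[OF st(1) tensor_scale[OF st(2)]] proj_scale[OF st(2)]
   by (simp add: diff_fscale[symmetric])
 qed
 then show "s = t" by simp
qed

lemma functor_F: "brauer_functor dl G (F_obj scale) F"
 unfolding brauer_functor_def gmod_hom_def using gmodule_F
 by (simp add: F_obj_def function_gmod_def F_tensor F_add_right F_scale_right F_act F_add_left F_scale_left F_bid F_bcomp)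

text \<open>The coordinates of \<open>sharp\<close> applied to \<open>f\<close> depend on
  \<open>f\<close> and \<open>t\<close> only through the coordinates of their tensor; this is what
  lets matrices of morphisms be multiplied in \<open>functor_Ft\<close>.\<close>

lemma bta_sharp:
 assumes g: "g : hom_brauer q q'" and f: "f : M p q" and t: "t : N p" and h: "h : um p q'"
 shows "bta p (sharp dl p q q' g f) t h = (\<Sum>h'\<in>um p q. bta p (sharp dl p q q' g (delta h')) (bta p f t h') h)"
proof -
 let ?y = "\<Sum>h'\<in>um p q. delta (delta h', bta p f t h')" and ?\<phi> = "%(f, t). (sharp dl p q q' g f, t)"
 have x: "delta (f, t) : gn p q" by (rule gn_delta[OF f t])
 have y: "?y : gn p q" by (intro gn_sum gn_delta free_on_delta upward_mono_upward bta_traceless t)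
 have "cs p q (delta (f, t)) = cs p q ?y" unfolding coset_eq[OF subspace_Rl] by (rule Rl_expand[OF f t])
 then have "cs p q' (free_map ?\<phi> (delta (f, t))) = cs p q' (free_map ?\<phi> ?y)"
  using sharp_fm(2)[OF g x] sharp_fm(2)[OF g y] by (simp only:)
 from iffD1[OF coset_Rl_eq[OF sharp_fm(1)[OF g x] sharp_fm(1)[OF g y]] this]
 have "psi p h (free_map ?\<phi> (delta (f, t))) = psi p h (free_map ?\<phi> ?y)" using h by blast
 then show ?thesis
  unfolding psi_free_map[OF y] psi_free_map[OF x] fext_sum_delta[OF finite_upward_mono] fext_delta
  by (simp only: prod.case fst_conv snd_conv)
qed

lemma functor_Ft: "brauer_functor dl G Fo Fm"
proof -
 have dM: "delta h : M p q" if "h : um p q" for h p q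
  by (rule free_on_delta[OF upward_mono_upward[OF that]])
 have hom: "gmod_hom G (Fo p') (Fo q') (Fm p' q' x)" if x: "x : hom_brauer p' q'" for p' q' x
  unfolding gmod_hom_def
 proof (intro conjI ballI allI)
  show "Fm p' q' x : carrier (Fo p') \<rightarrow> carrier (Fo q')" using Fm_closed[OF x] by auto
  fix A assume A: "A : carrier (Fo p')"
  note FA = Fm_closed[OF x A]
  show "Fm p' q' x (A \<oplus>\<^bsub>Fo p'\<^esub> B) = Fm p' q' x A \<oplus>\<^bsub>Fo q'\<^esub> Fm p' q' x B" if B: "B : carrier (Fo p')" for B
  proof (rule vec_eqI[OF Fm_closed[OF x add_closed[OF A B]] add_closed[OF FA Fm_closed[OF x B]]])
   fix p h assume h: "h : um p q'"
   show "vec q' (Fm p' q' x (A \<oplus>\<^bsub>Fo p'\<^esub> B)) p h = vec q' (Fm p' q' x A \<oplus>\<^bsub>Fo q'\<^esub> Fm p' q' x B) p h"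
    unfolding vec_add[OF FA Fm_closed[OF x B] h] vec_Fm[OF x A h] vec_Fm[OF x B h] vec_Fm[OF x add_closed[OF A B] h] sum.distrib[symmetric]
    by (rule sum.cong[OF refl]) (simp only: vec_add[OF A B] bta_add_right vec_traceless[OF A] vec_traceless[OF B])
  qed
  show "Fm p' q' x (c \<odot>\<^bsub>Fo p'\<^esub> A) = c \<odot>\<^bsub>Fo q'\<^esub> Fm p' q' x A" for c
  proof (rule vec_eqI[OF Fm_closed[OF x smult_closed[OF A]] smult_closed[OF FA]])
   fix p h assume h: "h : um p q'"
   show "vec q' (Fm p' q' x (c \<odot>\<^bsub>Fo p'\<^esub> A)) p h = vec q' (c \<odot>\<^bsub>Fo q'\<^esub> Fm p' q' x A) p h"
    unfolding vec_smult[OF FA h] vec_Fm[OF x A h] vec_Fm[OF x smult_closed[OF A] h] FS.scale_sum_right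
    by (rule sum.cong[OF refl]) (simp only: vec_smult[OF A] bta_scale_right vec_traceless[OF A])
  qed
  fix g assume g: "g : G"
  show "Fm p' q' x (act (Fo p') g A) = act (Fo q') g (Fm p' q' x A)"
  proof (rule vec_eqI[OF Fm_closed[OF x act_closed[OF A g]] act_closed[OF FA g]])
   fix p h assume h: "h : um p q'"
   show "vec q' (Fm p' q' x (act (Fo p') g A)) p h = vec q' (act (Fo q') g (Fm p' q' x A)) p h"
    unfolding vec_act[OF FA g h] vec_Fm[OF x A h] vec_Fm[OF x act_closed[OF A g] h] act_sum
    by (rule sum.cong[OF refl]) (simp only: vec_act[OF A g] bta_act[OF g traceless_tensor[OF vec_traceless[OF A]]])
  qed
 qed
 have add: "Fm p' q' (x + y) A = Fm p' q' x A \<oplus>\<^bsub>Fo q'\<^esub> Fm p' q' y A"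
  if x: "x : hom_brauer p' q'" and y: "y : hom_brauer p' q'" and A: "A : carrier (Fo p')" for p' q' x y A
 proof -
  have xy: "x + y : hom_brauer p' q'" using x y unfolding hom_brauer_def by (rule free_on_add)
  show ?thesis
  proof (rule vec_eqI[OF Fm_closed[OF xy A] add_closed[OF Fm_closed[OF x A] Fm_closed[OF y A]]])
   fix p h assume h: "h : um p q'"
   show "vec q' (Fm p' q' (x + y) A) p h = vec q' (Fm p' q' x A \<oplus>\<^bsub>Fo q'\<^esub> Fm p' q' y A) p h"
    unfolding vec_add[OF Fm_closed[OF x A] Fm_closed[OF y A] h] vec_Fm[OF x A h] vec_Fm[OF y A h] vec_Fm[OF xy A h] sum.distrib[symmetric]
    by (rule sum.cong[OF refl]) (simp only: sharp_add_left[OF x y dM] bta_add_left)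
  qed
 qed
 have sc: "Fm p' q' (fscale c x) A = c \<odot>\<^bsub>Fo q'\<^esub> Fm p' q' x A"
  if x: "x : hom_brauer p' q'" and A: "A : carrier (Fo p')" for p' q' x c A
 proof -
  have cx: "fscale c x : hom_brauer p' q'" using x unfolding hom_brauer_def by (rule free_on_fscale)
  show ?thesis
  proof (rule vec_eqI[OF Fm_closed[OF cx A] smult_closed[OF Fm_closed[OF x A]]])
   fix p h assume h: "h : um p q'"
   show "vec q' (Fm p' q' (fscale c x) A) p h = vec q' (c \<odot>\<^bsub>Fo q'\<^esub> Fm p' q' x A) p h"
    unfolding vec_smult[OF Fm_closed[OF x A] h] vec_Fm[OF x A h] vec_Fm[OF cx A h] FS.scale_sum_right
    by (rule sum.cong[OF refl]) (simp only: sharp_scale_left[OF x dM] bta_scale_left)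
  qed
 qed
 have idn: "Fm q q (bid q) A = A" if A: "A : carrier (Fo q)" for q A
 proof (rule vec_eqI[OF Fm_closed[OF bid_hom A] A])
  fix p h assume h: "h : um p q"
  have "vec q (Fm q q (bid q) A) p h = (\<Sum>h'\<in>um p q. if h' = h then vec q A p h else 0)"
   unfolding vec_Fm[OF bid_hom A h]
  proof (rule sum.cong[OF refl])
   fix h' assume h': "h' : um p q"
   show "bta p (sharp dl p q q (bid q) (delta h')) (vec q A p h') h = (if h' = h then vec q A p h else 0)"
    unfolding sharp_id[OF dM[OF h']] bta_delta[OF h' h traceless_tensor[OF vec_traceless[OF A h']]] by simp
  qed
  then show "vec q (Fm q q (bid q) A) p h = vec q A p h" using h by (simp only: sum.delta[OF finite_upward_mono] if_True)
 qed
 have cmp: "Fm p' r' (bcomp dl x y) A = Fm q' r' x (Fm p' q' y A)"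
  if x: "x : hom_brauer q' r'" and y: "y : hom_brauer p' q'" and A: "A : carrier (Fo p')" for p' q' r' x y A
 proof -
  have xy: "bcomp dl x y : hom_brauer p' r'" by (rule bcomp_hom[OF x y])
  note FA = Fm_closed[OF y A]
  show ?thesis
  proof (rule vec_eqI[OF Fm_closed[OF xy A] Fm_closed[OF x FA]])
   fix p h assume h: "h : um p r'"
   have "vec r' (Fm p' r' (bcomp dl x y) A) p h = (\<Sum>k\<in>um p p'. \<Sum>h'\<in>um p q'.
     bta p (sharp dl p q' r' x (delta h')) (bta p (sharp dl p p' q' y (delta k)) (vec p' A p k) h') h)"
    unfolding vec_Fm[OF xy A h]
   proof (rule sum.cong[OF refl])
    fix k assume k: "k : um p p'"
    show "bta p (sharp dl p p' r' (bcomp dl x y) (delta k)) (vec p' A p k) h = (\<Sum>h'\<in>um p q'.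
     bta p (sharp dl p q' r' x (delta h')) (bta p (sharp dl p p' q' y (delta k)) (vec p' A p k) h') h)"
     unfolding sharp_bcomp[OF x y dM[OF k]]
     by (rule bta_sharp[OF x sharp_free[OF y dM[OF k]] vec_traceless[OF A k] h])
   qed
   also have "... = (\<Sum>h'\<in>um p q'. \<Sum>k\<in>um p p'.
     bta p (sharp dl p q' r' x (delta h')) (bta p (sharp dl p p' q' y (delta k)) (vec p' A p k) h') h)"
    by (rule sum.swap)
   also have "... = vec r' (Fm q' r' x (Fm p' q' y A)) p h"
    unfolding vec_Fm[OF x FA h]
   proof (rule sum.cong[OF refl])
    fix h' assume h': "h' : um p q'"
    show "(\<Sum>k\<in>um p p'. bta p (sharp dl p q' r' x (delta h')) (bta p (sharp dl p p' q' y (delta k)) (vec p' A p k) h') h) =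
     bta p (sharp dl p q' r' x (delta h')) (vec q' (Fm p' q' y A) p h') h"
     unfolding vec_Fm[OF y A h']
     by (rule linear_sum[OF bta_linear, symmetric]) (intro traceless_tensor bta_traceless vec_traceless[OF A])
   qed
   finally show "vec r' (Fm p' r' (bcomp dl x y) A) p h = vec r' (Fm q' r' x (Fm p' q' y A)) p h" .
  qed
 qed
 show ?thesis
  unfolding brauer_functor_def by (intro conjI allI ballI gmodule_Ft hom add sc idn cmp)
qed

text \<open>For \<open>t\<close> traceless of degree \<open>p\<close>, the coordinates of \<open>F (g \<tau>) t\<close> in degrees other than \<open>p\<close> vanish,
 and those in degree \<open>p\<close> are given by the Gram matrix.\<close>

lemma coord_other:
 assumes u: "u : upward p q" and h: "h : um p' q" and ne: "p' ~= p" and t: "t : N p"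
 shows "proj p' (dmap q p' (bar h) (dmap p q u t)) = 0"
proof -
 note bh = bar_brauer[OF upward_brauer[OF upward_mono_upward[OF h]]] and ub = upward_brauer[OF u] and tt = traceless_tensor[OF t]
 have hu: "dcomp (bar h) u : brauer p p'" by (rule dcomp_brauer[OF bh ub])
 have "proj p' (dmap p p' (dcomp (bar h) u) t) = 0"
 proof (cases "p < p'")
  case True
  then show ?thesis by (rule proj_dmap_less[OF hu _ tt])
 next
  case False
  then have "dcomp (bar h) u \<notin> upward p p'" using ne upward_le[of "dcomp (bar h) u" p p'] by auto
  then show ?thesis using traceless_not_upward[OF hu _ t] proj_id[OF traceless_0] by simp
 qed
 then show ?thesis
  unfolding dmap_dcomp[OF bh ub tt] proj_scale[OF dmap_tensor[OF hu tt]] by (simp only: fscale_zero_right)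
qed

section \<open>Surjectivity by inverting the Gram matrix\<close>

abbreviation "gram p x z \<equiv> poly (map_poly of_int (gram_entry p x z)) dl"

lemma coord_gram:
 assumes g: "g : um p q" and h: "h : um p q" and \<tau>: "\<tau> permutes {..<p}" and t: "t : N p"
 shows "proj p (dmap q p (bar h) (dmap p q (dcomp g (pd p \<tau>)) t)) = (\<Sum>\<sigma>\<in>perms p. fscale (gram p (h, \<sigma>) (g, \<tau>)) (D p \<sigma> t))"
proof -
 note gu = upward_mono_upward[OF g] and hu = upward_mono_upward[OF h] and P = perm_diagram_brauer[OF \<tau>] and tt = traceless_tensor[OF t]
 note gb = upward_brauer[OF gu] and bh = bar_brauer[OF upward_brauer[OF hu]]
 let ?d = "dcomp (bar h) g" and ?l = "dl ^ loops (bar h) g"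
 have d: "?d : brauer p p" by (rule dcomp_brauer[OF bh gb])
 let ?dt = "dcomp ?d (pd p \<tau>)"
 have dt: "?dt : brauer p p" by (rule dcomp_brauer[OF d P])
 have gt: "dcomp g (pd p \<tau>) : brauer p q" by (rule dcomp_brauer[OF gb P])
 \<comment> \<open>A permutation adds no loops, so the power of the parameter is the one in the Gram
   entry of \<open>h\<close> and \<open>g\<close>.\<close>
 have lp: "loops (bar h) (dcomp g (pd p \<tau>)) = loops (bar h) g"
  using loops_assoc[OF bh gb P] loops_downward[OF gb perm_downward[OF \<tau>]] loops_downward[OF d perm_downward[OF \<tau>]] by simp
 have lhs: "proj p (dmap q p (bar h) (dmap p q (dcomp g (pd p \<tau>)) t)) = fscale ?l (proj p (dmap p p ?dt t))"
  unfolding dmap_dcomp[OF bh gt tt] lp dcomp_assoc[OF bh gb P] by (rule proj_scale[OF dmap_tensor[OF dt tt]])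
 note ge = gram_entry_eval[OF gu hu \<tau>, of _ dl]
 show ?thesis
 proof (cases "?dt : level p p")
  case True
  then obtain \<rho> where \<rho>: "\<rho> permutes {..<p}" "?dt = pd p \<rho>" unfolding level_eq by auto
  have "?d = dcomp (pd p \<rho>) (pd p (iv \<tau>))"
   using dcomp_perm_cancel(1)[OF d \<tau>] unfolding \<rho>(2) by simp
  then have dl: "?d : level p p"
   unfolding perm_dcomp[OF \<rho>(1) permutes_inv[OF \<tau>]] level_eq using permutes_compose[OF permutes_inv[OF \<tau>] \<rho>(1)] by auto
  have "(\<Sum>\<sigma>\<in>perms p. fscale (gram p (h, \<sigma>) (g, \<tau>)) (D p \<sigma> t)) = (\<Sum>\<sigma>\<in>perms p. if \<sigma> = \<rho> then fscale ?l (D p \<rho> t) else 0)"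
  proof (rule sum.cong[OF refl])
   fix \<sigma> assume "\<sigma> : perms p"
   then have \<sigma>: "\<sigma> permutes {..<p}" by simp
   have "gram p (h, \<sigma>) (g, \<tau>) = (if \<sigma> = \<rho> then ?l else 0)"
    using dl perm_diagram_inj[OF \<rho>(1) \<sigma>] unfolding ge[OF \<sigma>] \<rho>(2) by auto
   then show "fscale (gram p (h, \<sigma>) (g, \<tau>)) (D p \<sigma> t) = (if \<sigma> = \<rho> then fscale ?l (D p \<rho> t) else 0)"
    by (cases "\<sigma> = \<rho>") (simp_all only: simp_thms if_True if_False FS.scale_zero_left)
  qed
  also have "... = fscale ?l (D p \<rho> t)"
   using \<rho>(1) by (simp only: sum.delta[OF finite_perms] mem_Collect_eq if_True)
  finally show ?thesis unfolding lhs \<rho>(2) proj_id[OF perm_traceless[OF \<rho>(1) t]] by (rule sym)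
 next
  case False
  \<comment> \<open>A composite that is not level is either not downward, and then killed by the
    projection, or not upward, and then zero on traceless tensors. The Gram entries vanish as
    well.\<close>
  have "proj p (dmap p p ?dt t) = 0"
  proof (cases "?dt : upward p p")
   case True
   then have "?dt \<notin> downward p p" using False by (simp add: level_def)
   then show ?thesis by (rule proj_not_downward[OF dt _ tt])
  next
   case False
   then show ?thesis using traceless_not_upward[OF dt _ t] proj_id[OF traceless_0] by simp
  qed
  moreover have "(\<Sum>\<sigma>\<in>perms p. fscale (gram p (h, \<sigma>) (g, \<tau>)) (D p \<sigma> t)) = 0"
  proof (intro sum.neutral ballI)
   fix \<sigma> assume "\<sigma> : perms p"
   then have \<sigma>: "\<sigma> permutes {..<p}" by simp
   have "?dt ~= pd p \<sigma>" using False \<sigma> unfolding level_eq by auto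
   then show "fscale (gram p (h, \<sigma>) (g, \<tau>)) (D p \<sigma> t) = 0"
    unfolding ge[OF \<sigma>] by (simp only: simp_thms if_False FS.scale_zero_left)
  qed
  ultimately show ?thesis unfolding lhs by (simp only: fscale_zero_right)
 qed
qed

text \<open>The Gram matrix has rows \<open>(h, \<sigma>)\<close>, while only values at
  \<open>h\<close> are prescribed. Taking the columns \<open>(h', id)\<close> of a right inverse
  \<open>C\<close> as coefficients makes the rows with \<sigma> other than the identity contribute
  zero.\<close>

lemma solve:
 assumes ns: "poly (map_poly of_int (gram_det p q)) dl ~= 0" and t: "!!h. h : um p q ==> t h : N p"
 shows "\<exists>v\<in>tn q. \<forall>p' h. h : um p' q --> proj p' (dmap q p' (bar h) v) = (if p' = p then t h else 0)"
proof -
 let ?I = "um p q \<times> perms p"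
 have fin: "finite ?I" by (intro finite_cartesian_product finite_upward_mono finite_perms)
 obtain C where C: "!!x y. x : ?I ==> y : ?I ==> (\<Sum>z\<in>?I. gram p x z * C z y) = of_bool (x = y)"
  using det_on_inverse[OF comm_ring_hom_eval[of dl] fin, of "gram_entry p"] ns unfolding gram_det_def by blast
 have idp: "id : perms p" by (simp add: permutes_id)
 define s where "s z = (\<Sum>h'\<in>um p q. fscale (C z (h', id)) (t h'))" for z
 have sN: "s z : N p" for z unfolding s_def by (intro traceless_sum traceless_scale t)
 let ?u = "%z. dcomp (fst z) (pd p (snd z))"
 have u: "?u z : upward p q" if "z : ?I" for z
  using that by (auto intro: upward_dcomp[OF upward_mono_upward perm_upward])
 define v where "v = (\<Sum>z\<in>?I. dmap p q (?u z) (s z))"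
 have vt: "dmap p q (?u z) (s z) : tn q" if "z : ?I" for z
  by (rule dmap_tensor[OF upward_brauer[OF u[OF that]] traceless_tensor[OF sN]])
 have v: "v : tn q" unfolding v_def by (rule tensor_sum) (rule vt)
 have "proj p' (dmap q p' (bar h) v) = (if p' = p then t h else 0)" if h: "h : um p' q" for p' h
 proof -
  have lin: "linear_on (tn q) (%x. proj p' (dmap q p' (bar h) x))"
   unfolding linear_on_def by (simp add: dmap_add dmap_fscale proj_add proj_scale dmap_tensor[OF bar_um[OF v h]])
  have e1: "proj p' (dmap q p' (bar h) v) = (\<Sum>z\<in>?I. proj p' (dmap q p' (bar h) (dmap p q (?u z) (s z))))"
   unfolding v_def by (rule linear_sum[OF lin vt])
  show ?thesis
  proof (cases "p' = p")
   case False
   then show ?thesis unfolding e1 by (simp add: coord_other[OF u h False sN])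
  next
   case True
   then have hp: "h : um p q" using h by simp
   have "proj p' (dmap q p' (bar h) v) = (\<Sum>z\<in>?I. \<Sum>\<sigma>\<in>perms p. fscale (gram p (h, \<sigma>) z) (D p \<sigma> (s z)))"
    unfolding e1 unfolding True
   proof (rule sum.cong[OF refl])
    fix z assume z: "z : ?I"
    then have z': "fst z : um p q" "snd z permutes {..<p}" by auto
    show "proj p (dmap q p (bar h) (dmap p q (?u z) (s z))) = (\<Sum>\<sigma>\<in>perms p. fscale (gram p (h, \<sigma>) z) (D p \<sigma> (s z)))"
     using coord_gram[OF z'(1) hp z'(2) sN] by (simp only: prod.collapse)
   qed
   also have "... = (\<Sum>\<sigma>\<in>perms p. \<Sum>z\<in>?I. fscale (gram p (h, \<sigma>) z) (D p \<sigma> (s z)))" by (rule sum.swap)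
   also have "... = (\<Sum>\<sigma>\<in>perms p. if \<sigma> = id then t h else 0)"
   proof (rule sum.cong[OF refl])
    fix \<sigma> assume \<sigma>: "\<sigma> : perms p"
    have "(\<Sum>z\<in>?I. fscale (gram p (h, \<sigma>) z) (s z)) =
      (\<Sum>z\<in>?I. \<Sum>h'\<in>um p q. fscale (gram p (h, \<sigma>) z * C z (h', id)) (t h'))"
     unfolding s_def FS.scale_sum_right FS.scale_scale ..
    also have "... = (\<Sum>h'\<in>um p q. fscale (\<Sum>z\<in>?I. gram p (h, \<sigma>) z * C z (h', id)) (t h'))"
     unfolding FS.scale_sum_left by (rule sum.swap)
    also have "... = (\<Sum>h'\<in>um p q. if h' = h then (if \<sigma> = id then t h else 0) else 0)"
    proof (rule sum.cong[OF refl])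
     fix h' assume h': "h' : um p q"
     have "(h, \<sigma>) : ?I" "(h', id) : ?I" using hp \<sigma> h' idp by auto
     from C[OF this] have c: "(\<Sum>z\<in>?I. gram p (h, \<sigma>) z * C z (h', id)) = (if h' = h & \<sigma> = id then 1 else 0)" by auto
     show "fscale (\<Sum>z\<in>?I. gram p (h, \<sigma>) z * C z (h', id)) (t h') = (if h' = h then (if \<sigma> = id then t h else 0) else 0)"
      unfolding c by (cases "h' = h"; cases "\<sigma> = id") (simp_all only: simp_thms if_True if_False FS.scale_one FS.scale_zero_left)
    qed
    also have "... = (if \<sigma> = id then t h else 0)" using hp by (simp only: sum.delta[OF finite_upward_mono] if_True)
    finally have c: "(\<Sum>z\<in>?I. fscale (gram p (h, \<sigma>) z) (s z)) = (if \<sigma> = id then t h else 0)" .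
    have "(\<Sum>z\<in>?I. fscale (gram p (h, \<sigma>) z) (D p \<sigma> (s z))) = D p \<sigma> (\<Sum>z\<in>?I. fscale (gram p (h, \<sigma>) z) (s z))"
     by (rule linear_on_sum[OF dmap_linear traceless_tensor[OF sN], symmetric])
    also have "... = (if \<sigma> = id then t h else 0)"
     unfolding c using D_id[OF traceless_tensor[OF t[OF hp]]] by (simp add: dmap_zero)
    finally show "(\<Sum>z\<in>?I. fscale (gram p (h, \<sigma>) z) (D p \<sigma> (s z))) = (if \<sigma> = id then t h else 0)" .
   qed
   also have "... = t h" by (simp only: sum.delta[OF finite_perms] idp if_True)
   finally show ?thesis using True by simp
  qed
 qed
 then show ?thesis using v by blast
qed

text \<open>\<open>solve\<close> attains the coordinates of one degree and makes those of all other
  degrees zero, so the solutions for the different \<open>p\<close> can be added.\<close>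

lemma Ph_iso:
 assumes ns: "nonsingular_upto dl q"
 shows "gmod_iso G (F_obj scale q) (Fo q) (Ph q)"
proof -
 have "\<exists>v\<in>tn q. Ph q v = A" if A: "A : carrier (Fo q)" for A
 proof -
  have "\<exists>v\<in>tn q. \<forall>p' h. h : um p' q --> proj p' (dmap q p' (bar h) v) = (if p' = p then vec q A p h else 0)"
   if p: "p \<preceq> q" for p
  proof (rule solve)
   have "q \<preceq> q" by (simp add: preceq_def)
   then show "poly (map_poly of_int (gram_det p q)) dl ~= 0" using ns p unfolding nonsingular_upto_def by force
  qed (rule vec_traceless[OF A])
  then obtain v where v: "!!p. p \<preceq> q ==> v p : tn q"
   "!!p p' h. p \<preceq> q ==> h : um p' q ==> proj p' (dmap q p' (bar h) (v p)) = (if p' = p then vec q A p h else 0)"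
   by metis
  let ?P = "{p. p \<preceq> q}"
  have fin: "finite ?P" by (rule finite_subset[of _ "{..q}"]) (auto simp: preceq_def)
  let ?v = "\<Sum>p\<in>?P. v p"
  have vt: "?v : tn q" by (rule tensor_sum) (use v(1) in simp)
  have "Ph q ?v = A"
  proof (rule vec_eqI[OF Ph_carrier[OF vt] A])
   fix p h assume h: "h : um p q"
   have lin: "linear_on (tn q) (%x. proj p (dmap q p (bar h) x))"
    unfolding linear_on_def by (simp add: dmap_add dmap_fscale proj_add proj_scale dmap_tensor[OF bar_um[OF vt h]])
   have "vec q (Ph q ?v) p h = (\<Sum>p'\<in>?P. proj p (dmap q p (bar h) (v p')))"
    unfolding vec_Ph[OF vt h] by (rule linear_sum[OF lin]) (use v(1) in simp)
   also have "... = (\<Sum>p'\<in>?P. if p = p' then vec q A p h else 0)"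
    by (rule sum.cong[OF refl]) (use v(2) h in auto)
   also have "... = vec q A p h" using um_preceq[OF h] by (simp only: sum.delta'[OF fin] mem_Collect_eq if_True)
   finally show "vec q (Ph q ?v) p h = vec q A p h" .
  qed
  then show ?thesis using vt by blast
 qed
 then have "carrier (Fo q) \<subseteq> Ph q ` carrier (F_obj scale q)" by (force simp: F_obj_def function_gmod_def)
 moreover have "Ph q ` carrier (F_obj scale q) \<subseteq> carrier (Fo q)"
  using Ph_hom[of q] unfolding gmod_hom_def by auto
 ultimately show ?thesis unfolding gmod_iso_def bij_betw_def using Ph_hom Ph_inj by blast
qed

lemma Ph_natural: "natural_transformation dl G (F_obj scale) F Fo Fm Ph"
 unfolding natural_transformation_def using functor_F functor_Ft Ph_hom natural
 by (simp add: F_obj_def function_gmod_def)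

end

theorem theorem3:
  fixes scale :: "'k::field_char_0 \<Rightarrow> 'v::ab_group_add \<Rightarrow> 'v"
    and \<omega> :: "'v \<Rightarrow> 'v \<Rightarrow> 'k"
    and e \<delta> :: 'k
    and G :: "('v \<Rightarrow> 'v) set"
  assumes "vector_space scale"
    and "\<exists>S. finite S \<and> Modules.module.span scale S = UNIV"
    and "\<And>x. Vector_Spaces.linear scale (*) (\<omega> x)"
    and "\<And>y. Vector_Spaces.linear scale (*) (\<lambda>x. \<omega> x y)"
    and "\<And>x. (\<And>y. \<omega> x y = 0) \<Longrightarrow> x = 0"
    and "e = 1 \<or> e = -1"
    and "\<And>x y. \<omega> x y = e * \<omega> y x"
    and "\<delta> = e * of_nat (vector_space.dim scale (UNIV :: 'v set))"
    and "G = isometry_group scale \<omega>"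
  shows "(\<forall>q. gmod_hom G (F_obj scale q) (Ft_obj scale \<omega> e \<delta> q) (Phi scale \<omega> e \<delta> q) \<and>
              inj_on (Phi scale \<omega> e \<delta> q) (carrier (F_obj scale q))) \<and>
         natural_transformation \<delta> G
           (F_obj scale) (F_mor scale \<omega> e)
           (Ft_obj scale \<omega> e \<delta>) (Ft_mor scale \<omega> e \<delta>)
           (Phi scale \<omega> e \<delta>) \<and>
         (\<forall>q. nonsingular_upto \<delta> q \<longrightarrow>
              gmod_iso G (F_obj scale q) (Ft_obj scale \<omega> e \<delta> q) (Phi scale \<omega> e \<delta> q))"
proof -
 interpret form_space scale \<omega> e
  by (intro form_space.intro form_space_axioms.intro assms(1-7))
 show ?thesis
 proof (rule mono_basis_exists)
  fix n b \<iota> a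
  assume nb: "mono_family n b \<iota> a" "!!v. v = (\<Sum>k<n. scale (\<omega> (dual_family b \<iota> a k) v) (b k))"
  interpret mono_basis scale \<omega> e n b \<iota> a
   by (intro mono_basis.intro mono_basis_axioms.intro form_space_axioms nb)
  \<comment> \<open>The monomial basis has as many elements as the dimension, so the given parameter
    is the loop value \<open>dl\<close>.\<close>
  have \<delta>: "\<delta> = e * of_nat n" using assms(8) by (simp only: dim_n)
  show ?thesis
   unfolding \<delta> assms(9) using Ph_hom Ph_inj Ph_natural Ph_iso by blast
 qed
qed

end
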